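(* Fix $b^->0$. Then $$\lim_{b^+\to\infty}u_{b^-,b^+}(x,b^+t)=\widehat u(x,t)$$ locally uniformly for $(x,t)\in\overline\Omega\times(0,+\infty)$, with $\widehat u$ the solution to $$\begin{cases}\partial_t\widehat u=\Delta\widehat u&\text{in }\Omega\times(0,+\infty),\\ \widehat u=0&\text{on }\partial\Omega\times(0,+\infty),\\ \widehat u(\cdot,0^+)=\widetilde u_0&\text{in }\Omega.\end{cases}$$ Moreover, $\lim_{t\to\infty}\widehat u(\cdot,t)=0$ uniformly in $\overline\Omega$.
   Context: $\Omega\subset\mathbb{R}^N$, $N\ge1$, is a bounded smooth domain, $u_0$ is continuous on $\overline\Omega$ with $u_0|_{\partial\Omega}=0$. For $b^+>b^->0$ let $b(s)=b^-$ if $s<0$ and $b(s)=b^+$ if $s\ge0$. $u_{b^-,b^+}$ denotes the unique viscosity solution of $$b(\partial_tu)\partial_tu=\Delta u\ \text{ in }\Omega\times(0,+\infty),\quad u=0\ \text{ on }\partial\Omega\times(0,+\infty),\quad u(\cdot,0)=u_0\ \text{ in }\Omega,$$ that is, the continuous function $u:\overline\Omega\times[0,\infty)\to\mathbb{R}$ satisfying the boundary and initial conditions and such that, for every smooth $\phi$, $b(\partial_t\phi)\partial_t\phi-\Delta\phi\le0$ (resp. $\ge0$) at every local maximum (resp. minimum) point $(x_0,t_0)\in\Omega\times(0,\infty)$ of $u-\phi$. The projected initial datum is $$\widetilde u_0(x)=\sup\{v(x):\ v\le u_0,\ -\Delta v\le0\text{ in }\Omega\text{ in the viscosity sense, and }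 v|_{\partial\Omega}\le0\},$$ where viscosity subsolutions $v$ are bounded and upper semicontinuous on $\overline\Omega$. The notation $\widehat u(\cdot,0^+)$ means the limit of $\widehat u(\cdot,t)$ as $t\to0^+$. *)

theory Defs
  imports "HOL-Analysis.Analysis"
begin

section \<open>Differentiability classes and smooth domains\<close>

definition pderiv_dir :: "'a::euclidean_space \<Rightarrow> ('a \<Rightarrow> real) \<Rightarrow> 'a \<Rightarrow> real" where
  "pderiv_dir v f x = frechet_derivative f (at x) v"

definition laplacian :: "('a::euclidean_space \<Rightarrow> real) \<Rightarrow> 'a \<Rightarrow> real" where
  "laplacian f x = (\<Sum>i\<in>Basis. pderiv_dir i (pderiv_dir i f) x)"

text \<open>\<open>Ck_on k S f\<close>: \<open>f\<close> is of class \<open>C^k\<close> on \<open>S\<close>. Derivatives are taken in the full space,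
  so this is meant for open \<open>S\<close>.\<close>

primrec Ck_on :: "nat \<Rightarrow> 'a::euclidean_space set \<Rightarrow> ('a \<Rightarrow> real) \<Rightarrow> bool" where
  "Ck_on 0 S f \<longleftrightarrow> continuous_on S f"
| "Ck_on (Suc k) S f \<longleftrightarrow>
     (\<forall>x\<in>S. f differentiable (at x)) \<and> (\<forall>i\<in>Basis. Ck_on k S (pderiv_dir i f))"

definition smooth_on :: "'a::euclidean_space set \<Rightarrow> ('a \<Rightarrow> real) \<Rightarrow> bool" where
  "smooth_on S f \<longleftrightarrow> (\<forall>k. Ck_on k S f)"

text \<open>Near every boundary point, \<open>\<Omega>\<close> is the strict sublevel set of a smooth function with nonzero
  differential there. By the implicit function theorem this says that \<open>\<Omega>\<close> lies
  locally on one side of a smooth graph.\<close>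

definition bounded_smooth_domain :: "'a::euclidean_space set \<Rightarrow> bool" where
  "bounded_smooth_domain \<Omega> \<longleftrightarrow>
     open \<Omega> \<and> connected \<Omega> \<and> \<Omega> \<noteq> {} \<and> bounded \<Omega> \<and>
     (\<forall>x0\<in>frontier \<Omega>. \<exists>U \<rho>. open U \<and> x0 \<in> U \<and> smooth_on U \<rho> \<and>
        (\<exists>v. pderiv_dir v \<rho> x0 \<noteq> 0) \<and> \<Omega> \<inter> U = {y\<in>U. \<rho> y < 0})"


section \<open>Viscosity solutions\<close>

definition local_max_at :: "'a::metric_space set \<Rightarrow> ('a \<Rightarrow> real) \<Rightarrow> 'a \<Rightarrow> bool" where
  "local_max_at S f x \<longleftrightarrow> x \<in> S \<and> (\<exists>r>0. \<forall>y\<in>S \<inter> ball x r. f y \<le> f x)"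

definition local_min_at :: "'a::metric_space set \<Rightarrow> ('a \<Rightarrow> real) \<Rightarrow> 'a \<Rightarrow> bool" where
  "local_min_at S f x \<longleftrightarrow> x \<in> S \<and> (\<exists>r>0. \<forall>y\<in>S \<inter> ball x r. f x \<le> f y)"

definition b_coeff :: "real \<Rightarrow> real \<Rightarrow> real \<Rightarrow> real" where
  "b_coeff bm bp s = (if s < 0 then bm else bp)"

definition parabolic_op :: "real \<Rightarrow> real \<Rightarrow> ('a::euclidean_space \<times> real \<Rightarrow> real) \<Rightarrow> 'a \<Rightarrow> real \<Rightarrow> real" where
  "parabolic_op bm bp \<phi> x t =
     b_coeff bm bp (deriv (\<lambda>s. \<phi> (x, s)) t) * deriv (\<lambda>s. \<phi> (x, s)) t - laplacian (\<lambda>y. \<phi> (y, t)) x"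

definition parabolic_viscosity_solution ::
  "'a::euclidean_space set \<Rightarrow> real \<Rightarrow> real \<Rightarrow> ('a \<Rightarrow> real) \<Rightarrow> ('a \<Rightarrow> real \<Rightarrow> real) \<Rightarrow> bool" where
  "parabolic_viscosity_solution \<Omega> bm bp u0 u \<longleftrightarrow>
     continuous_on (closure \<Omega> \<times> {0..}) (\<lambda>(x, t). u x t) \<and>
     (\<forall>x\<in>frontier \<Omega>. \<forall>t>0. u x t = 0) \<and>
     (\<forall>x\<in>\<Omega>. u x 0 = u0 x) \<and>
     (\<forall>\<phi> x0 t0. smooth_on (\<Omega> \<times> {0<..}) \<phi> \<longrightarrow>
        local_max_at (\<Omega> \<times> {0<..}) (\<lambda>(x, t). u x t - \<phi> (x, t)) (x0, t0) \<longrightarrow>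
        parabolic_op bm bp \<phi> x0 t0 \<le> 0) \<and>
     (\<forall>\<phi> x0 t0. smooth_on (\<Omega> \<times> {0<..}) \<phi> \<longrightarrow>
        local_min_at (\<Omega> \<times> {0<..}) (\<lambda>(x, t). u x t - \<phi> (x, t)) (x0, t0) \<longrightarrow>
        parabolic_op bm bp \<phi> x0 t0 \<ge> 0)"


section \<open>The projected initial datum\<close>

definition usc_on :: "'a::topological_space set \<Rightarrow> ('a \<Rightarrow> real) \<Rightarrow> bool" where
  "usc_on S f \<longleftrightarrow> (\<forall>x\<in>S. \<forall>a>f x. eventually (\<lambda>y. f y < a) (at x within S))"

definition laplace_viscosity_subsolution :: "'a::euclidean_space set \<Rightarrow> ('a \<Rightarrow> real) \<Rightarrow> bool" where
  "laplace_viscosity_subsolution \<Omega> v \<longleftrightarrow>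
     bounded (v ` closure \<Omega>) \<and> usc_on (closure \<Omega>) v \<and>
     (\<forall>\<phi> x0. smooth_on \<Omega> \<phi> \<longrightarrow> local_max_at \<Omega> (\<lambda>x. v x - \<phi> x) x0 \<longrightarrow> - laplacian \<phi> x0 \<le> 0)"

text \<open>For \<open>x\<close> in the closure of \<open>\<Omega>\<close> the supremum is over a nonempty set bounded above by \<open>u0 x\<close>
  (constants below \<open>min u0\<close> and \<open>0\<close> compete), so the real-valued \<open>Sup\<close> is the intended one.\<close>

definition projected_datum :: "'a::euclidean_space set \<Rightarrow> ('a \<Rightarrow> real) \<Rightarrow> 'a \<Rightarrow> real" where
  "projected_datum \<Omega> u0 x =
     Sup {v x | v. (\<forall>y\<in>closure \<Omega>. v y \<le> u0 y) \<and> laplace_viscosity_subsolution \<Omega> v \<and>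
                   (\<forall>y\<in>frontier \<Omega>. v y \<le> 0)}"


section \<open>The heat equation\<close>

definition C21_on :: "'a::euclidean_space set \<Rightarrow> ('a \<Rightarrow> real \<Rightarrow> real) \<Rightarrow> bool" where
  "C21_on \<Omega> w \<longleftrightarrow>
     (\<forall>x\<in>\<Omega>. \<forall>t>0. (\<lambda>s. w x s) differentiable (at t)) \<and>
     (\<forall>t>0. Ck_on 2 \<Omega> (\<lambda>y. w y t)) \<and>
     continuous_on (\<Omega> \<times> {0<..}) (\<lambda>(x, t). deriv (\<lambda>s. w x s) t) \<and>
     (\<forall>i\<in>Basis. continuous_on (\<Omega> \<times> {0<..}) (\<lambda>(x, t). pderiv_dir i (\<lambda>y. w y t) x)) \<and>
     (\<forall>i\<in>Basis. \<forall>j\<in>Basis. continuous_on (\<Omega> \<times> {0<..})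
        (\<lambda>(x, t). pderiv_dir i (pderiv_dir j (\<lambda>y. w y t)) x))"

text \<open>Classical solution for positive times; values at nonpositive times are irrelevant. The
  limit as \<open>t\<close> tends to \<open>0\<close> is uniform in \<open>\<Omega>\<close>: with pointwise (or locally uniform) limits,
  solutions are not unique, because of singular solutions issued from a derivative of a
  Dirac mass at a boundary point.\<close>

definition heat_solution :: "'a::euclidean_space set \<Rightarrow> ('a \<Rightarrow> real) \<Rightarrow> ('a \<Rightarrow> real \<Rightarrow> real) \<Rightarrow> bool" where
  "heat_solution \<Omega> g w \<longleftrightarrow>
     continuous_on (closure \<Omega> \<times> {0<..}) (\<lambda>(x, t). w x t) \<and>
     C21_on \<Omega> w \<and>
     (\<forall>x\<in>\<Omega>. \<forall>t>0. deriv (\<lambda>s. w x s) t = laplacian (\<lambda>y. w y t) x) \<and>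
     (\<forall>x\<in>frontier \<Omega>. \<forall>t>0. w x t = 0) \<and>
     uniform_limit \<Omega> (\<lambda>t x. w x t) g (at_right 0)"

end

theory Submission
  imports Defs "HOL-Complex_Analysis.Great_Picard"
begin

text \<open>The projected datum is subharmonic, so the heat flow \<open>w\<close> starting from it is
  nondecreasing in time and, after rescaling time by \<open>bp\<close>, solves the nonlinear equation itself; as
  its datum lies below \<open>u0\<close>, comparison gives \<open>w x t \<le> u bp x (bp * t)\<close>.
  Conversely, on the time scale \<open>bp\<close> negative time derivatives cost almost nothing, so the maximum
  of \<open>u bp\<close> over a short time window is subharmonic up to an error \<open>O(1 / bp)\<close> and stays
  below \<open>u0\<close> up to a small error. It is therefore below the projected datum
  up to a small error, and comparison from that time on gives the upper bound.

  The flow \<open>w\<close> is a limit of discrete heat flows that average over lattice neighbours.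
  Barriers from exterior balls give equicontinuity up to the boundary, and comparing a discrete
  solution with its reflection in a hyperplane bounds its odd part, which gives interior derivative
  estimates that survive the limit.\<close>

section \<open>Calculus of partial derivatives\<close>

text \<open>Only smooth functions may be inserted into the viscosity inequalities, while
  \<open>u\<close> is merely continuous. Two nonsmooth solutions are never compared:
  \<open>u\<close> is only tested against smooth functions such as a quadratic or the rescaled flow,
  plus a function of time, so no doubling of variables occurs. This is why the flow must be smooth
  jointly in space and time.

  The reflection bound is used twice. A central difference of a discrete solution is again a
  discrete solution, of size O(s), so second differences are O(s^2). Difference quotients then
  converge at a uniform rate to functions that are themselves limits of discrete solutions; the
  bound can be iterated, and the heat equation converts space derivatives into time derivatives.

  The two halves of the limit rest on one asymmetry. A slope K / \<open>bp\<close> upwards is worth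
  K in the equation, whatever \<open>bp\<close> is, whereas a slope -K / \<open>bp\<close> is worth
  only -K \<open>bm\<close> / \<open>bp\<close>. So upward motion takes a time proportional to
  \<open>bp\<close>, which keeps \<open>u\<close> below the obstacle plus a small error on a
  rescaled window independent of \<open>bp\<close>, and downward motion is almost free.\<close>

lemma has_derivative_pderiv_dir:
  assumes "f differentiable (at x)"
  shows "(f has_derivative (\<lambda>v. pderiv_dir v f x)) (at x)"
  using assms unfolding pderiv_dir_def frechet_derivative_works by simp

lemma pderiv_dir_eqI: "(f has_derivative D) (at x) \<Longrightarrow> pderiv_dir v f x = D v"
  unfolding pderiv_dir_def by (metis frechet_derivative_at)

lemma pderiv_dir_cong_open:
  assumes "open S" "x \<in> S" "\<And>y. y \<in> S \<Longrightarrow> f y = g y"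
  shows "pderiv_dir v f x = pderiv_dir v g x"
proof -
  have "(f has_derivative D) (at x) = (g has_derivative D) (at x)" for D
    using assms by (metis has_derivative_transform_within_open)
  then show ?thesis
    unfolding pderiv_dir_def frechet_derivative_def by presburger
qed

lemma Ck_on_cong:
  assumes "open S" "\<And>y. y \<in> S \<Longrightarrow> f y = g y"
  shows "Ck_on k S f = Ck_on k S g"
  using assms(2)
proof (induction k arbitrary: f g)
  case 0
  then show ?case by (simp cong: continuous_on_cong)
next
  case (Suc k)
  have "(f differentiable (at x)) = (g differentiable (at x))" if "x \<in> S" for x
    unfolding differentiable_def using assms(1) Suc.prems that
    by (metis has_derivative_transform_within_open)
  moreover have "Ck_on k S (pderiv_dir i f) = Ck_on k S (pderiv_dir i g)" for i
    by (intro Suc.IH pderiv_dir_cong_open[OF assms(1)] Suc.prems)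
  ultimately show ?case by simp
qed

lemma Ck_on_SucD: "Ck_on (Suc k) S f \<Longrightarrow> Ck_on k S f"
proof (induction k arbitrary: f)
  case 0
  then show ?case
    by (auto intro!: differentiable_imp_continuous_on simp: differentiable_on_def differentiable_at_withinI)
next
  case (Suc k)
  then show ?case by (metis Ck_on.simps(2))
qed

lemma Ck_on_subset: "Ck_on k S f \<Longrightarrow> T \<subseteq> S \<Longrightarrow> Ck_on k T f"
  by (induction k arbitrary: f) (auto intro: continuous_on_subset)

lemma Ck_on_const: "Ck_on k S (\<lambda>x. c)"
proof (induction k arbitrary: c)
  case (Suc k)
  have "pderiv_dir i (\<lambda>x::'a. c) = (\<lambda>x. 0)" for i
    by (rule ext, rule pderiv_dir_eqI[where D = "\<lambda>_. 0"]) simp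
  with Suc show ?case by simp
qed simp

lemma Ck_on_linear:
  assumes "bounded_linear f"
  shows "Ck_on k S f"
proof (cases k)
  case 0
  then show ?thesis using assms by (simp add: linear_continuous_on)
next
  case (Suc m)
  have "pderiv_dir i f = (\<lambda>x. f i)" for i
    by (rule ext, rule pderiv_dir_eqI, rule bounded_linear_imp_has_derivative, fact)
  moreover have "f differentiable (at x)" for x
    using assms bounded_linear_imp_differentiable by blast
  ultimately show ?thesis using Suc by (simp add: Ck_on_const)
qed

lemma Ck_on_add:
  assumes "open S" "Ck_on k S f" "Ck_on k S g"
  shows "Ck_on k S (\<lambda>x. f x + g x)"
  using assms(2,3)
proof (induction k arbitrary: f g)
  case 0
  then show ?case by (simp add: continuous_on_add)
next
  case (Suc k)
  have "pderiv_dir i (\<lambda>x. f x + g x) x = pderiv_dir i f x + pderiv_dir i g x" if "x \<in> S" for i x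
    using Suc.prems that by (intro pderiv_dir_eqI has_derivative_add has_derivative_pderiv_dir) auto
  then have "Ck_on k S (pderiv_dir i (\<lambda>x. f x + g x)) = Ck_on k S (\<lambda>x. pderiv_dir i f x + pderiv_dir i g x)" for i
    by (intro Ck_on_cong[OF assms(1)])
  with Suc show ?case by auto
qed

lemma Ck_on_mult:
  assumes "open S" "Ck_on k S f" "Ck_on k S g"
  shows "Ck_on k S (\<lambda>x. f x * g x)"
  using assms(2,3)
proof (induction k arbitrary: f g)
  case 0
  then show ?case by (simp add: continuous_on_mult)
next
  case (Suc k)
  have "pderiv_dir i (\<lambda>x. f x * g x) x = f x * pderiv_dir i g x + pderiv_dir i f x * g x" if "x \<in> S" for i x
    using Suc.prems that by (intro pderiv_dir_eqI has_derivative_mult has_derivative_pderiv_dir) auto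
  then have "Ck_on k S (pderiv_dir i (\<lambda>x. f x * g x))
      = Ck_on k S (\<lambda>x. f x * pderiv_dir i g x + pderiv_dir i f x * g x)" for i
    by (intro Ck_on_cong[OF assms(1)])
  moreover have "Ck_on k S f" "Ck_on k S g" using Suc.prems Ck_on_SucD by blast+
  ultimately show ?case using Suc by (auto intro!: Ck_on_add[OF assms(1)])
qed

text \<open>The hypothesis on \<open>A\<close> keeps every partial derivative of \<open>f \<circ> L\<close> a multiple of
  a single partial derivative of \<open>f\<close>.\<close>

lemma Ck_on_compose_diag:
  fixes L :: "'a::euclidean_space \<Rightarrow> 'b::euclidean_space"
  assumes L: "\<And>x. (L has_derivative A) (at x)"
    and diag: "\<And>b. b \<in> Basis \<Longrightarrow> \<exists>c. \<exists>b'\<in>Basis. A b = c *\<^sub>R b'"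
    and T: "open T" "\<And>x. x \<in> T \<Longrightarrow> L x \<in> S" and f: "Ck_on k S f"
  shows "Ck_on k T (\<lambda>x. f (L x))"
  using f
proof (induction k arbitrary: f)
  case 0
  have "continuous_on T L"
    by (rule has_derivative_continuous_on[where f' = "\<lambda>_. A"]) (rule has_derivative_at_withinI[OF L])
  then have "continuous_on T (\<lambda>x. f (L x))"
    using 0 T continuous_on_compose2[of S f T L] by auto
  then show ?case by simp
next
  case (Suc k)
  have der: "((\<lambda>x. f (L x)) has_derivative (\<lambda>v. pderiv_dir (A v) f (L x))) (at x)" if "x \<in> T" for x
    using Suc.prems T that
    by (intro has_derivative_compose[OF L]
        has_derivative_pderiv_dir) auto
  have "Ck_on k T (pderiv_dir b (\<lambda>x. f (L x)))" if b: "b \<in> Basis" for b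
  proof -
    obtain c b' where b': "b' \<in> Basis" "A b = c *\<^sub>R b'" using diag[OF b] by blast
    have "pderiv_dir b (\<lambda>x. f (L x)) x = c * pderiv_dir b' f (L x)" if "x \<in> T" for x
    proof -
      have lin: "linear (\<lambda>v. pderiv_dir v f (L x))"
        using Suc.prems T that by (intro has_derivative_linear[OF has_derivative_pderiv_dir]) auto
      have "pderiv_dir b (\<lambda>x. f (L x)) x = pderiv_dir (A b) f (L x)"
        using der[OF that] by (rule pderiv_dir_eqI)
      also have "\<dots> = c * pderiv_dir b' f (L x)"
        using linear_cmul[OF lin, of c b'] by (simp add: b')
      finally show ?thesis .
    qed
    then have "Ck_on k T (pderiv_dir b (\<lambda>x. f (L x))) = Ck_on k T (\<lambda>x. c * pderiv_dir b' f (L x))"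
      by (intro Ck_on_cong[OF T(1)])
    moreover have "Ck_on k T (\<lambda>x. pderiv_dir b' f (L x))"
      using Suc b' by auto
    ultimately show ?thesis by (simp add: Ck_on_mult[OF T(1) Ck_on_const])
  qed
  moreover have "(\<lambda>x. f (L x)) differentiable (at x)" if "x \<in> T" for x
    using der[OF that] by (auto simp: differentiable_def)
  ultimately show ?case by simp
qed

lemma smooth_on_add: "open S \<Longrightarrow> smooth_on S f \<Longrightarrow> smooth_on S g \<Longrightarrow> smooth_on S (\<lambda>x. f x + g x)"
  by (simp add: smooth_on_def Ck_on_add)

lemma smooth_on_mult: "open S \<Longrightarrow> smooth_on S f \<Longrightarrow> smooth_on S g \<Longrightarrow> smooth_on S (\<lambda>x. f x * g x)"
  by (simp add: smooth_on_def Ck_on_mult)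

lemma smooth_on_const: "smooth_on S (\<lambda>x. c)"
  by (simp add: smooth_on_def Ck_on_const)

lemma smooth_on_linear: "bounded_linear f \<Longrightarrow> smooth_on S f"
  by (simp add: smooth_on_def Ck_on_linear)

lemma smooth_on_uminus: "open S \<Longrightarrow> smooth_on S f \<Longrightarrow> smooth_on S (\<lambda>x. - f x)"
  using smooth_on_mult[OF _ smooth_on_const[of S "-1"], of f] by simp

lemma smooth_on_diff: "open S \<Longrightarrow> smooth_on S f \<Longrightarrow> smooth_on S g \<Longrightarrow> smooth_on S (\<lambda>x. f x - g x)"
  using smooth_on_add[OF _ _ smooth_on_uminus, of S f g] by simp

lemma smooth_on_power: "open S \<Longrightarrow> smooth_on S f \<Longrightarrow> smooth_on S (\<lambda>x. f x ^ n)"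
  by (induction n) (auto intro: smooth_on_mult smooth_on_const)

lemma smooth_on_sum:
  "open S \<Longrightarrow> (\<And>i. i \<in> I \<Longrightarrow> smooth_on S (f i)) \<Longrightarrow> smooth_on S (\<lambda>x. \<Sum>i\<in>I. f i x)"
  by (induction I rule: infinite_finite_induct) (auto intro: smooth_on_add smooth_on_const)

lemma smooth_on_inner: "open S \<Longrightarrow> smooth_on S (\<lambda>x. (x - a) \<bullet> b)"
  unfolding inner_diff_left
  by (intro smooth_on_diff smooth_on_const smooth_on_linear bounded_linear_inner_left)

lemma smooth_on_dist_sq:
  fixes S :: "'a::euclidean_space set"
  assumes "open S" shows "smooth_on S (\<lambda>x. (norm (x - a))\<^sup>2)"
proof -
  have "(norm (x - a))\<^sup>2 = (\<Sum>i\<in>Basis. ((x - a) \<bullet> i)\<^sup>2)" for x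
    unfolding power2_norm_eq_inner by (subst euclidean_inner) (simp add: power2_eq_square)
  then show ?thesis
    by (simp only:) (intro smooth_on_sum smooth_on_power smooth_on_inner assms)
qed

lemma smooth_on_Ck: "smooth_on S f \<Longrightarrow> Ck_on k S f"
  by (simp add: smooth_on_def)

lemma Ck2_diff:
  assumes "Ck_on 2 S f" "x \<in> S"
  shows "f differentiable (at x)" "i \<in> Basis \<Longrightarrow> pderiv_dir i f differentiable (at x)"
  using assms by (auto simp: numeral_2_eq_2)

text \<open>The mixed derivatives need not be known to be symmetric.\<close>

definition taylor2 :: "('a::euclidean_space \<Rightarrow> real) \<Rightarrow> 'a \<Rightarrow> 'a \<Rightarrow> real" where
  "taylor2 f x0 y = f x0 + (\<Sum>i\<in>Basis. pderiv_dir i f x0 * ((y - x0) \<bullet> i))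
     + (\<Sum>i\<in>Basis. \<Sum>j\<in>Basis. pderiv_dir j (pderiv_dir i f) x0 * ((y - x0) \<bullet> i) * ((y - x0) \<bullet> j)) / 2"

lemma differentiable_pderiv_sum:
  fixes f :: "'a::euclidean_space \<Rightarrow> real"
  assumes "f differentiable (at x)"
  shows "pderiv_dir v f x = (\<Sum>i\<in>Basis. pderiv_dir i f x * (v \<bullet> i))"
proof -
  have lin: "linear (\<lambda>v. pderiv_dir v f x)"
    using has_derivative_linear[OF has_derivative_pderiv_dir[OF assms]] .
  have "pderiv_dir (\<Sum>i\<in>Basis. (v \<bullet> i) *\<^sub>R i) f x = (\<Sum>i\<in>Basis. (v \<bullet> i) * pderiv_dir i f x)"
    using linear_sum[OF lin, of "\<lambda>i. (v \<bullet> i) *\<^sub>R i" Basis] by (simp add: linear_cmul[OF lin])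
  then show ?thesis by (simp add: euclidean_representation mult.commute)
qed

lemma has_derivative_pderiv_sum:
  fixes f :: "'a::euclidean_space \<Rightarrow> real"
  assumes "f differentiable (at x)"
  shows "(f has_derivative (\<lambda>v. \<Sum>i\<in>Basis. pderiv_dir i f x * (v \<bullet> i))) (at x)"
  using has_derivative_pderiv_dir[OF assms]
  by (subst differentiable_pderiv_sum[OF assms, symmetric])

text \<open>Along the segment from \<open>x0\<close> to \<open>y\<close> the remainder has a
  derivative that is controlled by the first-order expansion of each partial derivative at
  \<open>x0\<close>; one application of the mean value theorem then gives the bound.\<close>

lemma taylor2_approx:
  assumes S: "open S" "x0 \<in> S" and f: "Ck_on 2 S f" and "\<epsilon> > 0"
  shows "\<exists>r>0. \<forall>y\<in>ball x0 r. \<bar>f y - taylor2 f x0 y\<bar> \<le> \<epsilon> * (norm (y - x0))\<^sup>2"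
proof -
  let ?p = "\<lambda>i. pderiv_dir i f" and ?q = "\<lambda>i j. pderiv_dir j (pderiv_dir i f) x0"
  \<comment> \<open>Each of the N partial derivatives contributes an error of at most
    \<open>\<epsilon>'\<close> times the squared norm, so together they use up
    \<open>\<epsilon>\<close>.\<close>
  define \<epsilon>' where "\<epsilon>' = \<epsilon> / DIM('a)"
  have "\<epsilon>' > 0" using \<open>\<epsilon> > 0\<close> by (simp add: \<epsilon>'_def)
  have "\<exists>d>0. \<forall>y. norm (y - x0) < d \<longrightarrow>
      \<bar>?p i y - ?p i x0 - (\<Sum>j\<in>Basis. ?q i j * ((y - x0) \<bullet> j))\<bar> \<le> \<epsilon>' * norm (y - x0)" if "i \<in> Basis" for i
  proof -
    have d: "?p i differentiable (at x0)" using Ck2_diff(2)[OF f S(2) that] .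
    show ?thesis
      using has_derivative_pderiv_sum[OF d] \<open>\<epsilon>' > 0\<close> unfolding has_derivative_at_alt
      by simp
  qed
  then obtain d where d: "\<And>i. i \<in> Basis \<Longrightarrow> d i > 0"
    "\<And>i y. i \<in> Basis \<Longrightarrow> norm (y - x0) < d i \<Longrightarrow>
      \<bar>?p i y - ?p i x0 - (\<Sum>j\<in>Basis. ?q i j * ((y - x0) \<bullet> j))\<bar> \<le> \<epsilon>' * norm (y - x0)"
    by metis
  obtain r0 where r0: "r0 > 0" "ball x0 r0 \<subseteq> S" using S open_contains_ball by blast
  define r where "r = min r0 (Min (d ` Basis))"
  have "r > 0" using r0 d by (auto simp: r_def)
  have rd: "r \<le> d i" if "i \<in> Basis" for i using that by (auto simp: r_def min_le_iff_disj)
  have "\<bar>f y - taylor2 f x0 y\<bar> \<le> \<epsilon> * (norm (y - x0))\<^sup>2" if y: "y \<in> ball x0 r" for y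
  proof -
    define v where "v = y - x0"
    have nv: "norm v < r" using y by (simp add: v_def dist_norm norm_minus_commute)
    \<comment> \<open>\<open>e\<close> is \<open>f\<close> along the segment minus the linear and
      quadratic Taylor terms; the constant term is left in, so that \<open>e 1 - e 0\<close> is
      exactly the Taylor remainder.\<close>
    define e where "e \<theta> = f (x0 + \<theta> *\<^sub>R v) - \<theta> * (\<Sum>i\<in>Basis. ?p i x0 * (v \<bullet> i))
       - \<theta>\<^sup>2 / 2 * (\<Sum>i\<in>Basis. \<Sum>j\<in>Basis. ?q i j * (v \<bullet> i) * (v \<bullet> j))" for \<theta> :: real
    define e' where "e' \<theta> = (\<Sum>i\<in>Basis. (v \<bullet> i) *
        (?p i (x0 + \<theta> *\<^sub>R v) - ?p i x0 - (\<Sum>j\<in>Basis. ?q i j * (\<theta> * (v \<bullet> j)))))" for \<theta> :: real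
    have der: "(e has_real_derivative e' \<theta>) (at \<theta>)" if \<theta>: "0 \<le> \<theta>" "\<theta> \<le> 1" for \<theta>
    proof -
      have "norm (\<theta> *\<^sub>R v) < r" using \<theta> nv mult_left_le_one_le[of "norm v" \<theta>] by simp
      then have "x0 + \<theta> *\<^sub>R v \<in> S" using r0(2) by (force simp: r_def dist_norm)
      then have df: "f differentiable (at (x0 + \<theta> *\<^sub>R v))" using Ck2_diff[OF f] by blast
      have "((\<lambda>\<theta>. f (x0 + \<theta> *\<^sub>R v)) has_derivative (\<lambda>s. \<Sum>i\<in>Basis. ?p i (x0 + \<theta> *\<^sub>R v) * ((s *\<^sub>R v) \<bullet> i))) (at \<theta>)"
        by (rule has_derivative_compose[where g = f and f = "\<lambda>\<theta>. x0 + \<theta> *\<^sub>R v" and f' = "\<lambda>s. s *\<^sub>R v", OF _ has_derivative_pderiv_sum[OF df]])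
          (auto intro!: derivative_eq_intros)
      moreover have "(\<Sum>i\<in>Basis. ?p i (x0 + \<theta> *\<^sub>R v) * ((s *\<^sub>R v) \<bullet> i))
          = (\<Sum>i\<in>Basis. ?p i (x0 + \<theta> *\<^sub>R v) * (v \<bullet> i)) * s" for s
        unfolding sum_distrib_right by (intro sum.cong) auto
      ultimately have 1: "((\<lambda>\<theta>. f (x0 + \<theta> *\<^sub>R v)) has_real_derivative
          (\<Sum>i\<in>Basis. ?p i (x0 + \<theta> *\<^sub>R v) * (v \<bullet> i))) (at \<theta>)"
        by (simp add: has_field_derivative_def)
      have 2: "e' \<theta> = (\<Sum>i\<in>Basis. ?p i (x0 + \<theta> *\<^sub>R v) * (v \<bullet> i)) - (\<Sum>i\<in>Basis. ?p i x0 * (v \<bullet> i))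
          - \<theta> * (\<Sum>i\<in>Basis. \<Sum>j\<in>Basis. ?q i j * (v \<bullet> i) * (v \<bullet> j))"
        unfolding e'_def sum_distrib_left sum_subtractf[symmetric]
        by (intro sum.cong) (auto simp: algebra_simps sum_distrib_left)
      show ?thesis unfolding e_def 2
        by (rule derivative_eq_intros 1 refl | simp)+
    qed
    obtain z where z: "0 < z" "z < 1" "e 1 - e 0 = (1 - 0) * e' z"
      using MVT2[of 0 1 e e'] der by auto
    have "\<bar>e' z\<bar> \<le> (\<Sum>i\<in>(Basis::'a set). norm v * (\<epsilon>' * norm v))"
      unfolding e'_def
    proof (intro order_trans[OF sum_abs] sum_mono)
      fix i :: 'a assume i: "i \<in> Basis"
      have nz: "norm (z *\<^sub>R v) \<le> norm v" using z mult_left_le_one_le[of "norm v" z] by simp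
      have "norm ((x0 + z *\<^sub>R v) - x0) < d i" using nz nv rd[OF i] by simp
      from d(2)[OF i this]
      have "\<bar>?p i (x0 + z *\<^sub>R v) - ?p i x0 - (\<Sum>j\<in>Basis. ?q i j * (z * (v \<bullet> j)))\<bar> \<le> \<epsilon>' * norm (z *\<^sub>R v)"
        by simp
      also have "\<dots> \<le> \<epsilon>' * norm v" using nz \<open>\<epsilon>' > 0\<close> by (intro mult_left_mono) auto
      finally show "\<bar>(v \<bullet> i) * (?p i (x0 + z *\<^sub>R v) - ?p i x0 - (\<Sum>j\<in>Basis. ?q i j * (z * (v \<bullet> j))))\<bar>
          \<le> norm v * (\<epsilon>' * norm v)"
        unfolding abs_mult using Basis_le_norm[OF i, of v] by (intro mult_mono) auto
    qed
    also have "\<dots> = \<epsilon> * (norm v)\<^sup>2" by (simp add: \<epsilon>'_def power2_eq_square)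
    finally have "\<bar>e 1 - e 0\<bar> \<le> \<epsilon> * (norm v)\<^sup>2" using z by simp
    moreover have "e 1 - e 0 = f y - taylor2 f x0 y"
      unfolding e_def taylor2_def v_def by simp
    ultimately show ?thesis by (simp add: v_def)
  qed
  then show ?thesis using \<open>r > 0\<close> by blast
qed

section \<open>Discrete averages and the Laplacian\<close>

text \<open>One step of the simple random walk on the lattice of mesh \<open>h\<close>. On quadratic
  polynomials it differs from the identity by exactly h^2 / (2 N) times the Laplacian, with no error
  term, which is why almost all barriers are quadratic.\<close>

definition avg :: "real \<Rightarrow> ('a::euclidean_space \<Rightarrow> real) \<Rightarrow> 'a \<Rightarrow> real" where
  "avg h f x = (\<Sum>i\<in>Basis. f (x + h *\<^sub>R i) + f (x - h *\<^sub>R i)) / (2 * real DIM('a))"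

lemma avg_add: "avg h (\<lambda>x. f x + g x) x = avg h f x + avg h g x"
  by (simp add: avg_def sum.distrib add_divide_distrib algebra_simps)

lemma avg_cmult: "avg h (\<lambda>x. c * f x) x = c * avg h f x"
  by (simp add: avg_def sum_distrib_left sum.distrib algebra_simps)

lemma avg_uminus: "avg h (\<lambda>x. - f x) x = - avg h f x"
  using avg_cmult[of h "-1" f x] by simp

lemma avg_diff: "avg h (\<lambda>x. f x - g x) x = avg h f x - avg h g x"
  using avg_add[of h f "\<lambda>x. - g x" x] avg_uminus[of h g x] by simp

lemma avg_const: "avg h (\<lambda>x. c) (x::'a::euclidean_space) = c"
  by (simp add: avg_def)

lemma avg_mono:
  assumes "\<And>i. i \<in> Basis \<Longrightarrow> f (x + h *\<^sub>R i) \<le> g (x + h *\<^sub>R i)"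
    "\<And>i. i \<in> Basis \<Longrightarrow> f (x - h *\<^sub>R i) \<le> g (x - h *\<^sub>R i)"
  shows "avg h f x \<le> avg h g x"
  unfolding avg_def by (intro divide_right_mono sum_mono add_mono assms) auto

lemma avg_shift: "avg h (\<lambda>x. f (x + a)) x = avg h f (x + a)"
  by (simp add: avg_def algebra_simps)

lemma avg_affine_sq:
  fixes a :: "'a::euclidean_space"
  assumes "norm e = 1"
  shows "avg h (\<lambda>x. ((x - a) \<bullet> e)\<^sup>2) x = ((x - a) \<bullet> e)\<^sup>2 + h\<^sup>2 / DIM('a)"
proof -
  have "((x + h *\<^sub>R i - a) \<bullet> e)\<^sup>2 + ((x - h *\<^sub>R i - a) \<bullet> e)\<^sup>2 = 2 * ((x - a) \<bullet> e)\<^sup>2 + 2 * h\<^sup>2 * (e \<bullet> i)\<^sup>2" for i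
    by (simp add: inner_diff_left inner_add_left inner_commute[of e i]) algebra
  then have "(\<Sum>i\<in>Basis. ((x + h *\<^sub>R i - a) \<bullet> e)\<^sup>2 + ((x - h *\<^sub>R i - a) \<bullet> e)\<^sup>2)
     = 2 * DIM('a) * ((x - a) \<bullet> e)\<^sup>2 + 2 * h\<^sup>2 * (\<Sum>i\<in>Basis. (e \<bullet> i)\<^sup>2)"
    by (simp add: sum.distrib sum_distrib_left)
  also have "(\<Sum>i\<in>Basis. (e \<bullet> i)\<^sup>2) = 1"
    using assms euclidean_inner[of e e] by (simp add: norm_eq_sqrt_inner power2_eq_square)
  finally show ?thesis by (simp add: avg_def field_simps)
qed

lemma avg_affine: "avg h (\<lambda>x. (x - a) \<bullet> e) x = (x - a) \<bullet> e"
  by (simp add: avg_def inner_diff_left inner_add_left sum.distrib sum_subtractf)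

lemma avg_dist_sq:
  fixes a :: "'a::euclidean_space"
  shows "avg h (\<lambda>x. (norm (x - a))\<^sup>2) x = (norm (x - a))\<^sup>2 + h\<^sup>2"
proof -
  have "(norm (x + h *\<^sub>R i - a))\<^sup>2 + (norm (x - h *\<^sub>R i - a))\<^sup>2 = 2 * (norm (x - a))\<^sup>2 + 2 * h\<^sup>2"
    if "i \<in> Basis" for i
  proof -
    have *: "x + h *\<^sub>R i - a = (x - a) + h *\<^sub>R i" "x - h *\<^sub>R i - a = (x - a) - h *\<^sub>R i" by auto
    show ?thesis unfolding * power2_norm_eq_inner
      using that by (simp add: inner_diff inner_add inner_commute power2_eq_square)
  qed
  then show ?thesis by (simp add: avg_def field_simps)
qed

text \<open>Linear terms and mixed second-order terms cancel between opposite neighbours, leaving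
  the diagonal second derivatives. The identity is exact and holds at every point \<open>x\<close>,
  so a Taylor polynomial can serve as a barrier in a whole ball.\<close>

lemma avg_taylor2:
  fixes x :: "'a::euclidean_space"
  shows "avg h (taylor2 f x0) x = taylor2 f x0 x + h\<^sup>2 / (2 * DIM('a)) * laplacian f x0"
proof -
  let ?q = "\<lambda>i j. pderiv_dir j (pderiv_dir i f) x0"
  define l where "l y = (\<Sum>i\<in>Basis. pderiv_dir i f x0 * (y \<bullet> i))" for y
  define Q where "Q y = (\<Sum>i\<in>Basis. \<Sum>j\<in>Basis. ?q i j * (y \<bullet> i) * (y \<bullet> j))" for y
  have T: "taylor2 f x0 y = f x0 + l (y - x0) + Q (y - x0) / 2" for y
    by (simp add: taylor2_def l_def Q_def)
  have "taylor2 f x0 (x + h *\<^sub>R k) + taylor2 f x0 (x - h *\<^sub>R k) = 2 * taylor2 f x0 x + h\<^sup>2 * ?q k k"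
    if k: "k \<in> Basis" for k
  proof -
    define y where "y = x - x0"
    have *: "x + h *\<^sub>R k - x0 = y + h *\<^sub>R k" "x - h *\<^sub>R k - x0 = y - h *\<^sub>R k" "x - x0 = y"
      by (auto simp: y_def)
    have "Q (y + h *\<^sub>R k) + Q (y - h *\<^sub>R k)
      = (\<Sum>i\<in>Basis. \<Sum>j\<in>Basis. 2 * (?q i j * (y \<bullet> i) * (y \<bullet> j)) + 2 * h\<^sup>2 * (?q i j * (k \<bullet> i) * (k \<bullet> j)))"
      unfolding sum.distrib[symmetric] Q_def
      by (intro sum.cong refl) (simp add: inner_diff_left inner_add_left power2_eq_square algebra_simps)
    also have "\<dots> = 2 * Q y + 2 * h\<^sup>2 * Q k"
      by (simp add: sum.distrib sum_distrib_left Q_def)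
    also have "Q k = ?q k k"
      using k by (simp add: Q_def inner_Basis if_distrib[of "\<lambda>x. _ * x"] if_distrib[of "\<lambda>x. x * _"]
          cong: if_cong)
    finally have Q: "Q (y + h *\<^sub>R k) + Q (y - h *\<^sub>R k) = 2 * Q y + 2 * h\<^sup>2 * ?q k k" .
    have l: "l (y + h *\<^sub>R k) + l (y - h *\<^sub>R k) = 2 * l y"
      unfolding l_def sum_distrib_left sum.distrib[symmetric]
      by (intro sum.cong refl) (simp add: inner_diff_left inner_add_left algebra_simps)
    show ?thesis unfolding T * using Q l by simp
  qed
  then have "avg h (taylor2 f x0) x
      = (\<Sum>k\<in>(Basis::'a set). 2 * taylor2 f x0 x + h\<^sup>2 * ?q k k) / (2 * DIM('a))"
    unfolding avg_def by simp
  then show ?thesis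
    by (simp add: sum.distrib laplacian_def sum_distrib_left[symmetric] field_simps)
qed

lemma taylor2_at [simp]: "taylor2 f x0 x0 = f x0"
  by (simp add: taylor2_def)

text \<open>Linearity of the Laplacian, its value on quadratics and its sign at maxima are all read
  off from this limit of averages, so that discrete and continuous arguments share one set of
  identities.\<close>

lemma avg_tendsto_laplacian:
  fixes x :: "'a::euclidean_space"
  assumes "open S" "x \<in> S" "Ck_on 2 S f"
  shows "((\<lambda>h. (avg h f x - f x) / h\<^sup>2) \<longlongrightarrow> laplacian f x / (2 * DIM('a))) (at_right 0)"
proof (rule tendstoI)
  fix e :: real assume "e > 0"
  then obtain r where r: "r > 0" "\<And>y. y \<in> ball x r \<Longrightarrow> \<bar>f y - taylor2 f x y\<bar> \<le> e / 2 * (norm (y - x))\<^sup>2"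
    using taylor2_approx[OF assms(1,2,3), of "e/2"] by auto
  have "dist ((avg h f x - f x) / h\<^sup>2) (laplacian f x / (2 * DIM('a))) < e" if h: "0 < h" "h < r" for h
  proof -
    have P: "\<bar>f (x + h *\<^sub>R i) - taylor2 f x (x + h *\<^sub>R i)\<bar> \<le> e / 2 * h\<^sup>2"
       "\<bar>f (x - h *\<^sub>R i) - taylor2 f x (x - h *\<^sub>R i)\<bar> \<le> e / 2 * h\<^sup>2" if "i \<in> Basis" for i
      using r(2)[of "x + h *\<^sub>R i"] r(2)[of "x - h *\<^sub>R i"] h that by (auto simp: dist_norm)
    have "avg h f x \<le> avg h (\<lambda>y. taylor2 f x y + e / 2 * h\<^sup>2) x"
      using P by (intro avg_mono) (smt (verit, best))+
    moreover have "avg h (\<lambda>y. taylor2 f x y - e / 2 * h\<^sup>2) x \<le> avg h f x"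
      using P by (intro avg_mono) (smt (verit, best))+
    ultimately have "\<bar>avg h f x - f x - h\<^sup>2 / (2 * DIM('a)) * laplacian f x\<bar> \<le> e / 2 * h\<^sup>2"
      unfolding avg_add avg_diff avg_const avg_taylor2 taylor2_at abs_le_iff by (intro conjI) linarith+
    moreover have "(avg h f x - f x) / h\<^sup>2 - laplacian f x / (2 * DIM('a))
        = (avg h f x - f x - h\<^sup>2 / (2 * DIM('a)) * laplacian f x) / h\<^sup>2"
      using h by (simp add: field_simps)
    ultimately have "\<bar>(avg h f x - f x) / h\<^sup>2 - laplacian f x / (2 * DIM('a))\<bar> \<le> e / 2"
      using h by (simp add: divide_le_eq)
    then show ?thesis using \<open>e > 0\<close> by (simp add: dist_real_def)
  qed
  then show "\<forall>\<^sub>F h in at_right 0. dist ((avg h f x - f x) / h\<^sup>2) (laplacian f x / (2 * DIM('a))) < e"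
    unfolding eventually_at_right_field using r(1) by blast
qed

lemma laplacian_ge:
  fixes x :: "'a::euclidean_space" and c :: real
  assumes "open S" "x \<in> S" "Ck_on 2 S f" "\<forall>\<^sub>F h in at_right 0. avg h f x \<ge> f x + c * h\<^sup>2"
  shows "laplacian f x \<ge> 2 * DIM('a) * c"
proof -
  have "\<forall>\<^sub>F h in at_right (0::real). (avg h f x - f x) / h\<^sup>2 \<ge> c"
    using assms(4) eventually_at_right_less[of "0::real"]
    by eventually_elim (simp add: pos_le_divide_eq)
  then have "laplacian f x / (2 * DIM('a)) \<ge> c"
    using tendsto_lowerbound[OF avg_tendsto_laplacian[OF assms(1-3)]] by simp
  then show ?thesis by (simp add: field_simps)
qed

lemma laplacian_add:
  assumes "open S" "x \<in> S" "Ck_on 2 S f" "Ck_on 2 S g"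
  shows "laplacian (\<lambda>y. f y + g y) x = laplacian f x + laplacian g x"
proof -
  have "((\<lambda>h. (avg h f x - f x) / h\<^sup>2 + (avg h g x - g x) / h\<^sup>2) \<longlongrightarrow>
     laplacian f x / (2 * DIM('a)) + laplacian g x / (2 * DIM('a))) (at_right 0)"
    using assms by (intro tendsto_add avg_tendsto_laplacian)
  moreover have "(avg h f x - f x) / h\<^sup>2 + (avg h g x - g x) / h\<^sup>2
      = (avg h (\<lambda>y. f y + g y) x - (f x + g x)) / h\<^sup>2" for h
    by (simp add: avg_add diff_divide_distrib add_divide_distrib)
  ultimately have "laplacian f x / (2 * DIM('a)) + laplacian g x / (2 * DIM('a))
      = laplacian (\<lambda>y. f y + g y) x / (2 * DIM('a))"
    using assms by (intro tendsto_unique[OF _ _ avg_tendsto_laplacian[OF assms(1,2) Ck_on_add]])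
      (auto simp: trivial_limit_at_right_real)
  then show ?thesis by (simp add: field_simps)
qed

lemma laplacian_const: "laplacian (\<lambda>y. c) (x::'a::euclidean_space) = 0"
proof -
  have "pderiv_dir i (\<lambda>x::'a. d) = (\<lambda>x. 0)" for i d
    by (rule ext, rule pderiv_dir_eqI[where D = "\<lambda>_. 0"]) simp
  then show ?thesis by (simp add: laplacian_def)
qed

lemma laplacian_cmult:
  assumes "open S" "x \<in> S" "Ck_on 2 S f"
  shows "laplacian (\<lambda>y. c * f y) x = c * laplacian f x"
proof -
  have "((\<lambda>h. c * ((avg h f x - f x) / h\<^sup>2)) \<longlongrightarrow> c * (laplacian f x / (2 * DIM('a)))) (at_right 0)"
    using assms by (intro tendsto_mult tendsto_const avg_tendsto_laplacian)
  also have "(\<lambda>h. c * ((avg h f x - f x) / h\<^sup>2)) = (\<lambda>h. (avg h (\<lambda>y. c * f y) x - c * f x) / h\<^sup>2)"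
    by (rule ext) (simp add: avg_cmult algebra_simps)
  finally have "c * (laplacian f x / (2 * DIM('a))) = laplacian (\<lambda>y. c * f y) x / (2 * DIM('a))"
    by (rule tendsto_unique[OF trivial_limit_at_right_real _
        avg_tendsto_laplacian[OF assms(1,2) Ck_on_mult[OF assms(1) Ck_on_const assms(3)]]])
  then show ?thesis by (simp add: field_simps)
qed

lemma laplacian_dist_sq: "laplacian (\<lambda>y. (norm (y - a))\<^sup>2) x = 2 * DIM('a)" for x :: "'a::euclidean_space"
proof -
  have "((\<lambda>h. (avg h (\<lambda>y. (norm (y - a))\<^sup>2) x - (norm (x - a))\<^sup>2) / h\<^sup>2) \<longlongrightarrow> 1) (at_right 0)"
    by (rule tendsto_eventually) (auto simp: avg_dist_sq eventually_at_right_field intro: exI[of _ 1])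
  then have "1 = laplacian (\<lambda>y. (norm (y - a))\<^sup>2) x / (2 * DIM('a))"
    by (intro tendsto_unique[OF _ _ avg_tendsto_laplacian[OF open_UNIV UNIV_I smooth_on_Ck[OF smooth_on_dist_sq]]])
      (auto simp: trivial_limit_at_right_real)
  then show ?thesis by (simp add: field_simps)
qed

section \<open>Facts from real analysis\<close>

text \<open>Coordinates are switched on one at a time. In the induction over \<open>B\<close> the
  increment \<open>v\<close> is supported on \<open>B\<close>; its part \<open>v'\<close> without
  the coordinate \<open>k\<close> is covered by the induction hypothesis, and the remaining move
  along \<open>k\<close> by the mean value theorem. In space-time the spatial partials and the time
  partial are obtained by different arguments, and this lemma combines them.\<close>

lemma has_derivative_partials:
  fixes f :: "'a::euclidean_space \<Rightarrow> real"
  assumes S: "open S" "x \<in> S"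
    and p: "\<And>i y. i \<in> Basis \<Longrightarrow> y \<in> S \<Longrightarrow> ((\<lambda>s. f (y + s *\<^sub>R i)) has_real_derivative p i y) (at 0)"
    and cont: "\<And>i. i \<in> Basis \<Longrightarrow> isCont (p i) x"
  shows "(f has_derivative (\<lambda>v. \<Sum>i\<in>Basis. p i x * (v \<bullet> i))) (at x)"
proof -
  have p': "((\<lambda>s. f (y + s *\<^sub>R i)) has_real_derivative p i (y + s *\<^sub>R i)) (at s)"
    if "i \<in> Basis" "y + s *\<^sub>R i \<in> S" for i y s
  proof -
    have "((\<lambda>u. f (y + s *\<^sub>R i + u *\<^sub>R i)) has_real_derivative p i (y + s *\<^sub>R i)) (at 0)"
      using p[OF that] .
    then have "((\<lambda>u. f (y + (u + s) *\<^sub>R i)) has_real_derivative p i (y + s *\<^sub>R i)) (at 0)"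
      by (simp add: algebra_simps)
    then show ?thesis using DERIV_shift[of "\<lambda>u. f (y + u *\<^sub>R i)" _ 0 s] by simp
  qed
  have main: "\<exists>\<delta>>0. \<forall>v. norm v < \<delta> \<longrightarrow> (\<forall>i\<in>Basis - B. v \<bullet> i = 0) \<longrightarrow>
      \<bar>f (x + v) - f x - (\<Sum>i\<in>B. p i x * (v \<bullet> i))\<bar> \<le> \<epsilon> * (\<Sum>i\<in>B. \<bar>v \<bullet> i\<bar>)"
    if "finite B" "B \<subseteq> Basis" "\<epsilon> > 0" for B and \<epsilon> :: real
    using that(1,2)
  proof (induction B rule: finite_induct)
    case empty
    have "v = 0" if "\<forall>i\<in>Basis. v \<bullet> i = 0" for v :: 'a
      using that euclidean_eq_iff[of v 0] by simp
    then have "f (x + v) = f x" if "\<forall>i\<in>Basis. v \<bullet> i = 0" for v using that by fastforce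
    then show ?case by (intro exI[of _ 1]) simp
  next
    case (insert k B)
    then obtain \<delta>1 where \<delta>1: "\<delta>1 > 0" "\<And>v. norm v < \<delta>1 \<Longrightarrow> (\<forall>i\<in>Basis - B. v \<bullet> i = 0) \<Longrightarrow>
      \<bar>f (x + v) - f x - (\<Sum>i\<in>B. p i x * (v \<bullet> i))\<bar> \<le> \<epsilon> * (\<Sum>i\<in>B. \<bar>v \<bullet> i\<bar>)"
      by auto
    have k: "k \<in> Basis" "k \<notin> B" using insert by auto
    obtain \<delta>2 where \<delta>2: "\<delta>2 > 0" "\<And>y. dist y x < \<delta>2 \<Longrightarrow> \<bar>p k y - p k x\<bar> \<le> \<epsilon>"
      using cont[OF k(1)] \<open>\<epsilon> > 0\<close> unfolding continuous_at_eps_delta dist_real_def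
      by (meson less_imp_le)
    obtain \<delta>3 where \<delta>3: "\<delta>3 > 0" "ball x \<delta>3 \<subseteq> S" using S open_contains_ball by blast
    \<comment> \<open>Removing the coordinate \<open>k\<close> can double the norm, and the move
      along \<open>k\<close> adds at most one more, whence the factor 3.\<close>
    define \<delta> where "\<delta> = min \<delta>1 (min \<delta>2 \<delta>3) / 3"
    have "\<bar>f (x + v) - f x - (\<Sum>i\<in>insert k B. p i x * (v \<bullet> i))\<bar> \<le> \<epsilon> * (\<Sum>i\<in>insert k B. \<bar>v \<bullet> i\<bar>)"
      if v: "norm v < \<delta>" "\<forall>i\<in>Basis - insert k B. v \<bullet> i = 0" for v
    proof -
      define c where "c = v \<bullet> k"
      define v' where "v' = v - c *\<^sub>R k"
      have cn: "\<bar>c\<bar> \<le> norm v" using Basis_le_norm[OF k(1)] by (simp add: c_def)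
      have v'n: "norm v' \<le> 2 * norm v"
        unfolding v'_def using norm_triangle_ineq4[of v "c *\<^sub>R k"] cn k by simp
      have vi: "v' \<bullet> i = (if i = k then 0 else v \<bullet> i)" if "i \<in> Basis" for i
        using that k by (auto simp: v'_def c_def inner_diff_left inner_Basis)
      have 1: "\<bar>f (x + v') - f x - (\<Sum>i\<in>B. p i x * (v' \<bullet> i))\<bar> \<le> \<epsilon> * (\<Sum>i\<in>B. \<bar>v' \<bullet> i\<bar>)"
        using v v'n \<delta>1(1) by (intro \<delta>1) (auto simp: vi \<delta>_def)
      have "(\<Sum>i\<in>B. p i x * (v' \<bullet> i)) = (\<Sum>i\<in>B. p i x * (v \<bullet> i))" "(\<Sum>i\<in>B. \<bar>v' \<bullet> i\<bar>) = (\<Sum>i\<in>B. \<bar>v \<bullet> i\<bar>)"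
        using insert k by (auto intro!: sum.cong simp: vi subset_iff)
      note 1 = 1[unfolded this]
      have near: "dist (x + v' + s *\<^sub>R k) x < 3 * \<delta>" if "\<bar>s\<bar> \<le> \<bar>c\<bar>" for s
        using norm_triangle_ineq[of v' "s *\<^sub>R k"] v'n cn that v k
        by (simp add: dist_norm add.assoc)
      have inS: "x + v' + s *\<^sub>R k \<in> S" if "\<bar>s\<bar> \<le> \<bar>c\<bar>" for s
        using near[OF that] \<delta>3 by (auto simp: \<delta>_def dist_commute subset_iff)
      have "((\<lambda>s. f (x + v' + s *\<^sub>R k)) has_real_derivative p k (x + v' + s *\<^sub>R k)) (at s)"
        if "\<bar>s\<bar> \<le> \<bar>c\<bar>" for s
        using p'[OF k(1) inS[OF that]] .
      then have "\<exists>z. \<bar>z\<bar> \<le> \<bar>c\<bar> \<and> f (x + v' + c *\<^sub>R k) - f (x + v' + 0 *\<^sub>R k) = c * p k (x + v' + z *\<^sub>R k)"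
      proof (cases "0 \<le> c")
        case True
        then show ?thesis
        proof (cases "c = 0")
          case False
          then have "0 < c" using True by simp
          then have "\<exists>z>0. z < c \<and> f (x + v' + c *\<^sub>R k) - f (x + v' + 0 *\<^sub>R k) = (c - 0) * p k (x + v' + z *\<^sub>R k)"
            by (intro MVT2 p'[OF k(1)] inS) auto
          then show ?thesis by force
        qed auto
      next
        case False
        then have "c < 0" by simp
        then have "\<exists>z>c. z < 0 \<and> f (x + v' + 0 *\<^sub>R k) - f (x + v' + c *\<^sub>R k) = (0 - c) * p k (x + v' + z *\<^sub>R k)"
          by (intro MVT2 p'[OF k(1)] inS) auto
        then obtain z where "c < z" "z < 0" "f (x + v' + 0 *\<^sub>R k) - f (x + v' + c *\<^sub>R k) = (0 - c) * p k (x + v' + z *\<^sub>R k)"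
          by blast
        then show ?thesis by (intro exI[of _ z]) (auto simp: algebra_simps)
      qed
      then obtain z where z: "\<bar>z\<bar> \<le> \<bar>c\<bar>" "f (x + v) - f (x + v') = c * p k (x + v' + z *\<^sub>R k)"
        by (auto simp: v'_def)
      have "\<bar>p k (x + v' + z *\<^sub>R k) - p k x\<bar> \<le> \<epsilon>"
        using near[OF z(1)] by (intro \<delta>2) (auto simp: \<delta>_def)
      then have "\<bar>c * (p k (x + v' + z *\<^sub>R k) - p k x)\<bar> \<le> \<epsilon> * \<bar>c\<bar>"
        unfolding abs_mult mult.commute[of \<epsilon>] by (intro mult_left_mono) auto
      then have 2: "\<bar>f (x + v) - f (x + v') - p k x * c\<bar> \<le> \<epsilon> * \<bar>c\<bar>"
        using z(2) by (simp add: algebra_simps)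
      have "\<bar>f (x + v) - f x - (p k x * c + (\<Sum>i\<in>B. p i x * (v \<bullet> i)))\<bar>
          \<le> \<epsilon> * \<bar>c\<bar> + \<epsilon> * (\<Sum>i\<in>B. \<bar>v \<bullet> i\<bar>)"
        using 1 2 by linarith
      then show ?thesis using insert(1) k(2) by (simp add: c_def algebra_simps)
    qed
    moreover have "\<delta> > 0" using \<delta>1 \<delta>2 \<delta>3 by (simp add: \<delta>_def)
    ultimately show ?case by blast
  qed
  show ?thesis unfolding has_derivative_at_alt
  proof (intro conjI allI impI)
    show "bounded_linear (\<lambda>v. \<Sum>i\<in>Basis. p i x * (v \<bullet> i))"
      by (intro bounded_linear_sum bounded_linear_const_mult bounded_linear_inner_left)
    fix e :: real assume "e > 0"
    then obtain \<delta> where \<delta>: "\<delta> > 0" "\<And>v. norm v < \<delta> \<Longrightarrow>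
      \<bar>f (x + v) - f x - (\<Sum>i\<in>Basis. p i x * (v \<bullet> i))\<bar> \<le> e / DIM('a) * (\<Sum>i\<in>Basis. \<bar>v \<bullet> i\<bar>)"
      using main[of Basis "e / DIM('a)"] by auto
    have "(\<Sum>i\<in>Basis. \<bar>v \<bullet> i\<bar>) \<le> DIM('a) * norm v" for v :: 'a
      using sum_bounded_above[of "Basis::'a set" "\<lambda>i. \<bar>v \<bullet> i\<bar>" "norm v"] Basis_le_norm by auto
    then have "e / DIM('a) * (\<Sum>i\<in>Basis. \<bar>v \<bullet> i\<bar>) \<le> e / DIM('a) * (DIM('a) * norm v)" for v :: 'a
      using \<open>e > 0\<close> by (intro mult_left_mono) auto
    then have "norm (f y - f x - (\<Sum>i\<in>Basis. p i x * ((y - x) \<bullet> i))) \<le> e * norm (y - x)" if "norm (y - x) < \<delta>" for y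
      using \<delta>(2)[OF that] by (force intro: order_trans)
    then show "\<exists>d>0. \<forall>y. norm (y - x) < d \<longrightarrow>
       norm (f y - f x - (\<Sum>i\<in>Basis. p i x * ((y - x) \<bullet> i))) \<le> e * norm (y - x)"
      using \<delta>(1) by blast
  qed
qed

text \<open>Without a maximum, the relatively open sets on which \<open>f\<close> is below one of
  its own values would cover \<open>K\<close>. In a finite subcover the largest of the finitely many
  values would have to lie below one of them.\<close>

lemma usc_on_attains_max:
  assumes "compact K" "K \<noteq> {}" "usc_on K f"
  shows "\<exists>x\<in>K. \<forall>y\<in>K. f y \<le> f x"
proof (rule ccontr)
  assume neg: "\<not> ?thesis"
  have op: "\<exists>T. open T \<and> {y\<in>K. f y < a} = K \<inter> T" for a
  proof -
    have "\<exists>T. open T \<and> x \<in> T \<and> K \<inter> T \<subseteq> {y\<in>K. f y < a}" if "x \<in> K" "f x < a" for x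
    proof -
      have "eventually (\<lambda>y. f y < a) (at x within K)" using assms(3) that by (auto simp: usc_on_def)
      then obtain T where "open T" "x \<in> T" "\<And>y. y \<in> T \<Longrightarrow> y \<noteq> x \<Longrightarrow> y \<in> K \<Longrightarrow> f y < a"
        unfolding eventually_at_topological by blast
      then show ?thesis using that by (intro exI[of _ T]) blast
    qed
    then obtain T where T: "\<And>x. x \<in> K \<Longrightarrow> f x < a \<Longrightarrow> open (T x) \<and> x \<in> T x \<and> K \<inter> T x \<subseteq> {y\<in>K. f y < a}"
      by metis
    show ?thesis
      using T by (intro exI[of _ "\<Union>x\<in>{y\<in>K. f y < a}. T x"]) blast
  qed
  then obtain T where T: "\<And>a. open (T a)" "\<And>a. {y\<in>K. f y < a} = K \<inter> T a" by metis
  have "K \<subseteq> (\<Union>y\<in>K. T (f y))"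
    using neg T(2) by (fastforce simp: not_le)
  then obtain D where D: "D \<subseteq> K" "finite D" "K \<subseteq> (\<Union>y\<in>D. T (f y))"
    using compactE_image[OF assms(1), of K "\<lambda>y. T (f y)"] T(1) by metis
  then have "D \<noteq> {}" using assms(2) by auto
  then have "Max (f ` D) \<in> f ` D" using D(2) by (intro Max_in) auto
  then obtain y where "y \<in> D" "f y = Max (f ` D)" by auto
  then have y: "y \<in> D" "\<And>z. z \<in> D \<Longrightarrow> f z \<le> f y" using D(2) by auto
  have "y \<in> K" using y(1) D(1) by auto
  then obtain z where "z \<in> D" "y \<in> T (f z)" using D(3) by blast
  then have "f y < f z" using T(2)[of "f z"] \<open>y \<in> K\<close> by auto
  then show False using y \<open>z \<in> D\<close> by force
qed

text \<open>The deviation of \<open>f\<close> from its chord on \<open>[0, s]\<close> is at most \<open>C y (s - y)\<close>, as an interior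
  maximum of the excess would contradict the bound on second differences.\<close>

lemma second_difference_chord:
  fixes f :: "real \<Rightarrow> real"
  assumes "C > 0" "s > 0" and cont: "continuous_on {0..s} f"
    and sd: "\<And>y \<sigma>. 0 \<le> \<sigma> \<Longrightarrow> 0 \<le> y - \<sigma> \<Longrightarrow> y + \<sigma> \<le> s \<Longrightarrow> f (y + \<sigma>) - 2 * f y + f (y - \<sigma>) \<ge> - C * \<sigma>\<^sup>2"
    and y: "0 \<le> y" "y \<le> s"
  shows "f y \<le> f 0 + y / s * (f s - f 0) + C * y * (s - y)"
proof (rule ccontr)
  define m where "m = (f s - f 0) / s"
  define g where "g y = f y - (f 0 + y * m + C * y * (s - y))" for y
  assume "\<not> ?thesis"
  then have gy: "g y > 0" by (simp add: g_def m_def)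
  have "continuous_on {0..s} g" unfolding g_def by (intro continuous_intros cont)
  then obtain z where z: "z \<in> {0..s}" "\<And>u. u \<in> {0..s} \<Longrightarrow> g u \<le> g z"
    using continuous_attains_sup[of "{0..s}" g] \<open>s > 0\<close> by fastforce
  have "g z > 0" using z(2)[of y] y gy by simp
  moreover have "g 0 = 0" "g s = 0" using \<open>s > 0\<close> by (auto simp: g_def m_def)
  ultimately have "0 < z" "z < s" using z(1) by (auto simp: less_le)
  define \<sigma> where "\<sigma> = min z (s - z)"
  have \<sigma>: "\<sigma> > 0" "\<sigma> \<le> z" "\<sigma> \<le> s - z" using \<open>0 < z\<close> \<open>z < s\<close> by (auto simp: \<sigma>_def)
  have "g (z + \<sigma>) \<le> g z" "g (z - \<sigma>) \<le> g z" using \<sigma> z(1) by (auto intro!: z(2))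
  then have "g (z + \<sigma>) - 2 * g z + g (z - \<sigma>) \<le> 0" by simp
  moreover have "g (z + \<sigma>) - 2 * g z + g (z - \<sigma>) = f (z + \<sigma>) - 2 * f z + f (z - \<sigma>) + 2 * C * \<sigma>\<^sup>2"
    unfolding g_def by (simp add: algebra_simps power2_eq_square)
  moreover have "f (z + \<sigma>) - 2 * f z + f (z - \<sigma>) \<ge> - C * \<sigma>\<^sup>2" using \<sigma> by (intro sd) auto
  moreover have "C * \<sigma>\<^sup>2 > 0" using \<open>C > 0\<close> \<sigma> by simp
  ultimately show False by linarith
qed

text \<open>By the chord bound, the difference quotients at two positive points differ by at most
  \<open>C\<close> times the distance of the points, so they converge at 0. A quotient on the left
  is tied to its mirror image by one symmetric second difference at 0. The explicit rate is recorded
  because it makes difference quotients converge locally uniformly later on.\<close>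

lemma second_difference_derivative:
  fixes f :: "real \<Rightarrow> real"
  assumes "C > 0" "R > 0" and cont: "continuous_on {-R..R} f"
    and sd: "\<And>y \<sigma>. 0 \<le> \<sigma> \<Longrightarrow> -R \<le> y - \<sigma> \<Longrightarrow> y + \<sigma> \<le> R \<Longrightarrow> \<bar>f (y + \<sigma>) - 2 * f y + f (y - \<sigma>)\<bar> \<le> C * \<sigma>\<^sup>2"
  obtains p where "(f has_real_derivative p) (at 0)"
    "\<And>\<sigma>. \<sigma> \<noteq> 0 \<Longrightarrow> \<bar>\<sigma>\<bar> \<le> R \<Longrightarrow> \<bar>(f \<sigma> - f 0) / \<sigma> - p\<bar> \<le> 2 * C * \<bar>\<sigma>\<bar>"
proof -
  define q where "q \<sigma> = (f \<sigma> - f 0) / \<sigma>" for \<sigma>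
  have lip: "\<bar>q y - q s\<bar> \<le> C * (s - y)" if "0 < y" "y \<le> s" "s \<le> R" for y s
  proof -
    have "continuous_on {0..s} f" using that \<open>R > 0\<close> by (intro continuous_on_subset[OF cont]) auto
    moreover have sd': "\<bar>f (z + \<sigma>) - 2 * f z + f (z - \<sigma>)\<bar> \<le> C * \<sigma>\<^sup>2" if "0 \<le> \<sigma>" "0 \<le> z - \<sigma>" "z + \<sigma> \<le> s" for z \<sigma>
      using that \<open>s \<le> R\<close> \<open>R > 0\<close> by (intro sd) auto
    ultimately have "f y \<le> f 0 + y / s * (f s - f 0) + C * y * (s - y)"
      using that \<open>C > 0\<close> by (intro second_difference_chord) (fastforce simp: abs_le_iff)+
    moreover have "- f y \<le> - f 0 + y / s * (- f s - - f 0) + C * y * (s - y)"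
    proof (rule second_difference_chord[where f = "\<lambda>y. - f y"])
      show "continuous_on {0..s} (\<lambda>y. - f y)" by (intro continuous_intros) fact
      show "- C * \<sigma>\<^sup>2 \<le> - f (z + \<sigma>) - 2 * - f z + - f (z - \<sigma>)" if "0 \<le> \<sigma>" "0 \<le> z - \<sigma>" "z + \<sigma> \<le> s" for z \<sigma>
        using sd'[OF that] by (simp add: abs_le_iff)
    qed (use that \<open>C > 0\<close> in auto)
    ultimately have "\<bar>f y - f 0 - y / s * (f s - f 0)\<bar> \<le> C * y * (s - y)"
      by (simp add: algebra_simps abs_le_iff)
    moreover have "f y - f 0 - y / s * (f s - f 0) = y * (q y - q s)"
      using that by (simp add: q_def field_simps)
    ultimately have "\<bar>y * (q y - q s)\<bar> \<le> C * y * (s - y)" by simp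
    then have "y * \<bar>q y - q s\<bar> \<le> y * (C * (s - y))"
      unfolding abs_mult using that by (simp only: abs_of_pos mult.assoc mult.left_commute)
    then show ?thesis using that by simp
  qed
  define X where "X n = q (R / Suc n)" for n
  have le: "R / Suc n \<le> R / Suc m" if "m \<le> n" for m n
    using that \<open>R > 0\<close> by (intro divide_left_mono) auto
  have XX: "\<bar>X m - X n\<bar> \<le> C * (R / Suc m)" if "m \<le> n" for m n
  proof -
    have "\<bar>X n - X m\<bar> \<le> C * (R / Suc m - R / Suc n)" unfolding X_def
      using \<open>R > 0\<close> le[OF that] le[of 0 m] by (intro lip) auto
    also have "\<dots> \<le> C * (R / Suc m)" using \<open>C > 0\<close> \<open>R > 0\<close> by (intro mult_left_mono) auto
    finally show ?thesis by (simp add: abs_minus_commute)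
  qed
  have lim0: "(\<lambda>n. R / Suc n) \<longlonglongrightarrow> 0"
    using tendsto_mult[OF tendsto_const[of R] LIMSEQ_inverse_real_of_nat] by (simp add: divide_inverse)
  have "Cauchy X"
  proof (rule metric_CauchyI)
    fix e :: real assume "e > 0"
    have "(\<lambda>n. C * (R / Suc n)) \<longlonglongrightarrow> C * 0" by (intro tendsto_intros lim0)
    then have "eventually (\<lambda>n. C * (R / Suc n) < e / 2) sequentially"
      using \<open>e > 0\<close> by (intro order_tendstoD) auto
    then obtain N where N: "C * (R / Suc N) < e / 2" by (auto simp: eventually_sequentially)
    have "dist (X m) (X n) < e" if "m \<ge> N" "n \<ge> N" for m n
      using XX[OF that(1)] XX[OF that(2)] N unfolding dist_real_def by linarith
    then show "\<exists>M. \<forall>m\<ge>M. \<forall>n\<ge>M. dist (X m) (X n) < e" by blast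
  qed
  then obtain p where p: "X \<longlonglongrightarrow> p" using Cauchy_convergent convergent_def by blast
  have pos: "\<bar>q s - p\<bar> \<le> C * s" if s: "0 < s" "s \<le> R" for s
  proof (rule tendsto_upperbound)
    show "(\<lambda>n. \<bar>q s - X n\<bar>) \<longlonglongrightarrow> \<bar>q s - p\<bar>" by (intro tendsto_intros p)
    have "eventually (\<lambda>n. R / Suc n < s) sequentially" using lim0 s by (intro order_tendstoD)
    then show "\<forall>\<^sub>F n in sequentially. \<bar>q s - X n\<bar> \<le> C * s"
    proof eventually_elim
      case (elim n)
      then have "\<bar>X n - q s\<bar> \<le> C * (s - R / Suc n)" unfolding X_def
        using \<open>R > 0\<close> s by (intro lip) auto
      also have "\<dots> \<le> C * s" using \<open>C > 0\<close> \<open>R > 0\<close> by (intro mult_left_mono) auto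
      finally show ?case by (simp add: abs_minus_commute)
    qed
  qed simp
  have bound: "\<bar>q \<sigma> - p\<bar> \<le> 2 * C * \<bar>\<sigma>\<bar>" if "\<sigma> \<noteq> 0" "\<bar>\<sigma>\<bar> \<le> R" for \<sigma>
  proof (cases "\<sigma> > 0")
    case True
    then have "\<bar>q \<sigma> - p\<bar> \<le> C * \<sigma>" using pos[of \<sigma>] that by simp
    also have "\<dots> \<le> 2 * C * \<bar>\<sigma>\<bar>" using True \<open>C > 0\<close> by simp
    finally show ?thesis .
  next
    case False
    then have s: "- \<sigma> > 0" "- \<sigma> \<le> R" using that by auto
    have "\<bar>f (0 + - \<sigma>) - 2 * f 0 + f (0 - - \<sigma>)\<bar> \<le> C * (- \<sigma>)\<^sup>2" using s by (intro sd) auto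
    moreover have "f (0 + - \<sigma>) - 2 * f 0 + f (0 - - \<sigma>) = (- \<sigma>) * (q (- \<sigma>) - q \<sigma>)"
      using s by (simp add: q_def field_simps)
    ultimately have "\<bar>(- \<sigma>) * (q (- \<sigma>) - q \<sigma>)\<bar> \<le> (- \<sigma>) * (C * (- \<sigma>))"
      by (simp add: power2_eq_square mult.left_commute)
    then have "(- \<sigma>) * \<bar>q (- \<sigma>) - q \<sigma>\<bar> \<le> (- \<sigma>) * (C * (- \<sigma>))"
      unfolding abs_mult using s(1) by (simp only: abs_of_pos)
    then have "\<bar>q (- \<sigma>) - q \<sigma>\<bar> \<le> C * (- \<sigma>)" using s by (metis mult_le_cancel_left_pos)
    then show ?thesis using pos[OF s] s by simp
  qed
  moreover have "(f has_real_derivative p) (at 0)"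
    unfolding DERIV_def
  proof (rule LIM_I)
    fix r :: real assume "r > 0"
    define d where "d = min R (r / (4 * C))"
    have "norm ((f (0 + x) - f 0) / x - p) < r" if "x \<noteq> 0 \<and> norm (x - 0) < d" for x
    proof -
      have "\<bar>x\<bar> < r / (4 * C)" using that by (simp add: d_def)
      then have "2 * C * \<bar>x\<bar> \<le> r / 2" using \<open>C > 0\<close> by (simp add: field_simps)
      moreover have "\<bar>q x - p\<bar> \<le> 2 * C * \<bar>x\<bar>" using that by (intro bound) (auto simp: d_def)
      ultimately show ?thesis using \<open>r > 0\<close> by (simp add: q_def)
    qed
    moreover have "d > 0" using \<open>R > 0\<close> \<open>C > 0\<close> \<open>r > 0\<close> by (simp add: d_def)
    ultimately show "\<exists>s>0. \<forall>x. x \<noteq> 0 \<and> norm (x - 0) < s \<longrightarrow> norm ((f (0 + x) - f 0) / x - p) < r" by blast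
  qed
  ultimately show ?thesis using that unfolding q_def by blast
qed

text \<open>Let \<open>c\<close> be the infimum of the times at which the increment exceeds slope
  \<open>\<epsilon>\<close>. Continuity gives the bound at \<open>c\<close>, and the right
  derivative carries it past \<open>c\<close>, a contradiction. Discrete solutions are controlled
  forward in time only, so one-sided information is what the limit provides.\<close>

lemma right_derivative_zero_const:
  fixes f :: "real \<Rightarrow> real"
  assumes "a \<le> b" and cont: "continuous_on {a..b} f"
    and der: "\<And>t \<epsilon>. a \<le> t \<Longrightarrow> t < b \<Longrightarrow> \<epsilon> > 0 \<Longrightarrow> \<exists>\<delta>>0. \<forall>s. t \<le> s \<and> s < t + \<delta> \<longrightarrow> \<bar>f s - f t\<bar> \<le> \<epsilon> * (s - t)"
  shows "f b = f a"
proof -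
  have "\<bar>f b - f a\<bar> \<le> \<epsilon> * (b - a)" if "\<epsilon> > 0" for \<epsilon>
  proof (rule ccontr)
    define T where "T = {t \<in> {a..b}. \<bar>f t - f a\<bar> > \<epsilon> * (t - a)}"
    define c where "c = Inf T"
    assume "\<not> ?thesis"
    then have bT: "b \<in> T" using \<open>a \<le> b\<close> by (simp add: T_def)
    have bdd: "bdd_below T" by (intro bdd_belowI[of _ a]) (simp add: T_def)
    have c: "a \<le> c" "c \<le> b" using bT bdd unfolding c_def
      by (auto intro!: cInf_greatest cInf_lower simp: T_def)
    have below: "\<bar>f t - f a\<bar> \<le> \<epsilon> * (t - a)" if "a \<le> t" "t < c" for t
      using that c cInf_lower[OF _ bdd, of t] by (fastforce simp: T_def c_def)
    have atc: "\<bar>f c - f a\<bar> \<le> \<epsilon> * (c - a)"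
    proof (cases "c = a")
      case False
      then have ac: "a < c" using c by simp
      have "continuous_on {a..c} (\<lambda>t. \<bar>f t - f a\<bar> - \<epsilon> * (t - a))"
        using c by (intro continuous_intros continuous_on_subset[OF cont]) auto
      then have "\<bar>f c - f a\<bar> - \<epsilon> * (c - a) \<le> 0"
        by (intro continuous_le_on_closure[of "{a<..<c}" "\<lambda>t. \<bar>f t - f a\<bar> - \<epsilon> * (t - a)" c 0])
          (use below ac in auto)
      then show ?thesis by simp
    qed simp
    then have "c < b" using c bT by (cases "c = b") (auto simp: T_def)
    then obtain \<delta> where \<delta>: "\<delta> > 0" "\<And>s. c \<le> s \<Longrightarrow> s < c + \<delta> \<Longrightarrow> \<bar>f s - f c\<bar> \<le> \<epsilon> * (s - c)"
      using der[OF c(1) _ \<open>\<epsilon> > 0\<close>] by blast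
    have "c + \<delta> \<le> t" if "t \<in> T" for t
    proof (rule ccontr)
      assume n: "\<not> c + \<delta> \<le> t"
      have "c \<le> t" using that bdd by (simp add: c_def cInf_lower)
      then have "\<bar>f t - f c\<bar> \<le> \<epsilon> * (t - c)" using n by (intro \<delta>) auto
      then have "\<bar>f t - f a\<bar> \<le> \<epsilon> * (t - a)" using atc by (simp add: algebra_simps)
      then show False using that by (simp add: T_def)
    qed
    then have "c + \<delta> \<le> c" unfolding c_def using bT by (intro cInf_greatest) auto
    then show False using \<delta> by simp
  qed
  then have "\<bar>f b - f a\<bar> \<le> e" if "e > 0" for e
  proof -
    have "\<bar>f b - f a\<bar> \<le> e / (b - a + 1) * (b - a)" using that \<open>a \<le> b\<close> \<open>\<And>\<epsilon>. \<epsilon> > 0 \<Longrightarrow> \<bar>f b - f a\<bar> \<le> \<epsilon> * (b - a)\<close>[of "e / (b - a + 1)"] by simp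
    also have "\<dots> \<le> e" using that \<open>a \<le> b\<close> by (simp add: field_simps)
    finally show ?thesis .
  qed
  then show ?thesis using field_le_epsilon[of "\<bar>f b - f a\<bar>" 0] by simp
qed

text \<open>The primitive of \<open>g\<close> has the same right derivative as \<open>f\<close>, so
  their difference is constant and \<open>f\<close> inherits the two-sided derivative of the
  primitive.\<close>

lemma continuous_right_derivative:
  fixes f g :: "real \<Rightarrow> real"
  assumes "a < t" "t < b" and cont: "continuous_on {a..b} f" "continuous_on {a..b} g"
    and der: "\<And>t \<epsilon>. a \<le> t \<Longrightarrow> t < b \<Longrightarrow> \<epsilon> > 0 \<Longrightarrow>
      \<exists>\<delta>>0. \<forall>s. t \<le> s \<and> s < t + \<delta> \<longrightarrow> \<bar>f s - f t - (s - t) * g t\<bar> \<le> \<epsilon> * (s - t)"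
  shows "(f has_real_derivative g t) (at t)"
proof -
  define G where "G t = integral {a..t} g" for t
  have dG: "(G has_real_derivative g s) (at s within {a..b})" if "s \<in> {a..b}" for s
    unfolding G_def using integral_has_real_derivative[OF cont(2) that] .
  have cG: "continuous_on {a..b} G" using dG DERIV_continuous_on by blast
  have eq: "f s - G s = f a - G a" if s: "a \<le> s" "s \<le> b" for s
  proof (rule right_derivative_zero_const[OF s(1), where f = "\<lambda>s. f s - G s"])
    show "continuous_on {a..s} (\<lambda>s. f s - G s)"
      using s by (intro continuous_intros continuous_on_subset[OF cont(1)] continuous_on_subset[OF cG]) auto
    fix t \<epsilon> :: real assume t: "a \<le> t" "t < s" "\<epsilon> > 0"
    obtain \<delta>1 where \<delta>1: "\<delta>1 > 0" "\<And>s. t \<le> s \<Longrightarrow> s < t + \<delta>1 \<Longrightarrow> \<bar>f s - f t - (s - t) * g t\<bar> \<le> \<epsilon>/2 * (s - t)"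
      using der[of t "\<epsilon>/2"] t s by auto
    have "(G has_derivative (\<lambda>h. h * g t)) (at t within {a..b})"
      using dG[of t] t s by (simp add: has_field_derivative_def mult.commute[of _ "g t"] lambda_one)
    then obtain \<delta>2 where \<delta>2: "\<delta>2 > 0" "\<And>y. y \<in> {a..b} \<Longrightarrow> norm (y - t) < \<delta>2 \<Longrightarrow>
        norm (G y - G t - (y - t) * g t) \<le> \<epsilon>/2 * norm (y - t)"
      using t unfolding has_derivative_within_alt by (meson half_gt_zero)
    have "\<bar>(f y - G y) - (f t - G t)\<bar> \<le> \<epsilon> * (y - t)" if "t \<le> y" "y < t + min (min \<delta>1 \<delta>2) (s - t)" for y
    proof -
      have A: "\<bar>f y - f t - (y - t) * g t\<bar> \<le> \<epsilon>/2 * (y - t)" using that by (intro \<delta>1) auto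
      have "norm (G y - G t - (y - t) * g t) \<le> \<epsilon>/2 * norm (y - t)" using that t s by (intro \<delta>2) auto
      then have "\<bar>G y - G t - (y - t) * g t\<bar> \<le> \<epsilon>/2 * (y - t)" using that by simp
      then have "\<bar>(f y - f t - (y - t) * g t) - (G y - G t - (y - t) * g t)\<bar> \<le> \<epsilon>/2 * (y - t) + \<epsilon>/2 * (y - t)"
        using A by linarith
      then show ?thesis by (simp add: algebra_simps)
    qed
    then show "\<exists>\<delta>>0. \<forall>y. t \<le> y \<and> y < t + \<delta> \<longrightarrow> \<bar>(f y - G y) - (f t - G t)\<bar> \<le> \<epsilon> * (y - t)"
      using \<delta>1 \<delta>2 t by (intro exI[of _ "min (min \<delta>1 \<delta>2) (s - t)"]) auto
  qed
  have "(G has_real_derivative g t) (at t)"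
    using dG[of t] assms(1,2) by (simp add: at_within_Icc_at)
  then have "((\<lambda>s. G s + (f a - G a)) has_real_derivative g t) (at t)"
    by (auto intro!: derivative_eq_intros)
  then show ?thesis
  proof (rule has_field_derivative_transform_within_open[where S = "{a<..<b}"])
    show "\<And>x. x \<in> {a<..<b} \<Longrightarrow> G x + (f a - G a) = f x" using eq by (simp add: algebra_simps)
  qed (use assms in auto)
qed

text \<open>Intended for discrete flows, which jump in time: their oscillation is small only once
  the mesh is fine, so the modulus is allowed to ignore finitely many indices for each tolerance. A
  diagonal argument gives convergence on a countable dense set, and the asymptotic modulus extends
  it to all points, locally uniformly.\<close>

lemma asymptotic_Arzela_Ascoli:
  fixes F :: "nat \<Rightarrow> 'p::euclidean_space \<Rightarrow> real"
  assumes bnd: "\<And>n p. \<bar>F n p\<bar> \<le> M"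
    and equi: "\<And>\<epsilon>. \<epsilon> > 0 \<Longrightarrow> \<exists>\<delta>>0. \<exists>N. \<forall>n\<ge>N. \<forall>p q. dist p q < \<delta> \<longrightarrow> \<bar>F n p - F n q\<bar> \<le> \<epsilon>"
  obtains r w where "strict_mono (r :: nat \<Rightarrow> nat)"
    "\<And>K. compact K \<Longrightarrow> uniform_limit K (\<lambda>n. F (r n)) w sequentially"
    "uniformly_continuous_on UNIV w"
proof -
  obtain D :: "'p set" where D: "countable D" "\<And>X. open X \<Longrightarrow> X \<noteq> {} \<Longrightarrow> \<exists>d\<in>D. d \<in> X"
    using countable_dense_setE by metis
  obtain r where r: "strict_mono (r :: nat \<Rightarrow> nat)" "\<And>d. d \<in> D \<Longrightarrow> \<exists>l. (\<lambda>n. F (r n) d) \<longlonglongrightarrow> l"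
    using function_convergent_subsequence[OF D(1), of F M] bnd by auto
  have rn: "n \<le> r n" for n using r(1) by (rule strict_mono_imp_increasing)
  have cau: "\<exists>\<delta>>0. \<exists>N. \<forall>m\<ge>N. \<forall>n\<ge>N. \<forall>q. dist q p < \<delta> \<longrightarrow> \<bar>F (r m) q - F (r n) q\<bar> \<le> e" if "e > 0" for e p
  proof -
    obtain \<delta> N where \<delta>: "\<delta> > 0" "\<And>n p q. n \<ge> N \<Longrightarrow> dist p q < \<delta> \<Longrightarrow> \<bar>F n p - F n q\<bar> \<le> e / 3"
      using equi[of "e/3"] \<open>e > 0\<close> by (metis divide_pos_pos zero_less_numeral)
    obtain d where d: "d \<in> D" "d \<in> ball p (\<delta>/2)" using D(2)[of "ball p (\<delta>/2)"] \<delta>(1) by auto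
    have "Cauchy (\<lambda>n. F (r n) d)" using r(2)[OF d(1)] LIMSEQ_imp_Cauchy by blast
    then obtain N' where N': "\<And>m n. m \<ge> N' \<Longrightarrow> n \<ge> N' \<Longrightarrow> dist (F (r m) d) (F (r n) d) < e / 3"
      using \<open>e > 0\<close> by (metis metric_CauchyD divide_pos_pos zero_less_numeral)
    have "\<bar>F (r m) q - F (r n) q\<bar> \<le> e" if mn: "m \<ge> max N N'" "n \<ge> max N N'" and q: "dist q p < \<delta>/2" for m n q
    proof -
      have "dist q d < \<delta>" using q d(2) dist_triangle[of q d p] by (simp add: dist_commute)
      moreover have "r m \<ge> N" "r n \<ge> N" using mn rn[of m] rn[of n] by auto
      ultimately have "\<bar>F (r m) q - F (r m) d\<bar> \<le> e / 3" "\<bar>F (r n) q - F (r n) d\<bar> \<le> e / 3"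
        using \<delta>(2)[of "r m" q d] \<delta>(2)[of "r n" q d] by auto
      moreover have "\<bar>F (r m) d - F (r n) d\<bar> < e / 3" using N'[of m n] mn by (simp add: dist_real_def)
      ultimately show ?thesis by linarith
    qed
    then show ?thesis using \<delta>(1) half_gt_zero by blast
  qed
  have "\<exists>l. (\<lambda>n. F (r n) p) \<longlonglongrightarrow> l" for p
  proof -
    have "Cauchy (\<lambda>n. F (r n) p)"
    proof (rule metric_CauchyI)
      fix e :: real assume "e > 0"
      then obtain \<delta> N where \<delta>: "\<delta> > 0" and N: "\<And>m n q. m \<ge> N \<Longrightarrow> n \<ge> N \<Longrightarrow> dist q p < \<delta> \<Longrightarrow> \<bar>F (r m) q - F (r n) q\<bar> \<le> e/2"
        using cau[of "e/2" p] by (metis half_gt_zero)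
      show "\<exists>M. \<forall>m\<ge>M. \<forall>n\<ge>M. dist (F (r m) p) (F (r n) p) < e"
      proof (intro exI allI impI)
        fix m n assume "m \<ge> N" "n \<ge> N"
        then show "dist (F (r m) p) (F (r n) p) < e"
          using N[of m n p] \<delta> \<open>e > 0\<close> by (simp add: dist_real_def)
      qed
    qed
    then show ?thesis using Cauchy_convergent convergent_def by blast
  qed
  then obtain w where w: "\<And>p. (\<lambda>n. F (r n) p) \<longlonglongrightarrow> w p" by metis
  have "uniform_limit K (\<lambda>n. F (r n)) w sequentially" if K: "compact K" for K
  proof (rule uniform_limitI)
    fix e :: real assume "e > 0"
    then obtain \<delta> N where \<delta>: "\<And>p. \<delta> p > 0" and N: "\<And>p m n q. m \<ge> N p \<Longrightarrow> n \<ge> N p \<Longrightarrow> dist q p < \<delta> p \<Longrightarrow> \<bar>F (r m) q - F (r n) q\<bar> \<le> e/2"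
      using cau[of "e/2"] by (metis half_gt_zero)
    have "K \<subseteq> (\<Union>p\<in>K. ball p (\<delta> p))" using \<delta> by force
    then obtain T where T: "T \<subseteq> K" "finite T" "K \<subseteq> (\<Union>p\<in>T. ball p (\<delta> p))"
      using compactE_image[OF K, of K "\<lambda>p. ball p (\<delta> p)"] by blast
    define N0 where "N0 = Max (insert 0 (N ` T))"
    have "dist (F (r n) q) (w q) < e" if "n \<ge> N0" "q \<in> K" for n q
    proof -
      obtain p where p: "p \<in> T" "q \<in> ball p (\<delta> p)" using T(3) \<open>q \<in> K\<close> by blast
      have Np: "N p \<le> N0" using p T(2) by (auto simp: N0_def)
      have "\<bar>F (r n) q - w q\<bar> \<le> e/2"
      proof (rule tendsto_upperbound)
        show "(\<lambda>m. \<bar>F (r n) q - F (r m) q\<bar>) \<longlonglongrightarrow> \<bar>F (r n) q - w q\<bar>" by (intro tendsto_intros w)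
        show "\<forall>\<^sub>F m in sequentially. \<bar>F (r n) q - F (r m) q\<bar> \<le> e/2"
          unfolding eventually_sequentially using N[of p n _ q] Np that p by (auto simp: dist_commute)
      qed simp
      then show ?thesis using \<open>e > 0\<close> by (simp add: dist_real_def)
    qed
    then show "\<forall>\<^sub>F n in sequentially. \<forall>x\<in>K. dist (F (r n) x) (w x) < e"
      unfolding eventually_sequentially by blast
  qed
  moreover have "uniformly_continuous_on UNIV w" unfolding uniformly_continuous_on_def
  proof (intro allI impI)
    fix e :: real assume "e > 0"
    then obtain \<delta> N where \<delta>: "\<delta> > 0" "\<And>n p q. n \<ge> N \<Longrightarrow> dist p q < \<delta> \<Longrightarrow> \<bar>F n p - F n q\<bar> \<le> e / 2"
      using equi[of "e/2"] \<open>e > 0\<close> by (metis half_gt_zero)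
    have "dist (w q) (w p) < e" if "dist q p < \<delta>" for p q
    proof -
      have "\<bar>w q - w p\<bar> \<le> e/2"
      proof (rule tendsto_upperbound)
        show "(\<lambda>m. \<bar>F (r m) q - F (r m) p\<bar>) \<longlonglongrightarrow> \<bar>w q - w p\<bar>" by (intro tendsto_intros w)
        show "\<forall>\<^sub>F m in sequentially. \<bar>F (r m) q - F (r m) p\<bar> \<le> e/2"
          unfolding eventually_sequentially using \<delta>(2) that rn order_trans by blast
      qed simp
      then show ?thesis using \<open>e > 0\<close> by (simp add: dist_real_def)
    qed
    then show "\<exists>d>0. \<forall>x\<in>UNIV. \<forall>x'\<in>UNIV. dist x' x < d \<longrightarrow> dist (w x') (w x) < e" using \<delta>(1) by blast
  qed
  ultimately show ?thesis using that r(1) by blast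
qed

section \<open>Limits of discrete heat flows\<close>

text \<open>One time step has length \<open>h\<^sup>2 / (2 N)\<close>, so that a step of the averaging operator
  approximates the heat equation.\<close>

definition disc_sol :: "real \<Rightarrow> ('a::euclidean_space \<times> real) set \<Rightarrow> ('a \<Rightarrow> real \<Rightarrow> real) \<Rightarrow> bool" where
  "disc_sol h K f \<longleftrightarrow> (\<forall>x t. (x, t) \<in> K \<longrightarrow> (x, t + h\<^sup>2 / (2 * DIM('a))) \<in> K \<longrightarrow>
     (\<forall>i\<in>Basis. (x + h *\<^sub>R i, t) \<in> K \<and> (x - h *\<^sub>R i, t) \<in> K) \<longrightarrow>
     f x (t + h\<^sup>2 / (2 * DIM('a))) = avg h (\<lambda>y. f y t) x)"

lemma disc_sol_subset: "disc_sol h K f \<Longrightarrow> K' \<subseteq> K \<Longrightarrow> disc_sol h K' f"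
  unfolding disc_sol_def by blast

lemma disc_sol_add: "disc_sol h K f \<Longrightarrow> disc_sol h K g \<Longrightarrow> disc_sol h K (\<lambda>x t. f x t + g x t)"
  by (simp add: disc_sol_def avg_add)

lemma disc_sol_cmult: "disc_sol h K f \<Longrightarrow> disc_sol h K (\<lambda>x t. c * f x t)"
  by (simp add: disc_sol_def avg_cmult)

lemma disc_sol_shift:
  assumes "disc_sol h K f" "\<And>x t. (x, t) \<in> K' \<Longrightarrow> (x + \<xi>, t) \<in> K"
  shows "disc_sol h K' (\<lambda>x t. f (x + \<xi>) t)"
  unfolding disc_sol_def
proof (intro allI impI)
  fix x :: 'a and t
  assume *: "(x, t) \<in> K'" "(x, t + h\<^sup>2 / (2 * DIM('a))) \<in> K'"
    "\<forall>i\<in>Basis. (x + h *\<^sub>R i, t) \<in> K' \<and> (x - h *\<^sub>R i, t) \<in> K'"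
  have "(x + \<xi> + h *\<^sub>R i, t) \<in> K \<and> (x + \<xi> - h *\<^sub>R i, t) \<in> K" if "i \<in> Basis" for i
    using assms(2)[of "x + h *\<^sub>R i" t] assms(2)[of "x - h *\<^sub>R i" t] * that by (simp add: algebra_simps)
  then have "f (x + \<xi>) (t + h\<^sup>2 / (2 * DIM('a))) = avg h (\<lambda>y. f y t) (x + \<xi>)"
    using assms * by (simp add: disc_sol_def)
  then show "f (x + \<xi>) (t + h\<^sup>2 / (2 * DIM('a))) = avg h (\<lambda>y. f (y + \<xi>) t) x"
    using avg_shift[of h "\<lambda>y. f y t" \<xi> x] by simp
qed

text \<open>Every real time lies on its own orbit of steps \<open>\<tau> h\<close>, so the initial
  bound has to cover the whole first layer of length \<open>\<tau> h\<close> and not only the time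
  \<open>a\<close>. Induction over the layers propagates it: averages are taken at points of
  \<open>I\<close>, whose stencils stay in \<open>X\<close>, and the other points of
  \<open>X\<close> act as lateral boundary.\<close>

lemma disc_max_principle:
  fixes d :: "'a::euclidean_space \<Rightarrow> real \<Rightarrow> real"
  defines "\<tau> \<equiv> \<lambda>h::real. h\<^sup>2 / (2 * DIM('a))"
  assumes h: "h > 0"
    and step: "\<And>x t. x \<in> I \<Longrightarrow> a \<le> t \<Longrightarrow> t + \<tau> h \<le> b \<Longrightarrow> d x (t + \<tau> h) \<le> avg h (\<lambda>y. d y t) x"
    and stencil: "\<And>x i. x \<in> I \<Longrightarrow> i \<in> Basis \<Longrightarrow> x + h *\<^sub>R i \<in> X \<and> x - h *\<^sub>R i \<in> X"
    and lateral: "\<And>x t. x \<in> X - I \<Longrightarrow> a \<le> t \<Longrightarrow> t \<le> b \<Longrightarrow> d x t \<le> c"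
    and init: "\<And>x t. x \<in> X \<Longrightarrow> a \<le> t \<Longrightarrow> t \<le> b \<Longrightarrow> t < a + \<tau> h \<Longrightarrow> d x t \<le> c"
    and xt: "x \<in> X" "a \<le> t" "t \<le> b"
  shows "d x t \<le> c"
proof -
  have \<tau>: "\<tau> h > 0" using h by (simp add: \<tau>_def)
  have "\<forall>x t. x \<in> X \<longrightarrow> a \<le> t \<longrightarrow> t \<le> b \<longrightarrow> t < a + real (Suc n) * \<tau> h \<longrightarrow> d x t \<le> c" for n
  proof (induction n)
    case 0
    then show ?case using init by simp
  next
    case (Suc n)
    show ?case
    proof (intro allI impI)
      fix x t assume *: "x \<in> X" "a \<le> t" "t \<le> b" "t < a + real (Suc (Suc n)) * \<tau> h"
      consider "t < a + \<tau> h" | "x \<notin> I" | "t \<ge> a + \<tau> h" "x \<in> I" by linarith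
      then show "d x t \<le> c"
      proof cases
        case 3
        have "d x (t - \<tau> h + \<tau> h) \<le> avg h (\<lambda>y. d y (t - \<tau> h)) x"
          using 3 * \<tau> by (intro step) auto
        also have "\<dots> \<le> avg h (\<lambda>y. c) x"
          using 3 * \<tau> stencil[OF 3(2)] by (intro avg_mono Suc.IH[rule_format]) (auto simp: algebra_simps)
        finally show ?thesis by (simp add: avg_const)
      qed (use * init lateral in auto)
    qed
  qed
  moreover obtain n where "(t - a) / \<tau> h < real n" using reals_Archimedean2 by blast
  then have "t < a + real (Suc n) * \<tau> h" using \<tau> by (simp add: field_simps)
  ultimately show ?thesis using xt by blast
qed

text \<open>The odd part of a discrete solution across a hyperplane is dominated by a quadratic barrier.
  Only points whose distance from the hyperplane is a multiple of \<open>h\<close> are considered, as for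
  those the random walk hits the hyperplane before crossing it.\<close>

lemma disc_reflection_le:
  fixes f :: "'a::euclidean_space \<Rightarrow> real \<Rightarrow> real" and M R :: real
  assumes e: "e \<in> Basis" and h: "0 < h" "h \<le> R / 2"
    and f: "disc_sol h (cball x0 R \<times> {t0 - R\<^sup>2..t0}) f"
    and M: "\<And>x t. x \<in> cball x0 R \<Longrightarrow> t0 - R\<^sup>2 \<le> t \<Longrightarrow> t \<le> t0 \<Longrightarrow> \<bar>f x t\<bar> \<le> M"
    and m: "real m * h \<le> R"
  shows "f (x0 + (real m * h) *\<^sub>R e) t0 - f (x0 - (real m * h) *\<^sub>R e) t0 \<le> 28 * DIM('a) * M * (real m * h) / R"
proof -
  define N where "N = real DIM('a)"
  define \<tau> where "\<tau> = h\<^sup>2 / (2 * N)"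
  have N: "N \<ge> 1" by (simp add: N_def DIM_ge_Suc0)
  have R: "R > 0" using h by simp
  have "\<bar>f x0 t0\<bar> \<le> M" using R by (intro M) auto
  then have M0: "M \<ge> 0" by simp
  define \<rho> where "\<rho> x = x - (2 * ((x - x0) \<bullet> e)) *\<^sub>R e" for x
  have en: "norm e = 1" "e \<bullet> e = 1" using e by auto
  have \<rho>n: "norm (\<rho> x - x0) = norm (x - x0)" for x
  proof -
    have eq: "\<rho> x - x0 = (x - x0) - (2 * ((x - x0) \<bullet> e)) *\<^sub>R e" by (simp add: \<rho>_def)
    show ?thesis unfolding norm_eq_sqrt_inner eq using en
      by (simp add: inner_diff inner_commute algebra_simps)
  qed
  \<comment> \<open>The odd part is at most \<open>2 * M\<close>. The coefficient \<open>a\<close>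
    makes the barrier reach this value at distance \<open>R / 2\<close> from \<open>x0\<close>, and
    \<open>c\<close> makes it reach this value when a time of at least \<open>R\<^sup>2 / 2\<close>
    is left. Then \<open>K = c / 2 + a * N\<close> is the value for which \<open>\<psi>\<close>
    solves the discrete equation exactly.\<close>
  define a where "a = 8 * M / R\<^sup>2"
  define c where "c = 4 * M / R\<^sup>2"
  define K where "K = c / 2 + a * N"
  have pos: "a \<ge> 0" "c \<ge> 0" "K \<ge> 0" using M0 N by (auto simp: a_def c_def K_def)
  define \<psi> where "\<psi> x t = a * (norm (x - x0))\<^sup>2 + c * (t0 - t) + K * (2 * R * ((x - x0) \<bullet> e) - ((x - x0) \<bullet> e)\<^sup>2)" for x t
  define d where "d x t = f x t - f (\<rho> x) t - \<psi> x t" for x t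
  define X where "X = {x \<in> cball x0 R. \<exists>m::nat. (x - x0) \<bullet> e = real m * h}"
  define I where "I = {x \<in> X. norm (x - x0) \<le> R - h \<and> (x - x0) \<bullet> e \<noteq> 0}"
  have X1: "norm (x - x0) \<le> R" "0 \<le> (x - x0) \<bullet> e" "(x - x0) \<bullet> e \<le> R" if "x \<in> X" for x
    using that Basis_le_norm[OF e, of "x - x0"] h by (auto simp: X_def dist_norm norm_minus_commute)
  have Xf: "f x t - f (\<rho> x) t \<le> 2 * M" if "x \<in> X" "t0 - R\<^sup>2 \<le> t" "t \<le> t0" for x t
    using M[of x t] M[of "\<rho> x" t] X1[OF that(1)] \<rho>n[of x] that by (simp add: dist_norm norm_minus_commute)
  have quad: "2 * R * s - s\<^sup>2 \<ge> 0" if "0 \<le> s" "s \<le> R" for s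
    using that mult_nonneg_nonneg[of s "2 * R - s"] by (simp add: power2_eq_square algebra_simps)
  have target: "x0 + (real m * h) *\<^sub>R e \<in> X"
    using m h en by (auto simp: X_def dist_norm)
  have "d (x0 + (real m * h) *\<^sub>R e) t0 \<le> 0"
  proof (rule disc_max_principle[where d = d and I = I and X = X and a = "t0 - R\<^sup>2" and b = t0 and h = h])
    fix x t assume x: "x \<in> I" and t: "t0 - R\<^sup>2 \<le> t" "t + h\<^sup>2 / (2 * DIM('a)) \<le> t0"
    have near: "norm (y - x0) \<le> R - h \<Longrightarrow> i \<in> Basis \<Longrightarrow> norm (y + h *\<^sub>R i - x0) \<le> R \<and> norm (y - h *\<^sub>R i - x0) \<le> R" for y i
      using norm_triangle_ineq[of "y - x0" "h *\<^sub>R i"] norm_triangle_ineq4[of "y - x0" "h *\<^sub>R i"] h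
      by (simp add: algebra_simps)
    have fa: "f y (t + \<tau>) = avg h (\<lambda>y. f y t) y" if y: "norm (y - x0) \<le> R - h" for y
    proof -
      have 1: "norm (y - x0) \<le> R" using y h by simp
      have "0 \<le> h\<^sup>2 / (2 * DIM('a))" by simp
      then have "t \<le> t0" "t0 - R\<^sup>2 \<le> t + h\<^sup>2 / (2 * DIM('a))" using t by linarith+
      then show ?thesis using f[unfolded disc_sol_def, rule_format, of y t] 1 near[OF y] t
        by (simp add: \<tau>_def N_def dist_norm norm_minus_commute)
    qed
    have xn: "norm (x - x0) \<le> R - h" using x by (simp add: I_def)
    \<comment> \<open>The reflection permutes the stencil: the two neighbours in direction
      \<open>e\<close> are exchanged and the others correspond to each other, so the reflected
      function satisfies the same discrete equation.\<close>
    have "avg h (\<lambda>y. f y t) (\<rho> x) = avg h (\<lambda>y. f (\<rho> y) t) x"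
    proof -
      have "f (\<rho> x + h *\<^sub>R i) t + f (\<rho> x - h *\<^sub>R i) t = f (\<rho> (x + h *\<^sub>R i)) t + f (\<rho> (x - h *\<^sub>R i)) t"
        if i: "i \<in> Basis" for i
      proof (cases "i = e")
        case True
        have "\<rho> (x + h *\<^sub>R i) = \<rho> x - h *\<^sub>R i" "\<rho> (x - h *\<^sub>R i) = \<rho> x + h *\<^sub>R i"
          unfolding True \<rho>_def by (simp_all add: inner_diff_left inner_add_left en algebra_simps scaleR_2[symmetric])
        then show ?thesis by simp
      next
        case False
        then have "i \<bullet> e = 0" using i e by (simp add: inner_Basis)
        then have "\<rho> (x + h *\<^sub>R i) = \<rho> x + h *\<^sub>R i" "\<rho> (x - h *\<^sub>R i) = \<rho> x - h *\<^sub>R i"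
          unfolding \<rho>_def by (simp_all add: inner_diff_left inner_add_left algebra_simps)
        then show ?thesis by simp
      qed
      then show ?thesis by (simp add: avg_def)
    qed
    moreover have "avg h (\<lambda>y. \<psi> y t) x = \<psi> x (t + \<tau>)"
    proof -
      have "avg h (\<lambda>y. \<psi> y t) x = a * ((norm (x - x0))\<^sup>2 + h\<^sup>2) + c * (t0 - t)
          + K * (2 * R * ((x - x0) \<bullet> e) - (((x - x0) \<bullet> e)\<^sup>2 + h\<^sup>2 / N))"
        unfolding \<psi>_def N_def avg_add avg_cmult avg_diff avg_const avg_dist_sq avg_affine avg_affine_sq[OF en(1)] ..
      also have "\<dots> = \<psi> x (t + \<tau>)"
        using N unfolding \<psi>_def \<tau>_def K_def by (simp add: field_simps)
      finally show ?thesis .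
    qed
    ultimately have "d x (t + \<tau>) = avg h (\<lambda>y. d y t) x"
      unfolding d_def avg_diff using fa[OF xn] fa[of "\<rho> x"] xn \<rho>n[of x] by simp
    then show "d x (t + h\<^sup>2 / (2 * DIM('a))) \<le> avg h (\<lambda>y. d y t) x"
      by (simp add: \<tau>_def N_def)
  next
    fix x i :: 'a assume x: "x \<in> I" and i: "i \<in> Basis"
    obtain m :: nat where m: "(x - x0) \<bullet> e = real m * h" using x by (auto simp: I_def X_def)
    then have "m \<noteq> 0" using x by (auto simp: I_def)
    then have m': "(x - x0) \<bullet> e - h = real (m - 1) * h" "(x - x0) \<bullet> e + h = real (m + 1) * h"
      using m by (auto simp: algebra_simps of_nat_diff)
    have n: "norm (x + h *\<^sub>R i - x0) \<le> R" "norm (x - h *\<^sub>R i - x0) \<le> R"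
      using norm_triangle_ineq[of "x - x0" "h *\<^sub>R i"] norm_triangle_ineq4[of "x - x0" "h *\<^sub>R i"] h x i
      by (auto simp: I_def algebra_simps)
    have "(x + h *\<^sub>R i - x0) \<bullet> e = (x - x0) \<bullet> e + (if i = e then h else 0)"
        "(x - h *\<^sub>R i - x0) \<bullet> e = (x - x0) \<bullet> e - (if i = e then h else 0)"
      using i e by (auto simp: inner_diff_left inner_add_left inner_Basis)
    then have "\<exists>m::nat. (x + h *\<^sub>R i - x0) \<bullet> e = real m * h" "\<exists>m::nat. (x - h *\<^sub>R i - x0) \<bullet> e = real m * h"
      using m m' by (metis add.right_neutral diff_zero)+
    then show "x + h *\<^sub>R i \<in> X \<and> x - h *\<^sub>R i \<in> X"
      using n by (auto simp: X_def dist_norm norm_minus_commute)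
  next
    fix x t assume x: "x \<in> X - I" and t: "t0 - R\<^sup>2 \<le> t" "t \<le> t0"
    have \<psi>0: "a * (norm (x - x0))\<^sup>2 \<ge> 0" "c * (t0 - t) \<ge> 0" "K * (2 * R * ((x - x0) \<bullet> e) - ((x - x0) \<bullet> e)\<^sup>2) \<ge> 0"
      using pos t quad X1 x by auto
    show "d x t \<le> 0"
    proof (cases "(x - x0) \<bullet> e = 0")
      case True
      then have "\<rho> x = x" by (simp add: \<rho>_def)
      then have "d x t = - \<psi> x t" by (simp add: d_def)
      then show ?thesis using \<psi>0 unfolding \<psi>_def by linarith
    next
      case False
      then have "norm (x - x0) \<ge> R / 2" using x h by (auto simp: I_def)
      then have "(R / 2)\<^sup>2 \<le> (norm (x - x0))\<^sup>2" using R by (intro power_mono) auto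
      then have "a * (R / 2)\<^sup>2 \<le> a * (norm (x - x0))\<^sup>2" using pos by (intro mult_left_mono)
      moreover have "a * (R / 2)\<^sup>2 = 2 * M" using R by (simp add: a_def power_divide)
      ultimately show ?thesis using \<psi>0 Xf[of x t] x t unfolding d_def \<psi>_def by auto
    qed
  next
    fix x t assume x: "x \<in> X" and t: "t0 - R\<^sup>2 \<le> t" "t \<le> t0" "t < t0 - R\<^sup>2 + h\<^sup>2 / (2 * DIM('a))"
    have "h\<^sup>2 \<le> (R / 2)\<^sup>2" using h by (intro power_mono) auto
    moreover have "h\<^sup>2 / (2 * N) \<le> h\<^sup>2 / 2" using N by (intro divide_left_mono) auto
    moreover have "(R / 2)\<^sup>2 = R\<^sup>2 / 4" "0 \<le> R\<^sup>2" by (simp_all add: power_divide)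
    ultimately have "h\<^sup>2 / (2 * N) \<le> R\<^sup>2 / 2" by linarith
    then have "R\<^sup>2 / 2 \<le> t0 - t" using t by (simp add: N_def)
    then have "c * (R\<^sup>2 / 2) \<le> c * (t0 - t)" using pos by (intro mult_left_mono)
    moreover have "c * (R\<^sup>2 / 2) = 2 * M" using R by (simp add: c_def)
    moreover have "a * (norm (x - x0))\<^sup>2 \<ge> 0" "K * (2 * R * ((x - x0) \<bullet> e) - ((x - x0) \<bullet> e)\<^sup>2) \<ge> 0"
      using pos quad X1 x by auto
    ultimately show "d x t \<le> 0" using Xf[OF x t(1,2)] unfolding d_def \<psi>_def by linarith
  qed (use h target in auto)
  then have d0: "d (x0 + s *\<^sub>R e) t0 \<le> 0" if "s = real m * h" for s using that by simp
  define s where "s = real m * h"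
  have s: "0 \<le> s" "s \<le> R" using m h by (auto simp: s_def)
  have \<rho>s: "\<rho> (x0 + s *\<^sub>R e) = x0 - s *\<^sub>R e"
    by (simp add: \<rho>_def en algebra_simps scaleR_2[symmetric])
  have "f (x0 + s *\<^sub>R e) t0 - f (x0 - s *\<^sub>R e) t0 \<le> a * s\<^sup>2 + K * (2 * R * s - s\<^sup>2)"
    using s \<rho>s d0[OF s_def] by (simp add: d_def \<psi>_def en)
  also have "\<dots> \<le> a * (R * s) + K * (2 * R * s)"
    using pos s R by (intro add_mono mult_left_mono) (auto simp: power2_eq_square mult_right_mono)
  also have "\<dots> = (12 + 16 * N) * M * s / R"
    using R by (simp add: K_def a_def c_def field_simps power2_eq_square)
  \<comment> \<open>The barrier yields the factor \<open>12 + 16 * N\<close>, which is at most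
    \<open>28 * N\<close> because \<open>N \<ge> 1\<close>.\<close>
  also have "\<dots> \<le> (28 * N) * M * s / R"
    using N M0 s R by (intro divide_right_mono mult_right_mono) auto
  finally show ?thesis by (simp add: s_def N_def)
qed

lemma disc_reflection:
  fixes f :: "'a::euclidean_space \<Rightarrow> real \<Rightarrow> real" and M R :: real
  assumes e: "e \<in> Basis" and h: "0 < h" "h \<le> R / 2"
    and f: "disc_sol h (cball x0 R \<times> {t0 - R\<^sup>2..t0}) f"
    and M: "\<And>x t. x \<in> cball x0 R \<Longrightarrow> t0 - R\<^sup>2 \<le> t \<Longrightarrow> t \<le> t0 \<Longrightarrow> \<bar>f x t\<bar> \<le> M"
    and m: "real m * h \<le> R"
  shows "\<bar>f (x0 + (real m * h) *\<^sub>R e) t0 - f (x0 - (real m * h) *\<^sub>R e) t0\<bar> \<le> 28 * DIM('a) * M * (real m * h) / R"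
proof -
  have "disc_sol h (cball x0 R \<times> {t0 - R\<^sup>2..t0}) (\<lambda>x t. - f x t)"
    using disc_sol_cmult[OF f, of "-1"] by simp
  then show ?thesis
    using disc_reflection_le[OF e h f M m] disc_reflection_le[OF e h, of x0 t0 "\<lambda>x t. - f x t" M m] M m
    by (simp add: abs_le_iff)
qed

text \<open>The approximating discrete solution may change with the tolerance and with
  \<open>n\<close>, and it only has to solve the scheme on \<open>K\<close>. This freedom makes the
  property linear, translation invariant and closed under uniform limits. The mesh sizes
  \<open>hs\<close> are left general because those that occur form a subsequence extracted by
  compactness.\<close>

definition disc_approx :: "(nat \<Rightarrow> real) \<Rightarrow> ('a::euclidean_space \<times> real) set \<Rightarrow> ('a \<Rightarrow> real \<Rightarrow> real) \<Rightarrow> bool" where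
  "disc_approx hs K v \<longleftrightarrow> (\<forall>\<epsilon>>0. \<forall>\<^sub>F n in sequentially. \<exists>f. disc_sol (hs n) K f \<and> (\<forall>(x, t)\<in>K. \<bar>f x t - v x t\<bar> \<le> \<epsilon>))"

lemma disc_approx_subset: "disc_approx hs K v \<Longrightarrow> K' \<subseteq> K \<Longrightarrow> disc_approx hs K' v"
  unfolding disc_approx_def
  by (smt (verit, ccfv_threshold) disc_sol_subset eventually_mono subsetD)

lemma disc_approx_add:
  assumes "disc_approx hs K u" "disc_approx hs K v"
  shows "disc_approx hs K (\<lambda>x t. u x t + v x t)"
  unfolding disc_approx_def
proof (intro allI impI)
  fix \<epsilon> :: real assume "\<epsilon> > 0"
  then have "\<epsilon> / 2 > 0" by simp
  then have "\<forall>\<^sub>F n in sequentially. \<exists>f. disc_sol (hs n) K f \<and> (\<forall>(x, t)\<in>K. \<bar>f x t - u x t\<bar> \<le> \<epsilon> / 2)"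
     "\<forall>\<^sub>F n in sequentially. \<exists>f. disc_sol (hs n) K f \<and> (\<forall>(x, t)\<in>K. \<bar>f x t - v x t\<bar> \<le> \<epsilon> / 2)"
    using assms unfolding disc_approx_def by blast+
  then show "\<forall>\<^sub>F n in sequentially. \<exists>f. disc_sol (hs n) K f \<and> (\<forall>(x, t)\<in>K. \<bar>f x t - (u x t + v x t)\<bar> \<le> \<epsilon>)"
  proof eventually_elim
    case (elim n)
    then obtain f g where fg: "disc_sol (hs n) K f" "disc_sol (hs n) K g"
      "\<And>x t. (x, t) \<in> K \<Longrightarrow> \<bar>f x t - u x t\<bar> \<le> \<epsilon> / 2" "\<And>x t. (x, t) \<in> K \<Longrightarrow> \<bar>g x t - v x t\<bar> \<le> \<epsilon> / 2"
      by fast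
    have "\<bar>f x t + g x t - (u x t + v x t)\<bar> \<le> \<epsilon>" if "(x, t) \<in> K" for x t
      using fg(3,4)[OF that] by linarith
    then show ?case using disc_sol_add[OF fg(1,2)] by (intro exI[of _ "\<lambda>x t. f x t + g x t"]) auto
  qed
qed

lemma disc_approx_cmult:
  assumes "disc_approx hs K v"
  shows "disc_approx hs K (\<lambda>x t. c * v x t)"
  unfolding disc_approx_def
proof (intro allI impI)
  fix \<epsilon> :: real assume "\<epsilon> > 0"
  then have "\<epsilon> / (\<bar>c\<bar> + 1) > 0" by (simp add: divide_pos_pos)
  then have "\<forall>\<^sub>F n in sequentially. \<exists>f. disc_sol (hs n) K f \<and> (\<forall>(x, t)\<in>K. \<bar>f x t - v x t\<bar> \<le> \<epsilon> / (\<bar>c\<bar> + 1))"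
    using assms unfolding disc_approx_def by blast
  then show "\<forall>\<^sub>F n in sequentially. \<exists>f. disc_sol (hs n) K f \<and> (\<forall>(x, t)\<in>K. \<bar>f x t - c * v x t\<bar> \<le> \<epsilon>)"
  proof eventually_elim
    case (elim n)
    then obtain f where f: "disc_sol (hs n) K f" "\<And>x t. (x, t) \<in> K \<Longrightarrow> \<bar>f x t - v x t\<bar> \<le> \<epsilon> / (\<bar>c\<bar> + 1)"
      by fast
    have "\<bar>c * f x t - c * v x t\<bar> \<le> \<epsilon>" if "(x, t) \<in> K" for x t
    proof -
      have "\<bar>c * f x t - c * v x t\<bar> = \<bar>c\<bar> * \<bar>f x t - v x t\<bar>" by (simp add: abs_mult right_diff_distrib[symmetric])
      also have "\<dots> \<le> (\<bar>c\<bar> + 1) * (\<epsilon> / (\<bar>c\<bar> + 1))" using f(2)[OF that] by (intro mult_mono) auto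
      also have "\<dots> = \<epsilon>" by (simp add: add_nonneg_eq_0_iff)
      finally show ?thesis .
    qed
    then show ?case using disc_sol_cmult[OF f(1)] by (intro exI[of _ "\<lambda>x t. c * f x t"]) auto
  qed
qed

lemma disc_approx_shift:
  assumes "disc_approx hs K v" "\<And>x t. (x, t) \<in> K' \<Longrightarrow> (x + \<xi>, t) \<in> K"
  shows "disc_approx hs K' (\<lambda>x t. v (x + \<xi>) t)"
  unfolding disc_approx_def
proof (intro allI impI)
  fix \<epsilon> :: real assume "\<epsilon> > 0"
  then have "\<forall>\<^sub>F n in sequentially. \<exists>f. disc_sol (hs n) K f \<and> (\<forall>(x, t)\<in>K. \<bar>f x t - v x t\<bar> \<le> \<epsilon>)"
    using assms unfolding disc_approx_def by blast
  then show "\<forall>\<^sub>F n in sequentially. \<exists>f. disc_sol (hs n) K' f \<and> (\<forall>(x, t)\<in>K'. \<bar>f x t - v (x + \<xi>) t\<bar> \<le> \<epsilon>)"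
  proof eventually_elim
    case (elim n)
    then obtain f where f: "disc_sol (hs n) K f" "\<And>x t. (x, t) \<in> K \<Longrightarrow> \<bar>f x t - v x t\<bar> \<le> \<epsilon>"
      by fast
    then show ?case
      using disc_sol_shift[OF f(1) assms(2)] assms(2) by (intro exI[of _ "\<lambda>x t. f (x + \<xi>) t"]) auto
  qed
qed

text \<open>Two tolerances \<open>\<epsilon> / 2\<close> are added. This closure is what brings
  derivatives back into the class: they are uniform limits of difference quotients, which are linear
  combinations of translates.\<close>

lemma disc_approx_limit:
  assumes "\<And>\<epsilon>. \<epsilon> > 0 \<Longrightarrow> \<exists>u. disc_approx hs K u \<and> (\<forall>(x, t)\<in>K. \<bar>u x t - v x t\<bar> \<le> \<epsilon>)"
  shows "disc_approx hs K v"
  unfolding disc_approx_def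
proof (intro allI impI)
  fix \<epsilon> :: real assume "\<epsilon> > 0"
  then have e2: "\<epsilon> / 2 > 0" by simp
  obtain u where u: "disc_approx hs K u" "\<And>x t. (x, t) \<in> K \<Longrightarrow> \<bar>u x t - v x t\<bar> \<le> \<epsilon> / 2"
    using assms[OF e2] by fast
  have "\<forall>\<^sub>F n in sequentially. \<exists>f. disc_sol (hs n) K f \<and> (\<forall>(x, t)\<in>K. \<bar>f x t - u x t\<bar> \<le> \<epsilon> / 2)"
    using u(1) e2 unfolding disc_approx_def by blast
  then show "\<forall>\<^sub>F n in sequentially. \<exists>f. disc_sol (hs n) K f \<and> (\<forall>(x, t)\<in>K. \<bar>f x t - v x t\<bar> \<le> \<epsilon>)"
  proof eventually_elim
    case (elim n)
    then obtain f where f: "disc_sol (hs n) K f" "\<And>x t. (x, t) \<in> K \<Longrightarrow> \<bar>f x t - u x t\<bar> \<le> \<epsilon> / 2"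
      by fast
    have "\<bar>f x t - v x t\<bar> \<le> \<epsilon>" if "(x, t) \<in> K" for x t
      using f(2)[OF that] u(2)[OF that] by linarith
    then show ?case using f(1) by blast
  qed
qed

lemma disc_approxD:
  assumes "disc_approx hs K v" "\<epsilon> > 0"
  shows "\<forall>\<^sub>F n in sequentially. \<exists>f. disc_sol (hs n) K f \<and> (\<forall>x t. (x, t) \<in> K \<longrightarrow> \<bar>f x t - v x t\<bar> \<le> \<epsilon>)"
  using assms by (auto simp: disc_approx_def case_prod_unfold Ball_def)

section \<open>Interior derivative estimates for limits of discrete solutions\<close>

locale mesh =
  fixes hs :: "nat \<Rightarrow> real"
  assumes hs_pos: "\<And>n. hs n > 0" and hs_lim: "hs \<longlonglongrightarrow> 0"
begin

lemma hs_small: "r > 0 \<Longrightarrow> \<forall>\<^sub>F n in sequentially. hs n < r"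
  using hs_lim by (rule order_tendstoD)

text \<open>The discrete estimate is available only for displacements that are multiples of the mesh
  size. So \<open>s\<close> is rounded down to the multiple \<open>\<sigma> n\<close> of
  \<open>hs n\<close>, which tends to \<open>s\<close>, and continuity of \<open>v\<close> carries
  the bound over; the approximation error \<open>\<epsilon>\<close> is sent to 0 at the very
  end.\<close>

lemma approx_reflection:
  fixes v :: "'a::euclidean_space \<Rightarrow> real \<Rightarrow> real" and M R s :: real
  assumes v: "disc_approx hs (cball x0 R \<times> {t0 - R\<^sup>2..t0}) v"
    and cont: "continuous_on (cball x0 R \<times> {t0 - R\<^sup>2..t0}) (\<lambda>(x, t). v x t)"
    and M: "\<And>x t. x \<in> cball x0 R \<Longrightarrow> t0 - R\<^sup>2 \<le> t \<Longrightarrow> t \<le> t0 \<Longrightarrow> \<bar>v x t\<bar> \<le> M"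
    and e: "e \<in> Basis" and R: "R > 0" and s: "0 \<le> s" "s \<le> R"
  shows "\<bar>v (x0 + s *\<^sub>R e) t0 - v (x0 - s *\<^sub>R e) t0\<bar> \<le> 28 * DIM('a) * M * s / R"
proof -
  define A where "A = \<bar>v (x0 + s *\<^sub>R e) t0 - v (x0 - s *\<^sub>R e) t0\<bar>"
  define C where "C = real (28 * DIM('a))"
  have C: "C \<ge> 0" by (simp add: C_def)
  define \<sigma> where "\<sigma> n = real (nat \<lfloor>s / hs n\<rfloor>) * hs n" for n
  have \<sigma>: "s - hs n \<le> \<sigma> n" "\<sigma> n \<le> s" "0 \<le> \<sigma> n" for n
  proof -
    have fl: "real (nat \<lfloor>s / hs n\<rfloor>) = of_int \<lfloor>s / hs n\<rfloor>"
      using s hs_pos[of n] by simp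
    have "(s / hs n - 1) * hs n \<le> of_int \<lfloor>s / hs n\<rfloor> * hs n"
      using hs_pos[of n] by (intro mult_right_mono) linarith+
    then show "s - hs n \<le> \<sigma> n" using hs_pos[of n] by (simp add: \<sigma>_def fl left_diff_distrib)
    have "of_int \<lfloor>s / hs n\<rfloor> * hs n \<le> (s / hs n) * hs n"
      using hs_pos[of n] by (intro mult_right_mono) auto
    then show "\<sigma> n \<le> s" using hs_pos[of n] by (simp add: \<sigma>_def fl)
    show "0 \<le> \<sigma> n" using hs_pos[of n] by (simp add: \<sigma>_def)
  qed
  have \<sigma>lim: "\<sigma> \<longlonglongrightarrow> s"
  proof (rule tendsto_sandwich[OF _ _ _ tendsto_const])
    show "(\<lambda>n. s - hs n) \<longlonglongrightarrow> s" using tendsto_diff[OF tendsto_const hs_lim, of s] by simp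
  qed (use \<sigma> in auto)
  have key: "A \<le> 2 * \<epsilon> + C * (M + \<epsilon>) * s / R" if "\<epsilon> > 0" for \<epsilon>
  proof (rule tendsto_upperbound)
    let ?V = "\<lambda>p. (\<lambda>(x, t). v x t) p"
    have cx: "continuous_on (cball x0 R) (\<lambda>x. v x t0)"
      using R by (intro continuous_on_compose2[OF cont, of _ "\<lambda>x. (x, t0)", simplified] continuous_intros) auto
    have "(\<lambda>n. v (x0 + \<sigma> n *\<^sub>R e) t0) \<longlonglongrightarrow> v (x0 + s *\<^sub>R e) t0"
      using \<sigma> s e by (intro continuous_on_tendsto_compose[OF cx] tendsto_intros \<sigma>lim)
        (auto simp: dist_norm intro!: always_eventually order_trans[OF \<sigma>(2)])
    moreover have "(\<lambda>n. v (x0 - \<sigma> n *\<^sub>R e) t0) \<longlonglongrightarrow> v (x0 - s *\<^sub>R e) t0"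
      using \<sigma> s e by (intro continuous_on_tendsto_compose[OF cx] tendsto_intros \<sigma>lim)
        (auto simp: dist_norm intro!: always_eventually order_trans[OF \<sigma>(2)])
    ultimately show "(\<lambda>n. \<bar>v (x0 + \<sigma> n *\<^sub>R e) t0 - v (x0 - \<sigma> n *\<^sub>R e) t0\<bar>) \<longlonglongrightarrow> A"
      unfolding A_def by (intro tendsto_intros)
    note disc_approxD[OF v that]
    moreover have "\<forall>\<^sub>F n in sequentially. hs n < R / 2" using R by (intro hs_small) auto
    ultimately show "\<forall>\<^sub>F n in sequentially. \<bar>v (x0 + \<sigma> n *\<^sub>R e) t0 - v (x0 - \<sigma> n *\<^sub>R e) t0\<bar> \<le> 2 * \<epsilon> + C * (M + \<epsilon>) * s / R"
    proof eventually_elim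
      case (elim n)
      then obtain f where f: "disc_sol (hs n) (cball x0 R \<times> {t0 - R\<^sup>2..t0}) f"
        and fv0: "\<forall>x t. (x, t) \<in> cball x0 R \<times> {t0 - R\<^sup>2..t0} \<longrightarrow> \<bar>f x t - v x t\<bar> \<le> \<epsilon>"
        by blast
      have fv: "\<bar>f x t - v x t\<bar> \<le> \<epsilon>" if "x \<in> cball x0 R" "t0 - R\<^sup>2 \<le> t" "t \<le> t0" for x t
        using fv0 that by simp
      have fM: "\<bar>f x t\<bar> \<le> M + \<epsilon>" if "x \<in> cball x0 R" "t0 - R\<^sup>2 \<le> t" "t \<le> t0" for x t
        using fv[OF that] M[OF that] by linarith
      have \<sigma>R: "\<sigma> n \<le> R" using \<sigma>(2)[of n] s by simp
      have "\<bar>f (x0 + \<sigma> n *\<^sub>R e) t0 - f (x0 - \<sigma> n *\<^sub>R e) t0\<bar> \<le> C * (M + \<epsilon>) * \<sigma> n / R"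
        unfolding C_def \<sigma>_def
        by (rule disc_reflection[OF e hs_pos _ f fM]) (use elim \<sigma>R in \<open>auto simp: \<sigma>_def\<close>)
      moreover have "C * (M + \<epsilon>) * \<sigma> n / R \<le> C * (M + \<epsilon>) * s / R"
      proof -
        have "\<bar>f x0 t0\<bar> \<le> M + \<epsilon>" using R by (intro fM) auto
        then have "0 \<le> M + \<epsilon>" by simp
        then show ?thesis using C R \<sigma>(2)[of n] by (intro divide_right_mono mult_left_mono) auto
      qed
      moreover have "\<bar>f (x0 + \<sigma> n *\<^sub>R e) t0 - v (x0 + \<sigma> n *\<^sub>R e) t0\<bar> \<le> \<epsilon>"
        "\<bar>f (x0 - \<sigma> n *\<^sub>R e) t0 - v (x0 - \<sigma> n *\<^sub>R e) t0\<bar> \<le> \<epsilon>"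
        using \<sigma>R \<sigma>(3)[of n] e R by (auto intro!: fv simp: dist_norm)
      ultimately show ?case by linarith
    qed
  qed simp
  have "((\<lambda>\<epsilon>. 2 * \<epsilon> + C * (M + \<epsilon>) * s / R) \<longlongrightarrow> 2 * 0 + C * (M + 0) * s / R) (at_right 0)"
    using R by (intro tendsto_intros) auto
  moreover have "\<forall>\<^sub>F \<epsilon> in at_right 0. A \<le> 2 * \<epsilon> + C * (M + \<epsilon>) * s / R"
    using key by (auto simp: eventually_at_right_field intro: exI[of _ 1])
  ultimately have "A \<le> 2 * 0 + C * (M + 0) * s / R"
    by (intro tendsto_lowerbound) auto
  then show ?thesis by (simp add: A_def C_def)
qed

text \<open>A second difference with step \<open>s\<close> is a central difference of the central
  difference \<open>D\<close>, both with \<open>r = s / 2\<close>. \<open>D\<close> is again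
  approximated by discrete solutions, and the reflection estimate bounds it on
  \<open>cball x0 R\<close>; a second use of the estimate gains another factor \<open>r / R\<close>.
  Since \<open>r\<close> is half of \<open>s\<close>, the constant 28 becomes 14. The doubled radius
  leaves room for a ball of radius \<open>R\<close> around every point of
  \<open>cball x0 R\<close>.\<close>

lemma approx_second_difference:
  fixes v :: "'a::euclidean_space \<Rightarrow> real \<Rightarrow> real" and M R s :: real
  assumes v: "disc_approx hs (cball x0 (2 * R) \<times> {t0 - (2 * R)\<^sup>2..t0}) v"
    and cont: "continuous_on (cball x0 (2 * R) \<times> {t0 - (2 * R)\<^sup>2..t0}) (\<lambda>(x, t). v x t)"
    and M: "\<And>x t. x \<in> cball x0 (2 * R) \<Longrightarrow> t0 - (2 * R)\<^sup>2 \<le> t \<Longrightarrow> t \<le> t0 \<Longrightarrow> \<bar>v x t\<bar> \<le> M"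
    and e: "e \<in> Basis" and R: "R > 0" and s: "0 \<le> s" "s \<le> R"
  shows "\<bar>v (x0 + s *\<^sub>R e) t0 - 2 * v x0 t0 + v (x0 - s *\<^sub>R e) t0\<bar> \<le> (14 * DIM('a))\<^sup>2 * M / R\<^sup>2 * s\<^sup>2"
proof -
  define r where "r = s / 2"
  define D where "D y t = v (y + r *\<^sub>R e) t - v (y - r *\<^sub>R e) t" for y t
  let ?Q = "cball x0 (2 * R) \<times> {t0 - (2 * R)\<^sup>2..t0}"
  have r: "0 \<le> r" "r \<le> R" using s R by (auto simp: r_def)
  have sq: "R\<^sup>2 + R\<^sup>2 \<le> (2 * R)\<^sup>2" by (simp add: power_mult_distrib)
  have inQ: "(y + \<theta> *\<^sub>R e, t) \<in> ?Q" if "(y, t) \<in> cball x0 R \<times> {t0 - R\<^sup>2..t0}" "\<bar>\<theta>\<bar> \<le> r" for y t \<theta>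
  proof -
    have "norm (x0 - y - \<theta> *\<^sub>R e) \<le> norm (x0 - y) + \<bar>\<theta>\<bar>"
      using norm_triangle_ineq4[of "x0 - y" "\<theta> *\<^sub>R e"] e by simp
    then show ?thesis using that r sq by (auto simp: dist_norm diff_diff_eq)
  qed
  have in1: "(y + r *\<^sub>R e, t) \<in> ?Q" "(y + (- r) *\<^sub>R e, t) \<in> ?Q" if "(y, t) \<in> cball x0 R \<times> {t0 - R\<^sup>2..t0}" for y t
    using inQ[OF that, of r] inQ[OF that, of "- r"] r by auto
  have aD: "disc_approx hs (cball x0 R \<times> {t0 - R\<^sup>2..t0}) D"
  proof -
    have "disc_approx hs (cball x0 R \<times> {t0 - R\<^sup>2..t0}) (\<lambda>y t. v (y + r *\<^sub>R e) t + (-1) * v (y + (- r) *\<^sub>R e) t)"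
      by (intro disc_approx_add disc_approx_cmult disc_approx_shift[OF v] in1)
    then show ?thesis by (simp add: D_def[abs_def])
  qed
  have cD: "continuous_on (cball x0 R \<times> {t0 - R\<^sup>2..t0}) (\<lambda>(y, t). D y t)"
  proof -
    have "continuous_on (cball x0 R \<times> {t0 - R\<^sup>2..t0}) (\<lambda>p. (\<lambda>(x, t). v x t) (fst p + \<theta> *\<^sub>R e, snd p))"
      if "\<bar>\<theta>\<bar> \<le> r" for \<theta>
      by (rule continuous_on_compose2[OF cont]) (use inQ that in \<open>auto intro!: continuous_intros\<close>)
    from continuous_on_diff[OF this[of r] this[of "- r"]] show ?thesis
      using r by (simp add: D_def case_prod_unfold)
  qed
  have MD: "\<bar>D y t\<bar> \<le> 28 * DIM('a) * M * r / R" if "y \<in> cball x0 R" "t0 - R\<^sup>2 \<le> t" "t \<le> t0" for y t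
    unfolding D_def
  proof (rule approx_reflection[OF _ _ _ e R r])
    have sub: "cball y R \<times> {t - R\<^sup>2..t} \<subseteq> ?Q"
    proof
      fix q assume "q \<in> cball y R \<times> {t - R\<^sup>2..t}"
      then obtain z s where q: "q = (z, s)" "dist y z \<le> R" "t - R\<^sup>2 \<le> s" "s \<le> t" by auto
      have "dist x0 z \<le> 2 * R" using dist_triangle[of x0 z y] q that by simp
      then show "q \<in> ?Q" using q that sq by simp
    qed
    show "disc_approx hs (cball y R \<times> {t - R\<^sup>2..t}) v" using disc_approx_subset[OF v sub] .
    show "continuous_on (cball y R \<times> {t - R\<^sup>2..t}) (\<lambda>(x, t). v x t)" using continuous_on_subset[OF cont sub] .
    show "\<bar>v x t'\<bar> \<le> M" if "x \<in> cball y R" "t - R\<^sup>2 \<le> t'" "t' \<le> t" for x t'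
      using subsetD[OF sub, of "(x, t')"] that by (intro M) auto
  qed
  have "\<bar>D (x0 + r *\<^sub>R e) t0 - D (x0 - r *\<^sub>R e) t0\<bar> \<le> 28 * DIM('a) * (28 * DIM('a) * M * r / R) * r / R"
    by (rule approx_reflection[OF aD cD MD e R r])
  moreover have "D (x0 + r *\<^sub>R e) t0 - D (x0 - r *\<^sub>R e) t0 = v (x0 + s *\<^sub>R e) t0 - 2 * v x0 t0 + v (x0 - s *\<^sub>R e) t0"
  proof -
    have "r *\<^sub>R e + r *\<^sub>R e = s *\<^sub>R e" by (simp add: r_def scaleR_add_left[symmetric])
    then have eq: "x0 + r *\<^sub>R e + r *\<^sub>R e = x0 + s *\<^sub>R e" "x0 - r *\<^sub>R e - r *\<^sub>R e = x0 - s *\<^sub>R e"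
      by (metis add.assoc, metis diff_diff_eq)
    show ?thesis unfolding D_def eq by simp
  qed
  moreover have "28 * DIM('a) * (28 * DIM('a) * M * r / R) * r / R = (14 * DIM('a))\<^sup>2 * M / R\<^sup>2 * s\<^sup>2"
    using R by (simp add: r_def power2_eq_square field_simps)
  ultimately show ?thesis by simp
qed

text \<open>A weak notion of solution of the heat equation. No differentiability is demanded, yet
  spatial derivatives will turn out to exist and to stay in the class, which then yields the
  equation and smoothness.\<close>

definition heat_class :: "('a::euclidean_space \<times> real) set \<Rightarrow> ('a \<Rightarrow> real \<Rightarrow> real) \<Rightarrow> bool" where
  "heat_class Q v \<longleftrightarrow> continuous_on Q (\<lambda>(x, t). v x t) \<and> (\<forall>K. compact K \<longrightarrow> K \<subseteq> Q \<longrightarrow> disc_approx hs K v)"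

lemma heat_class_add: "heat_class Q u \<Longrightarrow> heat_class Q v \<Longrightarrow> heat_class Q (\<lambda>x t. u x t + v x t)"
  unfolding heat_class_def case_prod_unfold by (auto intro: continuous_on_add disc_approx_add)

lemma heat_class_cmult: "heat_class Q v \<Longrightarrow> heat_class Q (\<lambda>x t. c * v x t)"
  unfolding heat_class_def case_prod_unfold by (auto intro!: continuous_intros disc_approx_cmult)

lemma heat_class_sum:
  assumes "finite I" "I \<noteq> {}" "\<And>i. i \<in> I \<Longrightarrow> heat_class Q (v i)"
  shows "heat_class Q (\<lambda>x t. \<Sum>i\<in>I. v i x t)"
  using assms by (induction I rule: finite_ne_induct) (auto intro: heat_class_add)

lemma compact_nbhd:
  fixes K :: "('a::euclidean_space \<times> real) set"
  assumes "compact K" "K \<subseteq> Q" "open Q"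
  obtains r where "r > 0" "\<And>p q. p \<in> K \<Longrightarrow> dist p q \<le> r \<Longrightarrow> q \<in> Q" "compact (\<Union>p\<in>K. cball p r)" "(\<Union>p\<in>K. cball p r) \<subseteq> Q"
proof -
  obtain r where r: "r > 0" "(\<Union>p\<in>K. cball p r) \<subseteq> Q"
    using compact_subset_open_imp_cball_epsilon_subset[OF assms(1,3,2)] by blast
  have "(\<Union>p\<in>K. cball p r) = {x + y |x y. x \<in> K \<and> y \<in> cball 0 r}"
  proof (intro set_eqI iffI)
    fix q assume "q \<in> (\<Union>p\<in>K. cball p r)"
    then obtain p where "p \<in> K" "dist p q \<le> r" by auto
    then show "q \<in> {x + y |x y. x \<in> K \<and> y \<in> cball 0 r}"
      by (intro CollectI exI[of _ p] exI[of _ "q - p"]) (auto simp: dist_norm norm_minus_commute)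
  next
    fix q assume "q \<in> {x + y |x y. x \<in> K \<and> y \<in> cball 0 r}"
    then obtain x y where "q = x + y" "x \<in> K" "norm y \<le> r" by auto
    then show "q \<in> (\<Union>p\<in>K. cball p r)" by (intro UN_I[of x]) (auto simp: dist_norm)
  qed
  then have "compact (\<Union>p\<in>K. cball p r)"
    using compact_sums[OF assms(1) compact_cball[of 0 r]] by simp
  moreover have "q \<in> Q" if "p \<in> K" "dist p q \<le> r" for p q
    using r(2) that by (meson UN_I mem_cball subsetD)
  ultimately show ?thesis using that r by metis
qed

text \<open>Functions in \<open>heat_class\<close> are differentiable in space, with difference quotients that
  converge locally uniformly; so the class is closed under spatial derivatives.\<close>

lemma heat_class_derivative:
  fixes v :: "'a::euclidean_space \<Rightarrow> real \<Rightarrow> real"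
  assumes Q: "open Q" and v: "heat_class Q v" and e: "e \<in> Basis"
  obtains v' where "heat_class Q v'"
    "\<And>x t. (x, t) \<in> Q \<Longrightarrow> ((\<lambda>s. v (x + s *\<^sub>R e) t) has_real_derivative v' x t) (at 0)"
proof -
  let ?D = "\<lambda>x t p. ((\<lambda>s. v (x + s *\<^sub>R e) t) has_real_derivative p) (at 0)"
  have contv: "continuous_on Q (\<lambda>(x, t). v x t)" using v by (simp add: heat_class_def)
  have loc: "\<exists>R>0. \<exists>C>0. \<forall>x t. (x, t) \<in> K \<longrightarrow> (\<forall>\<sigma>. \<bar>\<sigma>\<bar> \<le> R \<longrightarrow> (x + \<sigma> *\<^sub>R e, t) \<in> Q) \<and>
      (\<exists>p. ?D x t p \<and> (\<forall>\<sigma>. \<sigma> \<noteq> 0 \<longrightarrow> \<bar>\<sigma>\<bar> \<le> R \<longrightarrow> \<bar>(v (x + \<sigma> *\<^sub>R e) t - v x t) / \<sigma> - p\<bar> \<le> C * \<bar>\<sigma>\<bar>))"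
    if K: "compact K" "K \<subseteq> Q" for K
  proof -
    obtain r where r: "r > 0" "\<And>p q. p \<in> K \<Longrightarrow> dist p q \<le> r \<Longrightarrow> q \<in> Q"
       "compact (\<Union>p\<in>K. cball p r)" "(\<Union>p\<in>K. cball p r) \<subseteq> Q" using compact_nbhd[OF K Q] by metis
    let ?K' = "\<Union>p\<in>K. cball p r"
    have cK': "continuous_on ?K' (\<lambda>(x, t). v x t)" using contv r(4) continuous_on_subset by blast
    then obtain M where M: "M > 0" "\<And>x t. (x, t) \<in> ?K' \<Longrightarrow> \<bar>v x t\<bar> \<le> M"
      using compact_imp_bounded[OF compact_continuous_image[OF cK' r(3)]] unfolding bounded_pos by fastforce
    have aK': "disc_approx hs ?K' v" using v r by (simp add: heat_class_def)
    \<comment> \<open>All points used below lie within \<open>3 * R\<close> in space and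
      \<open>4 * R\<^sup>2\<close> in time of a point of \<open>K\<close>. As
      \<open>R \<le> 1\<close>, their distance from it is at most \<open>7 * R\<close>, which is
      less than \<open>r\<close>.\<close>
    define R where "R = min 1 (r / 8)"
    have R: "R > 0" "R \<le> 1" "8 * R \<le> r" using r by (auto simp: R_def)
    have R2: "R\<^sup>2 \<le> R" using R by (simp add: power2_eq_square mult_left_le)
    define C where "C = (14 * DIM('a))\<^sup>2 * M / R\<^sup>2"
    have C: "C > 0" using M R by (simp add: C_def)
    have *: "(\<forall>\<sigma>. \<bar>\<sigma>\<bar> \<le> R \<longrightarrow> (x + \<sigma> *\<^sub>R e, t) \<in> Q) \<and>
        (\<exists>p. ?D x t p \<and> (\<forall>\<sigma>. \<sigma> \<noteq> 0 \<longrightarrow> \<bar>\<sigma>\<bar> \<le> R \<longrightarrow> \<bar>(v (x + \<sigma> *\<^sub>R e) t - v x t) / \<sigma> - p\<bar> \<le> 2 * C * \<bar>\<sigma>\<bar>))"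
      if xt: "(x, t) \<in> K" for x t
    proof
      have near: "(y, s) \<in> ?K'" if "norm (y - x) \<le> 3 * R" "\<bar>s - t\<bar> \<le> 4 * R\<^sup>2" for y s
      proof -
        have "dist (x, t) (y, s) \<le> norm (y - x) + \<bar>s - t\<bar>"
          unfolding dist_prod_def using sqrt_sum_squares_le_sum[of "dist x y" "dist t s"]
          by (simp add: dist_norm norm_minus_commute abs_minus_commute)
        also have "\<dots> \<le> r" using that R R2 by simp
        finally show ?thesis using xt by auto
      qed
      have near0: "(x + \<sigma> *\<^sub>R e, t) \<in> ?K'" if "\<bar>\<sigma>\<bar> \<le> R" for \<sigma>
        using that R e by (intro near) auto
      then show "\<forall>\<sigma>. \<bar>\<sigma>\<bar> \<le> R \<longrightarrow> (x + \<sigma> *\<^sub>R e, t) \<in> Q" using r(4) by blast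
      define f where "f s = v (x + s *\<^sub>R e) t" for s
      have cf: "continuous_on {-R..R} f"
      proof -
        have "continuous_on {-R..R} (\<lambda>s. (\<lambda>(x, t). v x t) (x + s *\<^sub>R e, t))"
          by (rule continuous_on_compose2[OF cK']) (use near0 in \<open>auto intro!: continuous_intros simp del: UN_iff\<close>)
        then show ?thesis by (simp add: f_def[abs_def])
      qed
      have sd: "\<bar>f (y + \<sigma>) - 2 * f y + f (y - \<sigma>)\<bar> \<le> C * \<sigma>\<^sup>2" if "0 \<le> \<sigma>" "-R \<le> y - \<sigma>" "y + \<sigma> \<le> R" for y \<sigma>
      proof -
        let ?Q' = "cball (x + y *\<^sub>R e) (2 * R) \<times> {t - (2 * R)\<^sup>2..t}"
        have y: "\<bar>y\<bar> \<le> R" using that by auto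
        have sub: "?Q' \<subseteq> ?K'"
        proof
          fix q assume "q \<in> ?Q'"
          then obtain z s where q: "q = (z, s)" "norm (z - (x + y *\<^sub>R e)) \<le> 2 * R" "t - 4 * R\<^sup>2 \<le> s" "s \<le> t"
            by (auto simp: dist_norm norm_minus_commute power_mult_distrib)
          have "norm (z - x) \<le> norm (z - (x + y *\<^sub>R e)) + \<bar>y\<bar>"
            using norm_triangle_ineq[of "z - (x + y *\<^sub>R e)" "y *\<^sub>R e"] e by (simp add: algebra_simps)
          then show "q \<in> ?K'" unfolding q(1) using q y by (intro near) auto
        qed
        have "\<bar>v (x + y *\<^sub>R e + \<sigma> *\<^sub>R e) t - 2 * v (x + y *\<^sub>R e) t + v (x + y *\<^sub>R e - \<sigma> *\<^sub>R e) t\<bar> \<le> C * \<sigma>\<^sup>2"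
          unfolding C_def
        proof (rule approx_second_difference[OF _ _ _ e R(1)])
          show "disc_approx hs ?Q' v" using disc_approx_subset[OF aK' sub] .
          show "continuous_on ?Q' (\<lambda>(x, t). v x t)" using continuous_on_subset[OF cK' sub] .
          show "\<bar>v z s\<bar> \<le> M" if "z \<in> cball (x + y *\<^sub>R e) (2 * R)" "t - (2 * R)\<^sup>2 \<le> s" "s \<le> t" for z s
            by (rule M(2), rule subsetD[OF sub]) (use that in simp)
        qed (use that in auto)
        then show ?thesis by (simp add: f_def algebra_simps)
      qed
      show "\<exists>p. ?D x t p \<and> (\<forall>\<sigma>. \<sigma> \<noteq> 0 \<longrightarrow> \<bar>\<sigma>\<bar> \<le> R \<longrightarrow> \<bar>(v (x + \<sigma> *\<^sub>R e) t - v x t) / \<sigma> - p\<bar> \<le> 2 * C * \<bar>\<sigma>\<bar>)"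
      proof -
        obtain p where p: "(f has_real_derivative p) (at 0)"
          "\<And>\<sigma>. \<sigma> \<noteq> 0 \<Longrightarrow> \<bar>\<sigma>\<bar> \<le> R \<Longrightarrow> \<bar>(f \<sigma> - f 0) / \<sigma> - p\<bar> \<le> 2 * C * \<bar>\<sigma>\<bar>"
          using second_difference_derivative[OF C R(1) cf sd] by blast
        have "?D x t p" using p(1) by (simp add: f_def[abs_def])
        moreover have "f 0 = v x t" by (simp add: f_def)
        ultimately show ?thesis using p(2) by (auto simp: f_def)
      qed
    qed
    have "2 * C > 0" using C by simp
    then show ?thesis using * R(1) by blast
  qed
  define v' where "v' x t = (THE p. ?D x t p)" for x t
  have v'eq: "v' x t = p" if "?D x t p" for x t p
    unfolding v'_def using that DERIV_unique by blast
  have loc': "\<exists>R>0. \<exists>C>0. \<forall>x t. (x, t) \<in> K \<longrightarrow> (\<forall>\<sigma>. \<bar>\<sigma>\<bar> \<le> R \<longrightarrow> (x + \<sigma> *\<^sub>R e, t) \<in> Q) \<and>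
      ?D x t (v' x t) \<and> (\<forall>\<sigma>. \<sigma> \<noteq> 0 \<longrightarrow> \<bar>\<sigma>\<bar> \<le> R \<longrightarrow> \<bar>(v (x + \<sigma> *\<^sub>R e) t - v x t) / \<sigma> - v' x t\<bar> \<le> C * \<bar>\<sigma>\<bar>)"
    if K: "compact K" "K \<subseteq> Q" for K
  proof -
    obtain R C where "R > 0" "C > 0" and RC: "\<And>x t. (x, t) \<in> K \<Longrightarrow> (\<forall>\<sigma>. \<bar>\<sigma>\<bar> \<le> R \<longrightarrow> (x + \<sigma> *\<^sub>R e, t) \<in> Q) \<and>
      (\<exists>p. ?D x t p \<and> (\<forall>\<sigma>. \<sigma> \<noteq> 0 \<longrightarrow> \<bar>\<sigma>\<bar> \<le> R \<longrightarrow> \<bar>(v (x + \<sigma> *\<^sub>R e) t - v x t) / \<sigma> - p\<bar> \<le> C * \<bar>\<sigma>\<bar>))"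
      using loc[OF K] by blast
    have "(\<forall>\<sigma>. \<bar>\<sigma>\<bar> \<le> R \<longrightarrow> (x + \<sigma> *\<^sub>R e, t) \<in> Q) \<and>
      ?D x t (v' x t) \<and> (\<forall>\<sigma>. \<sigma> \<noteq> 0 \<longrightarrow> \<bar>\<sigma>\<bar> \<le> R \<longrightarrow> \<bar>(v (x + \<sigma> *\<^sub>R e) t - v x t) / \<sigma> - v' x t\<bar> \<le> C * \<bar>\<sigma>\<bar>)"
      if xt: "(x, t) \<in> K" for x t
    proof -
      obtain p where "?D x t p" "\<forall>\<sigma>. \<sigma> \<noteq> 0 \<longrightarrow> \<bar>\<sigma>\<bar> \<le> R \<longrightarrow> \<bar>(v (x + \<sigma> *\<^sub>R e) t - v x t) / \<sigma> - p\<bar> \<le> C * \<bar>\<sigma>\<bar>"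
        using RC[OF xt] by blast
      then show ?thesis using RC[OF xt] v'eq[of x t p] by simp
    qed
    then show ?thesis using \<open>R > 0\<close> \<open>C > 0\<close> by blast
  qed
  have der: "?D x t (v' x t)" if "(x, t) \<in> Q" for x t
  proof -
    have "compact {(x, t)}" "{(x, t)} \<subseteq> Q" using that by auto
    from loc'[OF this] show ?thesis by blast
  qed
  have quot: "\<exists>u. disc_approx hs K u \<and> continuous_on K (\<lambda>(x, t). u x t) \<and> (\<forall>x t. (x, t) \<in> K \<longrightarrow> \<bar>u x t - v' x t\<bar> \<le> \<epsilon>)"
    if K: "compact K" "K \<subseteq> Q" and "\<epsilon> > 0" for K \<epsilon>
  proof -
    obtain R C where R: "R > 0" "C > 0" "\<And>x t \<sigma>. (x, t) \<in> K \<Longrightarrow> \<bar>\<sigma>\<bar> \<le> R \<Longrightarrow> (x + \<sigma> *\<^sub>R e, t) \<in> Q"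
      "\<And>x t \<sigma>. (x, t) \<in> K \<Longrightarrow> \<sigma> \<noteq> 0 \<Longrightarrow> \<bar>\<sigma>\<bar> \<le> R \<Longrightarrow> \<bar>(v (x + \<sigma> *\<^sub>R e) t - v x t) / \<sigma> - v' x t\<bar> \<le> C * \<bar>\<sigma>\<bar>"
      using loc'[OF K] by blast
    define \<sigma> where "\<sigma> = min R (\<epsilon> / C)"
    have \<sigma>: "\<sigma> > 0" "\<sigma> \<le> R" "C * \<sigma> \<le> \<epsilon>" using R(1,2) \<open>\<epsilon> > 0\<close> by (auto simp: \<sigma>_def min_def field_simps)
    \<comment> \<open>The difference quotient is a linear combination of \<open>v\<close> and a
      translate of \<open>v\<close>, hence approximated by discrete solutions on \<open>K\<close>;
      \<open>\<sigma>\<close> is so small that it is within \<open>\<epsilon>\<close> of the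
      derivative.\<close>
    define u where "u x t = (1 / \<sigma>) * (v (x + \<sigma> *\<^sub>R e) t + (-1) * v x t)" for x t
    define K' where "K' = (\<lambda>p. p + (\<sigma> *\<^sub>R e, 0)) ` K"
    have K': "compact K'" unfolding K'_def by (intro compact_continuous_image continuous_intros K)
    have shift: "(x + \<sigma> *\<^sub>R e, t) \<in> K'" if "(x, t) \<in> K" for x t
      using that by (force simp: K'_def)
    have K'Q: "K' \<subseteq> Q" using R(3)[of _ _ \<sigma>] \<sigma> by (auto simp: K'_def)
    have "disc_approx hs K' v" "disc_approx hs K v" using v K' K'Q K by (auto simp: heat_class_def)
    then have "disc_approx hs K u" unfolding u_def
      by (intro disc_approx_add disc_approx_cmult disc_approx_shift[where K = K'] shift)
    moreover have "continuous_on K (\<lambda>p. (\<lambda>(x, t). v x t) (p + (\<sigma> *\<^sub>R e, 0)))"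
      by (rule continuous_on_compose2[OF contv]) (use K'Q in \<open>auto simp: K'_def intro!: continuous_intros\<close>)
    then have "continuous_on K (\<lambda>(x, t). u x t)"
      using continuous_on_subset[OF contv K(2)] unfolding u_def case_prod_unfold
      by (intro continuous_intros) auto
    moreover have "\<bar>u x t - v' x t\<bar> \<le> \<epsilon>" if "(x, t) \<in> K" for x t
      using R(4)[OF that, of \<sigma>] \<sigma> by (simp add: u_def)
    ultimately show ?thesis by blast
  qed
  have "continuous_on Q (\<lambda>(x, t). v' x t)"
    unfolding continuous_on_eq_continuous_at[OF Q]
  proof
    fix p assume "p \<in> Q"
    then obtain r where r: "r > 0" "cball p r \<subseteq> Q" using Q open_contains_cball by blast
    have "\<exists>u. continuous_on (cball p r) (\<lambda>(x, t). u x t) \<and> (\<forall>x t. (x, t) \<in> cball p r \<longrightarrow> \<bar>u x t - v' x t\<bar> \<le> inverse (Suc n))" for n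
      using quot[OF compact_cball r(2), of "inverse (Suc n)"] by auto
    then obtain u where u: "\<And>n. continuous_on (cball p r) (\<lambda>(x, t). u n x t)"
      "\<And>n x t. (x, t) \<in> cball p r \<Longrightarrow> \<bar>u n x t - v' x t\<bar> \<le> inverse (Suc n)"
      by metis
    have "uniform_limit (cball p r) (\<lambda>n (x, t). u n x t) (\<lambda>(x, t). v' x t) sequentially"
    proof (rule uniform_limitI)
      fix \<epsilon> :: real assume "\<epsilon> > 0"
      then have "\<forall>\<^sub>F n in sequentially. inverse (real (Suc n)) < \<epsilon>"
        using LIMSEQ_inverse_real_of_nat by (intro order_tendstoD)
      then show "\<forall>\<^sub>F n in sequentially. \<forall>x\<in>cball p r. dist (case x of (x, t) \<Rightarrow> u n x t) (case x of (x, t) \<Rightarrow> v' x t) < \<epsilon>"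
      proof eventually_elim
        case (elim n)
        then have "dist (u n x t) (v' x t) < \<epsilon>" if "(x, t) \<in> cball p r" for x t
          using u(2)[OF that, of n] by (simp add: dist_real_def)
        then show ?case by auto
      qed
    qed
    then have "continuous_on (cball p r) (\<lambda>(x, t). v' x t)"
      using u(1) by (intro uniform_limit_theorem[where F = sequentially]) auto
    then show "isCont (\<lambda>(x, t). v' x t) p" using r by (intro continuous_on_interior) auto
  qed
  moreover have "disc_approx hs K v'" if "compact K" "K \<subseteq> Q" for K
    using quot[OF that] by (intro disc_approx_limit) (simp add: case_prod_unfold Ball_def, blast)
  ultimately have "heat_class Q v'" by (simp add: heat_class_def)
  then show ?thesis using that der by blast
qed

end

lemma open_slice:
  assumes "open Q" shows "open {x. (x, t) \<in> Q}"
proof -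
  have "continuous_on UNIV (\<lambda>x. (x, t))" by (intro continuous_intros)
  from open_vimage[OF assms this] show ?thesis by (simp add: vimage_def)
qed

section \<open>The heat equation and smoothness for limits of discrete solutions\<close>

context mesh begin

text \<open>The second-order Taylor polynomial of the slice at \<open>t0\<close>, raised by 2 \<eta>
  |x - x0|^2 and moving upwards at speed \<open>\<Lambda> + \<epsilon>\<close>, is an exact solution
  of the scheme. Up to the approximation error it lies above the approximating discrete solution on
  the parabolic boundary of a small cylinder, and therefore inside. The scheme runs forward, so the
  bound concerns times after \<open>t0\<close>.\<close>

lemma heat_class_time_upper:
  fixes v :: "'a::euclidean_space \<Rightarrow> real \<Rightarrow> real" and \<epsilon> :: real
  assumes Q: "open Q" and v: "heat_class Q v" and xt: "(x0, t0) \<in> Q"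
    and Ck: "Ck_on 2 {x. (x, t0) \<in> Q} (\<lambda>y. v y t0)" and \<epsilon>: "\<epsilon> > 0"
  shows "\<exists>\<delta>>0. \<forall>s. t0 \<le> s \<and> s < t0 + \<delta> \<longrightarrow>
    v x0 s - v x0 t0 - (s - t0) * laplacian (\<lambda>y. v y t0) x0 \<le> \<epsilon> * (s - t0)"
proof -
  define N where "N = real DIM('a)"
  have N: "N \<ge> 1" by (simp add: N_def DIM_ge_Suc0)
  define \<Lambda> where "\<Lambda> = laplacian (\<lambda>y. v y t0) x0"
  \<comment> \<open>One averaging step raises \<open>2 * \<eta> * (norm (x - x0))\<^sup>2\<close> by
    \<open>\<epsilon> * h\<^sup>2 / (2 * N)\<close>, which is exactly what the extra speed
    \<open>\<epsilon>\<close> gains in one time step.\<close>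
  define \<eta> where "\<eta> = \<epsilon> / (4 * N)"
  define A where "A = \<Lambda> + \<epsilon>"
  define P where "P = taylor2 (\<lambda>y. v y t0) x0"
  have \<eta>: "\<eta> > 0" using \<epsilon> N by (simp add: \<eta>_def)
  obtain \<rho> where \<rho>: "\<rho> > 0" "cball (x0, t0) \<rho> \<subseteq> Q" using Q xt open_contains_cball by blast
  have oS: "open {x. (x, t0) \<in> Q}"
    by (rule open_slice[OF Q])
  obtain r1 where r1: "r1 > 0" "\<And>y. y \<in> ball x0 r1 \<Longrightarrow> \<bar>v y t0 - P y\<bar> \<le> \<eta> * (norm (y - x0))\<^sup>2"
    using taylor2_approx[OF oS _ Ck \<eta>, of x0] xt by (auto simp: P_def)
  define r where "r = min (\<rho> / 2) (r1 / 2)"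
  have r: "r > 0" "r \<le> \<rho> / 2" "r < r1" using \<rho> r1 by (auto simp: r_def)
  have sub0: "cball x0 r \<times> {t0..t0 + r} \<subseteq> Q"
  proof
    fix q assume "q \<in> cball x0 r \<times> {t0..t0 + r}"
    then obtain y s where q: "q = (y, s)" "dist x0 y \<le> r" "t0 \<le> s" "s \<le> t0 + r" by auto
    have "dist (x0, t0) (y, s) \<le> dist x0 y + dist t0 s"
      unfolding dist_prod_def using sqrt_sum_squares_le_sum[of "dist x0 y" "dist t0 s"] by simp
    also have "\<dots> \<le> \<rho>" using q r by (simp add: dist_real_def)
    finally show "q \<in> Q" using \<rho>(2) q(1) by auto
  qed
  have "compact (cball x0 r \<times> {t0..t0 + r})" by (intro compact_Times) auto
  moreover have "continuous_on (cball x0 r \<times> {t0..t0 + r}) (\<lambda>(x, t). v x t)"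
    using v sub0 continuous_on_subset unfolding heat_class_def by blast
  ultimately have uc: "uniformly_continuous_on (cball x0 r \<times> {t0..t0 + r}) (\<lambda>(x, t). v x t)"
    by (intro compact_uniformly_continuous)
  have uct: "\<exists>d>0. \<forall>x s. x \<in> cball x0 r \<longrightarrow> t0 \<le> s \<longrightarrow> s \<le> t0 + r \<longrightarrow> s < t0 + d \<longrightarrow> \<bar>v x s - v x t0\<bar> \<le> e" if "e > 0" for e
  proof -
    obtain d where d: "d > 0" "\<And>p q. p \<in> cball x0 r \<times> {t0..t0 + r} \<Longrightarrow> q \<in> cball x0 r \<times> {t0..t0 + r} \<Longrightarrow>
       dist q p < d \<Longrightarrow> dist (case q of (x, t) \<Rightarrow> v x t) (case p of (x, t) \<Rightarrow> v x t) < e"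
      using uc \<open>e > 0\<close> unfolding uniformly_continuous_on_def by metis
    have "\<bar>v x s - v x t0\<bar> \<le> e" if "x \<in> cball x0 r" "t0 \<le> s" "s \<le> t0 + r" "s < t0 + d" for x s
    proof -
      have "dist (x, s) (x, t0) < d" using that by (simp add: dist_prod_def dist_real_def)
      with d(2)[of "(x, t0)" "(x, s)"] show ?thesis using that r by (simp add: dist_real_def)
    qed
    then show ?thesis using d(1) by blast
  qed
  obtain d where d: "d > 0" "\<And>x s. x \<in> cball x0 r \<Longrightarrow> t0 \<le> s \<Longrightarrow> s \<le> t0 + r \<Longrightarrow> s < t0 + d \<Longrightarrow> \<bar>v x s - v x t0\<bar> \<le> \<eta> * r\<^sup>2 / 8"
    using uct[of "\<eta> * r\<^sup>2 / 8"] \<eta> r by auto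
  \<comment> \<open>At distance at least \<open>r / 2\<close> from \<open>x0\<close> the barrier
    exceeds the Taylor bound of the slice by \<open>\<eta> * r\<^sup>2 / 4\<close>. The oscillation
    of \<open>v\<close> in time and the drift \<open>A * (t - t0)\<close> may each consume half of
    this margin.\<close>
  define \<delta> where "\<delta> = min (min r (d / 2)) (\<eta> * r\<^sup>2 / (8 * (\<bar>A\<bar> + 1)))"
  have \<delta>: "\<delta> > 0" "\<delta> \<le> r" "\<delta> < d" "\<delta> \<le> \<eta> * r\<^sup>2 / (8 * (\<bar>A\<bar> + 1))"
    using r d \<eta> by (auto simp: \<delta>_def add_nonneg_pos)
  have \<delta>A: "\<bar>(s - t0) * A\<bar> \<le> \<eta> * r\<^sup>2 / 8" if "t0 \<le> s" "s \<le> t0 + \<delta>" for s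
  proof -
    have "\<bar>(s - t0) * A\<bar> \<le> \<delta> * (\<bar>A\<bar> + 1)" using that \<delta>(1) unfolding abs_mult by (intro mult_mono) auto
    also have "\<dots> \<le> \<eta> * r\<^sup>2 / (8 * (\<bar>A\<bar> + 1)) * (\<bar>A\<bar> + 1)" using \<delta>(4) by (intro mult_right_mono) auto
    also have "\<dots> = \<eta> * r\<^sup>2 / 8"
      using nonzero_mult_divide_mult_cancel_right[of "\<bar>A\<bar> + 1" "\<eta> * r\<^sup>2" 8] by (simp add: add_nonneg_eq_0_iff)
    finally show ?thesis .
  qed
  let ?K = "cball x0 r \<times> {t0..t0 + \<delta>}"
  have "compact ?K" "?K \<subseteq> Q" using sub0 \<delta> by (auto intro!: compact_Times)
  then have aK: "disc_approx hs ?K v" using v by (simp add: heat_class_def)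
  have main: "v x0 s \<le> v x0 t0 + (s - t0) * A + e" if s: "t0 \<le> s" "s \<le> t0 + \<delta>" and e: "e > 0" for s e
  proof -
    \<comment> \<open>Three units are spent in the comparison: on the oscillation of
      \<open>v\<close> over the first time layer, on the drift in that layer and on the distance of
      \<open>f\<close> from \<open>v\<close>. The fourth pays for returning from \<open>f\<close> to
      \<open>v\<close> at \<open>x0\<close>.\<close>
    define e1 where "e1 = e / 4"
    have e1: "e1 > 0" using e by (simp add: e1_def)
    obtain d1 where d1: "d1 > 0" "\<And>x s. x \<in> cball x0 r \<Longrightarrow> t0 \<le> s \<Longrightarrow> s \<le> t0 + r \<Longrightarrow> s < t0 + d1 \<Longrightarrow> \<bar>v x s - v x t0\<bar> \<le> e1"
      using uct[OF e1] by auto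
    define h0 where "h0 = min (min 1 (r / 4)) (min d1 (e1 / (\<bar>A\<bar> + 1)))"
    have h0: "h0 > 0" using r d1 e1 by (auto simp: h0_def add_nonneg_pos)
    obtain n where n: "hs n < h0" "\<exists>f. disc_sol (hs n) ?K f \<and> (\<forall>x t. (x, t) \<in> ?K \<longrightarrow> \<bar>f x t - v x t\<bar> \<le> e1)"
      using eventually_happens[OF eventually_conj[OF hs_small[OF h0] disc_approxD[OF aK e1]]] by auto
    define h where "h = hs n"
    have h: "h > 0" "h < 1" "h < r / 4" "h < d1" "h < e1 / (\<bar>A\<bar> + 1)" using n hs_pos[of n] by (auto simp: h_def h0_def)
    obtain f where f: "disc_sol h ?K f" "\<And>x t. x \<in> cball x0 r \<Longrightarrow> t0 \<le> t \<Longrightarrow> t \<le> t0 + \<delta> \<Longrightarrow> \<bar>f x t - v x t\<bar> \<le> e1"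
      using n(2) unfolding h_def by (auto simp del: mem_cball)
    define \<tau> where "\<tau> = h\<^sup>2 / (2 * N)"
    have "h\<^sup>2 \<le> h * 1" unfolding power2_eq_square using h by (intro mult_left_mono) auto
    moreover have "\<tau> \<le> h\<^sup>2 / 1" unfolding \<tau>_def using N by (intro divide_left_mono) auto
    ultimately have \<tau>: "0 \<le> \<tau>" "\<tau> \<le> h" using N by (auto simp: \<tau>_def)
    define \<psi> where "\<psi> x t = P x + 2 * \<eta> * (norm (x - x0))\<^sup>2 + A * (t - t0)" for x t
    define D where "D x t = f x t - \<psi> x t" for x t
    have fv: "f x t \<le> P x + \<eta> * (norm (x - x0))\<^sup>2 + \<bar>v x t - v x t0\<bar> + e1" if "x \<in> cball x0 r" "t0 \<le> t" "t \<le> t0 + \<delta>" for x t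
    proof -
      have "v x t0 \<le> P x + \<eta> * (norm (x - x0))\<^sup>2" using r1(2)[of x] that r by auto
      then show ?thesis using f(2)[OF that] by linarith
    qed
    have "D x0 s \<le> 3 * e1"
    proof (rule disc_max_principle[where d = D and X = "cball x0 r" and I = "{x. norm (x - x0) \<le> r - h}" and a = t0 and b = "t0 + \<delta>" and h = h])
      fix x t assume x: "x \<in> {x. norm (x - x0) \<le> r - h}" and t: "t0 \<le> t" "t + h\<^sup>2 / (2 * DIM('a)) \<le> t0 + \<delta>"
      have "norm (x + h *\<^sub>R i - x0) \<le> r \<and> norm (x - h *\<^sub>R i - x0) \<le> r" if "i \<in> Basis" for i
        using norm_triangle_ineq[of "x - x0" "h *\<^sub>R i"] norm_triangle_ineq4[of "x - x0" "h *\<^sub>R i"] h x that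
        by (simp add: algebra_simps)
      moreover have "0 \<le> h\<^sup>2 / (2 * DIM('a))" by simp
      then have "t \<le> t0 + \<delta>" "t0 \<le> t + h\<^sup>2 / (2 * DIM('a))" using t by linarith+
      ultimately have "f x (t + h\<^sup>2 / (2 * DIM('a))) = avg h (\<lambda>y. f y t) x"
        using f(1)[unfolded disc_sol_def, rule_format, of x t] x t h by (simp add: dist_norm norm_minus_commute)
      moreover have "avg h (\<lambda>y. \<psi> y t) x = \<psi> x (t + h\<^sup>2 / (2 * DIM('a)))"
      proof -
        have "avg h (\<lambda>y. \<psi> y t) x = P x + h\<^sup>2 / (2 * N) * \<Lambda> + 2 * \<eta> * ((norm (x - x0))\<^sup>2 + h\<^sup>2) + A * (t - t0)"
          unfolding \<psi>_def avg_add avg_cmult avg_const avg_dist_sq P_def avg_taylor2 \<Lambda>_def N_def by simp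
        also have "\<dots> = \<psi> x (t + h\<^sup>2 / (2 * N))"
          using N unfolding \<psi>_def A_def \<eta>_def by (simp add: field_simps)
        finally show ?thesis by (simp add: N_def)
      qed
      ultimately show "D x (t + h\<^sup>2 / (2 * DIM('a))) \<le> avg h (\<lambda>y. D y t) x"
        by (simp add: D_def avg_diff)
    next
      fix x i :: 'a assume "x \<in> {x. norm (x - x0) \<le> r - h}" "i \<in> Basis"
      then show "x + h *\<^sub>R i \<in> cball x0 r \<and> x - h *\<^sub>R i \<in> cball x0 r"
        using norm_triangle_ineq[of "x - x0" "h *\<^sub>R i"] norm_triangle_ineq4[of "x - x0" "h *\<^sub>R i"] h
        by (simp add: algebra_simps dist_norm norm_minus_commute)
    next
      fix x t assume x: "x \<in> cball x0 r - {x. norm (x - x0) \<le> r - h}" and t: "t0 \<le> t" "t \<le> t0 + \<delta>"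
      have "r / 2 \<le> norm (x - x0)" using x h by auto
      then have "(r / 2)\<^sup>2 \<le> (norm (x - x0))\<^sup>2" using r by (intro power_mono) auto
      then have "\<eta> * (r\<^sup>2 / 4) \<le> \<eta> * (norm (x - x0))\<^sup>2" using \<eta> by (intro mult_left_mono) (auto simp: power_divide)
      moreover have "\<bar>v x t - v x t0\<bar> \<le> \<eta> * r\<^sup>2 / 8" using x t \<delta> by (intro d) auto
      moreover have "f x t \<le> P x + \<eta> * (norm (x - x0))\<^sup>2 + \<bar>v x t - v x t0\<bar> + e1" using x t by (intro fv) auto
      moreover have "\<bar>A * (t - t0)\<bar> \<le> \<eta> * r\<^sup>2 / 8" using \<delta>A[OF t] by (simp add: mult.commute)
      ultimately show "D x t \<le> 3 * e1" unfolding D_def \<psi>_def using e1 by linarith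
    next
      fix x t assume x: "x \<in> cball x0 r" and t: "t0 \<le> t" "t \<le> t0 + \<delta>" "t < t0 + h\<^sup>2 / (2 * DIM('a))"
      have t\<tau>: "t < t0 + \<tau>" using t by (simp add: \<tau>_def N_def)
      have "\<bar>v x t - v x t0\<bar> \<le> e1" using x t \<delta> t\<tau> \<tau> h by (intro d1) auto
      moreover have "f x t \<le> P x + \<eta> * (norm (x - x0))\<^sup>2 + \<bar>v x t - v x t0\<bar> + e1" using x t by (intro fv) auto
      moreover have "\<bar>A * (t - t0)\<bar> \<le> e1"
      proof -
        have "\<bar>A * (t - t0)\<bar> \<le> (\<bar>A\<bar> + 1) * h" unfolding abs_mult using t t\<tau> \<tau> by (intro mult_mono) auto
        also have "\<dots> \<le> (\<bar>A\<bar> + 1) * (e1 / (\<bar>A\<bar> + 1))" using h by (intro mult_left_mono) auto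
        also have "\<dots> = e1" by (simp add: add_nonneg_eq_0_iff)
        finally show ?thesis .
      qed
      moreover have "0 \<le> \<eta> * (norm (x - x0))\<^sup>2" using \<eta> by simp
      ultimately show "D x t \<le> 3 * e1" unfolding D_def \<psi>_def by linarith
    qed (use h r s in auto)
    moreover have "\<bar>f x0 s - v x0 s\<bar> \<le> e1" using s r by (intro f) auto
    moreover have "\<psi> x0 s = v x0 t0 + (s - t0) * A" by (simp add: \<psi>_def P_def mult.commute)
    ultimately show ?thesis unfolding D_def e1_def by linarith
  qed
  have "v x0 s - v x0 t0 - (s - t0) * \<Lambda> \<le> \<epsilon> * (s - t0)" if "t0 \<le> s" "s < t0 + \<delta>" for s
  proof -
    have "v x0 s \<le> v x0 t0 + (s - t0) * A"
      by (rule field_le_epsilon) (rule main, use that in auto)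
    then show ?thesis by (simp add: A_def algebra_simps)
  qed
  then show ?thesis using \<delta>(1) unfolding \<Lambda>_def by blast
qed

lemma heat_class_partials:
  fixes v :: "'a::euclidean_space \<Rightarrow> real \<Rightarrow> real"
  assumes Q: "open Q" and v: "heat_class Q v"
  obtains D where "\<And>i. i \<in> Basis \<Longrightarrow> heat_class Q (D i)"
    "\<And>i x t. i \<in> Basis \<Longrightarrow> (x, t) \<in> Q \<Longrightarrow> ((\<lambda>s. v (x + s *\<^sub>R i) t) has_real_derivative D i x t) (at 0)"
    "\<And>x t. (x, t) \<in> Q \<Longrightarrow> (\<lambda>y. v y t) differentiable (at x)"
    "\<And>i x t. i \<in> Basis \<Longrightarrow> (x, t) \<in> Q \<Longrightarrow> pderiv_dir i (\<lambda>y. v y t) x = D i x t"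
proof -
  have "\<exists>v'. heat_class Q v' \<and> (\<forall>x t. (x, t) \<in> Q \<longrightarrow> ((\<lambda>s. v (x + s *\<^sub>R i) t) has_real_derivative v' x t) (at 0))"
    if i: "i \<in> Basis" for i
    using heat_class_derivative[OF Q v i] by metis
  then obtain D where D: "\<And>i. i \<in> Basis \<Longrightarrow> heat_class Q (D i)"
    "\<And>i x t. i \<in> Basis \<Longrightarrow> (x, t) \<in> Q \<Longrightarrow> ((\<lambda>s. v (x + s *\<^sub>R i) t) has_real_derivative D i x t) (at 0)"
    by metis
  have der: "((\<lambda>y. v y t) has_derivative (\<lambda>w. \<Sum>i\<in>Basis. D i x t * (w \<bullet> i))) (at x)" if xt: "(x, t) \<in> Q" for x t
  proof (rule has_derivative_partials[where S = "{x. (x, t) \<in> Q}" and p = "\<lambda>i y. D i y t"])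
    show "open {x. (x, t) \<in> Q}"
      by (rule open_slice[OF Q])
    fix i :: 'a assume i: "i \<in> Basis"
    have "isCont (\<lambda>p. case p of (x, t) \<Rightarrow> D i x t) (x, t)"
      using D(1)[OF i] xt Q by (simp add: heat_class_def continuous_on_eq_continuous_at)
    then have "isCont ((\<lambda>p. case p of (x, t) \<Rightarrow> D i x t) \<circ> (\<lambda>y. (y, t))) x"
      by (intro continuous_at_compose) (auto intro!: continuous_intros)
    then show "isCont (\<lambda>y. D i y t) x" by (simp add: o_def)
  qed (use D xt in auto)
  have "pderiv_dir i (\<lambda>y. v y t) x = D i x t" if "i \<in> Basis" "(x, t) \<in> Q" for i x t
    using pderiv_dir_eqI[OF der[OF that(2)], of i] that(1)
    by (simp add: inner_Basis if_distrib[of "\<lambda>x. _ * x"] cong: if_cong)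
  moreover have "(\<lambda>y. v y t) differentiable (at x)" if "(x, t) \<in> Q" for x t
    using der[OF that] by (auto simp: differentiable_def)
  ultimately show ?thesis using that D by blast
qed

lemma heat_class_slice:
  fixes v :: "'a::euclidean_space \<Rightarrow> real \<Rightarrow> real"
  assumes Q: "open Q" and v: "heat_class Q v"
  shows "Ck_on k {x. (x, t) \<in> Q} (\<lambda>y. v y t)"
  using v
proof (induction k arbitrary: v)
  case 0
  then have "continuous_on Q (\<lambda>(x, t). v x t)" by (simp add: heat_class_def)
  then have "continuous_on {x. (x, t) \<in> Q} (\<lambda>x. case (x, t) of (x, t) \<Rightarrow> v x t)"
    by (rule continuous_on_compose2) (auto intro!: continuous_intros)
  then show ?case by simp
next
  case (Suc k)
  obtain D where D: "\<And>i. i \<in> Basis \<Longrightarrow> heat_class Q (D i)"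
    "\<And>x t. (x, t) \<in> Q \<Longrightarrow> (\<lambda>y. v y t) differentiable (at x)"
    "\<And>i x t. i \<in> Basis \<Longrightarrow> (x, t) \<in> Q \<Longrightarrow> pderiv_dir i (\<lambda>y. v y t) x = D i x t"
    using heat_class_partials[OF Q Suc.prems] by metis
  have o: "open {x. (x, t) \<in> Q}"
    by (rule open_slice[OF Q])
  have "Ck_on k {x. (x, t) \<in> Q} (pderiv_dir i (\<lambda>y. v y t))" if "i \<in> Basis" for i
    using Ck_on_cong[OF o, of "pderiv_dir i (\<lambda>y. v y t)" "\<lambda>y. D i y t" k] D(3) Suc.IH[OF D(1)] that by simp
  then show ?case using D(2) by simp
qed

lemma heat_class_laplacian:
  fixes v :: "'a::euclidean_space \<Rightarrow> real \<Rightarrow> real"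
  assumes Q: "open Q" and v: "heat_class Q v"
  obtains L where "heat_class Q L" "\<And>x t. (x, t) \<in> Q \<Longrightarrow> laplacian (\<lambda>y. v y t) x = L x t"
proof -
  obtain D where D: "\<And>i. i \<in> Basis \<Longrightarrow> heat_class Q (D i)"
    "\<And>i x t. i \<in> Basis \<Longrightarrow> (x, t) \<in> Q \<Longrightarrow> pderiv_dir i (\<lambda>y. v y t) x = D i x t"
    using heat_class_partials[OF Q v] by metis
  have "\<exists>E. heat_class Q E \<and> (\<forall>x t. (x, t) \<in> Q \<longrightarrow> pderiv_dir i (\<lambda>y. D i y t) x = E x t)" if "i \<in> Basis" for i
    using heat_class_partials[OF Q D(1)[OF that]] that by metis
  then obtain E where E: "\<And>i. i \<in> Basis \<Longrightarrow> heat_class Q (E i)"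
    "\<And>i x t. i \<in> Basis \<Longrightarrow> (x, t) \<in> Q \<Longrightarrow> pderiv_dir i (\<lambda>y. D i y t) x = E i x t"
    by metis
  have o: "open {x. (x, t) \<in> Q}" for t
    by (rule open_slice[OF Q])
  have "laplacian (\<lambda>y. v y t) x = (\<Sum>i\<in>Basis. E i x t)" if "(x, t) \<in> Q" for x t
    unfolding laplacian_def
  proof (intro sum.cong refl)
    fix i :: 'a assume i: "i \<in> Basis"
    have "pderiv_dir i (pderiv_dir i (\<lambda>y. v y t)) x = pderiv_dir i (\<lambda>y. D i y t) x"
      by (rule pderiv_dir_cong_open[OF o[of t]]) (use D(2)[OF i] that in auto)
    then show "pderiv_dir i (pderiv_dir i (\<lambda>y. v y t)) x = E i x t" using E(2)[OF i that] by simp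
  qed
  moreover have "heat_class Q (\<lambda>x t. \<Sum>i\<in>Basis. E i x t)"
    using E(1) by (intro heat_class_sum) auto
  ultimately show ?thesis using that by blast
qed

text \<open>The one-sided estimate, applied to \<open>v\<close> and to its negative, identifies the
  Laplacian as the right derivative at every nearby time. The Laplacian belongs to the class and is
  thus continuous in time, and a continuous right derivative of a continuous function is a
  derivative.\<close>

lemma heat_class_time:
  fixes v :: "'a::euclidean_space \<Rightarrow> real \<Rightarrow> real"
  assumes Q: "open Q" and v: "heat_class Q v" and xt: "(x, t) \<in> Q"
  shows "((\<lambda>s. v x s) has_real_derivative laplacian (\<lambda>y. v y t) x) (at t)"
proof -
  obtain L where L: "heat_class Q L" "\<And>x t. (x, t) \<in> Q \<Longrightarrow> laplacian (\<lambda>y. v y t) x = L x t"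
    using heat_class_laplacian[OF Q v] by metis
  obtain \<rho> where \<rho>: "\<rho> > 0" "cball (x, t) \<rho> \<subseteq> Q" using Q xt open_contains_cball by blast
  have inQ: "(x, s) \<in> Q" if "s \<in> {t - \<rho>..t + \<rho>}" for s
    using \<rho>(2) that by (auto simp: dist_prod_def dist_real_def subset_iff)
  have c: "continuous_on {t - \<rho>..t + \<rho>} (\<lambda>s. u x s)" if "heat_class Q u" for u
  proof -
    have "continuous_on {t - \<rho>..t + \<rho>} (\<lambda>s. case (x, s) of (x, t) \<Rightarrow> u x t)"
      by (rule continuous_on_compose2[of Q]) (use that inQ in \<open>auto simp: heat_class_def intro!: continuous_intros\<close>)
    then show ?thesis by simp
  qed
  have "((\<lambda>s. v x s) has_real_derivative L x t) (at t)"
  proof (rule continuous_right_derivative[where a = "t - \<rho>" and b = "t + \<rho>"])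
    fix s \<epsilon> :: real assume s: "t - \<rho> \<le> s" "s < t + \<rho>" and \<epsilon>: "\<epsilon> > 0"
    have xs: "(x, s) \<in> Q" using s by (intro inQ) auto
    have Ck: "Ck_on 2 {y. (y, s) \<in> Q} (\<lambda>y. v y s)" using heat_class_slice[OF Q v] .
    have o: "open {y. (y, s) \<in> Q}"
      by (rule open_slice[OF Q])
    have v': "heat_class Q (\<lambda>x t. (-1) * v x t)" using heat_class_cmult[OF v] .
    obtain \<delta>1 where \<delta>1: "\<delta>1 > 0" "\<And>u. s \<le> u \<Longrightarrow> u < s + \<delta>1 \<Longrightarrow> v x u - v x s - (u - s) * L x s \<le> \<epsilon> * (u - s)"
      using heat_class_time_upper[OF Q v xs Ck \<epsilon>] L(2)[OF xs] by metis
    have "laplacian (\<lambda>y. (-1) * v y s) x = (-1) * L x s"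
      using laplacian_cmult[OF o _ Ck, of x "-1"] xs L(2)[OF xs] by simp
    then obtain \<delta>2 where \<delta>2: "\<delta>2 > 0" "\<And>u. s \<le> u \<Longrightarrow> u < s + \<delta>2 \<Longrightarrow>
        (-1) * v x u - (-1) * v x s - (u - s) * ((-1) * L x s) \<le> \<epsilon> * (u - s)"
      using heat_class_time_upper[OF Q v' xs heat_class_slice[OF Q v'] \<epsilon>] by metis
    have "\<bar>v x u - v x s - (u - s) * L x s\<bar> \<le> \<epsilon> * (u - s)" if "s \<le> u" "u < s + min \<delta>1 \<delta>2" for u
      using \<delta>1(2)[of u] \<delta>2(2)[of u] that unfolding abs_le_iff by (auto simp: algebra_simps)
    then show "\<exists>\<delta>>0. \<forall>u. s \<le> u \<and> u < s + \<delta> \<longrightarrow> \<bar>v x u - v x s - (u - s) * L x s\<bar> \<le> \<epsilon> * (u - s)"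
      using \<delta>1(1) \<delta>2(1) by (intro exI[of _ "min \<delta>1 \<delta>2"]) auto
  qed (use \<rho>(1) c v L in auto)
  then show ?thesis using L(2)[OF xt] by simp
qed

text \<open>The time derivative equals the Laplacian, a sum of second spatial derivatives. So every
  first partial derivative in space-time belongs to the class again, and induction over the order
  applies.\<close>

theorem heat_class_smooth:
  fixes v :: "'a::euclidean_space \<Rightarrow> real \<Rightarrow> real"
  assumes Q: "open Q" and v: "heat_class Q v"
  shows "Ck_on k Q (\<lambda>(x, t). v x t)"
  using v
proof (induction k arbitrary: v)
  case 0
  then show ?case by (simp add: heat_class_def)
next
  case (Suc k)
  obtain D where D: "\<And>i. i \<in> Basis \<Longrightarrow> heat_class Q (D i)"
    "\<And>i x t. i \<in> Basis \<Longrightarrow> (x, t) \<in> Q \<Longrightarrow> ((\<lambda>s. v (x + s *\<^sub>R i) t) has_real_derivative D i x t) (at 0)"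
    using heat_class_partials[OF Q Suc.prems] by metis
  obtain L where L: "heat_class Q L" "\<And>x t. (x, t) \<in> Q \<Longrightarrow> laplacian (\<lambda>y. v y t) x = L x t"
    using heat_class_laplacian[OF Q Suc.prems] by metis
  define p where "p b = (if snd b = 0 then D (fst b) else L)" for b :: "'a \<times> real"
  have p: "heat_class Q (p b)" if "b \<in> Basis" for b
    using that D L by (auto simp: p_def Basis_prod_def)
  have dp: "((\<lambda>s. case y + s *\<^sub>R b of (x, t) \<Rightarrow> v x t) has_real_derivative p b (fst y) (snd y)) (at 0)"
    if b: "b \<in> Basis" and y: "y \<in> Q" for b y
  proof -
    obtain x t where xt: "y = (x, t)" by (cases y)
    from b consider (sp) i where "i \<in> Basis" "b = (i, 0)" | (ti) "b = (0, 1)" by (auto simp: Basis_prod_def)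
    then show ?thesis
    proof cases
      case sp
      then show ?thesis using D(2)[of i x t] y xt by (simp add: p_def)
    next
      case ti
      have "((\<lambda>s. v x s) has_real_derivative L x t) (at (0 + t))"
        using heat_class_time[OF Q Suc.prems, of x t] y xt L(2) by simp
      then have "((\<lambda>s. v x (s + t)) has_real_derivative L x t) (at 0)"
        using DERIV_shift[of "v x" "L x t" 0 t] by simp
      then show ?thesis using ti xt by (simp add: p_def add.commute)
    qed
  qed
  have der: "((\<lambda>(x, t). v x t) has_derivative (\<lambda>w. \<Sum>b\<in>Basis. p b (fst y) (snd y) * (w \<bullet> b))) (at y)" if y: "y \<in> Q" for y
  proof (rule has_derivative_partials[OF Q y, where p = "\<lambda>b y. p b (fst y) (snd y)"])
    show "isCont (\<lambda>y. p b (fst y) (snd y)) y" if "b \<in> Basis" for b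
      using p[OF that] y Q by (simp add: heat_class_def continuous_on_eq_continuous_at case_prod_unfold)
  qed (rule dp)
  have pd: "pderiv_dir b (\<lambda>(x, t). v x t) y = p b (fst y) (snd y)" if "b \<in> Basis" "y \<in> Q" for b y
    using pderiv_dir_eqI[OF der[OF that(2)], of b] that(1)
    by (simp add: inner_Basis if_distrib[of "\<lambda>x. _ * x"] cong: if_cong)
  have "Ck_on k Q (pderiv_dir b (\<lambda>(x, t). v x t))" if b: "b \<in> Basis" for b
    using Ck_on_cong[OF Q, of "pderiv_dir b (\<lambda>(x, t). v x t)" "\<lambda>(x, t). p b x t" k] pd[OF b] Suc.IH[OF p[OF b]]
    by (simp add: case_prod_unfold)
  moreover have "(\<lambda>(x, t). v x t) differentiable (at y)" if "y \<in> Q" for y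
    using der[OF that] by (auto simp: differentiable_def)
  ultimately show ?case by simp
qed

end

section \<open>From derivatives in space-time to derivatives of slices\<close>

lemma slice_derivatives:
  fixes V :: "'a::euclidean_space \<times> real \<Rightarrow> real"
  assumes "V differentiable (at (x, t))"
  shows "pderiv_dir i (\<lambda>y. V (y, t)) x = pderiv_dir (i, 0) V (x, t)"
    "((\<lambda>s. V (x, s)) has_real_derivative pderiv_dir (0, 1) V (x, t)) (at t)"
proof -
  have "((\<lambda>y. V (y, t)) has_derivative (\<lambda>w. pderiv_dir (w, 0) V (x, t))) (at x)"
    by (rule has_derivative_compose[of "\<lambda>y. (y, t)" "\<lambda>w. (w, 0)" x UNIV V, OF _ has_derivative_pderiv_dir[OF assms]])
      (auto intro!: derivative_eq_intros)
  then show "pderiv_dir i (\<lambda>y. V (y, t)) x = pderiv_dir (i, 0) V (x, t)" by (rule pderiv_dir_eqI)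
  have "((\<lambda>s. V (x, s)) has_derivative (\<lambda>w. pderiv_dir (0, w) V (x, t))) (at t)"
    by (rule has_derivative_compose[of "\<lambda>s. (x, s)" "\<lambda>w. (0, w)" t UNIV V, OF _ has_derivative_pderiv_dir[OF assms]])
      (auto intro!: derivative_eq_intros)
  moreover have "(\<lambda>w. pderiv_dir (0, w) V (x, t)) = (*) (pderiv_dir (0, 1) V (x, t))"
  proof
    show "pderiv_dir (0, w) V (x, t) = pderiv_dir (0, 1) V (x, t) * w" for w
      using linear_cmul[OF has_derivative_linear[OF has_derivative_pderiv_dir[OF assms]], of w "(0, 1)"] by simp
  qed
  ultimately show "((\<lambda>s. V (x, s)) has_real_derivative pderiv_dir (0, 1) V (x, t)) (at t)"
    unfolding has_field_derivative_def by (simp only:)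
qed

lemma Ck_on_slice:
  fixes V :: "'a::euclidean_space \<times> real \<Rightarrow> real"
  assumes "Ck_on k (\<Omega> \<times> {0<..}) V" "open \<Omega>" "t > 0"
  shows "Ck_on k \<Omega> (\<lambda>y. V (y, t))"
proof (rule Ck_on_compose_diag[where A = "\<lambda>v. (v, 0)", OF _ _ assms(2) _ assms(1)])
  show "((\<lambda>y. (y, t)) has_derivative (\<lambda>v. (v, 0))) (at x)" for x :: 'a
    by (auto intro!: derivative_eq_intros)
  show "\<exists>c. \<exists>b'\<in>Basis. (b, 0::real) = c *\<^sub>R b'" if "b \<in> Basis" for b :: 'a
    using that by (intro exI[of _ 1] bexI[of _ "(b, 0)"]) (auto simp: Basis_prod_def)
qed (use assms in auto)

lemma smooth_on_imp_C21_on: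
  fixes v :: "'a::euclidean_space \<Rightarrow> real \<Rightarrow> real"
  assumes \<Omega>: "open \<Omega>" and sm: "smooth_on (\<Omega> \<times> {0<..}) (\<lambda>(x, t). v x t)"
  shows "C21_on \<Omega> v"
proof -
  define V where "V = (\<lambda>(x, t). v x t)"
  let ?Q = "\<Omega> \<times> {0::real<..}"
  have oQ: "open ?Q" using \<Omega> by (intro open_Times) auto
  have sm: "Ck_on k ?Q V" for k using sm by (simp add: V_def smooth_on_def)
  have dV: "V differentiable (at p)" if "p \<in> ?Q" for p
    using sm[of "Suc 0"] that unfolding Ck_on.simps(2) by blast
  have dV': "pderiv_dir b V differentiable (at p)" if "p \<in> ?Q" "b \<in> Basis" for b p
    using Ck2_diff(2)[OF sm] that by blast
  have cV: "continuous_on ?Q (pderiv_dir b V)" if "b \<in> Basis" for b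
    using sm[of "Suc 0"] that unfolding Ck_on.simps by blast
  have cV': "continuous_on ?Q (pderiv_dir c (pderiv_dir b V))" if "b \<in> Basis" "c \<in> Basis" for b c
    using sm[of "Suc (Suc 0)"] that unfolding Ck_on.simps by blast
  have B: "(i, 0) \<in> (Basis :: ('a \<times> real) set)" if "i \<in> Basis" for i using that by (simp add: Basis_prod_def)
  have B1: "(0, 1) \<in> (Basis :: ('a \<times> real) set)" by (simp add: Basis_prod_def)
  have p1: "pderiv_dir i (\<lambda>y. v y t) x = pderiv_dir (i, 0) V (x, t)" if "x \<in> \<Omega>" "t > 0" for i x t
    using slice_derivatives(1)[OF dV, of x t i] that by (simp add: V_def)
  have p2: "pderiv_dir i (pderiv_dir j (\<lambda>y. v y t)) x = pderiv_dir (i, 0) (pderiv_dir (j, 0) V) (x, t)"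
    if "x \<in> \<Omega>" "t > 0" "j \<in> Basis" for i j x t
  proof -
    have "pderiv_dir i (pderiv_dir j (\<lambda>y. v y t)) x = pderiv_dir i (\<lambda>y. pderiv_dir (j, 0) V (y, t)) x"
      by (rule pderiv_dir_cong_open[OF \<Omega> that(1)]) (simp add: p1 that)
    also have "\<dots> = pderiv_dir (i, 0) (pderiv_dir (j, 0) V) (x, t)"
      using that by (intro slice_derivatives dV' B) auto
    finally show ?thesis .
  qed
  have t1: "((\<lambda>s. v x s) has_real_derivative pderiv_dir (0, 1) V (x, t)) (at t)" if "x \<in> \<Omega>" "t > 0" for x t
    using slice_derivatives(2)[OF dV, of x t] that by (simp add: V_def)
  have cong: "continuous_on ?Q f \<Longrightarrow> (\<And>x t. x \<in> \<Omega> \<Longrightarrow> t > 0 \<Longrightarrow> g x t = f (x, t)) \<Longrightarrow> continuous_on ?Q (\<lambda>(x, t). g x t)"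
    for f :: "'a \<times> real \<Rightarrow> real" and g
    by (erule continuous_on_eq) auto
  show ?thesis unfolding C21_on_def
  proof (intro conjI ballI allI impI)
    show "(\<lambda>s. v x s) differentiable (at t)" if "x \<in> \<Omega>" "0 < t" for x t
      using t1[OF that] real_differentiable_def by blast
    show "Ck_on 2 \<Omega> (\<lambda>y. v y t)" if "0 < t" for t
      using Ck_on_slice[OF sm \<Omega> that, of 2] by (simp add: V_def)
    show "continuous_on ?Q (\<lambda>(x, t). deriv (\<lambda>s. v x s) t)"
      using t1 by (intro cong[OF cV[OF B1]]) (auto intro: DERIV_imp_deriv)
    show "continuous_on ?Q (\<lambda>(x, t). pderiv_dir i (\<lambda>y. v y t) x)" if "i \<in> Basis" for i
      by (rule cong[OF cV[OF B[OF that]]]) (rule p1)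
    show "continuous_on ?Q (\<lambda>(x, t). pderiv_dir i (pderiv_dir j (\<lambda>y. v y t)) x)" if "i \<in> Basis" "j \<in> Basis" for i j
      by (rule cong[OF cV'[OF B[OF that(2)] B[OF that(1)]]]) (rule p2[OF _ _ that(2)])
  qed
qed

section \<open>Barriers\<close>

text \<open>Near \<open>x0\<close> the defining function satisfies \<rho> y \<ge> g . (y - x0) - C
  |y - x0|^2, where \<open>g\<close> is its gradient at \<open>x0\<close>. If \<open>y\<close> lies
  in a small ball that is centred on the outward normal and passes through \<open>x0\<close>, then g
  . (y - x0) \<ge> 2 C |y - x0|^2. Hence \<rho> is positive at such a \<open>y\<close> other than
  \<open>x0\<close>, whereas on the closure of the domain it is at most 0.\<close>

lemma exterior_ball:
  fixes \<Omega> :: "'a::euclidean_space set"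
  assumes \<Omega>: "bounded_smooth_domain \<Omega>" and x0: "x0 \<in> frontier \<Omega>"
  obtains z r where "r > 0" "norm (x0 - z) = r" "\<And>y. y \<in> closure \<Omega> \<Longrightarrow> y \<noteq> x0 \<Longrightarrow> r < norm (y - z)"
proof -
  obtain U \<rho> v where U: "open U" "x0 \<in> U" and sm: "smooth_on U \<rho>" and v: "pderiv_dir v \<rho> x0 \<noteq> 0"
    and eq: "\<Omega> \<inter> U = {y \<in> U. \<rho> y < 0}" and o: "open \<Omega>"
    using \<Omega> x0 unfolding bounded_smooth_domain_def by blast
  have c\<rho>: "continuous_on U \<rho>" using smooth_on_Ck[OF sm, of 0] by simp
  have neg: "\<rho> y \<le> 0" if "y \<in> closure \<Omega>" "y \<in> U" for y
  proof (rule ccontr)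
    assume "\<not> \<rho> y \<le> 0"
    have "open (\<rho> -` {0<..} \<inter> U)"
      using c\<rho> continuous_on_open_vimage[OF U(1), of \<rho>] open_greaterThan by auto
    moreover have "y \<in> \<rho> -` {0<..} \<inter> U" using that \<open>\<not> \<rho> y \<le> 0\<close> by auto
    ultimately have "(\<rho> -` {0<..} \<inter> U) \<inter> \<Omega> \<noteq> {}"
      using that(1) open_Int_closure_eq_empty[of "\<rho> -` {0<..} \<inter> U" \<Omega>] by blast
    then obtain q where q: "q \<in> \<Omega> \<inter> U" "\<rho> q > 0" by auto
    then show False unfolding eq by simp
  qed
  have "x0 \<notin> \<Omega>" using x0 o by (simp add: frontier_def interior_open)
  then have "\<rho> x0 \<ge> 0" using eq U(2) by (force simp: not_le)
  moreover have "\<rho> x0 \<le> 0" using x0 U(2) by (intro neg) (auto simp: frontier_def)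
  ultimately have \<rho>0: "\<rho> x0 = 0" by simp
  have Ck: "Ck_on 2 U \<rho>" using sm by (rule smooth_on_Ck)
  have d\<rho>: "\<rho> differentiable (at x0)" using Ck2_diff(1)[OF Ck U(2)] .
  define g where "g = (\<Sum>i\<in>Basis. pderiv_dir i \<rho> x0 *\<^sub>R i)"
  have gw: "(\<Sum>i\<in>Basis. pderiv_dir i \<rho> x0 * (w \<bullet> i)) = g \<bullet> w" for w
    unfolding g_def inner_sum_left by (intro sum.cong refl) (simp add: inner_commute)
  have "pderiv_dir v \<rho> x0 = g \<bullet> v" by (rule trans[OF differentiable_pderiv_sum[OF d\<rho>] gw])
  then have "g \<noteq> 0" using v by auto
  then have g: "norm g > 0" by simp
  obtain r1 where r1: "r1 > 0" "\<And>y. y \<in> ball x0 r1 \<Longrightarrow> \<bar>\<rho> y - taylor2 \<rho> x0 y\<bar> \<le> 1 * (norm (y - x0))\<^sup>2"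
    using taylor2_approx[OF U Ck, of 1] by auto
  obtain r2 where r2: "r2 > 0" "ball x0 r2 \<subseteq> U" using U open_contains_ball by blast
  define B where "B = (\<Sum>i\<in>(Basis::'a set). \<Sum>j\<in>(Basis::'a set). \<bar>pderiv_dir j (pderiv_dir i \<rho>) x0\<bar>)"
  define C where "C = 1 + B / 2"
  have "B \<ge> 0" unfolding B_def by (intro sum_nonneg) auto
  then have C: "C > 0" by (simp add: C_def)
  have lower: "\<rho> y \<ge> g \<bullet> (y - x0) - C * (norm (y - x0))\<^sup>2" if "y \<in> ball x0 r1" for y
  proof -
    define w where "w = y - x0"
    define Q where "Q = (\<Sum>i\<in>Basis. \<Sum>j\<in>Basis. pderiv_dir j (pderiv_dir i \<rho>) x0 * (w \<bullet> i) * (w \<bullet> j))"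
    have "\<bar>Q\<bar> \<le> (\<Sum>i\<in>(Basis::'a set). \<Sum>j\<in>(Basis::'a set). \<bar>pderiv_dir j (pderiv_dir i \<rho>) x0\<bar> * (norm w)\<^sup>2)"
      unfolding Q_def
    proof (intro order_trans[OF sum_abs] sum_mono)
      fix i j :: 'a assume "i \<in> Basis" "j \<in> Basis"
      then have "\<bar>w \<bullet> i\<bar> * \<bar>w \<bullet> j\<bar> \<le> norm w * norm w"
        by (intro mult_mono Basis_le_norm) auto
      then show "\<bar>pderiv_dir j (pderiv_dir i \<rho>) x0 * (w \<bullet> i) * (w \<bullet> j)\<bar> \<le> \<bar>pderiv_dir j (pderiv_dir i \<rho>) x0\<bar> * (norm w)\<^sup>2"
        by (simp add: abs_mult mult.assoc power2_eq_square mult_left_mono)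
    qed
    also have "\<dots> = B * (norm w)\<^sup>2" by (simp add: B_def sum_distrib_right)
    finally have Q: "\<bar>Q\<bar> \<le> B * (norm w)\<^sup>2" .
    have "taylor2 \<rho> x0 y = g \<bullet> w + Q / 2" using \<rho>0 by (simp add: taylor2_def gw w_def Q_def)
    then have "\<rho> y \<ge> g \<bullet> w + Q / 2 - (norm w)\<^sup>2" using r1(2)[OF that] by (simp add: w_def abs_le_iff)
    moreover have "C * (norm w)\<^sup>2 = (norm w)\<^sup>2 + B * (norm w)\<^sup>2 / 2" by (simp add: C_def algebra_simps)
    ultimately show ?thesis using Q unfolding w_def[symmetric] by linarith
  qed
  \<comment> \<open>A point of the ball is at most \<open>2 * s\<close> away from \<open>x0\<close>,
    so a quarter of \<open>r1\<close> and of \<open>r2\<close> keeps it where the expansion holds;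
    the bound \<open>norm g / (4 * C)\<close> makes the ball curve faster than the quadratic
    error.\<close>
  define s where "s = min (min r1 r2 / 4) (norm g / (4 * C))"
  have s: "s > 0" "4 * s \<le> r1" "4 * s \<le> r2" "4 * C * s \<le> norm g"
  proof -
    show "s > 0" using r1(1) r2(1) g C by (simp add: s_def)
    have le: "s \<le> min r1 r2 / 4" "s \<le> norm g / (4 * C)"
      unfolding s_def by (rule min.cobounded1, rule min.cobounded2)
    from le(1) show "4 * s \<le> r1" "4 * s \<le> r2" by linarith+
    from le(2) show "4 * C * s \<le> norm g" using C by (simp add: field_simps)
  qed
  define z where "z = x0 + (s / norm g) *\<^sub>R g"
  have xz: "norm (x0 - z) = s" using g s by (simp add: z_def)
  moreover have "s < norm (y - z)" if y: "y \<in> closure \<Omega>" "y \<noteq> x0" for y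
  proof (rule ccontr)
    assume "\<not> s < norm (y - z)"
    then have yz: "norm (y - z) \<le> s" by simp
    define w where "w = y - x0"
    have w0: "norm w > 0" using y by (simp add: w_def)
    have "norm w \<le> 2 * s" using norm_triangle_ineq4[of "y - z" "x0 - z"] yz xz by (simp add: w_def)
    then have near: "dist x0 y < r1" "dist x0 y < r2" using s by (auto simp: w_def dist_norm norm_minus_commute)
    have "(norm (y - z))\<^sup>2 \<le> s\<^sup>2" using yz by (intro power_mono) auto
    moreover have "y - z = w - (s / norm g) *\<^sub>R g" by (simp add: w_def z_def)
    moreover have "(norm (w - (s / norm g) *\<^sub>R g))\<^sup>2 = (norm w)\<^sup>2 - 2 * (s / norm g) * (g \<bullet> w) + s\<^sup>2"
    proof -
      have "(s / norm g)\<^sup>2 * (g \<bullet> g) = s\<^sup>2" using g by (simp add: power_divide power2_norm_eq_inner[symmetric])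
      moreover have "(norm (w - c *\<^sub>R g))\<^sup>2 = (norm w)\<^sup>2 - 2 * c * (g \<bullet> w) + c\<^sup>2 * (g \<bullet> g)" for c
        unfolding power2_norm_eq_inner
        by (simp add: inner_diff_left inner_diff_right inner_commute power2_eq_square algebra_simps)
      ultimately show ?thesis by simp
    qed
    ultimately have "(norm w)\<^sup>2 \<le> 2 * (s / norm g) * (g \<bullet> w)" by simp
    then have 1: "norm g * (norm w)\<^sup>2 \<le> 2 * s * (g \<bullet> w)" using g by (simp add: field_simps)
    have "(4 * C * s) * (norm w)\<^sup>2 \<le> norm g * (norm w)\<^sup>2" using s by (intro mult_right_mono) auto
    then have "(2 * s) * (2 * C * (norm w)\<^sup>2) \<le> (2 * s) * (g \<bullet> w)" using 1 by (simp add: algebra_simps)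
    then have "2 * C * (norm w)\<^sup>2 \<le> g \<bullet> w" using s(1) by (metis mult_le_cancel_left_pos mult_pos_pos zero_less_numeral)
    then have "\<rho> y \<ge> C * (norm w)\<^sup>2" using lower[of y] near by (simp add: w_def)
    moreover have "C * (norm w)\<^sup>2 > 0" using C w0 by simp
    moreover have "\<rho> y \<le> 0" using y(1) near r2(2) by (intro neg) auto
    ultimately show False by simp
  qed
  ultimately show ?thesis using that s(1) by blast
qed

lemma exp_plus_exp_minus_ge: "2 + u\<^sup>2 / 2 \<le> exp u + exp (- u)" for u :: real
proof -
  have "2 + u\<^sup>2 / 2 \<le> exp \<bar>u\<bar> + exp (- \<bar>u\<bar>)"
    using exp_lower_Taylor_quadratic[of "\<bar>u\<bar>"] exp_ge_add_one_self[of "- \<bar>u\<bar>"] by simp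
  then show ?thesis by (cases "u \<ge> 0") auto
qed

text \<open>The Laplacian of the Gaussian is nonnegative as soon as 2 \<alpha> |x - z|^2 \<ge> N.
  With \<alpha> r^2 = 2 N there is room to spare, and it pays for the discretisation: opposite
  neighbours contribute exp u + exp(-u) with u proportional to \<open>h\<close>, which is bounded
  below by a quadratic.\<close>

lemma gaussian_subharmonic:
  fixes x z :: "'a::euclidean_space" and r h :: real
  defines "\<alpha> \<equiv> 2 * real DIM('a) / r\<^sup>2"
  assumes r: "r > 0" "r \<le> norm (x - z)" and h: "0 < h" "\<alpha> * h\<^sup>2 \<le> 1"
  shows "exp (- \<alpha> * (norm (x - z))\<^sup>2) \<le> avg h (\<lambda>y. exp (- \<alpha> * (norm (y - z))\<^sup>2)) x"
proof -
  let ?G = "\<lambda>y. exp (- \<alpha> * (norm (y - z))\<^sup>2)"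
  define N where "N = real DIM('a)"
  have N: "N \<ge> 1" by (simp add: N_def DIM_ge_Suc0)
  have \<alpha>: "\<alpha> > 0" using r N by (simp add: \<alpha>_def N_def)
  define E where "E = ?G x * exp (- \<alpha> * h\<^sup>2)"
  have E: "E > 0" by (simp add: E_def)
  have "E * (2 + 2 * \<alpha>\<^sup>2 * h\<^sup>2 * ((x - z) \<bullet> i)\<^sup>2) \<le> ?G (x + h *\<^sub>R i) + ?G (x - h *\<^sub>R i)" if i: "i \<in> Basis" for i
  proof -
    have sq: "(norm (x + h *\<^sub>R i - z))\<^sup>2 = (norm (x - z))\<^sup>2 + 2 * h * ((x - z) \<bullet> i) + h\<^sup>2"
      "(norm (x - h *\<^sub>R i - z))\<^sup>2 = (norm (x - z))\<^sup>2 - 2 * h * ((x - z) \<bullet> i) + h\<^sup>2"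
    proof -
      have *: "x + h *\<^sub>R i - z = (x - z) + h *\<^sub>R i" "x - h *\<^sub>R i - z = (x - z) - h *\<^sub>R i" by auto
      show "(norm (x + h *\<^sub>R i - z))\<^sup>2 = (norm (x - z))\<^sup>2 + 2 * h * ((x - z) \<bullet> i) + h\<^sup>2"
        "(norm (x - h *\<^sub>R i - z))\<^sup>2 = (norm (x - z))\<^sup>2 - 2 * h * ((x - z) \<bullet> i) + h\<^sup>2"
        unfolding * power2_norm_eq_inner using i
        by (simp_all add: inner_diff_left inner_diff_right inner_add_left inner_add_right inner_commute power2_eq_square)
    qed
    define u where "u = 2 * \<alpha> * h * ((x - z) \<bullet> i)"
    have "?G (x + h *\<^sub>R i) = E * exp (- u)" "?G (x - h *\<^sub>R i) = E * exp u"
      unfolding sq E_def u_def by (simp_all add: exp_add[symmetric] algebra_simps)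
    moreover have "E * (2 + u\<^sup>2 / 2) \<le> E * (exp u + exp (- u))"
      using E exp_plus_exp_minus_ge by (intro mult_left_mono) auto
    moreover have "u\<^sup>2 / 2 = 2 * \<alpha>\<^sup>2 * h\<^sup>2 * ((x - z) \<bullet> i)\<^sup>2" by (simp add: u_def power_mult_distrib)
    ultimately show ?thesis by (simp add: algebra_simps)
  qed
  then have "(\<Sum>i\<in>(Basis::'a set). E * (2 + 2 * \<alpha>\<^sup>2 * h\<^sup>2 * ((x - z) \<bullet> i)\<^sup>2)) / (2 * N) \<le> avg h ?G x"
    unfolding avg_def N_def using N by (intro divide_right_mono sum_mono) (auto simp: N_def)
  moreover have "(\<Sum>i\<in>(Basis::'a set). E * (2 + 2 * \<alpha>\<^sup>2 * h\<^sup>2 * ((x - z) \<bullet> i)\<^sup>2))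
      = E * (2 * N + 2 * \<alpha>\<^sup>2 * h\<^sup>2 * (norm (x - z))\<^sup>2)"
  proof -
    have "(norm (x - z))\<^sup>2 = (\<Sum>i\<in>Basis. ((x - z) \<bullet> i)\<^sup>2)"
      unfolding power2_norm_eq_inner by (subst euclidean_inner) (simp add: power2_eq_square)
    then show ?thesis by (simp add: N_def sum_distrib_left[symmetric] sum.distrib)
  qed
  moreover have "E * exp (\<alpha> * h\<^sup>2) \<le> E * (2 * N + 2 * \<alpha>\<^sup>2 * h\<^sup>2 * (norm (x - z))\<^sup>2) / (2 * N)"
  proof -
    \<comment> \<open>The factor exp(-\<alpha> h^2) contained in \<open>E\<close> has to be
      recovered. Its inverse is at most 1 + 2 \<alpha> h^2, and the value of \<open>\<alpha>\<close>
      turns 2 \<alpha> h^2 into \<alpha>^2 h^2 r^2 / N, which the quadratic gain covers outside the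
      ball.\<close>
    have "exp (\<alpha> * h\<^sup>2) \<le> 1 + \<alpha> * h\<^sup>2 + (\<alpha> * h\<^sup>2)\<^sup>2" using h \<alpha> by (intro exp_bound) auto
    also have "(\<alpha> * h\<^sup>2)\<^sup>2 \<le> \<alpha> * h\<^sup>2" unfolding power2_eq_square[of "\<alpha> * h\<^sup>2"] using h \<alpha> by (intro mult_left_le) auto
    also have "1 + \<alpha> * h\<^sup>2 + \<alpha> * h\<^sup>2 = 1 + \<alpha>\<^sup>2 * h\<^sup>2 * r\<^sup>2 / N"
      using r N by (simp add: \<alpha>_def N_def power2_eq_square field_simps)
    also have "\<dots> \<le> 1 + \<alpha>\<^sup>2 * h\<^sup>2 * (norm (x - z))\<^sup>2 / N"
      using N r by (intro add_left_mono divide_right_mono mult_left_mono power_mono) auto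
    also have "\<dots> = (2 * N + 2 * \<alpha>\<^sup>2 * h\<^sup>2 * (norm (x - z))\<^sup>2) / (2 * N)" using N by (simp add: field_simps)
    finally show ?thesis using E by (simp add: mult_left_mono flip: times_divide_eq_right)
  qed
  moreover have "E * exp (\<alpha> * h\<^sup>2) = ?G x" by (simp add: E_def mult.assoc exp_add[symmetric])
  ultimately show ?thesis by simp
qed

text \<open>Existence of barriers, stated through averages at all small mesh sizes so that one
  notion serves two purposes: the boundary estimate for discrete flows and, with reversed sign,
  viscosity subsolutions below the obstacle. \<open>H\<close> lives on the whole space because
  stencils of points of \<open>\<Omega>\<close> may leave the domain.\<close>

definition regular_point :: "'a::euclidean_space set \<Rightarrow> 'a \<Rightarrow> bool" where
  "regular_point \<Omega> x0 \<longleftrightarrow> (\<forall>g \<epsilon>. continuous_on (closure \<Omega>) g \<longrightarrow> g x0 = 0 \<longrightarrow> \<epsilon> > 0 \<longrightarrow>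
     (\<exists>H. continuous_on UNIV H \<and> H x0 = 0 \<and> (\<forall>y\<in>closure \<Omega>. 0 \<le> H y \<and> g y \<le> \<epsilon> + H y) \<and>
       (\<forall>\<^sub>F h in at_right 0. \<forall>x\<in>\<Omega>. avg h H x \<le> H x)))"

text \<open>The barrier is a multiple of exp(-\<alpha> r^2) - exp(-\<alpha> |y - z|^2): zero at the
  touching point, positive on the rest of the closure, and superharmonic outside the ball. Near
  \<open>x0\<close> the continuity of \<open>g\<close> suffices; away from it the barrier has a
  positive minimum, so a large factor dominates \<open>g\<close>.\<close>

lemma exterior_ball_regular:
  fixes \<Omega> :: "'a::euclidean_space set"
  assumes \<Omega>: "bounded \<Omega>" and r: "r > 0" "norm (x0 - z) = r"
    and ext: "\<And>y. y \<in> closure \<Omega> \<Longrightarrow> y \<noteq> x0 \<Longrightarrow> r < norm (y - z)"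
  shows "regular_point \<Omega> x0"
  unfolding regular_point_def
proof (intro allI impI)
  fix g :: "'a \<Rightarrow> real" and \<epsilon> :: real
  assume cg: "continuous_on (closure \<Omega>) g" and g0: "g x0 = 0" and \<epsilon>: "\<epsilon> > 0"
  define \<alpha> where "\<alpha> = 2 * real DIM('a) / r\<^sup>2"
  have \<alpha>: "\<alpha> > 0" using r by (simp add: \<alpha>_def)
  define G where "G y = exp (- \<alpha> * (norm (y - z))\<^sup>2)" for y
  define H0 where "H0 y = exp (- \<alpha> * r\<^sup>2) - G y" for y
  have cH0: "continuous_on S H0" for S unfolding H0_def G_def by (intro continuous_intros)
  have H00: "H0 x0 = 0" using r(2) by (simp add: H0_def G_def)
  have H0pos: "H0 y > 0" if "y \<in> closure \<Omega>" "y \<noteq> x0" for y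
  proof -
    have "r\<^sup>2 < (norm (y - z))\<^sup>2" using ext[OF that] r by (intro power_strict_mono) auto
    then show ?thesis using \<alpha> by (simp add: H0_def G_def)
  qed
  have comp: "compact (closure \<Omega>)" using \<Omega> by simp
  have "\<exists>M\<ge>0. \<forall>y\<in>closure \<Omega>. g y \<le> \<epsilon> + M * H0 y"
  proof (cases "x0 \<in> closure \<Omega>")
    case True
    then obtain d where d: "d > 0" "\<And>y. y \<in> closure \<Omega> \<Longrightarrow> dist y x0 < d \<Longrightarrow> g y < \<epsilon>"
      using cg \<epsilon> g0 unfolding continuous_on_iff by (metis abs_less_iff diff_zero dist_real_def)
    define K where "K = closure \<Omega> - ball x0 d"
    have K: "compact K" using comp by (simp add: K_def compact_diff)
    obtain B where B: "B > 0" "\<And>y. y \<in> closure \<Omega> \<Longrightarrow> \<bar>g y\<bar> \<le> B"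
      using compact_imp_bounded[OF compact_continuous_image[OF cg comp]] unfolding bounded_pos by auto
    obtain m where m: "m > 0" "\<And>y. y \<in> K \<Longrightarrow> m \<le> H0 y"
    proof (cases "K = {}")
      case False
      then obtain y where y: "y \<in> K" "\<And>u. u \<in> K \<Longrightarrow> H0 y \<le> H0 u"
        using continuous_attains_inf[OF K _ cH0] by blast
      have "H0 y > 0" using y(1) d(1) by (intro H0pos) (auto simp: K_def)
      then show ?thesis using that y by blast
    qed (use that[of 1] in auto)
    have "g y \<le> \<epsilon> + (B / m) * H0 y" if y: "y \<in> closure \<Omega>" for y
    proof (cases "y \<in> K")
      case True
      have "B = (B / m) * m" using m by simp
      also have "\<dots> \<le> (B / m) * H0 y" using m(1) m(2)[OF True] B(1) by (intro mult_left_mono) auto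
      finally show ?thesis using B(2)[OF y] \<epsilon> by simp
    next
      case False
      then have "g y < \<epsilon>" using y by (intro d) (auto simp: K_def dist_commute)
      moreover have "0 \<le> H0 y" using H0pos[OF y] H00 by fastforce
      then have "0 \<le> (B / m) * H0 y" using m B by simp
      ultimately show ?thesis by simp
    qed
    then show ?thesis using B(1) m(1) by (intro exI[of _ "B / m"]) auto
  next
    case False
    obtain B where B: "B > 0" "\<And>y. y \<in> closure \<Omega> \<Longrightarrow> \<bar>g y\<bar> \<le> B"
      using compact_imp_bounded[OF compact_continuous_image[OF cg comp]] unfolding bounded_pos by auto
    obtain m where m: "m > 0" "\<And>y. y \<in> closure \<Omega> \<Longrightarrow> m \<le> H0 y"
    proof (cases "closure \<Omega> = {}")
      case False
      then obtain y where y: "y \<in> closure \<Omega>" "\<And>u. u \<in> closure \<Omega> \<Longrightarrow> H0 y \<le> H0 u"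
        using continuous_attains_inf[OF comp _ cH0] by blast
      have "H0 y > 0" using y(1) \<open>x0 \<notin> closure \<Omega>\<close> by (intro H0pos) auto
      then show ?thesis using that y by blast
    qed (use that[of 1] in auto)
    have "g y \<le> \<epsilon> + (B / m) * H0 y" if y: "y \<in> closure \<Omega>" for y
    proof -
      have "B = (B / m) * m" using m by simp
      also have "\<dots> \<le> (B / m) * H0 y" using m(1) m(2)[OF y] B(1) by (intro mult_left_mono) auto
      finally show ?thesis using B(2)[OF y] \<epsilon> by simp
    qed
    then show ?thesis using B(1) m(1) by (intro exI[of _ "B / m"]) auto
  qed
  then obtain M where M: "M \<ge> 0" "\<And>y. y \<in> closure \<Omega> \<Longrightarrow> g y \<le> \<epsilon> + M * H0 y" by blast
  have "\<forall>\<^sub>F h in at_right 0. \<forall>x\<in>\<Omega>. avg h (\<lambda>y. M * H0 y) x \<le> M * H0 x"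
    unfolding eventually_at_right_field
  proof (intro exI[of _ "min 1 (1 / \<alpha>)"] conjI allI impI ballI)
    show "0 < min 1 (1 / \<alpha>)" using \<alpha> by simp
    fix h x assume h: "0 < h" "h < min 1 (1 / \<alpha>)" and x: "x \<in> \<Omega>"
    have "\<alpha> * h\<^sup>2 \<le> \<alpha> * h" unfolding power2_eq_square using h \<alpha> by (intro mult_left_mono mult_left_le) auto
    also have "\<dots> \<le> 1" using h \<alpha> by (simp add: field_simps)
    finally have h2: "\<alpha> * h\<^sup>2 \<le> 1" .
    have xc: "x \<in> closure \<Omega>" using x closure_subset by blast
    have "r \<le> norm (x - z)" using ext[OF xc] r(2) by (cases "x = x0") auto
    then have "G x \<le> avg h G x"
      unfolding G_def \<alpha>_def using r h h2 by (intro gaussian_subharmonic) (auto simp: \<alpha>_def)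
    then have "avg h H0 x \<le> H0 x" unfolding H0_def avg_diff avg_const by simp
    then show "avg h (\<lambda>y. M * H0 y) x \<le> M * H0 x" unfolding avg_cmult using M by (intro mult_left_mono)
  qed
  moreover have "0 \<le> M * H0 y" if "y \<in> closure \<Omega>" for y
    using H0pos[OF that] H00 M(1) by (cases "y = x0") auto
  moreover have "continuous_on UNIV (\<lambda>y. M * H0 y)" by (intro continuous_intros cH0)
  ultimately show "\<exists>H. continuous_on UNIV H \<and> H x0 = 0 \<and> (\<forall>y\<in>closure \<Omega>. 0 \<le> H y \<and> g y \<le> \<epsilon> + H y) \<and>
       (\<forall>\<^sub>F h in at_right 0. \<forall>x\<in>\<Omega>. avg h H x \<le> H x)"
    using M(2) H00 by (intro exI[of _ "\<lambda>y. M * H0 y"]) auto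
qed

lemma bounded_smooth_domain_regular:
  assumes "bounded_smooth_domain \<Omega>" "x0 \<in> frontier \<Omega>"
  shows "regular_point \<Omega> x0"
proof -
  obtain z r where "r > 0" "norm (x0 - z) = r" "\<And>y. y \<in> closure \<Omega> \<Longrightarrow> y \<noteq> x0 \<Longrightarrow> r < norm (y - z)"
    using exterior_ball[OF assms] by blast
  then show ?thesis using assms(1) by (intro exterior_ball_regular) (auto simp: bounded_smooth_domain_def)
qed

section \<open>Existence for the heat equation\<close>

text \<open>Time is real although the scheme advances in steps. The datum fills the whole first
  layer and all negative times, so that the flow is defined on all of space-time. The value 0 is
  imposed on the entire complement of \<open>\<Omega>\<close>, since a stencil can jump across the
  boundary.\<close>

definition disc_flow :: "'a::euclidean_space set \<Rightarrow> ('a \<Rightarrow> real) \<Rightarrow> real \<Rightarrow> ('a \<Rightarrow> real \<Rightarrow> real) \<Rightarrow> bool" where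
  "disc_flow \<Omega> g h F \<longleftrightarrow>
     (\<forall>x t. t < h\<^sup>2 / (2 * DIM('a)) \<longrightarrow> F x t = g x) \<and> (\<forall>x t. x \<notin> \<Omega> \<longrightarrow> F x t = 0) \<and>
     (\<forall>x t. x \<in> \<Omega> \<longrightarrow> t \<ge> 0 \<longrightarrow> F x (t + h\<^sup>2 / (2 * DIM('a))) = avg h (\<lambda>y. F y t) x)"

lemma disc_flow_exists:
  fixes \<Omega> :: "'a::euclidean_space set"
  assumes g: "\<And>x. x \<notin> \<Omega> \<Longrightarrow> g x = 0" and h: "h > 0"
  obtains F where "disc_flow \<Omega> g h F"
proof -
  define \<tau> where "\<tau> = h\<^sup>2 / (2 * DIM('a))"
  have \<tau>: "\<tau> > 0" using h by (simp add: \<tau>_def)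
  define step where "step f x = (if x \<in> \<Omega> then avg h f x else 0)" for f and x :: 'a
  define F where "F x t = (step ^^ nat \<lfloor>t / \<tau>\<rfloor>) g x" for x t
  have "F x t = g x" if "t < \<tau>" for x t
  proof -
    have "t / \<tau> < 1" using that \<tau> by simp
    then have "\<lfloor>t / \<tau>\<rfloor> \<le> 0" by linarith
    then show ?thesis by (simp add: F_def)
  qed
  moreover have "F x t = 0" if "x \<notin> \<Omega>" for x t
    using that g by (cases "nat \<lfloor>t / \<tau>\<rfloor>") (auto simp: F_def step_def)
  moreover have "F x (t + \<tau>) = avg h (\<lambda>y. F y t) x" if "x \<in> \<Omega>" "t \<ge> 0" for x t
  proof -
    have "(t + \<tau>) / \<tau> = t / \<tau> + 1" using \<tau> by (simp add: field_simps)
    then have "nat \<lfloor>(t + \<tau>) / \<tau>\<rfloor> = Suc (nat \<lfloor>t / \<tau>\<rfloor>)" using that \<tau> by (simp add: nat_add_distrib)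
    then show ?thesis using that by (simp add: F_def step_def)
  qed
  ultimately have "disc_flow \<Omega> g h F" unfolding disc_flow_def \<tau>_def by blast
  then show ?thesis using that by blast
qed

lemma disc_flow_uminus: "disc_flow \<Omega> g h F \<Longrightarrow> disc_flow \<Omega> (\<lambda>x. - g x) h (\<lambda>x t. - F x t)"
  by (simp add: disc_flow_def avg_uminus)

lemma disc_flow_max0:
  fixes \<Omega> :: "'a::euclidean_space set"
  shows "disc_flow \<Omega> g h F \<Longrightarrow> h > 0 \<Longrightarrow> F x (max 0 t) = F x t"
proof (cases "t \<ge> 0")
  case False
  assume F: "disc_flow \<Omega> g h F" and h: "h > 0"
  have "0 < h\<^sup>2 / (2 * DIM('a))" using h by simp
  moreover from this have "t < h\<^sup>2 / (2 * DIM('a))" using False by linarith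
  ultimately have "F x 0 = g x" "F x t = g x" using F unfolding disc_flow_def by blast+
  then show ?thesis using False by (simp add: max_def)
qed (simp add: max_def)

lemma disc_flow_bound:
  fixes F :: "'a::euclidean_space \<Rightarrow> real \<Rightarrow> real"
  assumes F: "disc_flow \<Omega> g h F" and h: "h > 0" and g: "\<And>x. \<bar>g x\<bar> \<le> M"
  shows "\<bar>F x t\<bar> \<le> M"
proof -
  have up: "F x t \<le> M" if F: "disc_flow \<Omega> g h F" and g: "\<And>x. \<bar>g x\<bar> \<le> M" and t: "t \<ge> 0" for F g t
  proof (rule disc_max_principle[where d = F and I = \<Omega> and X = UNIV and a = 0 and b = t and h = h])
    have "M \<ge> 0" using g[of x] by simp
    then show "F y s \<le> M" if "y \<in> UNIV - \<Omega>" for y s using F that by (simp add: disc_flow_def)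
    show "F y s \<le> M" if "s < 0 + h\<^sup>2 / (2 * DIM('a))" for y s
      using F that g[of y] by (simp add: disc_flow_def abs_le_iff)
    show "F y (s + h\<^sup>2 / (2 * DIM('a))) \<le> avg h (\<lambda>z. F z s) y" if "y \<in> \<Omega>" "0 \<le> s" for y s
      using F that by (simp add: disc_flow_def)
  qed (use h t in auto)
  have "F x (max 0 t) \<le> M" using up[OF F g] by simp
  moreover have "- F x (max 0 t) \<le> M" using up[OF disc_flow_uminus[OF F]] g by simp
  ultimately show ?thesis using disc_flow_max0[OF F h, of x t] by (simp add: abs_le_iff)
qed

text \<open>For each boundary point \<open>F - H\<close> obeys the discrete maximum principle, and
  compactness of the frontier makes \<open>\<delta>\<close> uniform. The tolerance is split into
  thirds: the slack in the domination of \<open>g\<close> by the barrier, the size of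
  \<open>H\<close> near \<open>x0\<close>, and the possible negativity of \<open>H\<close> at
  stencil points just outside \<open>\<Omega>\<close>, which uniform continuity controls.\<close>

lemma disc_flow_boundary_le:
  fixes \<Omega> :: "'a::euclidean_space set" and g :: "'a \<Rightarrow> real"
  assumes \<Omega>: "bounded \<Omega>" and reg: "\<And>x0. x0 \<in> frontier \<Omega> \<Longrightarrow> regular_point \<Omega> x0"
    and g: "continuous_on UNIV g" "\<And>x. x \<notin> \<Omega> \<Longrightarrow> g x = 0" and o: "open \<Omega>" and \<epsilon>: "\<epsilon> > 0"
  shows "\<exists>\<delta>>0. \<forall>\<^sub>F h in at_right 0. \<forall>F x y t. disc_flow \<Omega> g h F \<longrightarrow> y \<in> frontier \<Omega> \<longrightarrow> dist x y < \<delta> \<longrightarrow> F x t \<le> \<epsilon>"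
proof -
  have loc: "\<exists>\<delta>>0. \<forall>\<^sub>F h in at_right 0. \<forall>F x t. disc_flow \<Omega> g h F \<longrightarrow> dist x x0 < \<delta> \<longrightarrow> F x t \<le> \<epsilon>"
    if x0: "x0 \<in> frontier \<Omega>" for x0
  proof -
    have "g x0 = 0" using x0 o by (intro g(2)) (simp add: frontier_def interior_open)
    then obtain H where H: "continuous_on UNIV H" "H x0 = 0" "\<And>y. y \<in> closure \<Omega> \<Longrightarrow> 0 \<le> H y"
      "\<And>y. y \<in> closure \<Omega> \<Longrightarrow> g y \<le> \<epsilon> / 3 + H y" and avgH: "\<forall>\<^sub>F h in at_right 0. \<forall>x\<in>\<Omega>. avg h H x \<le> H x"
      using reg[OF x0] continuous_on_subset[OF g(1), of "closure \<Omega>"] \<epsilon> unfolding regular_point_def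
      by (smt (verit, best) divide_pos_pos subset_UNIV)
    obtain \<delta> where \<delta>: "\<delta> > 0" "\<And>x. dist x x0 < \<delta> \<Longrightarrow> H x < \<epsilon> / 3"
    proof -
      have "\<exists>\<delta>>0. \<forall>x\<in>UNIV. dist x x0 < \<delta> \<longrightarrow> dist (H x) (H x0) < \<epsilon> / 3"
        using H(1) \<epsilon> unfolding continuous_on_iff by (metis UNIV_I divide_pos_pos zero_less_numeral)
      then obtain d where "d > 0" and d: "\<And>x. dist x x0 < d \<Longrightarrow> dist (H x) (H x0) < \<epsilon> / 3" by auto
      moreover have "H x < \<epsilon> / 3" if "dist x x0 < d" for x
        using d[OF that] H(2) by (simp add: dist_real_def)
      ultimately show ?thesis using that by blast
    qed
    obtain B where B: "\<And>x. x \<in> \<Omega> \<Longrightarrow> norm x \<le> B" using \<Omega> by (auto simp: bounded_iff)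
    have "uniformly_continuous_on (cball 0 (B + 1)) H"
      using H(1) by (intro compact_uniformly_continuous continuous_on_subset[OF H(1)]) auto
    then obtain \<eta> where \<eta>: "\<eta> > 0" "\<And>x y. norm x \<le> B + 1 \<Longrightarrow> norm y \<le> B + 1 \<Longrightarrow> dist y x < \<eta> \<Longrightarrow> dist (H y) (H x) < \<epsilon> / 3"
      unfolding uniformly_continuous_on_def using \<epsilon> by (metis divide_pos_pos mem_cball_0 zero_less_numeral)
    have "\<forall>\<^sub>F h in at_right 0. 0 < h \<and> h < min 1 \<eta>"
      unfolding eventually_at_right_field using \<eta>(1) by (intro exI[of _ "min 1 \<eta>"]) auto
    then have "\<forall>\<^sub>F h in at_right 0. \<forall>F x t. disc_flow \<Omega> g h F \<longrightarrow> dist x x0 < \<delta> \<longrightarrow> F x t \<le> \<epsilon>"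
      using avgH
    proof eventually_elim
      case (elim h)
      define X where "X = {x. \<exists>y\<in>\<Omega>. dist y x \<le> h}"
      have Hneg: "- (\<epsilon> / 3) \<le> H x" if "x \<in> X" for x
      proof -
        obtain y where y: "y \<in> \<Omega>" "dist y x \<le> h" using \<open>x \<in> X\<close> by (auto simp: X_def)
        have "norm x \<le> norm y + dist y x" using norm_triangle_ineq4[of y "y - x"] by (simp add: dist_norm)
        then have "dist (H x) (H y) < \<epsilon> / 3" using y elim B[OF y(1)] by (intro \<eta>(2)) (auto simp: dist_commute)
        moreover have "0 \<le> H y" using y(1) closure_subset by (intro H(3)) auto
        ultimately show ?thesis unfolding dist_real_def by linarith
      qed
      have "F x t \<le> \<epsilon>" if F: "disc_flow \<Omega> g h F" and x: "dist x x0 < \<delta>" for F x t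
      proof (cases "x \<in> \<Omega>")
        case True
        have "F x (max 0 t) - H x \<le> 2 * \<epsilon> / 3"
        proof (rule disc_max_principle[where d = "\<lambda>x t. F x t - H x" and I = \<Omega> and X = X and a = 0 and b = "max 0 t" and h = h])
          show "F y (s + h\<^sup>2 / (2 * DIM('a))) - H y \<le> avg h (\<lambda>z. F z s - H z) y" if "y \<in> \<Omega>" "0 \<le> s" for y s
            using F that elim by (simp add: disc_flow_def avg_diff)
          show "y + h *\<^sub>R i \<in> X \<and> y - h *\<^sub>R i \<in> X" if "y \<in> \<Omega>" "i \<in> Basis" for y i
            using that elim by (auto simp: X_def dist_norm intro!: bexI[of _ y])
          show "F y s - H y \<le> 2 * \<epsilon> / 3" if "y \<in> X - \<Omega>" for y s
            using F that Hneg[of y] \<epsilon> by (auto simp: disc_flow_def)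
          show "F y s - H y \<le> 2 * \<epsilon> / 3" if "y \<in> X" "s < 0 + h\<^sup>2 / (2 * DIM('a))" for y s
          proof (cases "y \<in> \<Omega>")
            case True
            then have "g y \<le> \<epsilon> / 3 + H y" using closure_subset by (intro H(4)) auto
            then show ?thesis using F that \<epsilon> by (auto simp: disc_flow_def)
          next
            case False
            then have "F y s = 0" using F unfolding disc_flow_def by blast
            then show ?thesis using Hneg[OF that(1)] \<epsilon> by simp
          qed
          show "x \<in> X" using True elim by (auto simp: X_def intro!: bexI[of _ x])
        qed (use elim in auto)
        then show ?thesis using \<delta>(2)[OF x] disc_flow_max0[OF F, of x t] elim by simp
      next
        case False
        then show ?thesis using F \<epsilon> by (simp add: disc_flow_def)
      qed
      then show ?case by blast
    qed
    then show ?thesis using \<delta>(1) by blast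
  qed
  then have "\<forall>x0\<in>frontier \<Omega>. \<exists>\<delta>. \<delta> > 0 \<and>
      (\<forall>\<^sub>F h in at_right 0. \<forall>F x t. disc_flow \<Omega> g h F \<longrightarrow> dist x x0 < \<delta> \<longrightarrow> F x t \<le> \<epsilon>)" by blast
  from bchoice[OF this] obtain \<delta> where \<delta>: "\<And>x0. x0 \<in> frontier \<Omega> \<Longrightarrow> \<delta> x0 > 0"
    "\<And>x0. x0 \<in> frontier \<Omega> \<Longrightarrow> \<forall>\<^sub>F h in at_right 0. \<forall>F x t. disc_flow \<Omega> g h F \<longrightarrow> dist x x0 < \<delta> x0 \<longrightarrow> F x t \<le> \<epsilon>"
    by blast
  have comp: "compact (frontier \<Omega>)" using \<Omega> by (rule compact_frontier_bounded)
  have "frontier \<Omega> \<subseteq> (\<Union>x0\<in>frontier \<Omega>. ball x0 (\<delta> x0 / 2))" using \<delta>(1) by fastforce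
  then obtain T where T: "T \<subseteq> frontier \<Omega>" "finite T" "frontier \<Omega> \<subseteq> (\<Union>x0\<in>T. ball x0 (\<delta> x0 / 2))"
    using compactE_image[OF comp, of "frontier \<Omega>" "\<lambda>x0. ball x0 (\<delta> x0 / 2)"] by auto
  define d where "d = Min (insert 1 ((\<lambda>x0. \<delta> x0 / 2) ` T))"
  have d: "d > 0" using T \<delta>(1) by (auto simp: d_def)
  have d': "d \<le> \<delta> x0 / 2" if "x0 \<in> T" for x0
    unfolding d_def using that T(2) by (intro Min_le) auto
  have "\<forall>\<^sub>F h in at_right 0. \<forall>x0\<in>T. \<forall>F x t. disc_flow \<Omega> g h F \<longrightarrow> dist x x0 < \<delta> x0 \<longrightarrow> F x t \<le> \<epsilon>"
    using T \<delta>(2) by (intro eventually_ball_finite) auto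
  then have "\<forall>\<^sub>F h in at_right 0. \<forall>F x y t. disc_flow \<Omega> g h F \<longrightarrow> y \<in> frontier \<Omega> \<longrightarrow> dist x y < d \<longrightarrow> F x t \<le> \<epsilon>"
  proof eventually_elim
    case (elim h)
    have "F x t \<le> \<epsilon>" if F: "disc_flow \<Omega> g h F" and y: "y \<in> frontier \<Omega>" "dist x y < d" for F x y t
    proof -
      obtain x0 where x0: "x0 \<in> T" "dist x0 y < \<delta> x0 / 2" using T(3) y(1) by auto
      have "dist x x0 \<le> dist x y + dist x0 y" by (rule dist_triangle2)
      then have "dist x x0 < \<delta> x0" using x0 y d'[OF x0(1)] by simp
      then show ?thesis using elim x0(1) F by blast
    qed
    then show ?case by blast
  qed
  then show ?thesis using d by blast
qed

text \<open>The modulus of \<open>g\<close> gives g x \<le> g x0 + \<epsilon> + C |x - x0|^2, where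
  \<open>C = 2 * M / \<rho>\<^sup>2\<close> makes the quadratic exceed the total oscillation beyond
  distance \<open>\<rho>\<close>. Adding 2 N C t turns the quadratic into an exact solution of the
  scheme.\<close>

lemma disc_flow_initial_le:
  fixes g :: "'a::euclidean_space \<Rightarrow> real" and M \<rho> \<epsilon> :: real
  assumes F: "disc_flow \<Omega> g h F" and h: "h > 0" and M: "\<And>x. \<bar>g x\<bar> \<le> M"
    and g0: "\<And>x. x \<notin> \<Omega> \<Longrightarrow> g x = 0"
    and \<rho>: "\<rho> > 0" "\<And>x y. dist x y < \<rho> \<Longrightarrow> \<bar>g x - g y\<bar> \<le> \<epsilon>" and t: "t \<ge> 0"
  shows "F x0 t \<le> g x0 + \<epsilon> + 2 * M / \<rho>\<^sup>2 * (2 * DIM('a)) * t"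
proof -
  define C where "C = 2 * M / \<rho>\<^sup>2"
  define N where "N = real DIM('a)"
  have N: "N \<ge> 1" by (simp add: N_def DIM_ge_Suc0)
  have "M \<ge> 0" using M[of x0] by simp
  then have C: "C \<ge> 0" by (simp add: C_def)
  have \<epsilon>: "\<epsilon> \<ge> 0" using \<rho>(2)[of x0 x0] \<rho>(1) by simp
  have gC: "g x \<le> g x0 + \<epsilon> + C * (norm (x - x0))\<^sup>2" for x
  proof (cases "dist x x0 < \<rho>")
    case True
    have "0 \<le> C * (norm (x - x0))\<^sup>2" using C by simp
    then show ?thesis using \<rho>(2)[OF True] by linarith
  next
    case False
    then have "\<rho>\<^sup>2 \<le> (norm (x - x0))\<^sup>2" using \<rho>(1) by (intro power_mono) (auto simp: dist_norm)
    then have "C * \<rho>\<^sup>2 \<le> C * (norm (x - x0))\<^sup>2" using C by (intro mult_left_mono)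
    moreover have "C * \<rho>\<^sup>2 = 2 * M" using \<rho>(1) by (simp add: C_def)
    ultimately show ?thesis using M[of x] M[of x0] \<epsilon> by linarith
  qed
  define \<psi> where "\<psi> x t = C * (norm (x - x0))\<^sup>2 + C * (2 * N) * t" for x t
  have "F x0 t - \<psi> x0 t \<le> g x0 + \<epsilon>"
  proof (rule disc_max_principle[where d = "\<lambda>x t. F x t - \<psi> x t" and I = \<Omega> and X = UNIV and a = 0 and b = t and h = h])
    fix y :: 'a and s :: real assume y: "y \<in> \<Omega>" "0 \<le> s"
    have "avg h (\<lambda>z. \<psi> z s) y = C * ((norm (y - x0))\<^sup>2 + h\<^sup>2) + C * (2 * N) * s"
      unfolding \<psi>_def avg_add avg_cmult avg_dist_sq avg_const ..
    also have "\<dots> = \<psi> y (s + h\<^sup>2 / (2 * N))" using N by (simp add: \<psi>_def field_simps)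
    finally show "F y (s + h\<^sup>2 / (2 * DIM('a))) - \<psi> y (s + h\<^sup>2 / (2 * DIM('a))) \<le> avg h (\<lambda>z. F z s - \<psi> z s) y"
      using F y by (simp add: avg_diff disc_flow_def N_def)
  next
    fix y :: 'a and s :: real assume y: "y \<in> UNIV - \<Omega>" "0 \<le> s"
    have "0 \<le> C * (2 * N) * s" using C N y by simp
    moreover have "F y s = 0" using F y by (simp add: disc_flow_def)
    moreover have "g y = 0" using y g0 by simp
    ultimately show "F y s - \<psi> y s \<le> g x0 + \<epsilon>" using gC[of y] unfolding \<psi>_def by linarith
  next
    fix y :: 'a and s :: real assume y: "0 \<le> s" "s < 0 + h\<^sup>2 / (2 * DIM('a))"
    have "0 \<le> C * (2 * N) * s" using C N y by simp
    moreover have "F y s = g y" using F y by (simp add: disc_flow_def)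
    ultimately show "F y s - \<psi> y s \<le> g x0 + \<epsilon>" using gC[of y] unfolding \<psi>_def by linarith
  qed (use h t in auto)
  then show ?thesis by (simp add: \<psi>_def C_def N_def)
qed

lemma disc_flow_initial:
  fixes g :: "'a::euclidean_space \<Rightarrow> real" and M \<epsilon> :: real
  assumes M: "\<And>x. \<bar>g x\<bar> \<le> M" and g0: "\<And>x. x \<notin> \<Omega> \<Longrightarrow> g x = 0"
    and uc: "uniformly_continuous_on UNIV g" and \<epsilon>: "\<epsilon> > 0"
  shows "\<exists>\<kappa>>0. \<forall>h>0. \<forall>F x t. disc_flow \<Omega> g h F \<longrightarrow> t \<le> \<kappa> \<longrightarrow> \<bar>F x t - g x\<bar> \<le> \<epsilon>"
proof -
  obtain \<rho> where \<rho>: "\<rho> > 0" "\<And>x y. dist x y < \<rho> \<Longrightarrow> \<bar>g x - g y\<bar> \<le> \<epsilon> / 2"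
  proof -
    obtain \<rho> where "\<rho> > 0" "\<forall>x\<in>UNIV. \<forall>x'\<in>UNIV. dist x' x < \<rho> \<longrightarrow> dist (g x') (g x) < \<epsilon> / 2"
      using uc \<epsilon> unfolding uniformly_continuous_on_def by (meson half_gt_zero)
    then have "dist x y < \<rho> \<Longrightarrow> \<bar>g x - g y\<bar> \<le> \<epsilon> / 2" for x y by (force simp: dist_real_def intro: less_imp_le)
    then show ?thesis using that \<open>\<rho> > 0\<close> by blast
  qed
  define A where "A = 2 * M / \<rho>\<^sup>2 * (2 * DIM('a))"
  have "M \<ge> 0" using M[of 0] by simp
  then have A: "A \<ge> 0" by (simp add: A_def)
  define \<kappa> where "\<kappa> = \<epsilon> / 2 / (A + 1)"
  have \<kappa>: "\<kappa> > 0" using \<epsilon> A by (simp add: \<kappa>_def)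
  have A1: "A + 1 \<noteq> 0" using A by simp
  have "A * \<kappa> \<le> (A + 1) * \<kappa>" using \<kappa> by (intro mult_right_mono) auto
  also have "(A + 1) * \<kappa> = \<epsilon> / 2"
    by (simp only: \<kappa>_def times_divide_eq_right[of "A + 1" "\<epsilon> / 2" "A + 1"] nonzero_mult_div_cancel_left[OF A1])
  finally have A\<kappa>: "A * \<kappa> \<le> \<epsilon> / 2" .
  have "\<bar>F x t - g x\<bar> \<le> \<epsilon>" if h: "h > 0" and F: "disc_flow \<Omega> g h F" and t: "t \<le> \<kappa>" for h F x t
  proof -
    have "A * max 0 t \<le> A * \<kappa>" using A t \<kappa> by (intro mult_left_mono) auto
    then have At: "A * max 0 t \<le> \<epsilon> / 2" using A\<kappa> by simp
    have "F x (max 0 t) \<le> g x + \<epsilon> / 2 + A * max 0 t"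
      unfolding A_def by (rule disc_flow_initial_le[OF F h M g0 \<rho>]) auto
    moreover have "- F x (max 0 t) \<le> - g x + \<epsilon> / 2 + A * max 0 t"
      unfolding A_def by (rule disc_flow_initial_le[OF disc_flow_uminus[OF F] h _ _ \<rho>(1)])
        (use M g0 \<rho>(2) in \<open>auto simp: abs_minus_commute\<close>)
    ultimately show ?thesis using At disc_flow_max0[OF F h, of x t] by simp
  qed
  then show ?thesis using \<kappa> by blast
qed

lemma frontier_between:
  fixes x y :: "'a::euclidean_space"
  assumes "x \<in> \<Omega>" "y \<notin> \<Omega>"
  obtains z where "z \<in> frontier \<Omega>" "dist x z \<le> dist x y"
proof -
  have "closed_segment x y \<inter> frontier \<Omega> \<noteq> {}"
    using assms by (intro connected_Int_frontier) auto
  then obtain z where "z \<in> closed_segment x y" "z \<in> frontier \<Omega>" by auto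
  then show ?thesis using that dist_in_closed_segment[of z x y] by (simp add: dist_commute)
qed

text \<open>The difference between the flow and its spatial translate solves the scheme where both
  points lie in \<open>\<Omega>\<close>. If exactly one of them does, it is within
  \<open>\<delta>\<close> of the frontier, where the flow is small; in the first layer the modulus
  of \<open>g\<close> applies. So the modulus at the boundary and of the datum spreads to all
  times.\<close>

lemma disc_flow_space:
  fixes \<Omega> :: "'a::euclidean_space set" and g :: "'a \<Rightarrow> real"
  assumes \<Omega>: "bounded \<Omega>" "open \<Omega>" and reg: "\<And>x0. x0 \<in> frontier \<Omega> \<Longrightarrow> regular_point \<Omega> x0"
    and uc: "uniformly_continuous_on UNIV g" and g0: "\<And>x. x \<notin> \<Omega> \<Longrightarrow> g x = 0" and \<epsilon>: "\<epsilon> > 0"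
  shows "\<exists>\<delta>>0. \<forall>\<^sub>F h in at_right 0. \<forall>F x y t. disc_flow \<Omega> g h F \<longrightarrow> dist x y < \<delta> \<longrightarrow> \<bar>F x t - F y t\<bar> \<le> \<epsilon>"
proof -
  have cg: "continuous_on UNIV g" using uc by (rule uniformly_continuous_imp_continuous)
  obtain \<rho> where \<rho>: "\<rho> > 0" "\<And>x y. dist x y < \<rho> \<Longrightarrow> dist (g x) (g y) < \<epsilon>"
    using uc \<epsilon> unfolding uniformly_continuous_on_def by (metis UNIV_I)
  obtain \<delta>1 where \<delta>1: "\<delta>1 > 0" "\<forall>\<^sub>F h in at_right 0. \<forall>F x y t. disc_flow \<Omega> g h F \<longrightarrow> y \<in> frontier \<Omega> \<longrightarrow> dist x y < \<delta>1 \<longrightarrow> F x t \<le> \<epsilon>"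
    using disc_flow_boundary_le[OF \<Omega>(1) reg cg g0 \<Omega>(2) \<epsilon>] by auto
  have cg': "continuous_on UNIV (\<lambda>x. - g x)" using cg by (intro continuous_intros)
  obtain \<delta>2 where \<delta>2: "\<delta>2 > 0" "\<forall>\<^sub>F h in at_right 0. \<forall>F x y t. disc_flow \<Omega> (\<lambda>x. - g x) h F \<longrightarrow> y \<in> frontier \<Omega> \<longrightarrow> dist x y < \<delta>2 \<longrightarrow> F x t \<le> \<epsilon>"
    using disc_flow_boundary_le[OF \<Omega>(1) reg cg' _ \<Omega>(2) \<epsilon>] g0 by auto
  define \<delta> where "\<delta> = min \<rho> (min \<delta>1 \<delta>2)"
  have \<delta>: "\<delta> > 0" using \<rho> \<delta>1 \<delta>2 by (simp add: \<delta>_def)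
  have "\<forall>\<^sub>F h in at_right (0::real). h > 0" by (rule eventually_at_right_less)
  then have "\<forall>\<^sub>F h in at_right 0. \<forall>F x y t. disc_flow \<Omega> g h F \<longrightarrow> dist x y < \<delta> \<longrightarrow> \<bar>F x t - F y t\<bar> \<le> \<epsilon>"
    using \<delta>1(2) \<delta>2(2)
  proof eventually_elim
    case (elim h)
    have near: "\<bar>F x t\<bar> \<le> \<epsilon>" if F: "disc_flow \<Omega> g h F" and xy: "dist x y < \<delta>" "x \<in> \<Omega>" "y \<notin> \<Omega>" for F x y t
    proof -
      obtain z where z: "z \<in> frontier \<Omega>" "dist x z \<le> dist x y" using frontier_between[OF xy(2,3)] by blast
      have d: "dist x z < \<delta>1" "dist x z < \<delta>2" using z(2) xy(1) by (auto simp: \<delta>_def)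
      have "F x t \<le> \<epsilon>" using elim(2) F z(1) d(1) by blast
      moreover have "- F x t \<le> \<epsilon>" using elim(3)[rule_format, OF disc_flow_uminus[OF F] z(1) d(2)] .
      ultimately show ?thesis by simp
    qed
    have one: "F (x + \<xi>) t - F x t \<le> \<epsilon>" if F: "disc_flow \<Omega> g h F" and \<xi>: "norm \<xi> < \<delta>" and t: "t \<ge> 0" for F x \<xi> t
    proof (rule disc_max_principle[where d = "\<lambda>x t. F (x + \<xi>) t - F x t" and I = "{x \<in> \<Omega>. x + \<xi> \<in> \<Omega>}" and X = UNIV and a = 0 and b = t and h = h])
      fix y :: 'a and s :: real assume "y \<in> {x \<in> \<Omega>. x + \<xi> \<in> \<Omega>}" "0 \<le> s"
      then show "F (y + \<xi>) (s + h\<^sup>2 / (2 * DIM('a))) - F y (s + h\<^sup>2 / (2 * DIM('a))) \<le> avg h (\<lambda>z. F (z + \<xi>) s - F z s) y"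
        using F avg_shift[of h "\<lambda>z. F z s" \<xi> y] by (simp add: disc_flow_def avg_diff)
    next
      fix y :: 'a and s :: real assume y: "y \<in> UNIV - {x \<in> \<Omega>. x + \<xi> \<in> \<Omega>}"
      have d: "dist (y + \<xi>) y < \<delta>" "dist y (y + \<xi>) < \<delta>" using \<xi> by (auto simp: dist_norm)
      have out: "F z s = 0" if "z \<notin> \<Omega>" for z using F that unfolding disc_flow_def by blast
      consider "y \<in> \<Omega>" "y + \<xi> \<notin> \<Omega>" | "y \<notin> \<Omega>" "y + \<xi> \<in> \<Omega>" | "y \<notin> \<Omega>" "y + \<xi> \<notin> \<Omega>" using y by blast
      then show "F (y + \<xi>) s - F y s \<le> \<epsilon>"
      proof cases
        case 1
        then show ?thesis using near[OF F d(2) 1, of s] out[OF 1(2)] by simp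
      next
        case 2
        then show ?thesis using near[OF F d(1) 2(2,1), of s] out[OF 2(1)] by simp
      next
        case 3
        then show ?thesis using out \<epsilon> by simp
      qed
    next
      fix y :: 'a and s :: real assume s: "s < 0 + h\<^sup>2 / (2 * DIM('a))"
      have "dist (g (y + \<xi>)) (g y) < \<epsilon>" using \<xi> by (intro \<rho>(2)) (auto simp: dist_norm \<delta>_def)
      then show "F (y + \<xi>) s - F y s \<le> \<epsilon>" using F s by (simp add: disc_flow_def dist_real_def)
    qed (use elim t in auto)
    have "\<bar>F x t - F y t\<bar> \<le> \<epsilon>" if F: "disc_flow \<Omega> g h F" and xy: "dist x y < \<delta>" for F x y t
    proof -
      have "F (x + (y - x)) (max 0 t) - F x (max 0 t) \<le> \<epsilon>" "F (y + (x - y)) (max 0 t) - F y (max 0 t) \<le> \<epsilon>"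
        using one[OF F, of "y - x" "max 0 t" x] one[OF F, of "x - y" "max 0 t" y] xy
        by (auto simp: dist_norm norm_minus_commute)
      then show ?thesis using disc_flow_max0[OF F, of x t] disc_flow_max0[OF F, of y t] elim(1)
        by (simp add: abs_le_iff)
    qed
    then show ?case by blast
  qed
  then show ?thesis using \<delta> by blast
qed

text \<open>The same argument with a translate in time. The difference vanishes outside
  \<open>\<Omega>\<close>, so it only has to be bounded in the first layer, where the flow has not
  yet moved far from its datum.\<close>

lemma disc_flow_time:
  fixes \<Omega> :: "'a::euclidean_space set" and g :: "'a \<Rightarrow> real" and M \<epsilon> :: real
  assumes M: "\<And>x. \<bar>g x\<bar> \<le> M" and uc: "uniformly_continuous_on UNIV g"
    and g0: "\<And>x. x \<notin> \<Omega> \<Longrightarrow> g x = 0" and \<epsilon>: "\<epsilon> > 0"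
  shows "\<exists>\<delta>>0. \<forall>\<^sub>F h in at_right 0. \<forall>F x s t. disc_flow \<Omega> g h F \<longrightarrow> \<bar>s - t\<bar> < \<delta> \<longrightarrow> \<bar>F x s - F x t\<bar> \<le> \<epsilon>"
proof -
  obtain \<kappa> where \<kappa>: "\<kappa> > 0" "\<And>h F x t. h > 0 \<Longrightarrow> disc_flow \<Omega> g h F \<Longrightarrow> t \<le> \<kappa> \<Longrightarrow> \<bar>F x t - g x\<bar> \<le> \<epsilon>"
    using disc_flow_initial[OF M g0 uc \<epsilon>] by metis
  have "\<forall>\<^sub>F h in at_right (0::real). h > 0 \<and> h < min 1 (\<kappa> / 2)"
    unfolding eventually_at_right_field using \<kappa>(1) by (intro exI[of _ "min 1 (\<kappa> / 2)"]) auto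
  then have "\<forall>\<^sub>F h in at_right 0. \<forall>F x s t. disc_flow \<Omega> g h F \<longrightarrow> \<bar>s - t\<bar> < \<kappa> / 2 \<longrightarrow> \<bar>F x s - F x t\<bar> \<le> \<epsilon>"
  proof eventually_elim
    case (elim h)
    define \<tau> where "\<tau> = h\<^sup>2 / (2 * DIM('a))"
    have "h\<^sup>2 \<le> h" unfolding power2_eq_square using elim by (intro mult_left_le) auto
    moreover have "\<tau> \<le> h\<^sup>2 / 1"
    proof -
      have "1 \<le> real DIM('a)" by (simp add: DIM_ge_Suc0)
      then have "1 \<le> real (2 * DIM('a))" by linarith
      then show ?thesis unfolding \<tau>_def by (intro divide_left_mono) simp_all
    qed
    \<comment> \<open>A first layer of length at most \<open>\<kappa> / 2\<close> followed by a
      shift below \<open>\<kappa> / 2\<close> stays within the time \<open>\<kappa>\<close> during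
      which the flow is close to \<open>g\<close>.\<close>
    ultimately have \<tau>: "\<tau> \<le> \<kappa> / 2" "0 \<le> \<tau>" using elim by (auto simp: \<tau>_def)
    have one: "c * (F x (t + \<sigma>) - F x t) \<le> \<epsilon>"
      if F: "disc_flow \<Omega> g h F" and \<sigma>: "0 \<le> \<sigma>" "\<sigma> < \<kappa> / 2" and t: "t \<ge> 0" and c: "c = 1 \<or> c = -1" for F x \<sigma> t and c :: real
    proof (rule disc_max_principle[where d = "\<lambda>x t. c * (F x (t + \<sigma>) - F x t)" and I = \<Omega> and X = UNIV and a = 0 and b = t and h = h])
      fix y :: 'a and s :: real assume y: "y \<in> \<Omega>" "0 \<le> s"
      have "F y (s + \<sigma> + h\<^sup>2 / (2 * DIM('a))) = avg h (\<lambda>z. F z (s + \<sigma>)) y"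
        "F y (s + h\<^sup>2 / (2 * DIM('a))) = avg h (\<lambda>z. F z s) y"
        using F y \<sigma> unfolding disc_flow_def by auto
      then show "c * (F y (s + h\<^sup>2 / (2 * DIM('a)) + \<sigma>) - F y (s + h\<^sup>2 / (2 * DIM('a)))) \<le> avg h (\<lambda>z. c * (F z (s + \<sigma>) - F z s)) y"
        unfolding avg_cmult avg_diff by (simp add: algebra_simps)
    next
      fix y :: 'a and s :: real assume "y \<in> UNIV - \<Omega>"
      then show "c * (F y (s + \<sigma>) - F y s) \<le> \<epsilon>" using F \<epsilon> by (simp add: disc_flow_def)
    next
      fix y :: 'a and s :: real assume s: "0 \<le> s" "s < 0 + h\<^sup>2 / (2 * DIM('a))"
      have "\<bar>F y (s + \<sigma>) - g y\<bar> \<le> \<epsilon>" using elim F s \<sigma> \<tau> by (intro \<kappa>(2)) (auto simp: \<tau>_def)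
      moreover have "F y s = g y" using F s by (simp add: disc_flow_def)
      ultimately show "c * (F y (s + \<sigma>) - F y s) \<le> \<epsilon>" using c by auto
    qed (use elim t in auto)
    have ord: "\<bar>F x s - F x t\<bar> \<le> \<epsilon>" if F: "disc_flow \<Omega> g h F" and st: "0 \<le> t" "t \<le> s" "s - t < \<kappa> / 2" for F x s t
      using one[OF F, of "s - t" t 1 x] one[OF F, of "s - t" t "-1" x] st by (simp add: abs_le_iff)
    have "\<bar>F x s - F x t\<bar> \<le> \<epsilon>" if F: "disc_flow \<Omega> g h F" and st: "\<bar>s - t\<bar> < \<kappa> / 2" for F x s t
    proof -
      have "\<bar>F x (max 0 s) - F x (max 0 t)\<bar> \<le> \<epsilon>"
      proof (cases "max 0 t \<le> max 0 s")
        case True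
        show ?thesis by (rule ord[OF F]) (use st \<kappa>(1) True in \<open>auto simp: max_def split: if_splits\<close>)
      next
        case False
        have "\<bar>F x (max 0 t) - F x (max 0 s)\<bar> \<le> \<epsilon>" by (rule ord[OF F]) (use st \<kappa>(1) False in \<open>auto simp: max_def split: if_splits\<close>)
        then show ?thesis by (simp add: abs_minus_commute)
      qed
      then show ?thesis using disc_flow_max0[OF F, of x s] disc_flow_max0[OF F, of x t] elim by simp
    qed
    then show ?case by blast
  qed
  then show ?thesis using half_gt_zero[OF \<kappa>(1)] by blast
qed

text \<open>Discrete flows with mesh 1 / (n + 1) are bounded and asymptotically equicontinuous on
  all of space-time, so a subsequence converges locally uniformly. Each of them solves the scheme on
  every compact part of the open cylinder, which puts the limit in \<open>heat_class\<close>.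
  Boundary and initial values hold exactly for every \<open>n\<close> and survive the pointwise
  limit; uniform continuity up to them is part of the compactness.\<close>

theorem heat_existence:
  fixes \<Omega> :: "'a::euclidean_space set" and g :: "'a \<Rightarrow> real"
  assumes \<Omega>: "bounded \<Omega>" "open \<Omega>" and reg: "\<And>x0. x0 \<in> frontier \<Omega> \<Longrightarrow> regular_point \<Omega> x0"
    and uc: "uniformly_continuous_on UNIV g" and g0: "\<And>x. x \<notin> \<Omega> \<Longrightarrow> g x = 0" and M: "\<And>x. \<bar>g x\<bar> \<le> M"
  obtains w where "smooth_on (\<Omega> \<times> {0<..}) (\<lambda>(x, t). w x t)"
    "\<And>x t. x \<in> \<Omega> \<Longrightarrow> t > 0 \<Longrightarrow> ((\<lambda>s. w x s) has_real_derivative laplacian (\<lambda>y. w y t) x) (at t)"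
    "uniformly_continuous_on UNIV (\<lambda>(x, t). w x t)"
    "\<And>x t. x \<notin> \<Omega> \<Longrightarrow> w x t = 0" "\<And>x. w x 0 = g x"
proof -
  define h where "h n = inverse (real (Suc n))" for n
  have h: "h n > 0" for n by (simp add: h_def)
  have hlim: "h \<longlonglongrightarrow> 0" unfolding h_def[abs_def] by (rule LIMSEQ_inverse_real_of_nat)
  have hev: "\<forall>\<^sub>F n in sequentially. P (h n)" if "\<forall>\<^sub>F h in at_right 0. P h" for P
    by (rule eventually_compose_filterlim[OF that], rule tendsto_imp_filterlim_at_right[OF hlim]) (simp add: h)
  have "\<exists>F. disc_flow \<Omega> g (h n) F" for n
    by (rule disc_flow_exists[where \<Omega> = \<Omega> and g = g and h = "h n"]) (use g0 h in auto)
  then obtain W where W: "\<And>n. disc_flow \<Omega> g (h n) (W n)" by metis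
  define F where "F n p = W n (fst p) (snd p)" for n and p :: "'a \<times> real"
  have bnd: "\<bar>F n p\<bar> \<le> M" for n p unfolding F_def by (rule disc_flow_bound[OF W h M])
  have equi: "\<exists>\<delta>>0. \<exists>N. \<forall>n\<ge>N. \<forall>p q. dist p q < \<delta> \<longrightarrow> \<bar>F n p - F n q\<bar> \<le> \<epsilon>" if "\<epsilon> > 0" for \<epsilon>
  proof -
    have e2: "\<epsilon> / 2 > 0" using that by simp
    obtain \<delta>1 where \<delta>1: "\<delta>1 > 0" and ev1: "\<forall>\<^sub>F h in at_right 0. \<forall>F x y t. disc_flow \<Omega> g h F \<longrightarrow> dist x y < \<delta>1 \<longrightarrow> \<bar>F x t - F y t\<bar> \<le> \<epsilon> / 2"
      using disc_flow_space[OF \<Omega> reg uc g0 e2] by auto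
    obtain \<delta>2 where \<delta>2: "\<delta>2 > 0" and ev2: "\<forall>\<^sub>F h in at_right 0. \<forall>F x s t. disc_flow \<Omega> g h F \<longrightarrow> \<bar>s - t\<bar> < \<delta>2 \<longrightarrow> \<bar>F x s - F x t\<bar> \<le> \<epsilon> / 2"
      using disc_flow_time[OF M uc g0 e2] by auto
    obtain N where N: "\<And>n F x y t. n \<ge> N \<Longrightarrow> disc_flow \<Omega> g (h n) F \<Longrightarrow> dist x y < \<delta>1 \<Longrightarrow> \<bar>F x t - F y t\<bar> \<le> \<epsilon> / 2"
       "\<And>n F x s t. n \<ge> N \<Longrightarrow> disc_flow \<Omega> g (h n) F \<Longrightarrow> \<bar>s - t\<bar> < \<delta>2 \<Longrightarrow> \<bar>F x s - F x t\<bar> \<le> \<epsilon> / 2"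
      using eventually_conj[OF hev[OF ev1] hev[OF ev2]] unfolding eventually_sequentially by blast
    have "\<bar>F n p - F n q\<bar> \<le> \<epsilon>" if n: "n \<ge> N" and pq: "dist p q < min \<delta>1 \<delta>2" for n p q
    proof -
      have "dist (fst p) (fst q) < \<delta>1" "\<bar>snd p - snd q\<bar> < \<delta>2"
        using pq dist_fst_le[of p q] dist_snd_le[of p q] by (auto simp: dist_real_def)
      then have "\<bar>W n (fst p) (snd p) - W n (fst q) (snd p)\<bar> \<le> \<epsilon> / 2" "\<bar>W n (fst q) (snd p) - W n (fst q) (snd q)\<bar> \<le> \<epsilon> / 2"
        using N n W by blast+
      then show ?thesis unfolding F_def by linarith
    qed
    moreover have "min \<delta>1 \<delta>2 > 0" using \<delta>1 \<delta>2 by simp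
    ultimately show ?thesis by blast
  qed
  obtain r v where r: "strict_mono (r :: nat \<Rightarrow> nat)"
    and lim: "\<And>K. compact K \<Longrightarrow> uniform_limit K (\<lambda>n. F (r n)) v sequentially"
    and ucv: "uniformly_continuous_on UNIV v"
    using asymptotic_Arzela_Ascoli[OF bnd equi] by blast
  define w where "w x t = v (x, t)" for x t
  have plim: "(\<lambda>n. W (r n) x t) \<longlonglongrightarrow> w x t" for x t
    using tendsto_uniform_limitI[OF lim[of "{(x, t)}"], of "(x, t)"] by (simp add: F_def w_def)
  define hs where "hs n = h (r n)" for n
  interpret mesh hs
  proof
    show "hs n > 0" for n by (simp add: hs_def h)
    show "hs \<longlonglongrightarrow> 0" unfolding hs_def using LIMSEQ_subseq_LIMSEQ[OF hlim r] by (simp add: o_def)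
  qed
  let ?Q = "\<Omega> \<times> {0::real<..}"
  have oQ: "open ?Q" using \<Omega> by (intro open_Times) auto
  have hc: "heat_class ?Q w"
    unfolding heat_class_def
  proof (intro conjI allI impI)
    have "continuous_on UNIV v" using ucv by (rule uniformly_continuous_imp_continuous)
    then show "continuous_on ?Q (\<lambda>(x, t). w x t)"
      unfolding w_def by (auto simp: case_prod_unfold intro: continuous_on_subset)
    fix K assume K: "compact K" "K \<subseteq> ?Q"
    show "disc_approx hs K w" unfolding disc_approx_def
    proof (intro allI impI)
      fix \<epsilon> :: real assume "\<epsilon> > 0"
      from uniform_limitD[OF lim[OF K(1)] this]
      have "\<forall>\<^sub>F n in sequentially. \<forall>p\<in>K. dist (F (r n) p) (v p) < \<epsilon>" .
      then show "\<forall>\<^sub>F n in sequentially. \<exists>f. disc_sol (hs n) K f \<and> (\<forall>(x, t)\<in>K. \<bar>f x t - w x t\<bar> \<le> \<epsilon>)"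
      proof eventually_elim
        case (elim n)
        have "disc_sol (hs n) K (W (r n))"
          unfolding disc_sol_def
        proof (intro allI impI)
          fix x t assume "(x, t) \<in> K"
          then have "x \<in> \<Omega>" "t \<ge> 0" using K(2) by auto
          then show "W (r n) x (t + (hs n)\<^sup>2 / (2 * DIM('a))) = avg (hs n) (\<lambda>y. W (r n) y t) x"
            using W[of "r n"] unfolding disc_flow_def hs_def by blast
        qed
        moreover have "\<bar>W (r n) x t - w x t\<bar> \<le> \<epsilon>" if "(x, t) \<in> K" for x t
          using elim that by (force simp: F_def w_def dist_real_def)
        ultimately show ?case by blast
      qed
    qed
  qed
  have "smooth_on ?Q (\<lambda>(x, t). w x t)"
    unfolding smooth_on_def using heat_class_smooth[OF oQ hc] by blast
  moreover have "((\<lambda>s. w x s) has_real_derivative laplacian (\<lambda>y. w y t) x) (at t)" if "x \<in> \<Omega>" "t > 0" for x t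
    using heat_class_time[OF oQ hc, of x t] that by simp
  moreover have "uniformly_continuous_on UNIV (\<lambda>(x, t). w x t)" using ucv by (simp add: w_def case_prod_unfold)
  moreover have "w x t = 0" if "x \<notin> \<Omega>" for x t
  proof -
    have "W n x t = 0" for n using W[of n] that unfolding disc_flow_def by blast
    then show ?thesis using plim[of x t] by (simp add: LIMSEQ_const_iff)
  qed
  moreover have "w x 0 = g x" for x
  proof -
    have "W n x 0 = g x" for n using W[of n] h[of n] unfolding disc_flow_def by (simp add: divide_pos_pos)
    then show ?thesis using plim[of x 0] by (simp add: LIMSEQ_const_iff)
  qed
  ultimately show ?thesis using that by blast
qed

section \<open>Comparison principles\<close>

lemma usc_on_iff:
  "usc_on S f \<longleftrightarrow> (\<forall>x\<in>S. \<forall>a>f x. \<exists>T. open T \<and> x \<in> T \<and> (\<forall>y\<in>S \<inter> T. f y < a))"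
  unfolding usc_on_def eventually_at_topological
proof (intro ball_cong refl all_cong iffI)
  fix x a assume "x \<in> S" "f x < a" "\<exists>T. open T \<and> x \<in> T \<and> (\<forall>y\<in>T. y \<noteq> x \<longrightarrow> y \<in> S \<longrightarrow> f y < a)"
  then obtain T where "open T" "x \<in> T" "\<forall>y\<in>T. y \<noteq> x \<longrightarrow> y \<in> S \<longrightarrow> f y < a" by blast
  then show "\<exists>T. open T \<and> x \<in> T \<and> (\<forall>y\<in>S \<inter> T. f y < a)" using \<open>f x < a\<close> by (intro exI[of _ T]) auto
qed blast

lemma usc_on_diff_continuous:
  assumes f: "usc_on S f" and g: "continuous_on S g"
  shows "usc_on S (\<lambda>x. f x - g x)"
  unfolding usc_on_iff
proof (intro ballI allI impI)
  fix x a assume x: "x \<in> S" and a: "f x - g x < a"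
  define e where "e = (a - (f x - g x)) / 2"
  have e: "e > 0" using a by (simp add: e_def)
  obtain T1 where T1: "open T1" "x \<in> T1" "\<forall>y\<in>S \<inter> T1. f y < f x + e"
    using f x e unfolding usc_on_iff by (meson less_add_same_cancel1)
  obtain T2 where T2: "open T2" "x \<in> T2" "\<forall>y\<in>S. y \<in> T2 \<longrightarrow> g y \<in> {g x - e<..}"
    using g x e unfolding continuous_on_topological
    by (metis greaterThan_iff open_greaterThan diff_less_eq less_add_same_cancel1)
  have "f y - g y < a" if "y \<in> S \<inter> (T1 \<inter> T2)" for y
  proof -
    have "f y < f x + e" "g x - e < g y" using that T1(3) T2(3) by auto
    then show ?thesis by (simp add: e_def field_simps)
  qed
  then show "\<exists>T. open T \<and> x \<in> T \<and> (\<forall>y\<in>S \<inter> T. f y - g y < a)"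
    using T1 T2 by (intro exI[of _ "T1 \<inter> T2"]) auto
qed

lemma usc_on_continuous: "continuous_on S f \<Longrightarrow> usc_on S f"
proof -
  assume f: "continuous_on S f"
  have "usc_on S (\<lambda>x. 0)" by (auto simp: usc_on_def intro: always_eventually)
  from usc_on_diff_continuous[OF this continuous_on_minus[OF f]] show "usc_on S f" by simp
qed

lemma usc_on_fst: "usc_on S f \<Longrightarrow> usc_on (S \<times> T) (\<lambda>p. f (fst p))"
  unfolding usc_on_iff
proof (intro ballI allI impI)
  fix p a assume f: "\<forall>x\<in>S. \<forall>a>f x. \<exists>T. open T \<and> x \<in> T \<and> (\<forall>y\<in>S \<inter> T. f y < a)"
    and p: "p \<in> S \<times> T" "f (fst p) < a"
  then obtain U where U: "open U" "fst p \<in> U" "\<forall>y\<in>S \<inter> U. f y < a" by force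
  then show "\<exists>U. open U \<and> p \<in> U \<and> (\<forall>q\<in>(S \<times> T) \<inter> U. f (fst q) < a)"
    using p by (intro exI[of _ "U \<times> UNIV"]) (auto intro: open_Times simp: mem_Times_iff)
qed

text \<open>A function that is nonpositive on the parabolic boundary and positive somewhere before
  time \<open>S\<close> has an interior maximum after subtracting \<open>L (t / S)^(m + 1)\<close>: for large \<open>m\<close> this
  is negligible before time \<open>S\<close>, but it excludes a maximum at the final time \<open>S\<close>.\<close>

lemma penalised_max:
  fixes d :: "'a::euclidean_space \<times> real \<Rightarrow> real" and a S :: real
  assumes \<Omega>: "open \<Omega>" "bounded \<Omega>" and S: "0 \<le> a" "a < S"
    and usc: "usc_on (closure \<Omega> \<times> {a..S}) d"
    and lateral: "\<And>x t. x \<in> frontier \<Omega> \<Longrightarrow> a \<le> t \<Longrightarrow> t \<le> S \<Longrightarrow> d (x, t) \<le> 0"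
    and init: "\<And>x. x \<in> closure \<Omega> \<Longrightarrow> d (x, a) \<le> 0"
    and pt: "x1 \<in> closure \<Omega>" "a \<le> t1" "t1 < S" "d (x1, t1) > 0"
  obtains L m x0 t0 where "L \<ge> 0" "x0 \<in> \<Omega>" "a < t0" "t0 < S"
    "local_max_at (\<Omega> \<times> {0<..}) (\<lambda>p. d p - L * (snd p / S) ^ Suc m) (x0, t0)"
proof -
  let ?K = "closure \<Omega> \<times> {a..S}"
  have K: "compact ?K" using \<Omega> by (intro compact_Times) auto
  have p1: "(x1, t1) \<in> ?K" using pt by auto
  obtain pm where pm: "pm \<in> ?K" "\<And>q. q \<in> ?K \<Longrightarrow> d q \<le> d pm"
    using usc_on_attains_max[OF K _ usc] p1 by blast
  \<comment> \<open>With \<open>L\<close> the maximum of \<open>d\<close>, the penalty at time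
    \<open>S\<close> cancels every value of \<open>d\<close>, so a positive maximum of
    \<open>e\<close> cannot occur there.\<close>
  define L where "L = d pm"
  have L: "L > 0" "\<And>q. q \<in> ?K \<Longrightarrow> d q \<le> L" using pm(2)[OF p1] pt(4) pm(2) by (auto simp: L_def)
  have "0 \<le> t1 / S" "t1 / S < 1" using pt S by auto
  then have "(\<lambda>m. (t1 / S) ^ m) \<longlonglongrightarrow> 0" by (intro LIMSEQ_realpow_zero) auto
  \<comment> \<open>The exponent makes the penalty at \<open>t1 < S\<close> smaller than
    \<open>d (x1, t1)\<close>, so the penalised function is still positive at that point.\<close>
  then have "\<forall>\<^sub>F m in sequentially. (t1 / S) ^ m < d (x1, t1) / L"
    using pt(4) L by (intro order_tendstoD(2)) auto
  then obtain m0 where m0: "\<And>m. m \<ge> m0 \<Longrightarrow> (t1 / S) ^ m < d (x1, t1) / L" by (auto simp: eventually_sequentially)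
  have m: "(t1 / S) ^ Suc m0 < d (x1, t1) / L" by (rule m0) simp
  define e where "e p = d p - L * (snd p / S) ^ Suc m0" for p
  have "usc_on ?K e" unfolding e_def by (intro usc_on_diff_continuous usc continuous_intros) (use S in auto)
  then obtain p where p: "p \<in> ?K" "\<And>q. q \<in> ?K \<Longrightarrow> e q \<le> e p"
    using usc_on_attains_max[OF K] p1 by blast
  obtain x0 t0 where xt: "p = (x0, t0)" by (cases p)
  have "e (x1, t1) > 0" using m L(1) by (simp add: e_def field_simps)
  then have e0: "e (x0, t0) > 0" using p(2)[OF p1] xt by simp
  have mem: "x0 \<in> closure \<Omega>" "a \<le> t0" "t0 \<le> S" using p(1) xt by auto
  have "L * (t0 / S) ^ Suc m0 \<ge> 0" using L S mem by simp
  then have d0: "d (x0, t0) > 0" using e0 by (simp add: e_def)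
  have x0: "x0 \<in> \<Omega>"
  proof (rule ccontr)
    assume "x0 \<notin> \<Omega>"
    then have "x0 \<in> frontier \<Omega>" using mem(1) \<Omega>(1) by (simp add: frontier_def interior_open)
    then show False using lateral[of x0 t0] mem d0 by simp
  qed
  have "t0 \<noteq> a" using init[OF mem(1)] d0 by auto
  moreover have "t0 \<noteq> S"
  proof
    assume "t0 = S"
    then have "e (x0, t0) = d (x0, t0) - L" using S by (simp add: e_def)
    then show False using L(2)[of "(x0, t0)"] mem e0 by simp
  qed
  ultimately have t0: "a < t0" "t0 < S" using mem by auto
  have "open (\<Omega> \<times> {a<..<S})" using \<Omega> by (intro open_Times) auto
  then obtain r where r: "r > 0" "ball (x0, t0) r \<subseteq> \<Omega> \<times> {a<..<S}"
    using x0 t0 open_contains_ball by (metis greaterThanLessThan_iff mem_Sigma_iff)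
  have "\<forall>y\<in>(\<Omega> \<times> {0<..}) \<inter> ball (x0, t0) r. e y \<le> e (x0, t0)"
  proof
    fix y assume "y \<in> (\<Omega> \<times> {0<..}) \<inter> ball (x0, t0) r"
    then have "y \<in> \<Omega> \<times> {a<..<S}" using r(2) by blast
    then have "y \<in> ?K" using closure_subset by fastforce
    then show "e y \<le> e (x0, t0)" using p(2) xt by simp
  qed
  then have "local_max_at (\<Omega> \<times> {0<..}) e (x0, t0)"
    unfolding local_max_at_def using r(1) x0 t0 S by auto
  then show ?thesis using that[of L x0 t0 m0] L(1) x0 t0 unfolding e_def by simp
qed

section \<open>Derivatives at interior maxima and comparison of classical solutions\<close>

lemma local_max_slices:
  fixes d :: "'a::euclidean_space \<times> real \<Rightarrow> real"
  assumes "local_max_at (\<Omega> \<times> {0<..}) d (x0, t0)"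
  shows "local_max_at \<Omega> (\<lambda>x. d (x, t0)) x0" "\<exists>r>0. \<forall>t. \<bar>t - t0\<bar> < r \<longrightarrow> d (x0, t) \<le> d (x0, t0)"
proof -
  obtain r where r: "x0 \<in> \<Omega>" "t0 > 0" "r > 0" "\<And>y. y \<in> (\<Omega> \<times> {0<..}) \<inter> ball (x0, t0) r \<Longrightarrow> d y \<le> d (x0, t0)"
    using assms by (auto simp: local_max_at_def)
  have "d (y, t0) \<le> d (x0, t0)" if "y \<in> \<Omega> \<inter> ball x0 r" for y
    using that r(2) by (intro r(4)) (auto simp: dist_prod_def)
  then show "local_max_at \<Omega> (\<lambda>x. d (x, t0)) x0" unfolding local_max_at_def using r(1,3) by blast
  have "d (x0, t) \<le> d (x0, t0)" if "\<bar>t - t0\<bar> < min r t0" for t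
    using that r by (intro r(4)) (auto simp: dist_prod_def dist_real_def abs_if split: if_splits)
  then show "\<exists>r>0. \<forall>t. \<bar>t - t0\<bar> < r \<longrightarrow> d (x0, t) \<le> d (x0, t0)"
    using r by (intro exI[of _ "min r t0"]) auto
qed

lemma local_max_avg:
  assumes "local_max_at \<Omega> f x" "open \<Omega>"
  shows "\<forall>\<^sub>F h in at_right 0. avg h f x \<le> f x"
proof -
  obtain r where r: "x \<in> \<Omega>" "r > 0" "\<And>y. y \<in> \<Omega> \<inter> ball x r \<Longrightarrow> f y \<le> f x"
    using assms(1) by (auto simp: local_max_at_def)
  obtain s where s: "s > 0" "ball x s \<subseteq> \<Omega>" using assms(2) r(1) open_contains_ball by blast
  have "avg h f x \<le> avg h (\<lambda>y. f x) x" if "0 < h" "h < min r s" for h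
    using that s by (intro avg_mono r(3)) (auto simp: dist_norm subset_iff)
  then show ?thesis unfolding avg_const eventually_at_right_field
    using r(2) s(1) by (intro exI[of _ "min r s"]) auto
qed

lemma local_max_laplacian:
  assumes "local_max_at \<Omega> f x" "open \<Omega>" "Ck_on 2 \<Omega> f"
  shows "laplacian f x \<le> 0"
proof -
  have x: "x \<in> \<Omega>" using assms(1) by (simp add: local_max_at_def)
  have neg: "Ck_on 2 \<Omega> (\<lambda>y. -1 * f y)" by (intro Ck_on_mult Ck_on_const assms)
  have "\<forall>\<^sub>F h in at_right 0. avg h (\<lambda>y. -1 * f y) x \<ge> -1 * f x + 0 * h\<^sup>2"
    using local_max_avg[OF assms(1,2)] unfolding avg_cmult by eventually_elim simp
  from laplacian_ge[OF assms(2) x neg this] show ?thesis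
    using laplacian_cmult[OF assms(2) x assms(3), of "-1"] by simp
qed

lemma max_time_derivative:
  assumes "\<exists>r>0. \<forall>t. \<bar>t - t0\<bar> < r \<longrightarrow> f t \<le> f t0" "(f has_real_derivative D) (at t0)"
  shows "D = 0"
proof -
  obtain r where "r > 0" "\<forall>t. \<bar>t0 - t\<bar> < r \<longrightarrow> f t \<le> f t0"
    using assms(1) by (auto simp: abs_minus_commute)
  then show ?thesis using DERIV_local_max[OF assms(2)] by blast
qed

lemma penalty_derivative:
  fixes S :: real
  shows "((\<lambda>s. L * (s / S) ^ Suc m) has_real_derivative L * (Suc m * (t / S) ^ m / S)) (at t)"
proof -
  have D: "((\<lambda>s. L * (s / S) ^ Suc m) has_real_derivative
      L * (real (Suc m) * (1 / S * (t / S) ^ (Suc m - Suc 0)))) (at t)"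
    by (intro DERIV_cmult DERIV_power DERIV_cdivide DERIV_ident)
  show ?thesis by (rule DERIV_cong[OF D]) simp
qed

text \<open>At the interior maximum of the penalised \<open>d\<close> the Laplacian is at most 0,
  while the time derivative equals that of the penalty and is at least 0; this contradicts the
  strict inequality. Strictness is usually bought with a small multiple of time.\<close>

lemma classical_comparison:
  fixes d :: "'a::euclidean_space \<Rightarrow> real \<Rightarrow> real" and a :: real
  assumes \<Omega>: "open \<Omega>" "bounded \<Omega>" and a: "0 \<le> a"
    and cont: "continuous_on (closure \<Omega> \<times> {a..}) (\<lambda>(x, t). d x t)"
    and sub: "\<And>x t. x \<in> \<Omega> \<Longrightarrow> a < t \<Longrightarrow> \<exists>D. ((\<lambda>s. d x s) has_real_derivative D) (at t) \<and>
        Ck_on 2 \<Omega> (\<lambda>y. d y t) \<and> D < laplacian (\<lambda>y. d y t) x"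
    and lateral: "\<And>x t. x \<in> frontier \<Omega> \<Longrightarrow> a \<le> t \<Longrightarrow> d x t \<le> 0"
    and init: "\<And>x. x \<in> closure \<Omega> \<Longrightarrow> d x a \<le> 0"
    and x: "x \<in> closure \<Omega>" and t: "a \<le> t"
  shows "d x t \<le> 0"
proof (rule ccontr)
  assume neg: "\<not> d x t \<le> 0"
  define d' where "d' = (\<lambda>(x, t). d x t)"
  obtain L m x0 t0 where m: "L \<ge> 0" "x0 \<in> \<Omega>" "a < t0" "t0 < t + 1"
    "local_max_at (\<Omega> \<times> {0<..}) (\<lambda>p. d' p - L * (snd p / (t + 1)) ^ Suc m) (x0, t0)"
  proof (rule penalised_max[OF \<Omega> a, where S = "t + 1" and d = d' and ?x1.0 = x and ?t1.0 = t])
    show "usc_on (closure \<Omega> \<times> {a..t + 1}) d'"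
      unfolding d'_def by (intro usc_on_continuous continuous_on_subset[OF cont]) auto
  qed (use lateral init x t neg in \<open>auto simp: d'_def\<close>)
  obtain D where D: "((\<lambda>s. d x0 s) has_real_derivative D) (at t0)"
    "Ck_on 2 \<Omega> (\<lambda>y. d y t0)" "D < laplacian (\<lambda>y. d y t0) x0" using sub[OF m(2,3)] by blast
  note sl = local_max_slices[OF m(5)]
  define c where "c = L * (t0 / (t + 1)) ^ Suc m"
  have "local_max_at \<Omega> (\<lambda>x. d x t0 - c) x0" using sl(1) by (simp add: d'_def c_def)
  then have "local_max_at \<Omega> (\<lambda>x. d x t0) x0" by (simp add: local_max_at_def)
  then have "laplacian (\<lambda>y. d y t0) x0 \<le> 0" using local_max_laplacian \<Omega>(1) D(2) by blast
  moreover have "D - L * (Suc m * (t0 / (t + 1)) ^ m / (t + 1)) = 0"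
  proof (rule max_time_derivative)
    show "\<exists>r>0. \<forall>s. \<bar>s - t0\<bar> < r \<longrightarrow> d x0 s - L * (s / (t + 1)) ^ Suc m \<le> d x0 t0 - L * (t0 / (t + 1)) ^ Suc m"
      using sl(2) by (simp add: d'_def)
    show "((\<lambda>s. d x0 s - L * (s / (t + 1)) ^ Suc m) has_real_derivative D - L * (Suc m * (t0 / (t + 1)) ^ m / (t + 1))) (at t0)"
      by (intro DERIV_diff D(1) penalty_derivative)
  qed
  moreover have "L * (Suc m * (t0 / (t + 1)) ^ m / (t + 1)) \<ge> 0" using m a t by (intro mult_nonneg_nonneg divide_nonneg_nonneg) auto
  ultimately show False using D(3) by simp
qed

section \<open>Comparison of viscosity solutions with smooth functions\<close>

definition beta :: "real \<Rightarrow> real \<Rightarrow> real \<Rightarrow> real" where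
  "beta bm bp s = b_coeff bm bp s * s"

text \<open>The coefficient jumps at 0, but multiplied by its argument it becomes monotone. This
  monotonicity is how the nonlinearity enters the two viscosity comparisons below.\<close>

lemma beta_mono: "bm > 0 \<Longrightarrow> bp > 0 \<Longrightarrow> s \<le> s' \<Longrightarrow> beta bm bp s \<le> beta bm bp s'"
proof -
  assume *: "bm > 0" "bp > 0" "s \<le> s'"
  show ?thesis
  proof (cases "s < 0 \<and> 0 \<le> s'")
    case True
    then have "bm * s \<le> 0" "0 \<le> bp * s'" using * by (auto simp: mult_le_0_iff)
    then show ?thesis using True by (simp add: beta_def b_coeff_def)
  qed (use * in \<open>auto simp: beta_def b_coeff_def\<close>)
qed

lemma laplacian_add_const:
  assumes "open \<Omega>" "x \<in> \<Omega>" "Ck_on 2 \<Omega> f"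
  shows "laplacian (\<lambda>y. f y + c) x = laplacian f x"
proof -
  have "laplacian (\<lambda>y. f y + c) x = laplacian f x + laplacian (\<lambda>y. c) x"
    by (rule laplacian_add[OF assms Ck_on_const])
  then show ?thesis unfolding laplacian_const by simp
qed

lemma smooth_penalty:
  fixes S :: real and Q :: "('a::euclidean_space \<times> real) set"
  assumes "open Q"
  shows "smooth_on Q (\<lambda>p. L * (snd p / S) ^ n)"
  unfolding divide_inverse
  by (intro smooth_on_mult smooth_on_power smooth_on_const smooth_on_linear bounded_linear_snd assms)

lemma parabolic_op_perturb:
  fixes \<phi> :: "'a::euclidean_space \<times> real \<Rightarrow> real"
  assumes \<Omega>: "open \<Omega>" and \<phi>: "smooth_on (\<Omega> \<times> {0<..}) \<phi>" and x: "x \<in> \<Omega>" "t > 0"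
    and P: "(P has_real_derivative p) (at t)"
  shows "parabolic_op bm bp (\<lambda>q. \<phi> q + P (snd q)) x t
    = beta bm bp (deriv (\<lambda>s. \<phi> (x, s)) t + p) - laplacian (\<lambda>y. \<phi> (y, t)) x"
proof -
  have oQ: "open (\<Omega> \<times> {0::real<..})" using \<Omega> by (intro open_Times) auto
  have "\<phi> differentiable (at (x, t))" using Ck2_diff(1)[OF smooth_on_Ck[OF \<phi>]] x by simp
  from slice_derivatives(2)[OF this] have D: "((\<lambda>s. \<phi> (x, s)) has_real_derivative deriv (\<lambda>s. \<phi> (x, s)) t) (at t)"
    using DERIV_imp_deriv by fastforce
  have "deriv (\<lambda>s. \<phi> (x, s) + P s) t = deriv (\<lambda>s. \<phi> (x, s)) t + p"
    by (rule DERIV_imp_deriv) (intro DERIV_add D P)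
  moreover have "laplacian (\<lambda>y. \<phi> (y, t) + P t) x = laplacian (\<lambda>y. \<phi> (y, t)) x"
    by (rule laplacian_add_const[OF \<Omega> x(1) Ck_on_slice[OF smooth_on_Ck[OF \<phi>] \<Omega> x(2)]])
  ultimately show ?thesis by (simp add: parabolic_op_def beta_def)
qed

lemma viscosity_sub_comparison:
  fixes u :: "'a::euclidean_space \<Rightarrow> real \<Rightarrow> real" and a :: real
  assumes \<Omega>: "open \<Omega>" "bounded \<Omega>" and a: "0 \<le> a" and b: "bm > 0" "bp > 0"
    and u: "parabolic_viscosity_solution \<Omega> bm bp u0 u"
    and \<phi>: "smooth_on (\<Omega> \<times> {0<..}) \<phi>" "continuous_on (closure \<Omega> \<times> {a..}) \<phi>"
    and super: "\<And>x t. x \<in> \<Omega> \<Longrightarrow> a < t \<Longrightarrow> laplacian (\<lambda>y. \<phi> (y, t)) x < beta bm bp (deriv (\<lambda>s. \<phi> (x, s)) t)"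
    and lateral: "\<And>x t. x \<in> frontier \<Omega> \<Longrightarrow> a \<le> t \<Longrightarrow> u x t \<le> \<phi> (x, t)"
    and init: "\<And>x. x \<in> closure \<Omega> \<Longrightarrow> u x a \<le> \<phi> (x, a)"
    and x: "x \<in> closure \<Omega>" and t: "a \<le> t"
  shows "u x t \<le> \<phi> (x, t)"
proof (rule ccontr)
  assume neg: "\<not> u x t \<le> \<phi> (x, t)"
  define d where "d p = u (fst p) (snd p) - \<phi> p" for p
  have cu: "continuous_on (closure \<Omega> \<times> {0..}) (\<lambda>p. u (fst p) (snd p))"
    using u by (simp add: parabolic_viscosity_solution_def case_prod_unfold)
  obtain L m x0 t0 where m: "L \<ge> 0" "x0 \<in> \<Omega>" "a < t0" "t0 < t + 1"
    "local_max_at (\<Omega> \<times> {0<..}) (\<lambda>p. d p - L * (snd p / (t + 1)) ^ Suc m) (x0, t0)"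
  proof (rule penalised_max[OF \<Omega> a, where S = "t + 1" and d = d and ?x1.0 = x and ?t1.0 = t])
    have "continuous_on (closure \<Omega> \<times> {a..t + 1}) d" unfolding d_def
      using a by (intro continuous_on_diff continuous_on_subset[OF cu] continuous_on_subset[OF \<phi>(2)]) auto
    then show "usc_on (closure \<Omega> \<times> {a..t + 1}) d" by (rule usc_on_continuous)
  qed (use lateral init x t neg in \<open>auto simp: d_def\<close>)
  define P where "P s = L * (s / (t + 1)) ^ Suc m" for s
  define p where "p = L * (Suc m * (t0 / (t + 1)) ^ m / (t + 1))"
  have p: "p \<ge> 0" unfolding p_def using m a t by (intro mult_nonneg_nonneg divide_nonneg_nonneg) auto
  have oQ: "open (\<Omega> \<times> {0::real<..})" using \<Omega> by (intro open_Times) auto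
  have "smooth_on (\<Omega> \<times> {0<..}) (\<lambda>q. \<phi> q + P (snd q))"
    unfolding P_def by (intro smooth_on_add smooth_penalty \<phi> oQ)
  moreover have "local_max_at (\<Omega> \<times> {0<..}) (\<lambda>(x, t). u x t - (\<phi> (x, t) + P (snd (x, t)))) (x0, t0)"
    using m(5) by (simp add: d_def P_def case_prod_unfold diff_diff_eq)
  ultimately have "parabolic_op bm bp (\<lambda>q. \<phi> q + P (snd q)) x0 t0 \<le> 0"
    using u unfolding parabolic_viscosity_solution_def by blast
  moreover have "(P has_real_derivative p) (at t0)"
    unfolding P_def p_def by (rule penalty_derivative)
  ultimately have "beta bm bp (deriv (\<lambda>s. \<phi> (x0, s)) t0 + p) \<le> laplacian (\<lambda>y. \<phi> (y, t0)) x0"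
    using parabolic_op_perturb[OF \<Omega>(1) \<phi>(1) m(2), of t0 P p bm bp] m(3) a by simp
  moreover have "beta bm bp (deriv (\<lambda>s. \<phi> (x0, s)) t0) \<le> beta bm bp (deriv (\<lambda>s. \<phi> (x0, s)) t0 + p)"
    using p by (intro beta_mono b) auto
  ultimately show False using super[OF m(2,3)] by simp
qed

lemma viscosity_super_comparison:
  fixes u :: "'a::euclidean_space \<Rightarrow> real \<Rightarrow> real" and a :: real
  assumes \<Omega>: "open \<Omega>" "bounded \<Omega>" and a: "0 \<le> a" and b: "bm > 0" "bp > 0"
    and u: "parabolic_viscosity_solution \<Omega> bm bp u0 u"
    and \<phi>: "smooth_on (\<Omega> \<times> {0<..}) \<phi>" "continuous_on (closure \<Omega> \<times> {a..}) \<phi>"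
    and sub: "\<And>x t. x \<in> \<Omega> \<Longrightarrow> a < t \<Longrightarrow> beta bm bp (deriv (\<lambda>s. \<phi> (x, s)) t) < laplacian (\<lambda>y. \<phi> (y, t)) x"
    and lateral: "\<And>x t. x \<in> frontier \<Omega> \<Longrightarrow> a \<le> t \<Longrightarrow> \<phi> (x, t) \<le> u x t"
    and init: "\<And>x. x \<in> closure \<Omega> \<Longrightarrow> \<phi> (x, a) \<le> u x a"
    and x: "x \<in> closure \<Omega>" and t: "a \<le> t"
  shows "\<phi> (x, t) \<le> u x t"
proof (rule ccontr)
  assume neg: "\<not> \<phi> (x, t) \<le> u x t"
  define d where "d p = \<phi> p - u (fst p) (snd p)" for p
  have cu: "continuous_on (closure \<Omega> \<times> {0..}) (\<lambda>p. u (fst p) (snd p))"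
    using u by (simp add: parabolic_viscosity_solution_def case_prod_unfold)
  obtain L m x0 t0 where m: "L \<ge> 0" "x0 \<in> \<Omega>" "a < t0" "t0 < t + 1"
    "local_max_at (\<Omega> \<times> {0<..}) (\<lambda>p. d p - L * (snd p / (t + 1)) ^ Suc m) (x0, t0)"
  proof (rule penalised_max[OF \<Omega> a, where S = "t + 1" and d = d and ?x1.0 = x and ?t1.0 = t])
    have "continuous_on (closure \<Omega> \<times> {a..t + 1}) d" unfolding d_def
      using a by (intro continuous_on_diff continuous_on_subset[OF cu] continuous_on_subset[OF \<phi>(2)]) auto
    then show "usc_on (closure \<Omega> \<times> {a..t + 1}) d" by (rule usc_on_continuous)
  qed (use lateral init x t neg in \<open>auto simp: d_def\<close>)
  define P where "P s = - L * (s / (t + 1)) ^ Suc m" for s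
  define p where "p = - L * (Suc m * (t0 / (t + 1)) ^ m / (t + 1))"
  have p: "p \<le> 0" unfolding p_def using m a t by (intro mult_nonpos_nonneg divide_nonneg_nonneg) auto
  have oQ: "open (\<Omega> \<times> {0::real<..})" using \<Omega> by (intro open_Times) auto
  have "smooth_on (\<Omega> \<times> {0<..}) (\<lambda>q. \<phi> q + P (snd q))"
    unfolding P_def by (intro smooth_on_add smooth_penalty \<phi> oQ)
  moreover have "local_min_at (\<Omega> \<times> {0<..}) (\<lambda>(x, t). u x t - (\<phi> (x, t) + P (snd (x, t)))) (x0, t0)"
  proof -
    have "u (fst q) (snd q) - (\<phi> q + P (snd q)) = - (d q - L * (snd q / (t + 1)) ^ Suc m)" for q
      by (simp add: d_def P_def)
    then show ?thesis using m(5) unfolding local_max_at_def local_min_at_def case_prod_unfold prod.collapse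
      by (simp only: neg_le_iff_le)
  qed
  ultimately have "parabolic_op bm bp (\<lambda>q. \<phi> q + P (snd q)) x0 t0 \<ge> 0"
    using u unfolding parabolic_viscosity_solution_def by blast
  moreover have "(P has_real_derivative p) (at t0)"
    unfolding P_def p_def by (rule penalty_derivative)
  ultimately have "beta bm bp (deriv (\<lambda>s. \<phi> (x0, s)) t0 + p) \<ge> laplacian (\<lambda>y. \<phi> (y, t0)) x0"
    using parabolic_op_perturb[OF \<Omega>(1) \<phi>(1) m(2), of t0 P p bm bp] m(3) a by simp
  moreover have "beta bm bp (deriv (\<lambda>s. \<phi> (x0, s)) t0 + p) \<le> beta bm bp (deriv (\<lambda>s. \<phi> (x0, s)) t0)"
    using p by (intro beta_mono b) auto
  ultimately show False using sub[OF m(2,3)] by simp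
qed

text \<open>The uniform initial limit lets the comparison start at a small positive time
  \<open>a\<close>, when both solutions are within \<open>\<epsilon> / 2\<close> of \<open>g\<close>
  throughout \<open>\<Omega>\<close>. The difference is lowered by \<epsilon> + \<epsilon> s, which
  absorbs the initial gap and makes the inequality strict.\<close>

lemma heat_solution_le:
  fixes w1 w2 :: "'a::euclidean_space \<Rightarrow> real \<Rightarrow> real"
  assumes \<Omega>: "open \<Omega>" "bounded \<Omega>" and w1: "heat_solution \<Omega> g w1" and w2: "heat_solution \<Omega> g w2"
    and x: "x \<in> closure \<Omega>" and t: "t > 0"
  shows "w1 x t \<le> w2 x t"
proof (rule field_le_epsilon)
  fix e :: real assume e: "e > 0"
  define \<epsilon> where "\<epsilon> = e / (t + 1)"
  have \<epsilon>: "\<epsilon> > 0" using e t by (simp add: \<epsilon>_def)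
  have "\<forall>\<^sub>F s in at_right 0. \<forall>x\<in>\<Omega>. dist (w1 x s) (g x) < \<epsilon> / 2" "\<forall>\<^sub>F s in at_right 0. \<forall>x\<in>\<Omega>. dist (w2 x s) (g x) < \<epsilon> / 2"
    using w1 w2 half_gt_zero[OF \<epsilon>] unfolding heat_solution_def uniform_limit_iff by blast+
  moreover have "\<forall>\<^sub>F s in at_right (0::real). 0 < s \<and> s < t"
    using t unfolding eventually_at_right_field by (intro exI[of _ t]) auto
  ultimately have "\<forall>\<^sub>F s in at_right 0. 0 < s \<and> s < t \<and> (\<forall>x\<in>\<Omega>. w1 x s - w2 x s \<le> \<epsilon>)"
  proof eventually_elim
    case (elim s)
    have "w1 x s - w2 x s \<le> \<epsilon>" if "x \<in> \<Omega>" for x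
    proof -
      have "dist (w1 x s) (g x) < \<epsilon> / 2" "dist (w2 x s) (g x) < \<epsilon> / 2" using elim that by auto
      then show ?thesis unfolding dist_real_def by linarith
    qed
    then show ?case using elim by blast
  qed
  then obtain a where a: "0 < a" "a < t" "\<And>x. x \<in> \<Omega> \<Longrightarrow> w1 x a - w2 x a \<le> \<epsilon>"
    using eventually_happens'[OF trivial_limit_at_right_real] by blast
  have c: "continuous_on (closure \<Omega> \<times> {a..}) (\<lambda>p. w (fst p) (snd p))" if "heat_solution \<Omega> g w" for w
    using that a(1) by (auto simp: heat_solution_def case_prod_unfold elim: continuous_on_subset)
  have fr: "w x s = 0" if "heat_solution \<Omega> g w" "x \<in> frontier \<Omega>" "s > 0" for w x s
    using that by (simp add: heat_solution_def)
  define d where "d x s = w1 x s - w2 x s + (- \<epsilon> - \<epsilon> * s)" for x s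
  have "d x t \<le> 0"
  proof (rule classical_comparison[OF \<Omega>, where a = a and d = d])
    show "continuous_on (closure \<Omega> \<times> {a..}) (\<lambda>(x, t). d x t)"
      unfolding d_def case_prod_unfold by (intro continuous_intros c w1 w2)
  next
    fix y s assume y: "y \<in> \<Omega>" "a < s"
    have s: "s > 0" using y a by simp
    have C: "Ck_on 2 \<Omega> (\<lambda>y. w y s)" "((\<lambda>s. w y s) has_real_derivative laplacian (\<lambda>y. w y s) y) (at s)"
      if "heat_solution \<Omega> g w" for w
    proof -
      show "Ck_on 2 \<Omega> (\<lambda>y. w y s)" using that s by (simp add: heat_solution_def C21_on_def)
      have "(\<lambda>s. w y s) differentiable (at s)" "deriv (\<lambda>s. w y s) s = laplacian (\<lambda>y. w y s) y"
        using that s y by (simp_all add: heat_solution_def C21_on_def)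
      then show "((\<lambda>s. w y s) has_real_derivative laplacian (\<lambda>y. w y s) y) (at s)"
        by (metis DERIV_deriv_iff_real_differentiable)
    qed
    have C2': "Ck_on 2 \<Omega> (\<lambda>y. -1 * w2 y s)" by (intro Ck_on_mult Ck_on_const C w2 \<Omega>)
    have C1: "Ck_on 2 \<Omega> (\<lambda>y. w1 y s + -1 * w2 y s)" by (intro Ck_on_add C2' C w1 \<Omega>)
    have Cd: "Ck_on 2 \<Omega> (\<lambda>y. d y s)"
      using Ck_on_add[OF \<Omega>(1) C1 Ck_on_const, of "- \<epsilon> - \<epsilon> * s"] by (simp add: d_def)
    have "laplacian (\<lambda>y. d y s) y = laplacian (\<lambda>y. w1 y s) y - laplacian (\<lambda>y. w2 y s) y"
      using laplacian_add_const[OF \<Omega>(1) y(1) C1, of "- \<epsilon> - \<epsilon> * s"]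
        laplacian_add[OF \<Omega>(1) y(1) C(1)[OF w1] C2'] laplacian_cmult[OF \<Omega>(1) y(1) C(1)[OF w2], of "-1"]
      by (simp add: d_def)
    moreover have "((\<lambda>s. d y s) has_real_derivative
        laplacian (\<lambda>y. w1 y s) y - laplacian (\<lambda>y. w2 y s) y + (- \<epsilon>)) (at s)"
      unfolding d_def by (intro DERIV_add DERIV_diff C w1 w2) (auto intro!: derivative_eq_intros)
    ultimately show "\<exists>D. ((\<lambda>s. d y s) has_real_derivative D) (at s) \<and> Ck_on 2 \<Omega> (\<lambda>y. d y s) \<and> D < laplacian (\<lambda>y. d y s) y"
      using Cd \<epsilon> by (intro exI conjI) auto
  next
    fix y s assume "y \<in> frontier \<Omega>" "a \<le> s"
    then have "d y s = - \<epsilon> - \<epsilon> * s" "0 \<le> \<epsilon> * s"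
      using fr[OF w1, of y s] fr[OF w2, of y s] a \<epsilon> by (auto simp: d_def)
    then show "d y s \<le> 0" using \<epsilon> by linarith
  next
    fix y assume y: "y \<in> closure \<Omega>"
    have "\<epsilon> * a > 0" using \<epsilon> a by simp
    moreover have "w1 y a - w2 y a \<le> \<epsilon>"
    proof (cases "y \<in> \<Omega>")
      case False
      then have "y \<in> frontier \<Omega>" using y \<Omega>(1) by (simp add: frontier_def interior_open)
      then show ?thesis using fr[OF w1, of y a] fr[OF w2, of y a] a \<epsilon> by simp
    qed (rule a(3))
    ultimately show "d y a \<le> 0" by (simp add: d_def)
  qed (use a x in auto)
  then have "w1 x t \<le> w2 x t + \<epsilon> * (t + 1)" by (simp add: d_def algebra_simps)
  also have "\<epsilon> * (t + 1) = e" using t by (simp add: \<epsilon>_def)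
  finally show "w1 x t \<le> w2 x t + e" .
qed

section \<open>The projected initial datum\<close>

text \<open>At a local maximum of \<open>B - \<phi>\<close> the averages of \<open>\<phi>\<close>
  exceed its value at least as much as those of \<open>B\<close> do. So the mean value inequality
  passes from \<open>B\<close> to the smooth \<open>\<phi>\<close>, where its limit is the sign of
  the Laplacian.\<close>

lemma subsolution_of_avg:
  fixes B :: "'a::euclidean_space \<Rightarrow> real"
  assumes \<Omega>: "open \<Omega>" and B: "\<forall>\<^sub>F h in at_right 0. \<forall>x\<in>\<Omega>. B x \<le> avg h B x"
    and \<phi>: "smooth_on \<Omega> \<phi>" and max: "local_max_at \<Omega> (\<lambda>x. B x - \<phi> x) x0"
  shows "- laplacian \<phi> x0 \<le> 0"
proof -
  have x0: "x0 \<in> \<Omega>" using max by (simp add: local_max_at_def)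
  have "\<forall>\<^sub>F h in at_right 0. \<phi> x0 + 0 * h\<^sup>2 \<le> avg h \<phi> x0"
    using local_max_avg[OF max \<Omega>] B
  proof eventually_elim
    case (elim h)
    have "B x0 \<le> avg h B x0" using elim x0 by blast
    then show ?case using elim(1) unfolding avg_diff by simp
  qed
  from laplacian_ge[OF \<Omega> x0 smooth_on_Ck[OF \<phi>] this] show ?thesis by simp
qed

text \<open>Test functions only need to be of class \<open>C\<^sup>2\<close> near the contact point, and may be
  translated: replace them by a perturbed Taylor polynomial.\<close>

lemma subsolution_shift_test:
  fixes v \<phi> :: "'a::euclidean_space \<Rightarrow> real" and r :: real
  assumes \<Omega>: "open \<Omega>" and sub: "laplace_viscosity_subsolution \<Omega> v" and x0: "x0 + \<xi> \<in> \<Omega>"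
    and S: "open S" "x0 \<in> S" and \<phi>: "Ck_on 2 S \<phi>" and r: "r > 0"
    and max: "\<And>y. y \<in> ball x0 r \<Longrightarrow> v (y + \<xi>) - \<phi> y \<le> v (x0 + \<xi>) - \<phi> x0"
  shows "0 \<le> laplacian \<phi> x0"
proof (rule field_le_epsilon)
  fix e :: real assume e: "e > 0"
  define \<delta> where "\<delta> = e / (2 * DIM('a))"
  have \<delta>: "\<delta> > 0" using e by (simp add: \<delta>_def)
  obtain r1 where r1: "r1 > 0" "\<And>y. y \<in> ball x0 r1 \<Longrightarrow> \<bar>\<phi> y - taylor2 \<phi> x0 y\<bar> \<le> \<delta> * (norm (y - x0))\<^sup>2"
    using taylor2_approx[OF S \<phi> \<delta>] by auto
  \<comment> \<open>\<open>P\<close> agrees with the translated test function to second order,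
    except for a square of weight \<open>\<delta>\<close> that keeps it above; this square costs
    \<open>2 * DIM('a) * \<delta> = e\<close> in the Laplacian. Being a polynomial, \<open>P\<close>
    is smooth on all of \<open>\<Omega>\<close>, as the definition demands.\<close>
  define P where "P z = taylor2 \<phi> x0 (z - \<xi>) + \<delta> * (norm (z - (x0 + \<xi>)))\<^sup>2" for z
  have "smooth_on UNIV P"
    unfolding P_def taylor2_def divide_inverse diff_diff_eq
    by (intro smooth_on_add smooth_on_mult smooth_on_sum smooth_on_const smooth_on_inner smooth_on_dist_sq open_UNIV)
  then have Psm: "smooth_on T P" for T unfolding smooth_on_def using Ck_on_subset by blast
  have "local_max_at \<Omega> (\<lambda>z. v z - P z) (x0 + \<xi>)"
    unfolding local_max_at_def
  proof (intro conjI exI[of _ "min r r1"] ballI x0)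
    show "min r r1 > 0" using r r1 by simp
    fix z assume z: "z \<in> \<Omega> \<inter> ball (x0 + \<xi>) (min r r1)"
    define y where "y = z - \<xi>"
    have y: "y \<in> ball x0 r" "y \<in> ball x0 r1" using z by (auto simp: y_def dist_norm algebra_simps)
    have "\<phi> y \<le> P z" using r1(2)[OF y(2)] by (simp add: P_def y_def abs_le_iff algebra_simps)
    moreover have "P (x0 + \<xi>) = \<phi> x0" by (simp add: P_def)
    ultimately show "v z - P z \<le> v (x0 + \<xi>) - P (x0 + \<xi>)" using max[OF y(1)] by (simp add: y_def)
  qed
  then have "0 \<le> laplacian P (x0 + \<xi>)" using sub Psm unfolding laplace_viscosity_subsolution_def by fastforce
  also have "laplacian P (x0 + \<xi>) = laplacian \<phi> x0 + 2 * DIM('a) * \<delta>"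
  proof -
    have "(avg h P (x0 + \<xi>) - P (x0 + \<xi>)) / h\<^sup>2 = laplacian \<phi> x0 / (2 * DIM('a)) + \<delta>" if "h > 0" for h
    proof -
      have "avg h (\<lambda>z. taylor2 \<phi> x0 (z - \<xi>)) (x0 + \<xi>) = avg h (taylor2 \<phi> x0) x0"
        using avg_shift[of h "taylor2 \<phi> x0" "- \<xi>" "x0 + \<xi>"] by simp
      then have "avg h P (x0 + \<xi>) = \<phi> x0 + h\<^sup>2 / (2 * DIM('a)) * laplacian \<phi> x0 + \<delta> * h\<^sup>2"
        unfolding P_def avg_add avg_cmult avg_dist_sq by (simp add: avg_taylor2)
      moreover have "P (x0 + \<xi>) = \<phi> x0" by (simp add: P_def)
      ultimately show ?thesis using that by (simp add: field_simps)
    qed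
    then have "((\<lambda>h. (avg h P (x0 + \<xi>) - P (x0 + \<xi>)) / h\<^sup>2) \<longlongrightarrow> laplacian \<phi> x0 / (2 * DIM('a)) + \<delta>) (at_right 0)"
      by (intro tendsto_eventually) (auto simp: eventually_at_right_field intro: exI[of _ 1])
    then have "laplacian \<phi> x0 / (2 * DIM('a)) + \<delta> = laplacian P (x0 + \<xi>) / (2 * DIM('a))"
      by (rule tendsto_unique[OF trivial_limit_at_right_real _ avg_tendsto_laplacian[OF open_UNIV UNIV_I smooth_on_Ck[OF Psm]]])
    then show ?thesis by (simp add: field_simps)
  qed
  also have "2 * DIM('a) * \<delta> = e" by (simp add: \<delta>_def)
  finally show "0 \<le> laplacian \<phi> x0 + e" .
qed

definition competitor :: "'a::euclidean_space set \<Rightarrow> ('a \<Rightarrow> real) \<Rightarrow> ('a \<Rightarrow> real) \<Rightarrow> bool" where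
  "competitor \<Omega> u0 v \<longleftrightarrow> (\<forall>y\<in>closure \<Omega>. v y \<le> u0 y) \<and> laplace_viscosity_subsolution \<Omega> v \<and>
     (\<forall>y\<in>frontier \<Omega>. v y \<le> 0)"

lemma projected_datum_ge:
  assumes "competitor \<Omega> u0 v" "x \<in> closure \<Omega>"
  shows "v x \<le> projected_datum \<Omega> u0 x"
  unfolding projected_datum_def
proof (rule cSup_upper)
  show "v x \<in> {v x |v. (\<forall>y\<in>closure \<Omega>. v y \<le> u0 y) \<and> laplace_viscosity_subsolution \<Omega> v \<and> (\<forall>y\<in>frontier \<Omega>. v y \<le> 0)}"
    using assms unfolding competitor_def by blast
  show "bdd_above {v x |v. (\<forall>y\<in>closure \<Omega>. v y \<le> u0 y) \<and> laplace_viscosity_subsolution \<Omega> v \<and> (\<forall>y\<in>frontier \<Omega>. v y \<le> 0)}"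
    using assms(2) by (intro bdd_aboveI[of _ "u0 x"]) auto
qed

lemma projected_datum_le:
  assumes "competitor \<Omega> u0 v0" "\<And>v. competitor \<Omega> u0 v \<Longrightarrow> v x \<le> c"
  shows "projected_datum \<Omega> u0 x \<le> c"
  unfolding projected_datum_def
  by (rule cSup_least) (use assms in \<open>auto simp: competitor_def\<close>)

lemma competitor_const:
  fixes \<Omega> :: "'a::euclidean_space set"
  assumes "open \<Omega>" "\<And>x. x \<in> closure \<Omega> \<Longrightarrow> \<bar>u0 x\<bar> \<le> M" "M \<ge> 0"
  shows "competitor \<Omega> u0 (\<lambda>x. - M)"
proof -
  have "laplace_viscosity_subsolution \<Omega> (\<lambda>x. - M)"
    unfolding laplace_viscosity_subsolution_def
  proof (intro conjI allI impI)
    show "bounded ((\<lambda>x. - M) ` closure \<Omega>)" by (rule bounded_subset[of "{-M}"]) auto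
    show "usc_on (closure \<Omega>) (\<lambda>x. - M)" by (intro usc_on_continuous continuous_intros)
    show "- laplacian \<phi> x0 \<le> 0" if "smooth_on \<Omega> \<phi>" "local_max_at \<Omega> (\<lambda>x. - M - \<phi> x) x0" for \<phi> x0
      by (rule subsolution_of_avg[OF assms(1) _ that]) (simp add: avg_const)
  qed
  then show ?thesis using assms unfolding competitor_def by (force simp: abs_le_iff)
qed

text \<open>At a contact point one of the two functions attains the maximum and stays below it
  nearby, so its own test inequality applies. Finitely many competitors can therefore be glued
  together.\<close>

lemma competitor_max:
  assumes v: "competitor \<Omega> u0 v1" "competitor \<Omega> u0 v2"
  shows "competitor \<Omega> u0 (\<lambda>x. max (v1 x) (v2 x))"
proof -
  have s: "laplace_viscosity_subsolution \<Omega> v1" "laplace_viscosity_subsolution \<Omega> v2"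
    using v by (auto simp: competitor_def)
  have "laplace_viscosity_subsolution \<Omega> (\<lambda>x. max (v1 x) (v2 x))"
    unfolding laplace_viscosity_subsolution_def
  proof (intro conjI allI impI)
    obtain B1 B2 where "\<And>x. x \<in> closure \<Omega> \<Longrightarrow> \<bar>v1 x\<bar> \<le> B1" "\<And>x. x \<in> closure \<Omega> \<Longrightarrow> \<bar>v2 x\<bar> \<le> B2"
      using s unfolding laplace_viscosity_subsolution_def bounded_iff by auto
    then have "\<bar>max (v1 x) (v2 x)\<bar> \<le> max B1 B2" if "x \<in> closure \<Omega>" for x
      using that by (smt (verit, best) max_def)
    then show "bounded ((\<lambda>x. max (v1 x) (v2 x)) ` closure \<Omega>)" unfolding bounded_iff by auto
    have "usc_on (closure \<Omega>) v1" "usc_on (closure \<Omega>) v2" using s by (auto simp: laplace_viscosity_subsolution_def)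
    then show "usc_on (closure \<Omega>) (\<lambda>x. max (v1 x) (v2 x))"
      unfolding usc_on_def max_less_iff_conj by (auto intro: eventually_conj)
    fix \<phi> x0 assume \<phi>: "smooth_on \<Omega> \<phi>" and m: "local_max_at \<Omega> (\<lambda>x. max (v1 x) (v2 x) - \<phi> x) x0"
    have "local_max_at \<Omega> (\<lambda>x. v x - \<phi> x) x0" if "v x0 = max (v1 x0) (v2 x0)" "\<And>x. v x \<le> max (v1 x) (v2 x)" for v
      using m that unfolding local_max_at_def by (smt (verit, best))
    then show "- laplacian \<phi> x0 \<le> 0"
      using s \<phi> unfolding laplace_viscosity_subsolution_def by (metis max.cobounded1 max.cobounded2 max_def)
  qed
  then show ?thesis using v by (simp add: competitor_def)
qed

section \<open>Continuity of the projected datum\<close>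

locale obstacle =
  fixes \<Omega> :: "'a::euclidean_space set" and u0 :: "'a \<Rightarrow> real"
  assumes \<Omega>: "open \<Omega>" "bounded \<Omega>" and reg: "\<And>x0. x0 \<in> frontier \<Omega> \<Longrightarrow> regular_point \<Omega> x0"
    and cu0: "continuous_on (closure \<Omega>) u0" and u00: "\<And>x. x \<in> frontier \<Omega> \<Longrightarrow> u0 x = 0"
begin

lemma compact_closure: "compact (closure \<Omega>)"
  using \<Omega> by simp

lemma u0_bounded: obtains M where "M > 0" "\<And>x. x \<in> closure \<Omega> \<Longrightarrow> \<bar>u0 x\<bar> \<le> M"
  using compact_imp_bounded[OF compact_continuous_image[OF cu0 compact_closure]] unfolding bounded_pos by auto

lemma closure_cases: "x \<in> closure \<Omega> \<Longrightarrow> x \<notin> \<Omega> \<Longrightarrow> x \<in> frontier \<Omega>"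
  using \<Omega>(1) by (simp add: frontier_def interior_open)

lemma frontier_in_closure: "x \<in> frontier \<Omega> \<Longrightarrow> x \<in> closure \<Omega>"
  by (simp add: frontier_def)

lemma frontier_not_in: "x \<in> frontier \<Omega> \<Longrightarrow> x \<notin> \<Omega>"
  using \<Omega>(1) by (simp add: frontier_def interior_open)

lemma competitor_exists: obtains v where "competitor \<Omega> u0 v"
  using u0_bounded competitor_const[OF \<Omega>(1), of u0] by (metis less_imp_le)

lemma datum_le_u0: "x \<in> closure \<Omega> \<Longrightarrow> projected_datum \<Omega> u0 x \<le> u0 x"
  by (rule competitor_exists, rule projected_datum_le) (auto simp: competitor_def)

text \<open>Negating a barrier for \<open>- u0\<close> and lowering it by
  \<open>\<epsilon> / 2\<close> gives a subsolution below \<open>u0\<close> that is nearly 0 at one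
  boundary point. By compactness finitely many boundary points suffice, and the maximum of their
  competitors is good near the whole frontier.\<close>

lemma barrier_competitor:
  assumes \<epsilon>: "\<epsilon> > 0"
  obtains b \<delta> where "competitor \<Omega> u0 b" "\<delta> > 0"
    "\<And>x y. x \<in> closure \<Omega> \<Longrightarrow> y \<in> frontier \<Omega> \<Longrightarrow> dist x y < \<delta> \<Longrightarrow> - \<epsilon> \<le> b x"
proof -
  have "\<exists>B. competitor \<Omega> u0 B \<and> (\<exists>\<delta>>0. \<forall>x\<in>closure \<Omega>. dist x x0 < \<delta> \<longrightarrow> - \<epsilon> \<le> B x)" if x0: "x0 \<in> frontier \<Omega>" for x0
  proof -
    have "continuous_on (closure \<Omega>) (\<lambda>x. - u0 x)" by (intro continuous_intros cu0)
    moreover have "- u0 x0 = 0" "\<epsilon> / 2 > 0" using u00[OF x0] \<epsilon> by auto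
    ultimately obtain H where H: "continuous_on UNIV H" "H x0 = 0"
      "\<forall>y\<in>closure \<Omega>. 0 \<le> H y \<and> - u0 y \<le> \<epsilon> / 2 + H y" "\<forall>\<^sub>F h in at_right 0. \<forall>x\<in>\<Omega>. avg h H x \<le> H x"
      using reg[OF x0, unfolded regular_point_def, rule_format, of "\<lambda>x. - u0 x" "\<epsilon> / 2"] by blast
    define B where "B x = - (\<epsilon> / 2) - H x" for x
    have cB: "continuous_on UNIV B" unfolding B_def by (intro continuous_intros H)
    have cB': "continuous_on S B" for S using cB continuous_on_subset by blast
    have "laplace_viscosity_subsolution \<Omega> B"
      unfolding laplace_viscosity_subsolution_def
    proof (intro conjI allI impI)
      show "bounded (B ` closure \<Omega>)" using compact_imp_bounded[OF compact_continuous_image[OF cB' compact_closure]] .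
      show "usc_on (closure \<Omega>) B" by (rule usc_on_continuous[OF cB'])
      show "- laplacian \<phi> x0 \<le> 0" if "smooth_on \<Omega> \<phi>" "local_max_at \<Omega> (\<lambda>x. B x - \<phi> x) x0" for \<phi> x0
      proof (rule subsolution_of_avg[OF \<Omega>(1) _ that])
        show "\<forall>\<^sub>F h in at_right 0. \<forall>x\<in>\<Omega>. B x \<le> avg h B x"
          using H(4) unfolding B_def avg_diff avg_const by eventually_elim auto
      qed
    qed
    moreover have "B y \<le> u0 y" if "y \<in> closure \<Omega>" for y using H(3) that by (force simp: B_def)
    ultimately have "competitor \<Omega> u0 B" using u00 frontier_in_closure unfolding competitor_def by fastforce
    moreover have "\<exists>\<delta>>0. \<forall>x\<in>closure \<Omega>. dist x x0 < \<delta> \<longrightarrow> - \<epsilon> \<le> B x"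
    proof -
      obtain \<delta> where "\<delta> > 0" and \<delta>: "\<And>x. dist x x0 < \<delta> \<Longrightarrow> dist (B x) (B x0) < \<epsilon> / 2"
        using cB \<open>\<epsilon> / 2 > 0\<close> unfolding continuous_on_iff by blast
      have "- \<epsilon> \<le> B x" if "dist x x0 < \<delta>" for x
      proof -
        have "B x0 = - (\<epsilon> / 2)" by (simp add: B_def H(2))
        then show ?thesis using \<delta>[OF that] unfolding dist_real_def by linarith
      qed
      then show ?thesis using \<open>\<delta> > 0\<close> by blast
    qed
    ultimately show ?thesis by blast
  qed
  then have "\<forall>x0\<in>frontier \<Omega>. \<exists>p. competitor \<Omega> u0 (fst p) \<and> snd p > 0 \<and> (\<forall>x\<in>closure \<Omega>. dist x x0 < snd p \<longrightarrow> - \<epsilon> \<le> fst p x)"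
    by fastforce
  from bchoice[OF this] obtain p where p: "\<And>x0. x0 \<in> frontier \<Omega> \<Longrightarrow> competitor \<Omega> u0 (fst (p x0))"
    "\<And>x0. x0 \<in> frontier \<Omega> \<Longrightarrow> snd (p x0) > 0"
    "\<And>x0 x. x0 \<in> frontier \<Omega> \<Longrightarrow> x \<in> closure \<Omega> \<Longrightarrow> dist x x0 < snd (p x0) \<Longrightarrow> - \<epsilon> \<le> fst (p x0) x"
    by blast
  define \<rho> where "\<rho> x0 = snd (p x0) / 2" for x0
  have \<rho>: "\<rho> x0 > 0" if "x0 \<in> frontier \<Omega>" for x0 using p(2)[OF that] by (simp add: \<rho>_def)
  have "compact (frontier \<Omega>)" using \<Omega>(2) by (rule compact_frontier_bounded)
  moreover have "frontier \<Omega> \<subseteq> (\<Union>x0\<in>frontier \<Omega>. ball x0 (\<rho> x0))" using \<rho> by fastforce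
  ultimately obtain T where T: "T \<subseteq> frontier \<Omega>" "finite T" "frontier \<Omega> \<subseteq> (\<Union>x0\<in>T. ball x0 (\<rho> x0))"
    using compactE_image[of "frontier \<Omega>" "frontier \<Omega>" "\<lambda>x0. ball x0 (\<rho> x0)"] by auto
  have "\<exists>b. competitor \<Omega> u0 b \<and> (\<forall>x0\<in>T. \<forall>x. fst (p x0) x \<le> b x)"
    using T(2,1)
  proof (induction T rule: finite_induct)
    case empty
    then show ?case using competitor_exists by blast
  next
    case (insert x0 T)
    then obtain b where b: "competitor \<Omega> u0 b" "\<forall>x0\<in>T. \<forall>x. fst (p x0) x \<le> b x" by auto
    have "competitor \<Omega> u0 (\<lambda>x. max (fst (p x0) x) (b x))" using insert p(1) b(1) by (intro competitor_max) auto
    then show ?case using b(2) by (intro exI[of _ "\<lambda>x. max (fst (p x0) x) (b x)"]) (auto intro: max.coboundedI2)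
  qed
  then obtain b where b: "competitor \<Omega> u0 b" "\<And>x0 x. x0 \<in> T \<Longrightarrow> fst (p x0) x \<le> b x" by blast
  define d where "d = Min (insert 1 (\<rho> ` T))"
  have d: "d > 0" using T \<rho> by (auto simp: d_def)
  have d': "d \<le> \<rho> x0" if "x0 \<in> T" for x0 unfolding d_def using that T(2) by (intro Min_le) auto
  have "- \<epsilon> \<le> b x" if x: "x \<in> closure \<Omega>" and y: "y \<in> frontier \<Omega>" and xy: "dist x y < d" for x y
  proof -
    obtain x0 where x0: "x0 \<in> T" "dist x0 y < \<rho> x0" using T(3) y by auto
    have "dist x x0 \<le> dist x y + dist x0 y" by (rule dist_triangle2)
    then have "dist x x0 < snd (p x0)" using x0 xy d'[OF x0(1)] by (simp add: \<rho>_def)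
    then have "- \<epsilon> \<le> fst (p x0) x" using x0(1) T(1) x by (intro p(3)) auto
    then show ?thesis using b(2)[OF x0(1), of x] by simp
  qed
  then show ?thesis using that b(1) d by blast
qed

text \<open>Translating a competitor, lowering it and gluing it to a barrier near the boundary gives
  another competitor; hence the projected datum inherits the modulus of continuity.\<close>

lemma datum_modulus:
  assumes \<epsilon>: "\<epsilon> > 0"
  obtains \<delta> where "\<delta> > 0"
    "\<And>x y. x \<in> \<Omega> \<Longrightarrow> y \<in> \<Omega> \<Longrightarrow> dist x y < \<delta> \<Longrightarrow> projected_datum \<Omega> u0 y \<le> projected_datum \<Omega> u0 x + 3 * \<epsilon>"
    "\<And>x y. x \<in> \<Omega> \<Longrightarrow> y \<in> frontier \<Omega> \<Longrightarrow> dist x y < \<delta> \<Longrightarrow> \<bar>projected_datum \<Omega> u0 x\<bar> \<le> \<epsilon>"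
proof -
  obtain b \<delta>1 where b: "competitor \<Omega> u0 b" and \<delta>1: "\<delta>1 > 0"
    "\<And>x y. x \<in> closure \<Omega> \<Longrightarrow> y \<in> frontier \<Omega> \<Longrightarrow> dist x y < \<delta>1 \<Longrightarrow> - \<epsilon> \<le> b x"
    using barrier_competitor[OF \<epsilon>] by blast
  have "uniformly_continuous_on (closure \<Omega>) u0"
    using cu0 compact_closure by (rule compact_uniformly_continuous)
  then obtain \<delta>2 where \<delta>2: "\<delta>2 > 0" "\<And>x y. x \<in> closure \<Omega> \<Longrightarrow> y \<in> closure \<Omega> \<Longrightarrow> dist x y < \<delta>2 \<Longrightarrow> dist (u0 x) (u0 y) < \<epsilon>"
    using \<epsilon> unfolding uniformly_continuous_on_def by metis
  define \<delta> where "\<delta> = min \<delta>1 \<delta>2"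
  have \<delta>: "\<delta> > 0" using \<delta>1 \<delta>2 by (simp add: \<delta>_def)
  have blow: "- \<epsilon> \<le> b x" if "x \<in> closure \<Omega>" "y \<in> frontier \<Omega>" "dist x y < \<delta>" for x y
    using that by (intro \<delta>1(2)) (auto simp: \<delta>_def)
  have umod: "\<bar>u0 x - u0 y\<bar> < \<epsilon>" if "x \<in> closure \<Omega>" "y \<in> closure \<Omega>" "dist x y < \<delta>" for x y
    using \<delta>2(2)[OF that(1,2)] that(3) by (simp add: \<delta>_def dist_real_def)
  have near: "\<bar>u0 x\<bar> < \<epsilon>" if "x \<in> closure \<Omega>" "y \<in> frontier \<Omega>" "dist x y < \<delta>" for x y
    using umod[OF that(1) frontier_in_closure[OF that(2)] that(3)] u00[OF that(2)] by simp
  have bu: "b x \<le> u0 x" if "x \<in> closure \<Omega>" for x using b that by (simp add: competitor_def)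
  have main: "v (x + \<xi>) - 3 * \<epsilon> \<le> projected_datum \<Omega> u0 x"
    if v: "competitor \<Omega> u0 v" and x: "x \<in> \<Omega>" "x + \<xi> \<in> \<Omega>" and \<xi>: "norm \<xi> < \<delta> / 2" for v x \<xi>
  proof -
    have vu: "v z \<le> u0 z" if "z \<in> closure \<Omega>" for z using v that by (simp add: competitor_def)
    have sv: "laplace_viscosity_subsolution \<Omega> v" and sb: "laplace_viscosity_subsolution \<Omega> b"
      using v b by (auto simp: competitor_def)
    define v' where "v' z = (if z \<in> \<Omega> \<and> z + \<xi> \<in> \<Omega> then max (v (z + \<xi>) - 3 * \<epsilon>) (b z) else b z)" for z
    have cl: "z \<in> \<Omega> \<Longrightarrow> z \<in> closure \<Omega>" for z using closure_subset by blast
    have bv': "b z \<le> v' z" for z by (simp add: v'_def)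
    have shift: "v (z + \<xi>) \<le> u0 z + \<epsilon>" if "z \<in> closure \<Omega>" "z + \<xi> \<in> \<Omega>" for z
    proof -
      have "\<bar>u0 (z + \<xi>) - u0 z\<bar> < \<epsilon>" using that \<xi> \<delta> cl by (intro umod) (auto simp: dist_norm)
      then show ?thesis using vu[OF cl[OF that(2)]] by linarith
    qed
    have v'u: "v' z \<le> u0 z" if "z \<in> closure \<Omega>" for z
      using bu[OF that] shift[OF that] \<epsilon> by (auto simp: v'_def)
    \<comment> \<open>Within \<open>\<delta>\<close> of the frontier the translate is at most
      \<open>u0 z + \<epsilon>\<close>, hence below \<open>2 * \<epsilon>\<close>, and the barrier
      is at least \<open>- \<epsilon>\<close>. Lowering by \<open>3 * \<epsilon>\<close> lets the
      barrier win there, so the seam of the gluing is invisible.\<close>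
    have v'near: "v' z = b z" if "z \<in> closure \<Omega>" "y \<in> frontier \<Omega>" "dist z y < \<delta>" for z y
    proof -
      have "v (z + \<xi>) - 3 * \<epsilon> \<le> b z" if "z + \<xi> \<in> \<Omega>"
        using shift[OF \<open>z \<in> closure \<Omega>\<close> that] near[OF \<open>z \<in> closure \<Omega>\<close> \<open>y \<in> frontier \<Omega>\<close> \<open>dist z y < \<delta>\<close>]
          blow[OF \<open>z \<in> closure \<Omega>\<close> \<open>y \<in> frontier \<Omega>\<close> \<open>dist z y < \<delta>\<close>] by linarith
      then show ?thesis by (simp add: v'_def max_def)
    qed
    have deep: "ball z \<delta> \<subseteq> \<Omega>" if z: "z \<in> closure \<Omega>" "\<And>y. y \<in> frontier \<Omega> \<Longrightarrow> \<not> dist z y < \<delta>" for z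
    proof
      fix q assume q: "q \<in> ball z \<delta>"
      have "z \<in> \<Omega>" using closure_cases[OF z(1)] z(2)[of z] \<delta> by auto
      show "q \<in> \<Omega>"
      proof (rule ccontr)
        assume "q \<notin> \<Omega>"
        then obtain y where "y \<in> frontier \<Omega>" "dist z y \<le> dist z q" using frontier_between[OF \<open>z \<in> \<Omega>\<close>] by blast
        then show False using z(2)[of y] q by simp
      qed
    qed
    have deep': "y \<in> \<Omega>" "y + \<xi> \<in> \<Omega>" if "ball z \<delta> \<subseteq> \<Omega>" "y \<in> ball z (\<delta> / 2)" for z y
    proof -
      have "norm (y + \<xi> - z) \<le> norm (y - z) + norm \<xi>" using norm_triangle_ineq[of "y - z" \<xi>] by (simp add: algebra_simps)
      then have "y \<in> ball z \<delta>" "y + \<xi> \<in> ball z \<delta>" using that(2) \<xi> \<delta> by (auto simp: dist_norm norm_minus_commute)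
      then show "y \<in> \<Omega>" "y + \<xi> \<in> \<Omega>" using that(1) by auto
    qed
    have "laplace_viscosity_subsolution \<Omega> v'"
      unfolding laplace_viscosity_subsolution_def
    proof (intro conjI allI impI)
      obtain B where B: "\<And>z. z \<in> closure \<Omega> \<Longrightarrow> \<bar>b z\<bar> \<le> B"
        using sb unfolding laplace_viscosity_subsolution_def bounded_iff by auto
      obtain M where M: "\<And>z. z \<in> closure \<Omega> \<Longrightarrow> \<bar>u0 z\<bar> \<le> M" using u0_bounded by blast
      have "\<bar>v' z\<bar> \<le> B + M" if "z \<in> closure \<Omega>" for z
        using B[OF that] M[OF that] bv'[of z] v'u[OF that] by linarith
      then show "bounded (v' ` closure \<Omega>)" unfolding bounded_iff by auto
    next
      show "usc_on (closure \<Omega>) v'" unfolding usc_on_iff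
      proof (intro ballI allI impI)
        fix z a assume z: "z \<in> closure \<Omega>" and a: "v' z < a"
        have "b z < a" using bv'[of z] a by simp
        then obtain T where T: "open T" "z \<in> T" "\<forall>y\<in>closure \<Omega> \<inter> T. b y < a"
          using sb z unfolding laplace_viscosity_subsolution_def usc_on_iff by blast
        \<comment> \<open>Close to the frontier \<open>v'\<close> coincides with the barrier.
          Otherwise a ball of radius \<open>\<delta>\<close> around \<open>z\<close> fits into
          \<open>\<Omega>\<close>, so a neighbourhood of \<open>z\<close> and its translate stay
          inside and both branches of the maximum can be bounded.\<close>
        show "\<exists>T. open T \<and> z \<in> T \<and> (\<forall>y\<in>closure \<Omega> \<inter> T. v' y < a)"
        proof (cases "\<exists>y\<in>frontier \<Omega>. dist z y < \<delta>")
          case True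
          then obtain y where y: "y \<in> frontier \<Omega>" "dist z y < \<delta>" by blast
          have "v' q < a" if "q \<in> closure \<Omega> \<inter> (T \<inter> ball y \<delta>)" for q
            using v'near[of q y] y(1) T(3) that by (auto simp: dist_commute)
          then show ?thesis using T y by (intro exI[of _ "T \<inter> ball y \<delta>"]) (auto simp: dist_commute)
        next
          case False
          then have dz: "ball z \<delta> \<subseteq> \<Omega>" using deep[OF z] by blast
          have z': "z \<in> \<Omega>" "z + \<xi> \<in> \<Omega>" using deep'[OF dz, of z] \<delta> by auto
          have "v (z + \<xi>) < a + 3 * \<epsilon>" using a z' by (simp add: v'_def)
          then obtain T' where T': "open T'" "z + \<xi> \<in> T'" "\<forall>y\<in>closure \<Omega> \<inter> T'. v y < a + 3 * \<epsilon>"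
            using sv cl[OF z'(2)] unfolding laplace_viscosity_subsolution_def usc_on_iff by blast
          define O' where "O' = T \<inter> ball z (\<delta> / 2) \<inter> {y. y + \<xi> \<in> T'}"
          have "open {y. y + \<xi> \<in> T'}"
            using open_vimage[OF T'(1), of "\<lambda>y. y + \<xi>"] by (simp add: vimage_def continuous_on_add)
          then have "open O'" "z \<in> O'" using T T' \<delta> by (auto simp: O'_def)
          moreover have "v' q < a" if "q \<in> closure \<Omega> \<inter> O'" for q
          proof -
            have q: "q \<in> \<Omega>" "q + \<xi> \<in> \<Omega>" using deep'[OF dz, of q] that by (auto simp: O'_def)
            then have "v (q + \<xi>) < a + 3 * \<epsilon>" "b q < a" using T T' that cl by (auto simp: O'_def)
            then show ?thesis using q by (simp add: v'_def)
          qed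
          ultimately show ?thesis by blast
        qed
      qed
    next
      fix \<phi> x0 assume \<phi>: "smooth_on \<Omega> \<phi>" and m: "local_max_at \<Omega> (\<lambda>x. v' x - \<phi> x) x0"
      obtain r where r: "x0 \<in> \<Omega>" "r > 0" "\<And>y. y \<in> \<Omega> \<inter> ball x0 r \<Longrightarrow> v' y - \<phi> y \<le> v' x0 - \<phi> x0"
        using m by (auto simp: local_max_at_def)
      show "- laplacian \<phi> x0 \<le> 0"
      proof (cases "v' x0 = b x0")
        case True
        have "b y - \<phi> y \<le> b x0 - \<phi> x0" if "y \<in> \<Omega> \<inter> ball x0 r" for y
          using r(3)[OF that] bv'[of y] True by linarith
        then have "local_max_at \<Omega> (\<lambda>x. b x - \<phi> x) x0" unfolding local_max_at_def using r by blast
        then show ?thesis using sb \<phi> unfolding laplace_viscosity_subsolution_def by blast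
      next
        case False
        \<comment> \<open>\<open>v'\<close> differs from the barrier only at points deep inside
          \<open>\<Omega>\<close>. There it dominates the lowered translate and equals it at
          \<open>x0\<close>, so the contact is one for the translate of \<open>v\<close>.\<close>
        have x0c: "x0 \<in> closure \<Omega>" using cl r(1) .
        have dx: "ball x0 \<delta> \<subseteq> \<Omega>" using deep[OF x0c] v'near[OF x0c] False by blast
        have x0': "x0 + \<xi> \<in> \<Omega>" using deep'[OF dx, of x0] \<delta> by auto
        have eq: "v' x0 = v (x0 + \<xi>) - 3 * \<epsilon>" using False r(1) x0' by (auto simp: v'_def max_def split: if_splits)
        have "0 \<le> laplacian \<phi> x0"
        proof (rule subsolution_shift_test[OF \<Omega>(1) sv x0' \<Omega>(1) r(1) smooth_on_Ck[OF \<phi>], of "min r (\<delta> / 2)"])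
          show "0 < min r (\<delta> / 2)" using r \<delta> by simp
          fix y assume y: "y \<in> ball x0 (min r (\<delta> / 2))"
          then have y': "y \<in> \<Omega>" "y + \<xi> \<in> \<Omega>" using deep'[OF dx, of y] by auto
          then have "v (y + \<xi>) - 3 * \<epsilon> \<le> v' y" by (simp add: v'_def)
          moreover have "v' y - \<phi> y \<le> v' x0 - \<phi> x0" using y y' by (intro r(3)) auto
          ultimately show "v (y + \<xi>) - \<phi> y \<le> v (x0 + \<xi>) - \<phi> x0" using eq by linarith
        qed
        then show ?thesis by simp
      qed
    qed
    moreover have "v' y \<le> 0" if "y \<in> frontier \<Omega>" for y
      using v'u[OF frontier_in_closure[OF that]] u00[OF that] by simp
    ultimately have "competitor \<Omega> u0 v'" using v'u by (simp add: competitor_def)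
    then have "v' x \<le> projected_datum \<Omega> u0 x" using cl[OF x(1)] by (rule projected_datum_ge)
    moreover have "v (x + \<xi>) - 3 * \<epsilon> \<le> v' x" using x by (simp add: v'_def)
    ultimately show ?thesis by simp
  qed
  show ?thesis
  proof (rule that[of "\<delta> / 2"])
    show "\<delta> / 2 > 0" using \<delta> by simp
    show "projected_datum \<Omega> u0 y \<le> projected_datum \<Omega> u0 x + 3 * \<epsilon>" if "x \<in> \<Omega>" "y \<in> \<Omega>" "dist x y < \<delta> / 2" for x y
    proof (rule projected_datum_le[OF b])
      fix v assume "competitor \<Omega> u0 v"
      from main[OF this, of x "y - x"] that show "v y \<le> projected_datum \<Omega> u0 x + 3 * \<epsilon>"
        by (simp add: dist_norm norm_minus_commute)
    qed
    show "\<bar>projected_datum \<Omega> u0 x\<bar> \<le> \<epsilon>" if "x \<in> \<Omega>" "y \<in> frontier \<Omega>" "dist x y < \<delta> / 2" for x y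
    proof -
      have x: "x \<in> closure \<Omega>" using that(1) closure_subset by blast
      have xy: "dist x y < \<delta>" using that(3) \<delta> by simp
      show ?thesis
        using datum_le_u0[OF x] near[OF x that(2) xy] blow[OF x that(2) xy] projected_datum_ge[OF b x] by linarith
    qed
  qed
qed

lemma datum_uniformly_continuous:
  "uniformly_continuous_on UNIV (\<lambda>x. if x \<in> \<Omega> then projected_datum \<Omega> u0 x else 0)"
  unfolding uniformly_continuous_on_def
proof (intro allI impI)
  fix e :: real assume e: "e > 0"
  define \<epsilon> where "\<epsilon> = e / 4"
  have \<epsilon>: "\<epsilon> > 0" using e by (simp add: \<epsilon>_def)
  obtain \<delta> where \<delta>: "\<delta> > 0"
    "\<And>x y. x \<in> \<Omega> \<Longrightarrow> y \<in> \<Omega> \<Longrightarrow> dist x y < \<delta> \<Longrightarrow> projected_datum \<Omega> u0 y \<le> projected_datum \<Omega> u0 x + 3 * \<epsilon>"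
    "\<And>x y. x \<in> \<Omega> \<Longrightarrow> y \<in> frontier \<Omega> \<Longrightarrow> dist x y < \<delta> \<Longrightarrow> \<bar>projected_datum \<Omega> u0 x\<bar> \<le> \<epsilon>"
    using datum_modulus[OF \<epsilon>] by blast
  let ?g = "\<lambda>x. if x \<in> \<Omega> then projected_datum \<Omega> u0 x else 0"
  have out: "\<bar>?g x\<bar> \<le> \<epsilon>" if xy: "x \<in> \<Omega>" "y \<notin> \<Omega>" "dist x y < \<delta>" for x y
  proof -
    obtain z where "z \<in> frontier \<Omega>" "dist x z \<le> dist x y" using frontier_between[OF xy(1,2)] by blast
    then show ?thesis using \<delta>(3)[of x z] xy by simp
  qed
  have "dist (?g y) (?g x) < e" if xy: "dist y x < \<delta>" for x y
  proof -
    have xy': "dist x y < \<delta>" using xy by (simp add: dist_commute)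
    consider "x \<in> \<Omega>" "y \<in> \<Omega>" | "x \<in> \<Omega>" "y \<notin> \<Omega>" | "x \<notin> \<Omega>" "y \<in> \<Omega>" | "x \<notin> \<Omega>" "y \<notin> \<Omega>" by blast
    then show ?thesis
    proof cases
      case 1
      then have "\<bar>?g y - ?g x\<bar> \<le> 3 * \<epsilon>" using \<delta>(2)[OF 1 xy'] \<delta>(2)[OF 1(2,1) xy] by simp
      then show ?thesis using e unfolding dist_real_def \<epsilon>_def by linarith
    next
      case 2
      then show ?thesis using out[OF 2 xy'] e by (simp add: \<epsilon>_def dist_real_def)
    next
      case 3
      then show ?thesis using out[OF 3(2,1) xy] e by (simp add: \<epsilon>_def dist_real_def)
    qed (use e in auto)
  qed
  then show "\<exists>d>0. \<forall>x\<in>UNIV. \<forall>x'\<in>UNIV. dist x' x < d \<longrightarrow> dist (?g x') (?g x) < e" using \<delta>(1) by blast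
qed

end

section \<open>The fast reaction limit\<close>

lemma smooth_on_fst:
  fixes f :: "'a::euclidean_space \<Rightarrow> real"
  assumes "open \<Omega>" "smooth_on \<Omega> f"
  shows "smooth_on (\<Omega> \<times> {0::real<..}) (\<lambda>p. f (fst p))"
  unfolding smooth_on_def
proof
  fix k
  show "Ck_on k (\<Omega> \<times> {0::real<..}) (\<lambda>p. f (fst p))"
  proof (rule Ck_on_compose_diag[where A = fst and S = \<Omega>])
    show "\<exists>c. \<exists>b'\<in>Basis. fst b = c *\<^sub>R b'" if "b \<in> Basis" for b :: "'a \<times> real"
    proof -
      obtain i :: 'a where i: "i \<in> Basis" using nonempty_Basis by blast
      from that consider j where "j \<in> Basis" "b = (j, 0)" | "b = (0, 1)" by (auto simp: Basis_prod_def)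
      then show ?thesis
      proof cases
        case 1
        then show ?thesis by (intro exI[of _ 1] bexI[of _ j]) auto
      next
        case 2
        then show ?thesis using i by (intro exI[of _ 0] bexI[of _ i]) auto
      qed
    qed
    show "open (\<Omega> \<times> {0::real<..})" using assms by (intro open_Times) auto
    show "Ck_on k \<Omega> f" using assms by (simp add: smooth_on_def)
  qed (auto intro!: derivative_eq_intros)
qed

lemma smooth_on_rescale_time:
  fixes F :: "'a::euclidean_space \<times> real \<Rightarrow> real" and c :: real
  assumes \<Omega>: "open \<Omega>" and F: "smooth_on (\<Omega> \<times> {0<..}) F" and c: "c > 0"
  shows "smooth_on (\<Omega> \<times> {0<..}) (\<lambda>p. F (fst p, snd p / c))"
  unfolding smooth_on_def
proof
  fix k
  show "Ck_on k (\<Omega> \<times> {0<..}) (\<lambda>p. F (fst p, snd p / c))"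
  proof (rule Ck_on_compose_diag[where A = "\<lambda>p. (fst p, snd p / c)" and S = "\<Omega> \<times> {0<..}"])
    show "((\<lambda>p. (fst p, snd p / c)) has_derivative (\<lambda>p. (fst p, snd p / c))) (at p)" for p :: "'a \<times> real"
      unfolding divide_inverse by (auto intro!: derivative_eq_intros)
    show "\<exists>d. \<exists>b'\<in>Basis. (fst b, snd b / c) = d *\<^sub>R b'" if "b \<in> Basis" for b :: "'a \<times> real"
    proof -
      from that consider j where "j \<in> Basis" "b = (j, 0)" | "b = (0, 1)" by (auto simp: Basis_prod_def)
      then show ?thesis
      proof cases
        case 1
        then show ?thesis by (intro exI[of _ 1] bexI[of _ "(j, 0)"]) (auto simp: Basis_prod_def)
      next
        case 2
        then show ?thesis by (intro exI[of _ "1 / c"] bexI[of _ "(0, 1)"]) (auto simp: Basis_prod_def)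
      qed
    qed
    show "open (\<Omega> \<times> {0::real<..})" using \<Omega> by (intro open_Times) auto
    show "Ck_on k (\<Omega> \<times> {0<..}) F" using F by (simp add: smooth_on_def)
  qed (use c in auto)
qed

text \<open>The definition prescribes the datum in the open domain and the boundary value for
  positive times; continuity on the closed cylinder and the vanishing of \<open>u0\<close> on the
  frontier supply the bottom edge.\<close>

lemma viscosity_solution_boundary:
  fixes u :: "'a::euclidean_space \<Rightarrow> real \<Rightarrow> real"
  assumes u: "parabolic_viscosity_solution \<Omega> bm bp u0 u" and u0: "continuous_on (closure \<Omega>) u0"
    "\<And>x. x \<in> frontier \<Omega> \<Longrightarrow> u0 x = 0"
  shows "x \<in> closure \<Omega> \<Longrightarrow> u x 0 = u0 x" "x \<in> frontier \<Omega> \<Longrightarrow> t \<ge> 0 \<Longrightarrow> u x t = 0"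
proof -
  have "continuous_on (closure \<Omega>) (\<lambda>x. (\<lambda>(x, t). u x t) (x, 0))"
    by (rule continuous_on_compose2[where t = "closure \<Omega> \<times> {0..}"])
      (use u in \<open>auto simp: parabolic_viscosity_solution_def intro!: continuous_intros\<close>)
  then have c: "continuous_on (closure \<Omega>) (\<lambda>x. u x 0 - u0 x)" using u0(1) by (auto intro!: continuous_intros)
  have z: "u x 0 - u0 x = 0" if "x \<in> closure \<Omega>" for x
    by (rule continuous_constant_on_closure[OF c _ that]) (use u in \<open>simp add: parabolic_viscosity_solution_def\<close>)
  then show "x \<in> closure \<Omega> \<Longrightarrow> u x 0 = u0 x" by fastforce
  have "u x 0 = 0" if "x \<in> frontier \<Omega>" for x using z[of x] u0(2)[OF that] that by (simp add: frontier_def)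
  then show "x \<in> frontier \<Omega> \<Longrightarrow> t \<ge> 0 \<Longrightarrow> u x t = 0"
    using u by (cases "t = 0") (auto simp: parabolic_viscosity_solution_def)
qed

section \<open>Bounds for the viscosity solutions on the time scale \<open>bp\<close>\<close>

context obstacle
begin

lemma oQ: "open (\<Omega> \<times> {0::real<..})"
  using \<Omega> by (intro open_Times) auto

text \<open>The quadratic barrier around \<open>x\<close> rises with slope \<open>A / bp\<close>,
  for which the nonlinearity takes the value \<open>A\<close> whatever \<open>bp\<close> is; hence
  \<open>\<kappa>\<close> does not depend on \<open>bp\<close>. The bound is one-sided for a reason:
  decreasing costs only \<open>bm\<close>, so on this time scale the solution may drop almost at
  once.\<close>

lemma initial_upper_bound:
  assumes \<epsilon>: "\<epsilon> > 0" and bm: "bm > 0"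
  obtains \<kappa> where "\<kappa> > 0" "\<And>bp u x s. bp > 0 \<Longrightarrow> parabolic_viscosity_solution \<Omega> bm bp u0 u \<Longrightarrow> x \<in> closure \<Omega> \<Longrightarrow>
     0 \<le> s \<Longrightarrow> s \<le> \<kappa> * bp \<Longrightarrow> u x s \<le> u0 x + \<epsilon>"
proof -
  obtain M where M: "M > 0" "\<And>x. x \<in> closure \<Omega> \<Longrightarrow> \<bar>u0 x\<bar> \<le> M" using u0_bounded by blast
  have "uniformly_continuous_on (closure \<Omega>) u0"
    using cu0 compact_closure by (rule compact_uniformly_continuous)
  then obtain \<rho> where \<rho>: "\<rho> > 0" "\<And>x y. x \<in> closure \<Omega> \<Longrightarrow> y \<in> closure \<Omega> \<Longrightarrow> dist y x < \<rho> \<Longrightarrow> dist (u0 y) (u0 x) < \<epsilon> / 2"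
    using half_gt_zero[OF \<epsilon>] unfolding uniformly_continuous_on_def by metis
  define C where "C = 2 * M / \<rho>\<^sup>2"
  define N where "N = real DIM('a)"
  have C: "C > 0" using M \<rho> by (simp add: C_def)
  have N: "N \<ge> 1" by (simp add: N_def DIM_ge_Suc0)
  have uC: "u0 y \<le> u0 x + \<epsilon> / 2 + C * (norm (y - x))\<^sup>2" if xy: "x \<in> closure \<Omega>" "y \<in> closure \<Omega>" for x y
  proof (cases "dist y x < \<rho>")
    case True
    have "0 \<le> C * (norm (y - x))\<^sup>2" using C by simp
    then show ?thesis using \<rho>(2)[OF xy True] unfolding dist_real_def by linarith
  next
    case False
    then have "\<rho>\<^sup>2 \<le> (norm (y - x))\<^sup>2" using \<rho>(1) by (intro power_mono) (auto simp: dist_norm)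
    then have "C * \<rho>\<^sup>2 \<le> C * (norm (y - x))\<^sup>2" using C by (intro mult_left_mono) auto
    moreover have "C * \<rho>\<^sup>2 = 2 * M" using \<rho>(1) by (simp add: C_def)
    ultimately show ?thesis using M(2)[OF xy(1)] M(2)[OF xy(2)] \<epsilon> by linarith
  qed
  \<comment> \<open>The quadratic term has Laplacian \<open>2 * N * C\<close>; the added 1 makes the
    differential inequality strict.\<close>
  define A where "A = 2 * N * C + 1"
  have "0 \<le> 2 * N * C" using N C by simp
  then have A: "A > 0" unfolding A_def by linarith
  define \<kappa> where "\<kappa> = \<epsilon> / 2 / A"
  have \<kappa>: "\<kappa> > 0" using \<epsilon> A by (simp add: \<kappa>_def)
  have "u x s \<le> u0 x + \<epsilon>" if bp: "bp > 0" and u: "parabolic_viscosity_solution \<Omega> bm bp u0 u" and x: "x \<in> closure \<Omega>"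
    and s: "0 \<le> s" "s \<le> \<kappa> * bp" for bp u x s
  proof -
    define \<phi> :: "'a \<times> real \<Rightarrow> real" where "\<phi> p = C * (norm (fst p - x))\<^sup>2 + (A / bp * snd p + (u0 x + \<epsilon> / 2))" for p
    have ub: "\<And>y. y \<in> closure \<Omega> \<Longrightarrow> u y 0 = u0 y" "\<And>y t. y \<in> frontier \<Omega> \<Longrightarrow> t \<ge> 0 \<Longrightarrow> u y t = 0"
      using viscosity_solution_boundary[OF u cu0 u00] by blast+
    have "u x s \<le> \<phi> (x, s)"
    proof (rule viscosity_sub_comparison[OF \<Omega> order_refl bm bp u])
      show "smooth_on (\<Omega> \<times> {0<..}) \<phi>" unfolding \<phi>_def
        by (intro smooth_on_add smooth_on_mult smooth_on_const oQ smooth_on_fst[OF \<Omega>(1), of "\<lambda>y. (norm (y - x))\<^sup>2"]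
            smooth_on_dist_sq \<Omega> smooth_on_linear bounded_linear_snd)
      show "continuous_on (closure \<Omega> \<times> {0..}) \<phi>" unfolding \<phi>_def by (intro continuous_intros)
    next
      fix y t assume y: "y \<in> \<Omega>" "0 < (t::real)"
      have "deriv (\<lambda>s. \<phi> (y, s)) t = A / bp"
        by (rule DERIV_imp_deriv) (use bp in \<open>auto simp: \<phi>_def intro!: derivative_eq_intros\<close>)
      moreover have "beta bm bp (A / bp) = A" using bp less_not_sym[OF divide_pos_pos[OF A bp]] by (simp add: beta_def b_coeff_def)
      moreover have "laplacian (\<lambda>y. \<phi> (y, t)) y = C * (2 * N)"
      proof -
        have "laplacian (\<lambda>y. C * (norm (y - x))\<^sup>2 + (A / bp * t + (u0 x + \<epsilon> / 2))) y = laplacian (\<lambda>y. C * (norm (y - x))\<^sup>2) y"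
          by (intro laplacian_add_const[OF open_UNIV UNIV_I] smooth_on_Ck smooth_on_mult smooth_on_const smooth_on_dist_sq open_UNIV)
        also have "\<dots> = C * laplacian (\<lambda>y. (norm (y - x))\<^sup>2) y"
          by (intro laplacian_cmult[OF open_UNIV UNIV_I] smooth_on_Ck smooth_on_dist_sq open_UNIV)
        finally show ?thesis by (simp add: \<phi>_def laplacian_dist_sq N_def)
      qed
      ultimately show "laplacian (\<lambda>y. \<phi> (y, t)) y < beta bm bp (deriv (\<lambda>s. \<phi> (y, s)) t)"
        by (simp add: A_def algebra_simps)
    next
      fix y t assume y: "y \<in> frontier \<Omega>" "0 \<le> (t::real)"
      have "0 \<le> A / bp * t" using A bp y by simp
      then show "u y t \<le> \<phi> (y, t)" using ub(2)[OF y] uC[OF x frontier_in_closure[OF y(1)]] u00[OF y(1)]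
        by (simp add: \<phi>_def)
    next
      fix y assume y: "y \<in> closure \<Omega>"
      then show "u y 0 \<le> \<phi> (y, 0)" using ub(1)[OF y] uC[OF x y] by (simp add: \<phi>_def)
    qed (use x s in auto)
    also have "\<phi> (x, s) = A * (s / bp) + (u0 x + \<epsilon> / 2)" by (simp add: \<phi>_def)
    also have "A * (s / bp) \<le> A * \<kappa>" using s bp A by (intro mult_left_mono) (auto simp: field_simps)
    also have "A * \<kappa> = \<epsilon> / 2" using A by (simp add: \<kappa>_def)
    finally show ?thesis by simp
  qed
  then show ?thesis using that \<kappa> by blast
qed

text \<open>Taking the maximum over a time window, with a quadratic penalty in time that forces the
  maximum into the interior, turns \<open>u\<close> into an almost subharmonic function, because
  the time derivative of the test function has size \<open>1 / bp\<close>.\<close>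

lemma fast_projection:
  fixes u :: "'a \<Rightarrow> real \<Rightarrow> real" and \<delta> M1 C R \<epsilon> bm bp :: real
  assumes b: "bm > 0" "bp > 0" and u: "parabolic_viscosity_solution \<Omega> bm bp u0 u"
    and \<delta>: "\<delta> > 0" and M1: "\<And>x t. x \<in> closure \<Omega> \<Longrightarrow> 0 \<le> t \<Longrightarrow> t \<le> 2 * \<delta> \<Longrightarrow> \<bar>u x (bp * t)\<bar> \<le> M1"
    and up: "\<And>x t. x \<in> closure \<Omega> \<Longrightarrow> 0 \<le> t \<Longrightarrow> t \<le> 2 * \<delta> \<Longrightarrow> u x (bp * t) \<le> u0 x + \<epsilon>"
    and C: "C > 0" "2 * M1 < C * \<delta>\<^sup>2" and R: "\<And>x. x \<in> closure \<Omega> \<Longrightarrow> norm x \<le> R"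
    and x: "x \<in> closure \<Omega>"
  shows "u x (bp * \<delta>) \<le> projected_datum \<Omega> u0 x + \<epsilon> + C * \<delta> * bm * R\<^sup>2 / (DIM('a) * bp)"
proof -
  define N where "N = real DIM('a)"
  have N: "N \<ge> 1" by (simp add: N_def DIM_ge_Suc0)
  \<comment> \<open>In the original time the penalty has slope at least
    \<open>- 2 * C * \<delta> / bp\<close> on the window, and negative slopes are weighted by
    \<open>bm\<close>; so the nonlinearity is at least \<open>- k\<close> there.\<close>
  define k where "k = 2 * C * \<delta> * bm / bp"
  have k: "k \<ge> 0" using b C \<delta> by (simp add: k_def)
  define z where "z y t = u y (bp * t) - C * (t - \<delta>)\<^sup>2" for y t
  have cz: "continuous_on (closure \<Omega> \<times> {0..2 * \<delta>}) (\<lambda>p. z (fst p) (snd p))"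
  proof -
    have "continuous_on (closure \<Omega> \<times> {0..2 * \<delta>}) (\<lambda>p. (\<lambda>(x, t). u x t) (fst p, bp * snd p))"
      by (rule continuous_on_compose2[where t = "closure \<Omega> \<times> {0..}"])
        (use u b in \<open>auto simp: parabolic_viscosity_solution_def intro!: continuous_intros\<close>)
    then show ?thesis unfolding z_def by (auto intro!: continuous_intros)
  qed
  have "\<exists>t\<in>{0..2 * \<delta>}. \<forall>t'\<in>{0..2 * \<delta>}. z y t' \<le> z y t" if y: "y \<in> closure \<Omega>" for y
  proof (rule continuous_attains_sup)
    have "continuous_on {0..2 * \<delta>} (\<lambda>t. (\<lambda>p. z (fst p) (snd p)) (y, t))"
      by (rule continuous_on_compose2[OF cz]) (use y in \<open>auto intro!: continuous_intros\<close>)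
    then show "continuous_on {0..2 * \<delta>} (z y)" by simp
  qed (use \<delta> in auto)
  then have "\<forall>y\<in>closure \<Omega>. \<exists>t. t \<in> {0..2 * \<delta>} \<and> (\<forall>t'\<in>{0..2 * \<delta>}. z y t' \<le> z y t)" by blast
  from bchoice[OF this] obtain T where T: "\<And>y. y \<in> closure \<Omega> \<Longrightarrow> T y \<in> {0..2 * \<delta>}"
    "\<And>y t. y \<in> closure \<Omega> \<Longrightarrow> t \<in> {0..2 * \<delta>} \<Longrightarrow> z y t \<le> z y (T y)" by blast
  define V where "V y = z y (T y)" for y
  have Vge: "u y (bp * \<delta>) \<le> V y" if "y \<in> closure \<Omega>" for y
    using T(2)[OF that, of \<delta>] \<delta> by (simp add: V_def z_def)
  have zle: "z y t \<le> u y (bp * t)" for y t using C by (simp add: z_def)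
  have Vle: "V y \<le> u0 y + \<epsilon>" if "y \<in> closure \<Omega>" for y
    using zle[of y "T y"] up[OF that, of "T y"] T(1)[OF that] by (simp add: V_def)
  have VM: "\<bar>V y\<bar> \<le> M1" if "y \<in> closure \<Omega>" for y
    using zle[of y "T y"] M1[OF that, of "T y"] T(1)[OF that] Vge[OF that] M1[OF that, of \<delta>] \<delta>
    by (auto simp: V_def abs_le_iff)
  have Tint: "0 < T y" "T y < 2 * \<delta>" if y: "y \<in> closure \<Omega>" for y
  proof -
    \<comment> \<open>At an end of the window the penalty is
      \<open>C * \<delta>\<^sup>2 > 2 * M1\<close>, which pushes the value below
      \<open>- M1\<close>, while the midpoint \<open>\<delta>\<close> carries no penalty and already
      gives at least \<open>- M1\<close>.\<close>
    have "T y \<noteq> 0 \<and> T y \<noteq> 2 * \<delta>"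
    proof (rule ccontr)
      assume "\<not> ?thesis"
      then have "(T y - \<delta>)\<^sup>2 = \<delta>\<^sup>2" by (auto simp: power2_eq_square)
      then have "V y = u y (bp * T y) - C * \<delta>\<^sup>2" by (simp add: V_def z_def)
      moreover have "u y (bp * T y) \<le> M1" using M1[OF y, of "T y"] T(1)[OF y] by auto
      ultimately show False using VM[OF y] C by linarith
    qed
    then show "0 < T y" "T y < 2 * \<delta>" using T(1)[OF y] by auto
  qed
  define c where "c = k / (2 * N)"
  have c: "c \<ge> 0" using k N by (simp add: c_def)
  \<comment> \<open>The added square \<open>c * (norm y)\<^sup>2\<close> raises the Laplacian by
    \<open>k\<close> and so compensates the defect of \<open>V\<close>; the subtracted constants
    bring the result below the obstacle.\<close>
  define V' where "V' y = V y - (- c * (norm (y - 0))\<^sup>2 + (c * R\<^sup>2 + \<epsilon>))" for y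
  have V'u: "V' y \<le> u0 y" if "y \<in> closure \<Omega>" for y
  proof -
    have "(norm y)\<^sup>2 \<le> R\<^sup>2" using R[OF that] by (intro power_mono) auto
    then have "c * (norm y)\<^sup>2 \<le> c * R\<^sup>2" using c by (intro mult_left_mono)
    then show ?thesis using Vle[OF that] by (simp add: V'_def)
  qed
  have "laplace_viscosity_subsolution \<Omega> V'"
    unfolding laplace_viscosity_subsolution_def
  proof (intro conjI allI impI)
    obtain M where M: "\<And>z. z \<in> closure \<Omega> \<Longrightarrow> \<bar>u0 z\<bar> \<le> M" using u0_bounded by blast
    have "\<bar>V' y\<bar> \<le> M + M1 + (c * R\<^sup>2 + \<bar>\<epsilon>\<bar>)" if y: "y \<in> closure \<Omega>" for y
    proof -
      have "V y - (c * R\<^sup>2 + \<epsilon>) \<le> V' y" "0 \<le> c * R\<^sup>2" using c by (auto simp: V'_def)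
      then show ?thesis using VM[OF y] V'u[OF y] M[OF y] by linarith
    qed
    then show "bounded (V' ` closure \<Omega>)" unfolding bounded_iff by auto
    have "usc_on (closure \<Omega>) V"
      unfolding usc_on_iff
    proof (intro ballI allI impI)
      fix y a assume y: "y \<in> closure \<Omega>" and a: "V y < a"
      have "uniformly_continuous_on (closure \<Omega> \<times> {0..2 * \<delta>}) (\<lambda>p. z (fst p) (snd p))"
        by (intro compact_uniformly_continuous cz compact_Times compact_closure) auto
      then obtain d where d: "d > 0" "\<And>p q. p \<in> closure \<Omega> \<times> {0..2 * \<delta>} \<Longrightarrow> q \<in> closure \<Omega> \<times> {0..2 * \<delta>} \<Longrightarrow>
          dist q p < d \<Longrightarrow> dist (z (fst q) (snd q)) (z (fst p) (snd p)) < a - V y"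
        using a unfolding uniformly_continuous_on_def by (metis diff_gt_0_iff_gt)
      have "V q < a" if q: "q \<in> closure \<Omega> \<inter> ball y d" for q
      proof -
        have "dist (z q (T q)) (z y (T q)) < a - V y"
          using d(2)[of "(y, T q)" "(q, T q)"] q y T(1)[of q] by (simp add: dist_prod_def dist_commute)
        moreover have "z y (T q) \<le> V y" using T(2)[OF y, of "T q"] T(1)[of q] q by (simp add: V_def)
        ultimately show ?thesis unfolding V_def[of q] dist_real_def by linarith
      qed
      then show "\<exists>T. open T \<and> y \<in> T \<and> (\<forall>q\<in>closure \<Omega> \<inter> T. V q < a)"
        using d(1) by (intro exI[of _ "ball y d"]) auto
    qed
    then show "usc_on (closure \<Omega>) V'" unfolding V'_def
      by (intro usc_on_diff_continuous continuous_intros)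
    fix \<phi> x0 assume \<phi>: "smooth_on \<Omega> \<phi>" and m: "local_max_at \<Omega> (\<lambda>x. V' x - \<phi> x) x0"
    obtain r where r: "x0 \<in> \<Omega>" "r > 0" "\<And>y. y \<in> \<Omega> \<inter> ball x0 r \<Longrightarrow> V' y - \<phi> y \<le> V' x0 - \<phi> x0"
      using m by (auto simp: local_max_at_def)
    have cl: "y \<in> \<Omega> \<Longrightarrow> y \<in> closure \<Omega>" for y using closure_subset by blast
    define \<psi> where "\<psi> y = \<phi> y + - c * (norm (y - 0))\<^sup>2" for y
    have sq: "smooth_on \<Omega> (\<lambda>y. - c * (norm (y - 0))\<^sup>2)"
      by (intro smooth_on_mult smooth_on_const smooth_on_dist_sq \<Omega>)
    have \<psi>: "smooth_on \<Omega> \<psi>" unfolding \<psi>_def by (intro smooth_on_add \<phi> sq \<Omega>)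
    have V\<psi>: "V y - \<psi> y \<le> V x0 - \<psi> x0" if "y \<in> \<Omega> \<inter> ball x0 r" for y
      using r(3)[OF that] by (simp add: V'_def \<psi>_def)
    define t0 where "t0 = T x0"
    have t0: "0 < t0" "t0 < 2 * \<delta>" using Tint[OF cl[OF r(1)]] by (auto simp: t0_def)
    define P where "P s = C * (s / bp - \<delta>)\<^sup>2" for s
    define p where "p = 2 * C * (t0 - \<delta>) / bp"
    have dP: "(P has_real_derivative p) (at (bp * t0))"
      unfolding P_def p_def using b by (auto intro!: derivative_eq_intros)
    have sP: "smooth_on (\<Omega> \<times> {0<..}) (\<lambda>q. P (snd q))" unfolding P_def divide_inverse
      by (intro smooth_on_mult smooth_on_power smooth_on_diff smooth_on_const smooth_on_linear bounded_linear_snd oQ)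
    have s\<psi>: "smooth_on (\<Omega> \<times> {0::real<..}) (\<lambda>q. \<psi> (fst q))" by (rule smooth_on_fst[OF \<Omega>(1) \<psi>])
    \<comment> \<open>A contact of \<open>V\<close> in space lifts to a contact of \<open>u\<close>
      in space-time: the time penalty becomes part of the test function, and since the maximising
      time is interior, nearby times still belong to the window.\<close>
    have "local_max_at (\<Omega> \<times> {0<..}) (\<lambda>(x, t). u x t - (\<psi> (fst (x, t)) + P (snd (x, t)))) (x0, bp * t0)"
      unfolding local_max_at_def
    proof (intro conjI exI[of _ "min r (min (bp * t0) (bp * (2 * \<delta> - t0)))"] ballI)
      show "(x0, bp * t0) \<in> \<Omega> \<times> {0<..}" using r(1) b t0 by simp
      show "0 < min r (min (bp * t0) (bp * (2 * \<delta> - t0)))" using r b t0 by simp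
      fix q assume q: "q \<in> (\<Omega> \<times> {0<..}) \<inter> ball (x0, bp * t0) (min r (min (bp * t0) (bp * (2 * \<delta> - t0))))"
      obtain y s where ys: "q = (y, s)" by (cases q)
      have y: "y \<in> \<Omega> \<inter> ball x0 r" using q ys dist_fst_le[of "(x0, bp * t0)" "(y, s)"] by auto
      have "\<bar>bp * t0 - s\<bar> < min (bp * t0) (bp * (2 * \<delta> - t0))"
        using q ys dist_snd_le[of "(x0, bp * t0)" "(y, s)"] by (auto simp: dist_real_def)
      then have "0 \<le> s" "s \<le> bp * (2 * \<delta>)" by (auto simp: abs_if algebra_simps split: if_splits)
      then have sb: "s / bp \<in> {0..2 * \<delta>}" using b by (auto simp: field_simps)
      have "bp * (s / bp) = s" using b by simp
      then have "u y s - P s = z y (s / bp)" by (simp add: z_def P_def)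
      also have "\<dots> \<le> V y" using T(2)[of y "s / bp"] cl y sb by (simp add: V_def)
      finally have "u y s - P s \<le> V y" .
      moreover have "u x0 (bp * t0) - P (bp * t0) = V x0" using b by (simp add: V_def z_def P_def t0_def)
      ultimately show "(case q of (x, t) \<Rightarrow> u x t - (\<psi> (fst (x, t)) + P (snd (x, t))))
          \<le> (case (x0, bp * t0) of (x, t) \<Rightarrow> u x t - (\<psi> (fst (x, t)) + P (snd (x, t))))"
        using V\<psi>[OF y] ys by simp
    qed
    then have "parabolic_op bm bp (\<lambda>q. \<psi> (fst q) + P (snd q)) x0 (bp * t0) \<le> 0"
      using u smooth_on_add[OF oQ s\<psi> sP] unfolding parabolic_viscosity_solution_def by blast
    moreover have "bp * t0 > 0" using b t0 by simp
    from parabolic_op_perturb[OF \<Omega>(1) s\<psi> r(1) this dP, of bm bp]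
    have "parabolic_op bm bp (\<lambda>q. \<psi> (fst q) + P (snd q)) x0 (bp * t0) = beta bm bp p - laplacian \<psi> x0" by simp
    moreover have "- k \<le> beta bm bp p"
    proof -
      have neg: "- (2 * C * \<delta> / bp) < 0" using C \<delta> b by simp
      have "- k = beta bm bp (- (2 * C * \<delta> / bp))"
        using neg by (simp add: beta_def b_coeff_def k_def)
      also have "- (2 * C * \<delta> / bp) = 2 * C * (- \<delta>) / bp" by simp
      also have "beta bm bp (2 * C * (- \<delta>) / bp) \<le> beta bm bp p"
        unfolding p_def using C b t0 by (intro beta_mono divide_right_mono mult_left_mono) auto
      finally show ?thesis .
    qed
    ultimately have "- k \<le> laplacian \<psi> x0" by simp
    moreover have "laplacian \<psi> x0 = laplacian \<phi> x0 - k"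
    proof -
      have "laplacian \<psi> x0 = laplacian \<phi> x0 + laplacian (\<lambda>y. - c * (norm (y - 0))\<^sup>2) x0"
        unfolding \<psi>_def by (intro laplacian_add[OF \<Omega>(1) r(1)] smooth_on_Ck \<phi> sq)
      also have "laplacian (\<lambda>y. - c * (norm (y - 0))\<^sup>2) x0 = - c * laplacian (\<lambda>y. (norm (y - 0))\<^sup>2) x0"
        by (intro laplacian_cmult[OF open_UNIV UNIV_I] smooth_on_Ck smooth_on_dist_sq open_UNIV)
      also have "\<dots> = - k" unfolding laplacian_dist_sq using N by (simp add: c_def N_def)
      finally show ?thesis by simp
    qed
    ultimately show "- laplacian \<phi> x0 \<le> 0" by simp
  qed
  moreover have "V' y \<le> 0" if "y \<in> frontier \<Omega>" for y
    using V'u[OF frontier_in_closure[OF that]] u00[OF that] by simp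
  ultimately have "competitor \<Omega> u0 V'" using V'u by (simp add: competitor_def)
  then have "V' x \<le> projected_datum \<Omega> u0 x" using x by (rule projected_datum_ge)
  moreover have "V x - (c * R\<^sup>2 + \<epsilon>) \<le> V' x" using c by (simp add: V'_def)
  moreover have "c * R\<^sup>2 = C * \<delta> * bm * R\<^sup>2 / (DIM('a) * bp)" using N b by (simp add: c_def k_def N_def field_simps)
  ultimately show ?thesis using Vge[OF x] by linarith
qed

end

section \<open>Monotonicity and decay of the flow issued from the projected datum\<close>

locale projected_flow = obstacle \<Omega> u0
  for \<Omega> :: "'a::euclidean_space set" and u0 :: "'a \<Rightarrow> real" +
  fixes w :: "'a \<Rightarrow> real \<Rightarrow> real"
  assumes w_smooth: "smooth_on (\<Omega> \<times> {0<..}) (\<lambda>(x, t). w x t)"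
    and w_heat: "\<And>x t. x \<in> \<Omega> \<Longrightarrow> t > 0 \<Longrightarrow> ((\<lambda>s. w x s) has_real_derivative laplacian (\<lambda>y. w y t) x) (at t)"
    and w_uc: "uniformly_continuous_on UNIV (\<lambda>(x, t). w x t)"
    and w_out: "\<And>x t. x \<notin> \<Omega> \<Longrightarrow> w x t = 0"
    and w_init: "\<And>x. x \<in> \<Omega> \<Longrightarrow> w x 0 = projected_datum \<Omega> u0 x"
begin

lemma w_cont: "continuous_on S (\<lambda>p. w (fst p) (snd p))"
  using uniformly_continuous_imp_continuous[OF w_uc] continuous_on_subset by (fastforce simp: case_prod_unfold)

lemma w_cont_compose:
  assumes "continuous_on S f" "continuous_on S g"
  shows "continuous_on S (\<lambda>p. w (f p) (g p))"
  using continuous_on_compose2[OF w_cont[of UNIV] continuous_on_Pair[OF assms]] by simp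

lemma w_slice: "t > 0 \<Longrightarrow> Ck_on k \<Omega> (\<lambda>y. w y t)"
  using Ck_on_slice[OF smooth_on_Ck[OF w_smooth] \<Omega>(1)] by simp

lemma w_frontier: "x \<in> frontier \<Omega> \<Longrightarrow> w x t = 0"
  using w_out frontier_not_in by blast

lemma w_heat_solution: "heat_solution \<Omega> (projected_datum \<Omega> u0) w"
  unfolding heat_solution_def
proof (intro conjI ballI allI impI)
  show "continuous_on (closure \<Omega> \<times> {0<..}) (\<lambda>(x, t). w x t)" using w_cont by (simp add: case_prod_unfold)
  show "C21_on \<Omega> w" by (rule smooth_on_imp_C21_on[OF \<Omega>(1) w_smooth])
  show "deriv (\<lambda>s. w x s) t = laplacian (\<lambda>y. w y t) x" if "x \<in> \<Omega>" "0 < t" for x t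
    using w_heat[OF that] by (rule DERIV_imp_deriv)
  show "w x t = 0" if "x \<in> frontier \<Omega>" for x t using that by (rule w_frontier)
  show "uniform_limit \<Omega> (\<lambda>t x. w x t) (projected_datum \<Omega> u0) (at_right 0)"
  proof (rule uniform_limitI)
    fix e :: real assume "e > 0"
    then obtain d where d: "d > 0" "\<And>p q. dist q p < d \<Longrightarrow> dist (w (fst q) (snd q)) (w (fst p) (snd p)) < e"
      using w_uc unfolding uniformly_continuous_on_def case_prod_unfold by (metis UNIV_I)
    have "dist (w x t) (projected_datum \<Omega> u0 x) < e" if "0 < t" "t < d" "x \<in> \<Omega>" for x t
      using d(2)[of "(x, t)" "(x, 0)"] that w_init[OF that(3)] by (simp add: dist_prod_def)
    then show "\<forall>\<^sub>F t in at_right 0. \<forall>x\<in>\<Omega>. dist (w x t) (projected_datum \<Omega> u0 x) < e"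
      unfolding eventually_at_right_field using d(1) by blast
  qed
qed

text \<open>A competitor, taken constant in time, is a viscosity subsolution of the heat equation,
  and a time slice of the smooth \<open>w\<close> can serve as its test function. At an interior
  maximum of the penalised difference this test makes the Laplacian of \<open>w\<close> nonnegative,
  whereas vanishing of the time derivative makes it negative.\<close>

lemma competitor_le_w:
  assumes v: "competitor \<Omega> u0 v" and x: "x \<in> closure \<Omega>" and t: "t \<ge> 0"
  shows "v x \<le> w x t"
proof (rule field_le_epsilon)
  fix e :: real assume e: "e > 0"
  define \<epsilon> where "\<epsilon> = e / (t + 1)"
  have \<epsilon>: "\<epsilon> > 0" "\<epsilon> * (t + 1) = e" using e t by (auto simp: \<epsilon>_def)
  have sv: "laplace_viscosity_subsolution \<Omega> v" "\<And>y. y \<in> frontier \<Omega> \<Longrightarrow> v y \<le> 0"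
    using v by (auto simp: competitor_def)
  define d where "d p = v (fst p) - (w (fst p) (snd p) + \<epsilon> * snd p)" for p
  have "d (x, t) \<le> 0"
  proof (rule ccontr)
    assume neg: "\<not> d (x, t) \<le> 0"
    obtain L m x0 t0 where m: "L \<ge> 0" "x0 \<in> \<Omega>" "0 < t0" "t0 < t + 1"
      "local_max_at (\<Omega> \<times> {0<..}) (\<lambda>p. d p - L * (snd p / (t + 1)) ^ Suc m) (x0, t0)"
    proof (rule penalised_max[OF \<Omega> order_refl, where S = "t + 1" and d = d and ?x1.0 = x and ?t1.0 = t])
      have "usc_on (closure \<Omega>) v" using sv by (simp add: laplace_viscosity_subsolution_def)
      then show "usc_on (closure \<Omega> \<times> {0..t + 1}) d"
        unfolding d_def by (intro usc_on_diff_continuous usc_on_fst continuous_intros w_cont)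
      show "d (y, s) \<le> 0" if "y \<in> frontier \<Omega>" "0 \<le> s" for y s
      proof -
        have "0 \<le> \<epsilon> * s" using \<epsilon> that by simp
        then show ?thesis using sv(2)[OF that(1)] w_frontier[OF that(1), of s] by (simp add: d_def)
      qed
      show "d (y, 0) \<le> 0" if y: "y \<in> closure \<Omega>" for y
      proof (cases "y \<in> \<Omega>")
        case True
        then show ?thesis using projected_datum_ge[OF v y] w_init by (simp add: d_def)
      next
        case False
        then have "y \<in> frontier \<Omega>" using closure_cases[OF y] by blast
        then show ?thesis using sv(2) w_frontier[of y 0] by (simp add: d_def)
      qed
    qed (use t x neg in auto)
    note sl = local_max_slices[OF m(5)]
    define c where "c = L * (t0 / (t + 1)) ^ Suc m"
    have "local_max_at \<Omega> (\<lambda>y. v y - (w y t0 + \<epsilon> * t0) - c) x0" using sl(1) by (simp add: d_def c_def)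
    then have "local_max_at \<Omega> (\<lambda>y. v y - w y t0) x0" by (simp add: local_max_at_def)
    moreover have "smooth_on \<Omega> (\<lambda>y. w y t0)" using w_slice[OF m(3)] by (simp add: smooth_on_def)
    ultimately have "0 \<le> laplacian (\<lambda>y. w y t0) x0"
      using sv(1) unfolding laplace_viscosity_subsolution_def by fastforce
    moreover have "0 - (laplacian (\<lambda>y. w y t0) x0 + \<epsilon>) - L * (Suc m * (t0 / (t + 1)) ^ m / (t + 1)) = 0"
    proof (rule max_time_derivative)
      show "\<exists>r>0. \<forall>s. \<bar>s - t0\<bar> < r \<longrightarrow> v x0 - (w x0 s + \<epsilon> * s) - L * (s / (t + 1)) ^ Suc m
          \<le> v x0 - (w x0 t0 + \<epsilon> * t0) - L * (t0 / (t + 1)) ^ Suc m"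
        using sl(2) by (simp add: d_def)
      have "((\<lambda>s. \<epsilon> * s) has_real_derivative \<epsilon>) (at t0)" by (auto intro!: derivative_eq_intros)
      then show "((\<lambda>s. v x0 - (w x0 s + \<epsilon> * s) - L * (s / (t + 1)) ^ Suc m) has_real_derivative
          0 - (laplacian (\<lambda>y. w y t0) x0 + \<epsilon>) - L * (Suc m * (t0 / (t + 1)) ^ m / (t + 1))) (at t0)"
        by (intro DERIV_diff DERIV_add DERIV_const penalty_derivative w_heat m)
    qed
    moreover have "L * (Suc m * (t0 / (t + 1)) ^ m / (t + 1)) \<ge> 0"
      using m t by (intro mult_nonneg_nonneg divide_nonneg_nonneg) auto
    ultimately show False using \<epsilon> by linarith
  qed
  then have "v x \<le> w x t + \<epsilon> * t" by (simp add: d_def)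
  also have "\<epsilon> * t \<le> e" using \<epsilon> by (simp add: algebra_simps)
  finally show "v x \<le> w x t + e" by simp
qed

lemma datum_le_w:
  assumes "x \<in> closure \<Omega>" "t \<ge> 0"
  shows "projected_datum \<Omega> u0 x \<le> w x t"
  by (rule competitor_exists, rule projected_datum_le) (use competitor_le_w assms in auto)

lemma w_initial_le_u0: "x \<in> closure \<Omega> \<Longrightarrow> w x 0 \<le> u0 x"
  using datum_le_u0[of x] w_init[of x] closure_cases[of x] w_frontier[of x 0] u00[of x] by fastforce

lemma classical_data:
  assumes x: "x \<in> \<Omega>" "t > 0" and q: "Ck_on 2 \<Omega> q" and c: "(c has_real_derivative c') (at t)"
  shows "((\<lambda>s. a * w x s + c s * q x) has_real_derivative a * laplacian (\<lambda>y. w y t) x + c' * q x) (at t)"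
    "Ck_on 2 \<Omega> (\<lambda>y. a * w y t + c t * q y)"
    "laplacian (\<lambda>y. a * w y t + c t * q y) x = a * laplacian (\<lambda>y. w y t) x + c t * laplacian q x"
proof -
  have 1: "Ck_on 2 \<Omega> (\<lambda>y. a * w y t)" and 2: "Ck_on 2 \<Omega> (\<lambda>y. c t * q y)"
    by (intro Ck_on_mult Ck_on_const w_slice q x \<Omega>)+
  show "Ck_on 2 \<Omega> (\<lambda>y. a * w y t + c t * q y)" by (rule Ck_on_add[OF \<Omega>(1) 1 2])
  show "laplacian (\<lambda>y. a * w y t + c t * q y) x = a * laplacian (\<lambda>y. w y t) x + c t * laplacian q x"
    using laplacian_add[OF \<Omega>(1) x(1) 1 2] laplacian_cmult[OF \<Omega>(1) x(1) w_slice[OF x(2)], of a]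
      laplacian_cmult[OF \<Omega>(1) x(1) q, of "c t"] by simp
  show "((\<lambda>s. a * w x s + c s * q x) has_real_derivative a * laplacian (\<lambda>y. w y t) x + c' * q x) (at t)"
    by (intro DERIV_add DERIV_cmult w_heat x DERIV_cmult_right c)
qed

text \<open>All competitors stay below the flow, hence so does their supremum, the initial datum:
  the order holds between the times 0 and \<open>\<sigma>\<close>. Comparing the flow with its
  translate by \<open>\<sigma>\<close> propagates this order to all times.\<close>

lemma w_mono:
  assumes x: "x \<in> closure \<Omega>" and t: "t \<ge> 0" and \<sigma>: "\<sigma> \<ge> 0"
  shows "w x t \<le> w x (t + \<sigma>)"
proof (rule field_le_epsilon)
  fix e :: real assume e: "e > 0"
  define \<epsilon> where "\<epsilon> = e / (t + 1)"
  have \<epsilon>: "\<epsilon> > 0" "\<epsilon> * (t + 1) = e" using e t by (auto simp: \<epsilon>_def)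
  define d where "d y s = (1 * w y s + - \<epsilon> * s * 1) + - 1 * w y (s + \<sigma>)" for y s
  have "d x t \<le> 0"
  proof (rule classical_comparison[OF \<Omega> order_refl, where d = d])
    show "continuous_on (closure \<Omega> \<times> {0..}) (\<lambda>(x, t). d x t)"
      unfolding d_def case_prod_unfold by (intro continuous_intros w_cont_compose)
  next
    fix y s assume y: "y \<in> \<Omega>" "0 < (s::real)"
    have s\<sigma>: "0 < s + \<sigma>" using y \<sigma> by simp
    have c: "((\<lambda>s. - \<epsilon> * s) has_real_derivative - \<epsilon>) (at s)" by (auto intro!: derivative_eq_intros)
    note cd = classical_data[OF y Ck_on_const[where c = 1] c, of 1]
    have 2: "Ck_on 2 \<Omega> (\<lambda>y. - 1 * w y (s + \<sigma>))" by (intro Ck_on_mult Ck_on_const w_slice s\<sigma> \<Omega>)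
    have "((\<lambda>r. w y (r + \<sigma>)) has_real_derivative laplacian (\<lambda>y. w y (s + \<sigma>)) y) (at s)"
      using w_heat[OF y(1) s\<sigma>] DERIV_shift[of "w y" _ s \<sigma>] by simp
    then have D: "((\<lambda>r. d y r) has_real_derivative
        (1 * laplacian (\<lambda>y. w y s) y + - \<epsilon> * 1) + - 1 * laplacian (\<lambda>y. w y (s + \<sigma>)) y) (at s)"
      unfolding d_def by (intro DERIV_add cd(1) DERIV_cmult)
    have L: "laplacian (\<lambda>y. d y s) y = laplacian (\<lambda>y. w y s) y - laplacian (\<lambda>y. w y (s + \<sigma>)) y"
      unfolding d_def using laplacian_add[OF \<Omega>(1) y(1) cd(2) 2] cd(3)
        laplacian_cmult[OF \<Omega>(1) y(1) w_slice[OF s\<sigma>], of "- 1"] laplacian_const[of 1 y] by simp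
    have "Ck_on 2 \<Omega> (\<lambda>y. d y s)" unfolding d_def by (rule Ck_on_add[OF \<Omega>(1) cd(2) 2])
    then show "\<exists>D. ((\<lambda>r. d y r) has_real_derivative D) (at s) \<and> Ck_on 2 \<Omega> (\<lambda>y. d y s) \<and> D < laplacian (\<lambda>y. d y s) y"
      using D L \<epsilon> by (intro exI conjI) (assumption+, simp)
  next
    show "d y s \<le> 0" if "y \<in> frontier \<Omega>" "0 \<le> s" for y s
      using that \<epsilon> by (simp add: d_def w_frontier)
    show "d y 0 \<le> 0" if y: "y \<in> closure \<Omega>" for y
    proof (cases "y \<in> \<Omega>")
      case True
      then show ?thesis using datum_le_w[OF y \<sigma>] w_init by (simp add: d_def)
    next
      case False
      then show ?thesis by (simp add: d_def w_out)
    qed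
  qed (use x t in auto)
  then have "w x t \<le> w x (t + \<sigma>) + \<epsilon> * t" by (simp add: d_def)
  also have "\<epsilon> * t \<le> e" using \<epsilon> by (simp add: algebra_simps)
  finally show "w x t \<le> w x (t + \<sigma>) + e" by simp
qed

text \<open>The Laplacian is the time derivative, so a negative value would make \<open>w\<close>
  strictly smaller shortly afterwards, against monotonicity in time.\<close>

lemma w_subharmonic:
  assumes x: "x \<in> \<Omega>" and t: "t > 0"
  shows "0 \<le> laplacian (\<lambda>y. w y t) x"
proof (rule ccontr)
  assume "\<not> ?thesis"
  then obtain d where d: "d > 0" "\<forall>h>0. h < d \<longrightarrow> w x (t + h) < w x t"
    using DERIV_neg_dec_right[OF w_heat[OF x t]] by auto
  have "x \<in> closure \<Omega>" using x closure_subset by blast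
  then have "w x t \<le> w x (t + d / 2)" using t d by (intro w_mono) auto
  moreover have "w x (t + d / 2) < w x t" using d by simp
  ultimately show False by simp
qed

text \<open>Both \<open>w\<close> and \<open>- w\<close> are compared with K exp(-l t) (2 R^2 -
  |x|^2), a strict supersolution of the heat equation that is nonnegative on the boundary and
  initially at least \<open>M\<close>.\<close>

lemma w_decay: "uniform_limit (closure \<Omega>) (\<lambda>t x. w x t) (\<lambda>x. 0) at_top"
proof -
  obtain R where R: "R > 0" "\<And>x. x \<in> closure \<Omega> \<Longrightarrow> norm x \<le> R"
    using compact_imp_bounded[OF compact_closure] unfolding bounded_pos by blast
  obtain M where M: "M > 0" "\<And>x. x \<in> closure \<Omega> \<Longrightarrow> \<bar>u0 x\<bar> \<le> M" using u0_bounded by blast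
  have w0: "\<bar>w x 0\<bar> \<le> M" if x: "x \<in> closure \<Omega>" for x
  proof -
    have "- M \<le> w x 0" using competitor_le_w[OF competitor_const[OF \<Omega>(1) M(2)] x] M(1) by simp
    then show ?thesis using w_initial_le_u0[OF x] M(2)[OF x] by simp
  qed
  define N where "N = real DIM('a)"
  have N: "N \<ge> 1" by (simp add: N_def DIM_ge_Suc0)
  \<comment> \<open>The profile \<open>q\<close> is at most \<open>2 * R\<^sup>2\<close> and has
    Laplacian \<open>- 2 * N\<close>. This rate gives \<open>l * q y \<le> N\<close>, half of what
    the differential inequality allows, hence strictness.\<close>
  define l where "l = N / (2 * R\<^sup>2)"
  have l: "l > 0" using N R by (simp add: l_def)
  define K where "K = M / R\<^sup>2"
  have K: "K > 0" using M R by (simp add: K_def)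
  define q where "q y = (- 1) * (norm (y - 0))\<^sup>2 + 2 * R\<^sup>2" for y :: 'a
  have q: "R\<^sup>2 \<le> q y" "q y \<le> 2 * R\<^sup>2" if "y \<in> closure \<Omega>" for y
  proof -
    have "(norm y)\<^sup>2 \<le> R\<^sup>2" using R(2)[OF that] by (intro power_mono) auto
    then show "R\<^sup>2 \<le> q y" "q y \<le> 2 * R\<^sup>2" by (auto simp: q_def)
  qed
  have sq: "smooth_on UNIV (\<lambda>y::'a. (- 1) * (norm (y - 0))\<^sup>2)"
    by (intro smooth_on_mult smooth_on_const smooth_on_dist_sq open_UNIV)
  have Cq: "Ck_on 2 \<Omega> q"
    unfolding q_def using smooth_on_add[OF open_UNIV sq smooth_on_const] Ck_on_subset[OF smooth_on_Ck] by blast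
  have Lq: "laplacian q y = - 2 * N" for y
  proof -
    have "laplacian q y = laplacian (\<lambda>y::'a. (- 1) * (norm (y - 0))\<^sup>2) y"
      unfolding q_def by (rule laplacian_add_const[OF open_UNIV UNIV_I smooth_on_Ck[OF sq]])
    also have "\<dots> = (- 1) * laplacian (\<lambda>y::'a. (norm (y - 0))\<^sup>2) y"
      by (intro laplacian_cmult[OF open_UNIV UNIV_I] smooth_on_Ck smooth_on_dist_sq open_UNIV)
    finally show ?thesis unfolding laplacian_dist_sq by (simp add: N_def)
  qed
  have cq: "continuous_on S (\<lambda>p. q (f p))" if "continuous_on S f" for S and f :: "'a \<times> real \<Rightarrow> 'a"
    unfolding q_def by (intro continuous_intros that)
  have one: "a * w x t \<le> K * exp (- l * t) * (2 * R\<^sup>2)" if a: "a = 1 \<or> a = - 1" and x: "x \<in> closure \<Omega>" and t: "t \<ge> 0" for a x t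
  proof -
    define c where "c s = - K * exp (- l * s)" for s
    have dc: "(c has_real_derivative K * l * exp (- l * s)) (at s)" for s
      unfolding c_def by (auto intro!: derivative_eq_intros)
    have "a * w x t + c t * q x \<le> 0"
    proof (rule classical_comparison[OF \<Omega> order_refl, where d = "\<lambda>y s. a * w y s + c s * q y"])
      show "continuous_on (closure \<Omega> \<times> {0..}) (\<lambda>(y, s). a * w y s + c s * q y)"
        unfolding case_prod_unfold c_def by (intro continuous_intros w_cont_compose cq)
    next
      fix y s assume y: "y \<in> \<Omega>" "0 < (s::real)"
      note cd = classical_data[OF y Cq dc, of a]
      have yc: "y \<in> closure \<Omega>" using y(1) closure_subset by blast
      have E: "K * exp (- l * s) > 0" using K by simp
      have "l * q y \<le> l * (2 * R\<^sup>2)" using q(2)[OF yc] l by (intro mult_left_mono) auto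
      also have "\<dots> < 2 * N" using N R by (simp add: l_def)
      finally have "(K * exp (- l * s)) * (l * q y) < (K * exp (- l * s)) * (2 * N)"
        using E by (rule mult_strict_left_mono)
      then have lt: "a * laplacian (\<lambda>y. w y s) y + K * l * exp (- l * s) * q y < laplacian (\<lambda>y. a * w y s + c s * q y) y"
        unfolding cd(3) Lq by (simp add: c_def algebra_simps)
      show "\<exists>D. ((\<lambda>s. a * w y s + c s * q y) has_real_derivative D) (at s) \<and> Ck_on 2 \<Omega> (\<lambda>y. a * w y s + c s * q y) \<and>
          D < laplacian (\<lambda>y. a * w y s + c s * q y) y"
        using cd(1,2) lt by blast
    next
      fix y s assume y: "y \<in> frontier \<Omega>"
      have "0 \<le> q y" using q(1)[OF frontier_in_closure[OF y]] R(1) by (meson order_trans zero_le_power2)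
      then show "a * w y s + c s * q y \<le> 0" using K by (simp add: w_frontier[OF y] c_def)
    next
      fix y assume y: "y \<in> closure \<Omega>"
      have "K * R\<^sup>2 \<le> K * q y" using q(1)[OF y] K by (intro mult_left_mono) auto
      moreover have "K * R\<^sup>2 = M" using R by (simp add: K_def)
      moreover have "a * w y 0 \<le> M" using a w0[OF y] by auto
      ultimately show "a * w y 0 + c 0 * q y \<le> 0" by (simp add: c_def)
    qed (use x t in auto)
    then have "a * w x t \<le> K * exp (- l * t) * q x" by (simp add: c_def)
    also have "\<dots> \<le> K * exp (- l * t) * (2 * R\<^sup>2)" using q(2)[OF x] K by (intro mult_left_mono) auto
    finally show ?thesis .
  qed
  show ?thesis
  proof (rule uniform_limitI)
    fix e :: real assume e: "e > 0"
    have "((\<lambda>t. K * exp (- l * t) * (2 * R\<^sup>2)) \<longlongrightarrow> K * 0 * (2 * R\<^sup>2)) at_top"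
    proof (intro tendsto_mult tendsto_const)
      have "filterlim (\<lambda>t. - l * t) at_bot at_top"
        using filterlim_tendsto_neg_mult_at_bot[OF tendsto_const _ filterlim_ident, of "- l"] l by simp
      then show "((\<lambda>t. exp (- l * t)) \<longlongrightarrow> 0) at_top" by (rule filterlim_compose[OF exp_at_bot])
    qed
    then have "\<forall>\<^sub>F t in at_top. K * exp (- l * t) * (2 * R\<^sup>2) < e" using e by (intro order_tendstoD) auto
    then show "\<forall>\<^sub>F t in at_top. \<forall>x\<in>closure \<Omega>. dist (w x t) 0 < e"
      using eventually_ge_at_top[of "0::real"]
    proof eventually_elim
      case (elim t)
      have "\<bar>w x t\<bar> < e" if "x \<in> closure \<Omega>" for x
        using one[of 1 x t] one[of "- 1" x t] elim that by auto
      then show ?case by simp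
    qed
  qed
qed

text \<open>Rescaled in time, \<open>w\<close> solves the nonlinear equation itself since \<open>\<partial>\<^sub>t w \<ge> 0\<close>.\<close>

lemma rescaled_test:
  fixes bp k c :: real
  assumes bp: "bp > 0"
  defines "\<phi> \<equiv> \<lambda>p. w (fst p) (snd p / bp) + (k * snd p + c)"
  shows "smooth_on (\<Omega> \<times> {0<..}) \<phi>" "continuous_on S \<phi>"
    "\<And>x t. x \<in> \<Omega> \<Longrightarrow> t > 0 \<Longrightarrow> deriv (\<lambda>s. \<phi> (x, s)) t = laplacian (\<lambda>y. w y (t / bp)) x / bp + k"
    "\<And>x t. x \<in> \<Omega> \<Longrightarrow> t > 0 \<Longrightarrow> laplacian (\<lambda>y. \<phi> (y, t)) x = laplacian (\<lambda>y. w y (t / bp)) x"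
proof -
  have "smooth_on (\<Omega> \<times> {0<..}) (\<lambda>p. w (fst p) (snd p / bp))"
    using smooth_on_rescale_time[OF \<Omega>(1) w_smooth bp] by simp
  moreover have "smooth_on (\<Omega> \<times> {0<..}) (\<lambda>p. k * snd p + c)"
    by (intro smooth_on_add smooth_on_mult smooth_on_const smooth_on_linear bounded_linear_snd oQ)
  ultimately show "smooth_on (\<Omega> \<times> {0<..}) \<phi>" unfolding \<phi>_def by (rule smooth_on_add[OF oQ])
  show "continuous_on S \<phi>" unfolding \<phi>_def using bp by (intro continuous_intros w_cont_compose) auto
  fix x and t :: real assume x: "x \<in> \<Omega>" and t: "t > 0"
  have tb: "t / bp > 0" using t bp by simp
  have "((\<lambda>s. w x (s / bp)) has_real_derivative laplacian (\<lambda>y. w y (t / bp)) x * (1 / bp)) (at t)"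
    by (rule DERIV_chain2[where g = "\<lambda>s. s / bp", OF w_heat[OF x tb] DERIV_cdivide[OF DERIV_ident]])
  moreover have "((\<lambda>s. k * s + c) has_real_derivative k) (at t)" by (auto intro!: derivative_eq_intros)
  ultimately have "((\<lambda>s. \<phi> (x, s)) has_real_derivative laplacian (\<lambda>y. w y (t / bp)) x * (1 / bp) + k) (at t)"
    unfolding \<phi>_def fst_conv snd_conv by (rule DERIV_add)
  then show "deriv (\<lambda>s. \<phi> (x, s)) t = laplacian (\<lambda>y. w y (t / bp)) x / bp + k"
    by (simp add: DERIV_imp_deriv)
  show "laplacian (\<lambda>y. \<phi> (y, t)) x = laplacian (\<lambda>y. w y (t / bp)) x"
    unfolding \<phi>_def fst_conv snd_conv by (rule laplacian_add_const[OF \<Omega>(1) x w_slice[OF tb]])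
qed

text \<open>Subtracting \<epsilon> s turns the rescaled flow into a strict subsolution on both
  branches of the nonlinearity: a nonnegative slope yields \<open>L - bp * \<epsilon>\<close>, and a
  negative slope yields a negative number, which is below \<open>L \<ge> 0\<close>.\<close>

lemma flow_le_solution:
  assumes b: "bm > 0" "bp > 0" and u: "parabolic_viscosity_solution \<Omega> bm bp u0 u"
    and x: "x \<in> closure \<Omega>" and s: "s \<ge> 0"
  shows "w x (s / bp) \<le> u x s"
proof (rule field_le_epsilon)
  fix e :: real assume e: "e > 0"
  define \<epsilon> where "\<epsilon> = e / (s + 1)"
  have \<epsilon>: "\<epsilon> > 0" "\<epsilon> * (s + 1) = e" using e s by (auto simp: \<epsilon>_def)
  note rt = rescaled_test[OF b(2), where k = "- \<epsilon>" and c = 0]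
  have ub: "\<And>y. y \<in> closure \<Omega> \<Longrightarrow> u y 0 = u0 y" "\<And>y t. y \<in> frontier \<Omega> \<Longrightarrow> t \<ge> 0 \<Longrightarrow> u y t = 0"
    using viscosity_solution_boundary[OF u cu0 u00] by blast+
  let ?\<phi> = "\<lambda>p. w (fst p) (snd p / bp) + (- \<epsilon> * snd p + 0)"
  have "?\<phi> (x, s) \<le> u x s"
  proof (rule viscosity_super_comparison[OF \<Omega> order_refl b u rt(1) rt(2)])
    fix y t assume y: "y \<in> \<Omega>" "0 < (t::real)"
    define L where "L = laplacian (\<lambda>y. w y (t / bp)) y"
    have "t / bp > 0" using y b by simp
    then have L: "L \<ge> 0" unfolding L_def by (rule w_subharmonic[OF y(1)])
    have "beta bm bp (L / bp + - \<epsilon>) < L"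
    proof (cases "L / bp + - \<epsilon> < 0")
      case True
      then have "bm * (L / bp + - \<epsilon>) < 0" using b(1) by (simp add: mult_less_0_iff)
      then show ?thesis using True L unfolding beta_def b_coeff_def by simp
    next
      case False
      have "bp * (L / bp + - \<epsilon>) = L - bp * \<epsilon>" using b by (simp add: field_simps)
      moreover have "bp * \<epsilon> > 0" using b \<epsilon> by simp
      ultimately show ?thesis using False unfolding beta_def b_coeff_def by simp
    qed
    then show "beta bm bp (deriv (\<lambda>s. ?\<phi> (y, s)) t) < laplacian (\<lambda>y. ?\<phi> (y, t)) y"
      unfolding rt(3)[OF y] rt(4)[OF y] L_def .
  next
    show "?\<phi> (y, t) \<le> u y t" if "y \<in> frontier \<Omega>" "0 \<le> t" for y t
      using that ub(2)[OF that] \<epsilon> by (simp add: w_frontier)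
    show "?\<phi> (y, 0) \<le> u y 0" if "y \<in> closure \<Omega>" for y
      using w_initial_le_u0[OF that] ub(1)[OF that] by simp
  qed (use x s in auto)
  then have "w x (s / bp) \<le> u x s + \<epsilon> * s" by simp
  also have "\<epsilon> * s \<le> e" using \<epsilon> by (simp add: algebra_simps)
  finally show "w x (s / bp) \<le> u x s + e" by simp
qed

text \<open>The comparison begins at time \<open>bp * \<delta>\<close>, when the solution has
  dropped to the projected datum up to \<open>\<epsilon>\<close>. The flow at time
  \<open>\<delta>\<close> lies above that datum as well, so the flow can be used without a shift in
  time. Adding k s makes the slope strictly positive, where the weight is \<open>bp\<close>.\<close>

lemma solution_le_flow:
  assumes b: "bm > 0" "bp > 0" and u: "parabolic_viscosity_solution \<Omega> bm bp u0 u" and \<delta>: "\<delta> > 0" and \<epsilon>: "\<epsilon> > 0"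
    and init: "\<And>x. x \<in> closure \<Omega> \<Longrightarrow> u x (bp * \<delta>) \<le> projected_datum \<Omega> u0 x + \<epsilon>"
    and x: "x \<in> closure \<Omega>" and s: "s \<ge> bp * \<delta>"
  shows "u x s \<le> w x (s / bp) + \<epsilon>"
proof (rule field_le_epsilon)
  fix e :: real assume e: "e > 0"
  have s0: "s \<ge> 0" using s b \<delta> by (meson less_imp_le mult_pos_pos order_trans)
  define k where "k = e / (s + 1)"
  have k: "k > 0" "k * (s + 1) = e" using e s0 by (auto simp: k_def)
  note rt = rescaled_test[OF b(2), where k = k and c = \<epsilon>]
  have ub: "\<And>y t. y \<in> frontier \<Omega> \<Longrightarrow> t \<ge> 0 \<Longrightarrow> u y t = 0"
    using viscosity_solution_boundary[OF u cu0 u00] by blast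
  have a: "0 \<le> bp * \<delta>" using b \<delta> by simp
  let ?\<phi> = "\<lambda>p. w (fst p) (snd p / bp) + (k * snd p + \<epsilon>)"
  have "u x s \<le> ?\<phi> (x, s)"
  proof (rule viscosity_sub_comparison[OF \<Omega> a b u rt(1) rt(2)])
    fix y t assume y: "y \<in> \<Omega>" "bp * \<delta> < t"
    then have t: "t > 0" using a by simp
    define L where "L = laplacian (\<lambda>y. w y (t / bp)) y"
    have "t / bp > 0" using t b by simp
    then have L: "L \<ge> 0" unfolding L_def by (rule w_subharmonic[OF y(1)])
    have "0 \<le> L / bp" using L b by simp
    then have "\<not> L / bp + k < 0" using k by simp
    moreover have "bp * (L / bp + k) = L + bp * k" using b by (simp add: field_simps)
    moreover have "bp * k > 0" using b k by simp
    ultimately have "L < beta bm bp (L / bp + k)" unfolding beta_def b_coeff_def by simp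
    then show "laplacian (\<lambda>y. ?\<phi> (y, t)) y < beta bm bp (deriv (\<lambda>s. ?\<phi> (y, s)) t)"
      unfolding rt(3)[OF y(1) t] rt(4)[OF y(1) t] L_def .
  next
    fix y t assume y: "y \<in> frontier \<Omega>" "bp * \<delta> \<le> t"
    then have "0 \<le> t" using a by simp
    moreover from this have "0 \<le> k * t" using k by simp
    ultimately show "u y t \<le> ?\<phi> (y, t)" using ub[OF y(1)] \<epsilon> by (simp add: w_frontier[OF y(1)])
  next
    fix y assume y: "y \<in> closure \<Omega>"
    have "u y (bp * \<delta>) \<le> w y \<delta> + \<epsilon>" using init[OF y] datum_le_w[OF y, of \<delta>] \<delta> by simp
    moreover have "0 \<le> k * (bp * \<delta>)" using k a by simp
    ultimately show "u y (bp * \<delta>) \<le> ?\<phi> (y, bp * \<delta>)" using b by simp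
  qed (use x s in auto)
  also have "?\<phi> (x, s) = w x (s / bp) + k * s + \<epsilon>" by simp
  also have "k * s \<le> e" using k by (simp add: algebra_simps)
  finally show "u x s \<le> w x (s / bp) + \<epsilon> + e" by simp
qed

text \<open>The order of the choices matters: the tolerance fixes \<open>\<kappa>\<close>, then the
  window \<open>\<delta>\<close> and the size \<open>C\<close> of the penalty are chosen, all
  independent of \<open>bp\<close>; only then is \<open>bp\<close> taken so large that the remaining
  error \<open>A / bp\<close> is below \<open>e / 2\<close>. The lower bound by the flow holds for
  each \<open>bp > bm\<close> and also supplies the lower half of the bound
  \<open>M1\<close>.\<close>

lemma fast_limit:
  fixes u :: "real \<Rightarrow> 'a \<Rightarrow> real \<Rightarrow> real"
  assumes bm: "bm > 0" and u: "\<And>bp. bp > bm \<Longrightarrow> parabolic_viscosity_solution \<Omega> bm bp u0 (u bp)"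
    and e: "e > 0" and \<delta>0: "\<delta>0 > 0"
  shows "\<forall>\<^sub>F bp in at_top. \<forall>x\<in>closure \<Omega>. \<forall>t\<ge>\<delta>0. \<bar>u bp x (bp * t) - w x t\<bar> \<le> e"
proof -
  have e2: "e / 2 > 0" using e by simp
  obtain \<kappa> where \<kappa>: "\<kappa> > 0" "\<And>bp u x s. bp > 0 \<Longrightarrow> parabolic_viscosity_solution \<Omega> bm bp u0 u \<Longrightarrow> x \<in> closure \<Omega> \<Longrightarrow>
     0 \<le> s \<Longrightarrow> s \<le> \<kappa> * bp \<Longrightarrow> u x s \<le> u0 x + e / 2"
    using initial_upper_bound[OF e2 bm] by blast
  obtain M where M: "M > 0" "\<And>x. x \<in> closure \<Omega> \<Longrightarrow> \<bar>u0 x\<bar> \<le> M" using u0_bounded by blast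
  obtain R where R: "R > 0" "\<And>x. x \<in> closure \<Omega> \<Longrightarrow> norm x \<le> R"
    using compact_imp_bounded[OF compact_closure] unfolding bounded_pos by blast
  define \<delta> where "\<delta> = min (\<kappa> / 2) \<delta>0"
  have \<delta>: "\<delta> > 0" "2 * \<delta> \<le> \<kappa>" "\<delta> \<le> \<delta>0" using \<kappa> \<delta>0 by (auto simp: \<delta>_def)
  define M1 where "M1 = M + e / 2"
  define C where "C = (2 * M1 + 1) / \<delta>\<^sup>2"
  have C: "C > 0" "2 * M1 < C * \<delta>\<^sup>2" using M e \<delta> by (auto simp: C_def M1_def)
  define A where "A = C * \<delta> * bm * R\<^sup>2 / DIM('a)"
  have "((\<lambda>bp. A / bp) \<longlongrightarrow> 0) at_top" by (rule tendsto_divide_0[OF tendsto_const filterlim_at_top_imp_at_infinity[OF filterlim_ident]])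
  then have "\<forall>\<^sub>F bp in at_top. A / bp < e / 2" using e2 by (rule order_tendstoD)
  then show ?thesis using eventually_gt_at_top[of bm]
  proof eventually_elim
    case (elim bp)
    have bp: "bp > 0" using elim bm by simp
    note ubp = u[OF elim(2)]
    have up: "u bp x (bp * t) \<le> u0 x + e / 2" if "x \<in> closure \<Omega>" "0 \<le> t" "t \<le> 2 * \<delta>" for x t
    proof (rule \<kappa>(2)[OF bp ubp that(1)])
      show "0 \<le> bp * t" using bp that by simp
      have "bp * t \<le> bp * \<kappa>" using that \<delta> bp by (intro mult_left_mono) auto
      then show "bp * t \<le> \<kappa> * bp" by (simp add: mult.commute)
    qed
    have low: "w x t \<le> u bp x (bp * t)" if "x \<in> closure \<Omega>" "0 \<le> t" for x t
      using flow_le_solution[OF bm bp ubp that(1), of "bp * t"] bp that by simp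
    have bnd: "\<bar>u bp x (bp * t)\<bar> \<le> M1" if x: "x \<in> closure \<Omega>" and t: "0 \<le> t" "t \<le> 2 * \<delta>" for x t
    proof -
      have "- M \<le> w x t" using competitor_le_w[OF competitor_const[OF \<Omega>(1) M(2)] x t(1)] M(1) by simp
      then show ?thesis using low[OF x t(1)] up[OF x t] M(2)[OF x] e by (simp add: M1_def abs_le_iff)
    qed
    have init: "u bp x (bp * \<delta>) \<le> projected_datum \<Omega> u0 x + e" if x: "x \<in> closure \<Omega>" for x
    proof -
      have "u bp x (bp * \<delta>) \<le> projected_datum \<Omega> u0 x + e / 2 + C * \<delta> * bm * R\<^sup>2 / (DIM('a) * bp)"
        by (rule fast_projection[OF bm bp ubp \<delta>(1) bnd up C R(2) x])
      also have "C * \<delta> * bm * R\<^sup>2 / (DIM('a) * bp) = A / bp" by (simp add: A_def)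
      finally show ?thesis using elim(1) by linarith
    qed
    have "\<bar>u bp x (bp * t) - w x t\<bar> \<le> e" if x: "x \<in> closure \<Omega>" and t: "t \<ge> \<delta>0" for x t
    proof -
      have "bp * \<delta> \<le> bp * t" using t \<delta> bp by (intro mult_left_mono) auto
      then have "u bp x (bp * t) \<le> w x (bp * t / bp) + e"
        by (intro solution_le_flow[OF bm bp ubp \<delta>(1) e init x])
      then show ?thesis using low[OF x, of t] t \<delta>0 bp by (simp add: abs_le_iff)
    qed
    then show ?case by blast
  qed
qed

end

theorem theorem1p4:
  fixes \<Omega> :: "'a::euclidean_space set"
    and u0 :: "'a \<Rightarrow> real"
    and bm :: real
    and u :: "real \<Rightarrow> 'a \<Rightarrow> real \<Rightarrow> real"
  assumes "bounded_smooth_domain \<Omega>"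
    and "continuous_on (closure \<Omega>) u0"
    and "\<forall>x\<in>frontier \<Omega>. u0 x = 0"
    and "bm > 0"
    and "\<forall>bp>bm. parabolic_viscosity_solution \<Omega> bm bp u0 (u bp)"
  shows "\<exists>w. heat_solution \<Omega> (projected_datum \<Omega> u0) w \<and>
     (\<forall>w'. heat_solution \<Omega> (projected_datum \<Omega> u0) w' \<longrightarrow>
        (\<forall>x\<in>closure \<Omega>. \<forall>t>0. w' x t = w x t)) \<and>
     (\<forall>K. compact K \<and> K \<subseteq> closure \<Omega> \<times> {0<..} \<longrightarrow>
        uniform_limit K (\<lambda>bp (x, t). u bp x (bp * t)) (\<lambda>(x, t). w x t) at_top) \<and>
     uniform_limit (closure \<Omega>) (\<lambda>t x. w x t) (\<lambda>x. 0) at_top"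
proof -
  have \<Omega>: "open \<Omega>" "bounded \<Omega>" using assms(1) by (auto simp: bounded_smooth_domain_def)
  interpret obstacle \<Omega> u0
    using \<Omega> assms bounded_smooth_domain_regular by unfold_locales auto
  \<comment> \<open>The projected datum tends to 0 at the frontier, so its extension by 0 is
    uniformly continuous on the whole space, which is the form of datum that the discrete flows
    take.\<close>
  define g where "g x = (if x \<in> \<Omega> then projected_datum \<Omega> u0 x else 0)" for x
  have ucg: "uniformly_continuous_on UNIV g" unfolding g_def by (rule datum_uniformly_continuous)
  obtain M where M: "M > 0" "\<And>x. x \<in> closure \<Omega> \<Longrightarrow> \<bar>u0 x\<bar> \<le> M" using u0_bounded by blast
  have gM: "\<bar>g x\<bar> \<le> M" for x
  proof (cases "x \<in> \<Omega>")
    case True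
    then have x: "x \<in> closure \<Omega>" using closure_subset by blast
    have "- M \<le> projected_datum \<Omega> u0 x"
      using projected_datum_ge[OF competitor_const[OF \<Omega>(1) M(2)] x] M(1) by simp
    then show ?thesis using datum_le_u0[OF x] M(2)[OF x] True by (simp add: g_def)
  qed (use M in \<open>simp add: g_def\<close>)
  have g0: "g x = 0" if "x \<notin> \<Omega>" for x using that by (simp add: g_def)
  obtain w where w: "smooth_on (\<Omega> \<times> {0<..}) (\<lambda>(x, t). w x t)"
    "\<And>x t. x \<in> \<Omega> \<Longrightarrow> t > 0 \<Longrightarrow> ((\<lambda>s. w x s) has_real_derivative laplacian (\<lambda>y. w y t) x) (at t)"
    "uniformly_continuous_on UNIV (\<lambda>(x, t). w x t)"
    "\<And>x t. x \<notin> \<Omega> \<Longrightarrow> w x t = 0" "\<And>x. w x 0 = g x"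
    using heat_existence[OF \<Omega>(2,1) reg ucg g0 gM] by metis
  interpret projected_flow \<Omega> u0 w
    using w by unfold_locales (auto simp: g_def)
  have "w' x t = w x t" if "heat_solution \<Omega> (projected_datum \<Omega> u0) w'" "x \<in> closure \<Omega>" "t > 0" for w' x t
    using heat_solution_le[OF \<Omega> that(1) w_heat_solution that(2,3)]
      heat_solution_le[OF \<Omega> w_heat_solution that(1) that(2,3)] by simp
  moreover have "uniform_limit K (\<lambda>bp (x, t). u bp x (bp * t)) (\<lambda>(x, t). w x t) at_top"
    if K: "compact K" "K \<subseteq> closure \<Omega> \<times> {0<..}" for K
  proof (cases "K = {}")
    case False
    have "continuous_on K (snd :: 'a \<times> real \<Rightarrow> real)" by (intro continuous_intros)
    \<comment> \<open>A compact set of positive times has a smallest one, and it plays the part of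
      \<open>\<delta>0\<close> in the estimate that is uniform over all later times.\<close>
    then obtain p where p: "p \<in> K" "\<And>q. q \<in> K \<Longrightarrow> snd p \<le> snd q"
      using continuous_attains_inf[OF K(1) False] by blast
    have \<delta>0: "snd p > 0" using p(1) K(2) by auto
    show ?thesis
    proof (rule uniform_limitI)
      fix e :: real assume "e > 0"
      then have e2: "e / 2 > 0" by simp
      have "\<forall>\<^sub>F bp in at_top. \<forall>x\<in>closure \<Omega>. \<forall>t\<ge>snd p. \<bar>u bp x (bp * t) - w x t\<bar> \<le> e / 2"
        by (rule fast_limit[OF assms(4) _ e2 \<delta>0]) (use assms(5) in blast)
      then show "\<forall>\<^sub>F bp in at_top. \<forall>q\<in>K. dist (case q of (x, t) \<Rightarrow> u bp x (bp * t)) (case q of (x, t) \<Rightarrow> w x t) < e"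
      proof eventually_elim
        case (elim bp)
        have "dist (u bp x (bp * t)) (w x t) < e" if "(x, t) \<in> K" for x t
        proof -
          have "x \<in> closure \<Omega>" "t \<ge> snd p" using K(2) p(2)[OF that] that by auto
          then have "\<bar>u bp x (bp * t) - w x t\<bar> \<le> e / 2" using elim by blast
          then show ?thesis using e2 by (simp add: dist_real_def)
        qed
        then show ?case by auto
      qed
    qed
  qed (simp add: uniform_limit_iff)
  ultimately show ?thesis using w_heat_solution w_decay by blast
qed

end
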